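(* Let $n\ge2$, let $\Omega\subset\mathbb{R}^n$ be a domain with $|\Omega|=1$, and let $X(\Omega)$, $Y(\Omega)$ be two rearrangement invariant spaces. Assume that the following Sobolev–Poincaré inequality holds: $$\left(\int_\Omega|f(x)-f_\Omega|^{n/(n-1)}dx\right)^{\frac{n-1}{n}}\preceq\int_\Omega|\nabla f(x)|\,dx\qquad\text{for all } f\in W^{1,1}(\Omega).$$ Then the following statements are equivalent. (i) For all $f\in L^1(0,1)$, $$\|f\|_{\hat Y}\preceq\left\|s^{-1/n}[f^{**}(s)-f^*(s)]\right\|_{\hat X}+\|f\|_{L^1}.$$ (ii) $$\left\|\int_t^1 s^{1/n}f(s)\frac{ds}{s}\right\|_{\hat Y}\preceq\|f\|_{\hat X}\qquad\text{for all } f\in\hat X,\ f\ge0.$$ (iii) For all $f\in W^1_X(\Omega)$, $$\|f-f_\Omega\|_{Y(\Omega)}\preceq\|\nabla f\|_{X(\Omega)}.$$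
   Context: $f_\Omega=\frac{1}{|\Omega|}\int_\Omega f$. $f^*$ denotes the decreasing rearrangement of $|f|$ on $(0,1)$ and $f^{**}(t)=\frac1t\int_0^t f^*(s)\,ds$. $A\preceq B$ means $A\le C\,B$ with a constant $C>0$ independent of the function $f$ (it may depend on the fixed data $\Omega$, $n$, $X$, $Y$). For a rearrangement invariant (r.i.) space $X(\Omega)$ (in the sense of Bennett–Sharpley), $\hat X=\hat X(0,1)$ denotes its representation as a function space on $(0,1)$, so that $\|f\|_{X(\Omega)}=\|f^*\|_{\hat X}$. $W^1_X(\Omega)=\{f\in X(\Omega):\nabla f\in X(\Omega)\}$ and $\|\nabla f\|_{X(\Omega)}=\||\nabla f|\|_{X(\Omega)}$. Norms are understood to be $+\infty$ for functions not in the space. *)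

theory Defs
  imports "HOL-Analysis.Analysis"
begin

section \<open>Decreasing rearrangements\<close>

definition distr_fun :: "'a measure \<Rightarrow> ('a \<Rightarrow> ennreal) \<Rightarrow> ennreal \<Rightarrow> ennreal" where
  "distr_fun M f l = emeasure M {x \<in> space M. l < f x}"

definition equimeasurable :: "'a measure \<Rightarrow> ('a \<Rightarrow> ennreal) \<Rightarrow> ('a \<Rightarrow> ennreal) \<Rightarrow> bool" where
  "equimeasurable M f g \<longleftrightarrow> (\<forall>l. distr_fun M f l = distr_fun M g l)"

definition rearr :: "'a measure \<Rightarrow> ('a \<Rightarrow> ennreal) \<Rightarrow> real \<Rightarrow> ennreal" where
  "rearr M f t = Inf {l. distr_fun M f l \<le> ennreal t}"

definition max_rearr :: "'a measure \<Rightarrow> ('a \<Rightarrow> ennreal) \<Rightarrow> real \<Rightarrow> ennreal" where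
  "max_rearr M f t = (\<integral>\<^sup>+ s \<in> {0<..<t}. rearr M f s \<partial>lebesgue) / ennreal t"

section \<open>Rearrangement invariant spaces\<close>

text \<open>
  As in Bennett and Sharpley, a space is given by a function norm on the cone of nonnegative
  measurable functions, with values in the extended nonnegative reals; it consists of the
  measurable real functions f for which the norm of the absolute value of f is finite.
\<close>

type_synonym 'a fun_norm = "('a \<Rightarrow> ennreal) \<Rightarrow> ennreal"

definition banach_function_norm :: "'a measure \<Rightarrow> 'a fun_norm \<Rightarrow> bool" where
  "banach_function_norm M \<rho> \<longleftrightarrow>
     (\<forall>f \<in> borel_measurable M. \<rho> f = 0 \<longleftrightarrow> (AE x in M. f x = 0)) \<and>
     (\<forall>f \<in> borel_measurable M. \<forall>a::real. 0 \<le> a \<longrightarrow> \<rho> (\<lambda>x. ennreal a * f x) = ennreal a * \<rho> f) \<and>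
     (\<forall>f \<in> borel_measurable M. \<forall>g \<in> borel_measurable M. \<rho> (\<lambda>x. f x + g x) \<le> \<rho> f + \<rho> g) \<and>
     (\<forall>f \<in> borel_measurable M. \<forall>g \<in> borel_measurable M.
        (AE x in M. g x \<le> f x) \<longrightarrow> \<rho> g \<le> \<rho> f) \<and>
     (\<forall>F. \<forall>f \<in> borel_measurable M. (\<forall>k::nat. F k \<in> borel_measurable M) \<longrightarrow>
        (AE x in M. incseq (\<lambda>k. F k x) \<and> f x = (SUP k. F k x)) \<longrightarrow>
        incseq (\<lambda>k. \<rho> (F k)) \<and> \<rho> f = (SUP k. \<rho> (F k))) \<and>
     (\<forall>A \<in> sets M. emeasure M A < \<infinity> \<longrightarrow> \<rho> (indicator A) < \<infinity>) \<and>
     (\<forall>A \<in> sets M. emeasure M A < \<infinity> \<longrightarrow>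
        (\<exists>C::real. \<forall>f \<in> borel_measurable M. (\<integral>\<^sup>+ x \<in> A. f x \<partial>M) \<le> ennreal C * \<rho> f))"

definition ri_norm :: "'a measure \<Rightarrow> 'a fun_norm \<Rightarrow> bool" where
  "ri_norm M \<rho> \<longleftrightarrow> banach_function_norm M \<rho> \<and>
     (\<forall>f \<in> borel_measurable M. \<forall>g \<in> borel_measurable M.
        (AE x in M. f x < \<infinity>) \<longrightarrow> (AE x in M. g x < \<infinity>) \<longrightarrow>
        equimeasurable M f g \<longrightarrow> \<rho> f = \<rho> g)"

definition fnorm :: "'a fun_norm \<Rightarrow> ('a \<Rightarrow> real) \<Rightarrow> ennreal" where
  "fnorm \<rho> f = \<rho> (\<lambda>x. ennreal \<bar>f x\<bar>)"

definition fspace :: "'a measure \<Rightarrow> 'a fun_norm \<Rightarrow> ('a \<Rightarrow> real) set" where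
  "fspace M \<rho> = {f \<in> borel_measurable M. fnorm \<rho> f < \<infinity>}"

abbreviation L1_norm :: "'a measure \<Rightarrow> 'a fun_norm" where
  "L1_norm M \<equiv> nn_integral M"

abbreviation I01 :: "real measure" where
  "I01 \<equiv> lebesgue_on {0<..<1}"

text \<open>
  The representation on the unit interval of an r.i. norm over a space of measure one. By the
  Luxemburg representation theorem it exists, and it is unique on measurable functions if the
  underlying measure has no atoms.
\<close>

definition represents :: "'a measure \<Rightarrow> real fun_norm \<Rightarrow> 'a fun_norm \<Rightarrow> bool" where
  "represents M \<rho>h \<rho> \<longleftrightarrow> ri_norm I01 \<rho>h \<and> (\<forall>f \<in> borel_measurable M. \<rho> f = \<rho>h (rearr M f))"

section \<open>Weak gradients and Sobolev spaces\<close>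

definition partial_deriv :: "'n \<Rightarrow> (real^'n::finite \<Rightarrow> real) \<Rightarrow> real^'n \<Rightarrow> real" where
  "partial_deriv i \<phi> x = frechet_derivative \<phi> (at x) (axis i 1)"

primrec C_diff :: "nat \<Rightarrow> (real^'n::finite \<Rightarrow> real) \<Rightarrow> bool" where
  "C_diff 0 \<phi> \<longleftrightarrow> continuous_on UNIV \<phi>"
| "C_diff (Suc k) \<phi> \<longleftrightarrow> (\<forall>x. \<phi> differentiable (at x)) \<and> (\<forall>i. C_diff k (partial_deriv i \<phi>))"

definition test_functions :: "(real^'n::finite) set \<Rightarrow> (real^'n \<Rightarrow> real) set" where
  "test_functions \<Omega> = {\<phi>. (\<forall>k. C_diff k \<phi>) \<and>
     compact (closure {x. \<phi> x \<noteq> 0}) \<and> closure {x. \<phi> x \<noteq> 0} \<subseteq> \<Omega>}"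

definition locally_integrable ::
  "(real^'n::finite) set \<Rightarrow> (real^'n \<Rightarrow> 'b::euclidean_space) \<Rightarrow> bool" where
  "locally_integrable \<Omega> f \<longleftrightarrow> (\<forall>K. compact K \<and> K \<subseteq> \<Omega> \<longrightarrow> f absolutely_integrable_on K)"

definition has_weak_gradient ::
  "(real^'n::finite \<Rightarrow> real) \<Rightarrow> (real^'n \<Rightarrow> real^'n) \<Rightarrow> (real^'n) set \<Rightarrow> bool" where
  "has_weak_gradient f Df \<Omega> \<longleftrightarrow> locally_integrable \<Omega> f \<and> locally_integrable \<Omega> Df \<and>
     (\<forall>\<phi> \<in> test_functions \<Omega>. \<forall>i.
        (LINT x|lebesgue_on \<Omega>. f x * partial_deriv i \<phi> x) =
        - (LINT x|lebesgue_on \<Omega>. (Df x $ i) * \<phi> x))"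

text \<open>
  Weak gradients are determined only up to null sets, so the Sobolev space is presented as the
  set of all pairs of a function in it and a representative of its weak gradient.
\<close>

definition sobolev_W1 ::
  "(real^'n::finite) set \<Rightarrow> (real^'n) fun_norm \<Rightarrow> ((real^'n \<Rightarrow> real) \<times> (real^'n \<Rightarrow> real^'n)) set" where
  "sobolev_W1 \<Omega> \<rho> = {(f, Df). f \<in> fspace (lebesgue_on \<Omega>) \<rho> \<and> has_weak_gradient f Df \<Omega> \<and>
     (\<lambda>x. norm (Df x)) \<in> fspace (lebesgue_on \<Omega>) \<rho>}"

definition mean :: "(real^'n::finite) set \<Rightarrow> (real^'n \<Rightarrow> real) \<Rightarrow> real" where
  "mean \<Omega> f = (LINT x|lebesgue_on \<Omega>. f x) / measure lebesgue \<Omega>"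

text \<open>
  The integrability requirement expresses that the left-hand side is finite (the Bochner integral
  of a non-integrable function is 0).
\<close>

definition sobolev_poincare :: "(real^'n::finite) set \<Rightarrow> bool" where
  "sobolev_poincare \<Omega> \<longleftrightarrow> (let n = real CARD('n) in
     \<exists>C>0. \<forall>(f, Df) \<in> sobolev_W1 \<Omega> (L1_norm (lebesgue_on \<Omega>)).
       integrable (lebesgue_on \<Omega>) (\<lambda>x. \<bar>f x - mean \<Omega> f\<bar> powr (n / (n - 1))) \<and>
       (LINT x|lebesgue_on \<Omega>. \<bar>f x - mean \<Omega> f\<bar> powr (n / (n - 1))) powr ((n - 1) / n)
         \<le> C * (LINT x|lebesgue_on \<Omega>. norm (Df x)))"

end

theory Submission
  imports Defs
begin

text \<open>
  (i) and (ii) are equivalent by one-dimensional arguments. Since the derivative of f** is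
  (f* - f**) / s, Tonelli's theorem bounds f* by the Hardy operator in (ii), applied to
  s powr (-1/n) * (f** - f*), plus the L1 norm of f. Conversely, for f = Qk, with Q the operator in
  (ii), the oscillation f** - f* is at most the average over (0, t) of s powr (1/n) * k, and the
  resulting operator, mapping k to t powr (-1/n - 1) times the integral of s powr (1/n) * k over
  (0, t), is bounded on the spaces of integrable and of bounded functions, hence on every r.i. space
  by the Hardy-Littlewood-Polya principle.

  For (ii) to (iii), the Sobolev-Poincare inequality is applied to the truncations of
  |f - mean| between its rearranged values at consecutive dyadic points. This bounds the increments
  of the rearrangement by integrals of the gradient over the level strips; averaging the gradient
  over the strips decreases the norm, again by Hardy-Littlewood-Polya, and summation yields the
  Hardy operator of the averaged gradient. For (iii) to (ii), a radial function with prescribed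
  gradient averages on dyadic annuli in a ball contained in \<open>\<Omega>\<close> dominates a discretised Qk.
\<close>

section \<open>Decreasing rearrangements\<close>

text \<open>The norms on \<Omega> and on the unit interval are linked only through distribution
  functions, so functions on the two spaces have to be compared without a map between them. The
  Hardy-Littlewood-Polya principle is therefore stated for two functions on two probability spaces,
  and its hypothesis compares the integrals of the positive parts of f - c and g - c for all c \<ge>
  0. These integrals depend on the distributions alone, and they are easy to control both for an
  operator bounded on integrable and on bounded functions and for averages over disjoint sets. The
  rearrangement of a Sobolev function enters by its values at the points 2^-k alone, and the
  Sobolev-Poincare inequality by its weak-type consequence: a truncation sits at its two extreme
  values on sets of known measure, so Chebyshev loses only a constant. The price is the weak
  gradient of a truncation. As weak gradients are given by testing against smooth functions, the
  chain rule is proved by mollification near the support of each test function.\<close>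

lemma distr_fun_antimono:
  assumes "f \<in> borel_measurable M" "l \<le> l'"
  shows "distr_fun M f l' \<le> distr_fun M f l"
  unfolding distr_fun_def using assms by (intro emeasure_mono) auto

text \<open>The infimum defining the rearrangement is attained: it is the limit of a decreasing
  sequence of admissible levels, and the superlevel set of the limit is the increasing union of
  theirs, so continuity from below applies.\<close>

lemma distr_fun_rearr_le:
  assumes [measurable]: "f \<in> borel_measurable M"
  shows "distr_fun M f (rearr M f t) \<le> ennreal t"
proof -
  let ?A = "{l. distr_fun M f l \<le> ennreal t}"
  have "{x \<in> space M. top < f x} = {}" by auto
  then have "?A \<noteq> {}" by (auto simp: distr_fun_def intro!: exI[of _ top])
  then obtain F :: "nat \<Rightarrow> ennreal" where F: "decseq F" "range F \<subseteq> ?A" "Inf ?A = (INF i. F i)"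
    using ennreal_Inf_countable_INF[of ?A] by metis
  have eq: "{x \<in> space M. Inf ?A < f x} = (\<Union>i. {x \<in> space M. F i < f x})"
    unfolding F(3) by (auto simp: INF_less_iff)
  have inc: "incseq (\<lambda>i. {x \<in> space M. F i < f x})"
    using F(1) by (auto simp: incseq_def decseq_def intro: le_less_trans)
  have "emeasure M (\<Union>i. {x \<in> space M. F i < f x}) = (SUP i. emeasure M {x \<in> space M. F i < f x})"
    using inc by (intro SUP_emeasure_incseq[symmetric]) auto
  also have "\<dots> \<le> ennreal t"
    using F(2) by (intro SUP_least) (auto simp: distr_fun_def)
  finally show ?thesis unfolding rearr_def distr_fun_def[of _ _ "Inf _"] eq .
qed

text \<open>This equivalence stands in for the definition almost everywhere below. It makes every
  superlevel set of \<open>rearr M f\<close> an initial interval, and since the right-hand side is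
  an open condition on \<open>t\<close>, it contains right continuity.\<close>

lemma less_rearr_iff:
  assumes [measurable]: "f \<in> borel_measurable M"
  shows "l < rearr M f t \<longleftrightarrow> ennreal t < distr_fun M f l"
proof
  assume "l < rearr M f t"
  then show "ennreal t < distr_fun M f l"
    unfolding rearr_def by (metis (mono_tags, lifting) Inf_lower mem_Collect_eq not_less)
next
  assume *: "ennreal t < distr_fun M f l"
  show "l < rearr M f t"
  proof (rule ccontr)
    assume "\<not> l < rearr M f t"
    then have "distr_fun M f l \<le> distr_fun M f (rearr M f t)"
      by (intro distr_fun_antimono) auto
    with distr_fun_rearr_le[OF assms, of t] * show False by auto
  qed
qed

lemma rearr_antimono:
  assumes "s \<le> t"
  shows "rearr M f t \<le> rearr M f s"
  unfolding rearr_def using assms by (intro Inf_superset_mono) (auto intro: order_trans ennreal_leI)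

lemma rearr_measurable:
  assumes "f \<in> borel_measurable M"
  shows "rearr M f \<in> borel_measurable borel"
proof (rule borel_measurableI_greater)
  fix y
  have "{x \<in> space borel. y < rearr M f x} = {x \<in> space borel. ennreal x < distr_fun M f y}"
    by (simp add: less_rearr_iff[OF assms])
  also have "\<dots> \<in> sets borel" by measurable
  finally show "{x \<in> space borel. y < rearr M f x} \<in> sets borel" .
qed

lemma borel_measurable_I01:
  assumes "f \<in> borel_measurable borel"
  shows "f \<in> borel_measurable I01"
  using assms by (intro measurable_restrict_space1 measurable_completion) simp

lemma emeasure_I01:
  assumes "A \<in> sets lebesgue"
  shows "emeasure I01 ({0<..<1} \<inter> A) = emeasure lebesgue ({0<..<1} \<inter> A)"
  using assms by (subst emeasure_restrict_space) auto

lemma emeasure_I01_space [simp]: "emeasure I01 {0<..<1} = 1"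
  by (subst emeasure_restrict_space) auto

text \<open>By \<open>less_rearr_iff\<close> the superlevel set is the interval from 0 to the value
  of the distribution function, and total mass one keeps that value inside the unit
  interval.\<close>

lemma distr_fun_I01_rearr:
  assumes "f \<in> borel_measurable M" "emeasure M (space M) = 1"
  shows "distr_fun I01 (rearr M f) l = distr_fun M f l"
proof -
  let ?d = "distr_fun M f l"
  have "?d \<le> 1" unfolding distr_fun_def assms(2)[symmetric] by (rule emeasure_space)
  then have "?d < top" using ennreal_one_less_top le_less_trans by blast
  then obtain r where r: "?d = ennreal r" "0 \<le> r" by (cases ?d) auto
  have "r \<le> 1" using \<open>?d \<le> 1\<close> r by simp
  have "{t \<in> {0<..<1}. ennreal t < ?d} = {0<..<r}"
    using r \<open>r \<le> 1\<close> by (auto simp: ennreal_less_iff)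
  then have "distr_fun I01 (rearr M f) l = emeasure I01 ({0<..<1} \<inter> {0<..<r})"
    using \<open>r \<le> 1\<close> by (simp add: distr_fun_def[of I01] less_rearr_iff[OF assms(1)] Int_absorb1)
  also have "\<dots> = ennreal r"
    using \<open>r \<le> 1\<close> r by (subst emeasure_I01) (auto simp: Int_absorb1)
  finally show ?thesis using r by simp
qed

section \<open>Integrals determined by distribution functions\<close>

lemma Ioi_Int_Ioi: "{a<..} \<inter> {b<..} = {max a b<..}" for a b :: "'a :: linorder"
  by auto

text \<open>Open half-lines generate the Borel sets and are stable under intersection. None of them
  contains 0, so the whole space is added to the generator to serve as the cover by sets of finite
  measure.\<close>

lemma distr_eqI_distr_fun:
  assumes [measurable]: "f \<in> borel_measurable M" "g \<in> borel_measurable N"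
    and fin: "emeasure M (space M) = 1" "emeasure N (space N) = 1"
    and eq: "\<And>l. distr_fun M f l = distr_fun N g l"
  shows "distr M borel f = distr N borel g"
proof (rule measure_eqI_generator_eq[where E = "range greaterThan \<union> {UNIV}" and A = "\<lambda>_. UNIV" and \<Omega> = UNIV])
  show "Int_stable (range greaterThan \<union> {UNIV :: ennreal set})"
    by (auto simp: Int_stable_def Ioi_Int_Ioi)
  have s: "sigma_sets UNIV (range greaterThan) = sets (borel :: ennreal measure)"
    by (subst borel_Ioi) auto
  have "sigma_sets UNIV (range greaterThan \<union> {UNIV :: ennreal set}) = sigma_sets UNIV (range greaterThan)"
  proof (rule antisym)
    show "sigma_sets UNIV (range greaterThan \<union> {UNIV :: ennreal set}) \<subseteq> sigma_sets UNIV (range greaterThan)"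
      by (rule sigma_sets_mono) (auto intro: sigma_sets_top)
  qed (rule sigma_sets_subseteq, auto)
  then show "sets (distr M borel f) = sigma_sets UNIV (range greaterThan \<union> {UNIV})"
    "sets (distr N borel g) = sigma_sets UNIV (range greaterThan \<union> {UNIV})"
    using s by auto
  fix X :: "ennreal set" assume "X \<in> range greaterThan \<union> {UNIV}"
  then consider l where "X = {l<..}" | "X = UNIV" by auto
  then show "emeasure (distr M borel f) X = emeasure (distr N borel g) X"
  proof cases
    case 1
    have "f -` {l<..} \<inter> space M = {x \<in> space M. l < f x}" "g -` {l<..} \<inter> space N = {x \<in> space N. l < g x}"
      by auto
    then show ?thesis using eq[of l] 1 by (simp add: emeasure_distr distr_fun_def)
  qed (simp add: emeasure_distr fin)
qed (auto simp: emeasure_distr fin)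

lemma nn_integral_eq_of_distr_fun:
  assumes [measurable]: "f \<in> borel_measurable M" "g \<in> borel_measurable N" "\<phi> \<in> borel_measurable borel"
    and "emeasure M (space M) = 1" "emeasure N (space N) = 1"
    and "\<And>l. distr_fun M f l = distr_fun N g l"
  shows "(\<integral>\<^sup>+x. \<phi> (f x) \<partial>M) = (\<integral>\<^sup>+x. \<phi> (g x) \<partial>N)"
proof -
  have "(\<integral>\<^sup>+x. \<phi> (f x) \<partial>M) = (\<integral>\<^sup>+y. \<phi> y \<partial>distr M borel f)"
    by (simp add: nn_integral_distr)
  also have "\<dots> = (\<integral>\<^sup>+y. \<phi> y \<partial>distr N borel g)"
    using distr_eqI_distr_fun[OF assms(1,2,4-6)] by simp
  also have "\<dots> = (\<integral>\<^sup>+x. \<phi> (g x) \<partial>N)"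
    by (simp add: nn_integral_distr)
  finally show ?thesis .
qed

lemma nn_integral_rearr:
  assumes [measurable]: "f \<in> borel_measurable M" "\<phi> \<in> borel_measurable borel"
    and "emeasure M (space M) = 1"
  shows "(\<integral>\<^sup>+t. \<phi> (rearr M f t) \<partial>I01) = (\<integral>\<^sup>+x. \<phi> (f x) \<partial>M)"
  using assms by (intro nn_integral_eq_of_distr_fun borel_measurable_I01 rearr_measurable distr_fun_I01_rearr) auto

section \<open>The Hardy-Littlewood-Polya principle\<close>

text \<open>The argument of Robin Hood transfers. Moving mass from a coordinate with a surplus to a
  later one with a deficit replaces \<open>y\<close> by a convex combination of \<open>y\<close> and
  a transposition of \<open>y\<close>, which does not increase a convex symmetric functional. Each
  transfer makes one more coordinate agree with \<open>x\<close>, hence the induction on the number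
  of disagreements. The sums are compared by inequality, so the process ends in coordinatewise
  domination and monotonicity finishes.\<close>

lemma hardy_littlewood_polya_vector:
  fixes \<Phi> :: "(nat \<Rightarrow> real) \<Rightarrow> ennreal" and x y :: "nat \<Rightarrow> real"
  assumes mono: "\<And>u v. (\<And>i. i < N \<Longrightarrow> 0 \<le> u i) \<Longrightarrow> (\<And>i. i < N \<Longrightarrow> u i \<le> v i) \<Longrightarrow> \<Phi> u \<le> \<Phi> v"
    and convex: "\<And>u v a b. (\<And>i. i < N \<Longrightarrow> 0 \<le> u i) \<Longrightarrow> (\<And>i. i < N \<Longrightarrow> 0 \<le> v i) \<Longrightarrow> 0 \<le> a \<Longrightarrow> 0 \<le> b \<Longrightarrow> a + b = 1 \<Longrightarrow>
        \<Phi> (\<lambda>i. a * u i + b * v i) \<le> ennreal a * \<Phi> u + ennreal b * \<Phi> v"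
    and symm: "\<And>u i k. (\<And>i. i < N \<Longrightarrow> 0 \<le> u i) \<Longrightarrow> i < N \<Longrightarrow> k < N \<Longrightarrow> \<Phi> (u \<circ> Transposition.transpose i k) = \<Phi> u"
    and x: "\<And>i. i < N \<Longrightarrow> 0 \<le> x i" "\<And>i k. i \<le> k \<Longrightarrow> k < N \<Longrightarrow> x k \<le> x i"
    and y: "\<And>i. i < N \<Longrightarrow> 0 \<le> y i"
    and sums: "\<And>k. k \<le> N \<Longrightarrow> (\<Sum>i<k. x i) \<le> (\<Sum>i<k. y i)"
  shows "\<Phi> x \<le> \<Phi> y"
  using y sums
proof (induction "card {i. i < N \<and> x i \<noteq> y i}" arbitrary: y rule: less_induct)
  case less
  show ?case
  proof (cases "\<forall>i<N. x i \<le> y i")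
    case True
    then show ?thesis using mono x by auto
  next
    case False
    \<comment> \<open>The first deficit. All earlier coordinates satisfy x \<le> y, so the partial
      sum through \<open>k\<close> forces a strict surplus somewhere before it.\<close>
    define k where "k = (LEAST k. k < N \<and> y k < x k)"
    have k: "k < N" "y k < x k"
      using LeastI_ex[of "\<lambda>k. k < N \<and> y k < x k"] False unfolding k_def by (auto simp: not_le)
    have below: "x j \<le> y j" if "j < k" for j
      using not_less_Least[of j "\<lambda>k. k < N \<and> y k < x k"] that k(1) unfolding k_def[symmetric] by auto
    have "\<exists>i<k. x i < y i"
    proof (rule ccontr)
      assume "\<not> (\<exists>i<k. x i < y i)"
      then have "x i = y i" if "i < k" for i using below[OF that] that by force
      then have "(\<Sum>i<k. x i) = (\<Sum>i<k. y i)" by (intro sum.cong) auto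
      then have "(\<Sum>i<Suc k. y i) < (\<Sum>i<Suc k. x i)" using k by simp
      with less.prems(2)[of "Suc k"] k show False by auto
    qed
    then obtain i where i: "i < k" "x i < y i" by auto
    \<comment> \<open>The largest transfer that creates neither a deficit at \<open>i\<close> nor a
      surplus at \<open>k\<close>; it removes one of the two disagreements.\<close>
    define d where "d = min (y i - x i) (x k - y k)"
    define y' where "y' = y(i := y i - d, k := y k + d)"
    have d: "0 < d" "d \<le> y i - x i" "d \<le> x k - y k" using i k by (auto simp: d_def)
    have "x k \<le> x i" using x(2)[of i k] i k by auto
    \<comment> \<open>y i - d \<ge> x i \<ge> x k > y k, so the transfer stops short of exchanging
      the two values and the weight \<open>b\<close> below is at most 1.\<close>
    then have gap: "d < y i - y k" using d i k by auto
    have "{j. j < N \<and> x j \<noteq> y' j} \<subset> {j. j < N \<and> x j \<noteq> y j}"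
    proof (cases "d = y i - x i")
      case True
      then have "i \<notin> {j. j < N \<and> x j \<noteq> y' j}" "i \<in> {j. j < N \<and> x j \<noteq> y j}"
        using i k by (auto simp: y'_def)
      moreover have "{j. j < N \<and> x j \<noteq> y' j} \<subseteq> {j. j < N \<and> x j \<noteq> y j}"
        using i k by (auto simp: y'_def split: if_splits)
      ultimately show ?thesis by blast
    next
      case False
      then have "d = x k - y k" by (auto simp: d_def min_def split: if_splits)
      then have "k \<notin> {j. j < N \<and> x j \<noteq> y' j}" "k \<in> {j. j < N \<and> x j \<noteq> y j}"
        using i k by (auto simp: y'_def)
      moreover have "{j. j < N \<and> x j \<noteq> y' j} \<subseteq> {j. j < N \<and> x j \<noteq> y j}"
        using i k by (auto simp: y'_def split: if_splits)
      ultimately show ?thesis by blast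
    qed
    then have card: "card {j. j < N \<and> x j \<noteq> y' j} < card {j. j < N \<and> x j \<noteq> y j}"
      by (intro psubset_card_mono) auto
    have y': "0 \<le> y' j" if "j < N" for j
    proof -
      have "0 \<le> y i - d" using d x(1)[of i] i k by linarith
      then show ?thesis using less.prems(1) that d by (auto simp: y'_def)
    qed
    have sums': "(\<Sum>j<m. x j) \<le> (\<Sum>j<m. y' j)" if m: "m \<le> N" for m
    proof -
      have y'_eq: "y' j = y j + (if j = k then d else 0) - (if j = i then d else 0)" for j
        using i by (auto simp: y'_def)
      have eq: "(\<Sum>j<m. y' j) = (\<Sum>j<m. y j) + (if k < m then d else 0) - (if i < m then d else 0)"
        unfolding y'_eq by (simp add: sum.distrib sum_subtractf)
      show ?thesis
      \<comment> \<open>Only sums that contain \<open>i\<close> but not \<open>k\<close> decrease.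
        They lie before the first deficit, where the surplus at \<open>i\<close> alone pays for
        \<open>d\<close>.\<close>
      proof (cases "i < m \<and> m \<le> k")
        case True
        have "d \<le> y i - x i" by (fact d)
        also have "\<dots> \<le> (\<Sum>j<m. y j - x j)"
          using True below by (intro member_le_sum) auto
        finally show ?thesis using True eq by (simp add: sum_subtractf)
      next
        case False
        then show ?thesis using eq less.prems(2)[OF m] i d by auto
      qed
    qed
    have "\<Phi> x \<le> \<Phi> y'" using less.hyps[OF card y' sums'] by auto
    also have "\<Phi> y' \<le> \<Phi> y"
    proof -
      define b where "b = d / (y i - y k)"
      have b: "0 \<le> b" "b \<le> 1" "b * (y i - y k) = d" using d gap by (auto simp: b_def)
      have "y' = (\<lambda>j. (1 - b) * y j + b * (y \<circ> Transposition.transpose i k) j)"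
        using b(3) i by (auto simp: y'_def fun_eq_iff Transposition.transpose_def algebra_simps)
      then have "\<Phi> y' \<le> ennreal (1 - b) * \<Phi> y + ennreal b * \<Phi> (y \<circ> Transposition.transpose i k)"
        using convex[of y "y \<circ> Transposition.transpose i k" "1 - b" b] b less.prems(1) i k
        by (simp add: Transposition.transpose_def)
      also have "\<dots> = ennreal (1 - b) * \<Phi> y + ennreal b * \<Phi> y"
        using symm[of y i k] less.prems(1) i k by auto
      also have "\<dots> = \<Phi> y"
        using b by (simp flip: distrib_right ennreal_plus)
      finally show ?thesis .
    qed
    finally show ?thesis .
  qed
qed

text \<open>Partial sums of a sequence constant on blocks are linear within a block, those of the
  decreasing \<open>y\<close> are concave, so comparison at the block ends suffices. Concretely, a
  failure inside a block needs some \<open>y j\<close> below the block value; the later entries are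
  then below it too, and the failure persists to the end of the block.\<close>

lemma partial_sums_le_from_blocks:
  fixes x y :: "nat \<Rightarrow> real"
  assumes B: "0 < B"
    and y: "\<And>i k. i \<le> k \<Longrightarrow> k < A * B \<Longrightarrow> y k \<le> y i"
    and nodes: "\<And>a. a \<le> A \<Longrightarrow> (\<Sum>j<a * B. x (j div B)) \<le> (\<Sum>j<a * B. y j)"
    and k: "k \<le> A * B"
  shows "(\<Sum>j<k. x (j div B)) \<le> (\<Sum>j<k. y j)"
proof (cases "k = A * B")
  case True
  then show ?thesis using nodes by auto
next
  case False
  define a where "a = k div B"
  have a: "a * B \<le> k" "k < Suc a * B" "a < A"
    using B k False by (auto simp: a_def div_less_iff_less_mult dividend_less_div_times)
  have sp: "(\<Sum>j<k. f j) = (\<Sum>j<a*B. f j) + (\<Sum>j=a*B..<k. f j)" for f :: "nat \<Rightarrow> real"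
    using a by (simp add: lessThan_atLeast0 sum.atLeastLessThan_concat)
  have sp2: "(\<Sum>j<Suc a*B. f j) = (\<Sum>j<k. f j) + (\<Sum>j=k..<Suc a*B. f j)" for f :: "nat \<Rightarrow> real"
    using a by (simp only: lessThan_atLeast0) (intro sum.atLeastLessThan_concat[symmetric], auto)
  have dv: "j div B = a" if "a * B \<le> j" "j < Suc a * B" for j
    using that B by (intro div_nat_eqI) (auto simp: mult.commute)
  show ?thesis
  proof (rule ccontr)
    assume neg: "\<not> ?thesis"
    have "(\<Sum>j<a*B. x (j div B)) \<le> (\<Sum>j<a*B. y j)" using nodes a by auto
    with neg have less: "(\<Sum>j=a*B..<k. y j) < (\<Sum>j=a*B..<k. x (j div B))" by (simp add: sp)
    have "\<not> (\<forall>j\<in>{a*B..<k}. x (j div B) \<le> y j)"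
    proof
      assume "\<forall>j\<in>{a*B..<k}. x (j div B) \<le> y j"
      then have "(\<Sum>j=a*B..<k. x (j div B)) \<le> (\<Sum>j=a*B..<k. y j)" by (intro sum_mono) auto
      with less show False by simp
    qed
    then obtain j where j: "a * B \<le> j" "j < k" "y j < x (j div B)"
      by (auto simp: not_le)
    have "(\<Sum>j=k..<Suc a*B. y j) \<le> (\<Sum>j=k..<Suc a*B. x (j div B))"
    proof (rule sum_mono)
      fix l assume l: "l \<in> {k..<Suc a * B}"
      have "Suc a * B \<le> A * B" using a by (intro mult_le_mono1) auto
      then have "y l \<le> y j" using l j by (intro y) auto
      also have "y j \<le> x (l div B)" using j l a dv[of j] dv[of l] by auto
      finally show "y l \<le> x (l div B)" .
    qed
    with neg have "(\<Sum>j<Suc a*B. y j) < (\<Sum>j<Suc a*B. x (j div B))" unfolding sp2 by linarith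
    then show False using nodes[of "Suc a"] a by auto
  qed
qed

section \<open>Rules for function norms\<close>

lemma bfn_mono:
  assumes "banach_function_norm M \<rho>" "f \<in> borel_measurable M" "g \<in> borel_measurable M" "AE x in M. g x \<le> f x"
  shows "\<rho> g \<le> \<rho> f"
  using assms unfolding banach_function_norm_def by blast

lemma bfn_cong_AE:
  assumes "banach_function_norm M \<rho>" "f \<in> borel_measurable M" "g \<in> borel_measurable M" "AE x in M. g x = f x"
  shows "\<rho> g = \<rho> f"
  using assms by (intro antisym bfn_mono[of M]) auto

lemma bfn_cmult:
  assumes "banach_function_norm M \<rho>" "f \<in> borel_measurable M" "0 \<le> a"
  shows "\<rho> (\<lambda>x. ennreal a * f x) = ennreal a * \<rho> f"
  using assms unfolding banach_function_norm_def by blast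

lemma bfn_add:
  assumes "banach_function_norm M \<rho>" "f \<in> borel_measurable M" "g \<in> borel_measurable M"
  shows "\<rho> (\<lambda>x. f x + g x) \<le> \<rho> f + \<rho> g"
  using assms unfolding banach_function_norm_def by blast

lemma bfn_SUP:
  assumes "banach_function_norm M \<rho>" "f \<in> borel_measurable M" "\<And>k::nat. F k \<in> borel_measurable M"
    "AE x in M. incseq (\<lambda>k. F k x) \<and> f x = (SUP k. F k x)"
  shows "\<rho> f = (SUP k. \<rho> (F k))"
proof -
  have "\<forall>F. \<forall>f \<in> borel_measurable M. (\<forall>k::nat. F k \<in> borel_measurable M) \<longrightarrow>
        (AE x in M. incseq (\<lambda>k. F k x) \<and> f x = (SUP k. F k x)) \<longrightarrow>
        incseq (\<lambda>k. \<rho> (F k)) \<and> \<rho> f = (SUP k. \<rho> (F k))"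
    using assms(1) unfolding banach_function_norm_def by blast
  then show ?thesis using assms(2-4) by blast
qed

lemma ri_equimeasurable:
  assumes "ri_norm M \<rho>" "f \<in> borel_measurable M" "g \<in> borel_measurable M"
    "AE x in M. f x < \<infinity>" "AE x in M. g x < \<infinity>" "\<And>l. distr_fun M f l = distr_fun M g l"
  shows "\<rho> f = \<rho> g"
  using assms unfolding ri_norm_def equimeasurable_def by blast

lemma ri_bfn: "ri_norm M \<rho> \<Longrightarrow> banach_function_norm M \<rho>"
  by (simp add: ri_norm_def)

lemma AE_I01_I: "(\<And>t. 0 < t \<Longrightarrow> t < 1 \<Longrightarrow> P t) \<Longrightarrow> AE t in I01. P t"
  by (rule AE_I2) auto

section \<open>Step functions on equal cells\<close>

definition step_fun :: "nat \<Rightarrow> (nat \<Rightarrow> real) \<Rightarrow> real \<Rightarrow> ennreal" where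
  "step_fun N y t = (\<Sum>i<N. ennreal (y i) * indicator {real i / real N<..real (Suc i) / real N} t)"

lemma step_fun_measurable: "step_fun N y \<in> borel_measurable borel"
  unfolding step_fun_def[abs_def] by measurable

text \<open>The cells are closed on the right, so the cell of \<open>t\<close> ends at the ceiling
  of N t divided by N. A step function taking the values of a decreasing function at the right ends
  therefore lies below it.\<close>

lemma step_cell:
  assumes "0 < N" "0 < t" "t \<le> 1"
  shows "\<exists>i<N. real i / real N < t \<and> t \<le> real (Suc i) / real N \<and> real (Suc i) = of_int \<lceil>real N * t\<rceil>"
proof -
  define i where "i = nat \<lceil>real N * t\<rceil> - 1"
  have "0 < real N * t" using assms by simp
  then have "1 \<le> \<lceil>real N * t\<rceil>" by linarith
  then have i: "real (Suc i) = of_int \<lceil>real N * t\<rceil>" by (simp add: i_def)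
  have "real N * t \<le> real N" using assms by (simp add: mult_left_le)
  then have "\<lceil>real N * t\<rceil> \<le> int N" by (simp add: ceiling_le_iff)
  then have "real (Suc i) \<le> real N" unfolding i by linarith
  then have "i < N" by linarith
  moreover have "real i < real N * t" "real N * t \<le> real (Suc i)" using i by linarith+
  ultimately show ?thesis using assms i by (intro exI[of _ i]) (auto simp: field_simps)
qed

lemma step_fun_eq:
  assumes "i < N" "real i / real N < t" "t \<le> real (Suc i) / real N"
  shows "step_fun N y t = ennreal (y i)"
proof -
  have "t \<in> {real j / real N<..real (Suc j) / real N} \<longleftrightarrow> j = i" if "j < N" for j
  proof
    assume t: "t \<in> {real j / real N<..real (Suc j) / real N}"
    have N: "0 < real N" using assms by simp
    have "real i < real (Suc j)" "real j < real (Suc i)"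
      using t assms N by (simp_all add: field_simps)
    then show "j = i" by linarith
  qed (use assms in auto)
  then have "step_fun N y t = (\<Sum>j<N. if j = i then ennreal (y j) else 0)"
    unfolding step_fun_def by (intro sum.cong) (auto simp: indicator_def)
  then show ?thesis using assms by simp
qed

lemma emeasure_I01_Ioc:
  assumes "0 \<le> a" "a \<le> b" "b \<le> 1"
  shows "emeasure I01 ({0<..<1} \<inter> {a<..b}) = ennreal (b - a)"
proof -
  have "emeasure I01 ({0<..<1} \<inter> {a<..b}) = emeasure lborel ({0<..<1} \<inter> {a<..b})"
    by (subst emeasure_I01) auto
  \<comment> \<open>For b = 1 the right endpoint is not in the space, so it is discarded in all
    cases as a null set.\<close>
  also have "\<dots> = emeasure lborel {a<..<b}"
  proof (rule emeasure_eq_AE)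
    show "AE x in lborel. (x \<in> {0<..<1} \<inter> {a<..b}) = (x \<in> {a<..<b})"
      using AE_lborel_singleton[of b] by eventually_elim (use assms in auto)
  qed auto
  finally show ?thesis using assms by simp
qed

lemma nn_integral_step_fun:
  assumes "0 < N" "a \<le> N" "\<And>i. i < N \<Longrightarrow> 0 \<le> y i"
  shows "(\<integral>\<^sup>+t. step_fun N y t * indicator {0<..real a / real N} t \<partial>I01) = ennreal ((\<Sum>i<a. y i) / real N)"
proof -
  have "(\<integral>\<^sup>+t. step_fun N y t * indicator {0<..real a / real N} t \<partial>I01) =
    (\<integral>\<^sup>+t. (\<Sum>i<a. ennreal (y i) * indicator ({0<..<1} \<inter> {real i / real N<..real (Suc i) / real N}) t) \<partial>I01)"
  proof (rule nn_integral_cong)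
    fix t assume "t \<in> space I01"
    then have t: "0 < t" "t < 1" by auto
    obtain i where i: "i < N" "real i / real N < t" "t \<le> real (Suc i) / real N"
      using step_cell[OF assms(1) t(1) less_imp_le[OF t(2)]] by blast
    have iff: "t \<le> real a / real N \<longleftrightarrow> i < a"
    proof
      assume "t \<le> real a / real N"
      then have "real i / real N < real a / real N" using i by linarith
      then show "i < a" using assms by (simp add: divide_less_cancel)
    next
      assume "i < a"
      then have "real (Suc i) / real N \<le> real a / real N" by (intro divide_right_mono) auto
      then show "t \<le> real a / real N" using i by linarith
    qed
    have N: "0 < real N" using assms by simp
    have eq: "t \<in> {real j / real N<..real (Suc j) / real N} \<longleftrightarrow> j = i" for j
    proof
      assume u: "t \<in> {real j / real N<..real (Suc j) / real N}"
      have "real i < real (Suc j)" "real j < real (Suc i)"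
        using u i N by (simp_all add: field_simps)
      then show "j = i" by linarith
    qed (use i in auto)
    have "(\<Sum>j<a. ennreal (y j) * indicator ({0<..<1} \<inter> {real j / real N<..real (Suc j) / real N}) t) =
      (\<Sum>j<a. if j = i then ennreal (y j) else 0)"
      using eq t by (intro sum.cong) (auto simp: indicator_def)
    then show "step_fun N y t * indicator {0<..real a / real N} t =
       (\<Sum>j<a. ennreal (y j) * indicator ({0<..<1} \<inter> {real j / real N<..real (Suc j) / real N}) t)"
      using step_fun_eq[OF i, of y] iff t by (auto simp: indicator_def)
  qed
  also have "\<dots> = (\<Sum>i<a. ennreal (y i) * emeasure I01 ({0<..<1} \<inter> {real i / real N<..real (Suc i) / real N}))"
  proof (subst nn_integral_sum)
    show "(\<lambda>t. ennreal (y i) * indicator ({0<..<1} \<inter> {real i / real N<..real (Suc i) / real N}) t) \<in> borel_measurable I01" for i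
      by (intro borel_measurable_I01) measurable
  qed (auto intro!: sum.cong nn_integral_cmult_indicator simp: sets_restrict_space)
  also have "\<dots> = (\<Sum>i<a. ennreal (y i / real N))"
  proof (intro sum.cong refl)
    fix i assume i: "i \<in> {..<a}"
    then have "real (Suc i) / real N \<le> 1" using assms by auto
    then have "emeasure I01 ({0<..<1} \<inter> {real i / real N<..real (Suc i) / real N}) = ennreal (real (Suc i) / real N - real i / real N)"
      by (intro emeasure_I01_Ioc) (auto intro!: divide_right_mono)
    also have "real (Suc i) / real N - real i / real N = 1 / real N" by (simp add: add_divide_distrib)
    finally show "ennreal (y i) * emeasure I01 ({0<..<1} \<inter> {real i / real N<..real (Suc i) / real N}) = ennreal (y i / real N)"
      using assms i by (simp flip: ennreal_mult)
  qed
  also have "\<dots> = ennreal ((\<Sum>i<a. y i) / real N)"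
    using assms by (subst sum_ennreal) (auto simp: sum_divide_distrib)
  finally show ?thesis .
qed

text \<open>The indicator of a superlevel set of a step function is again a step function, with
  values 0 and 1, so the integral formula for step functions counts the cells.\<close>

lemma distr_fun_step_fun:
  assumes N: "0 < N" and y: "\<And>i. i < N \<Longrightarrow> 0 \<le> y i"
  shows "distr_fun I01 (step_fun N y) l = ennreal ((\<Sum>i<N. of_bool (l < ennreal (y i))) / real N)"
proof -
  have [measurable]: "step_fun N y \<in> borel_measurable I01"
    by (intro borel_measurable_I01 step_fun_measurable)
  have "distr_fun I01 (step_fun N y) l = (\<integral>\<^sup>+t. indicator {t \<in> space I01. l < step_fun N y t} t \<partial>I01)"
  proof -
    have "{t \<in> space I01. l < step_fun N y t} \<in> sets I01" by measurable
    then show ?thesis unfolding distr_fun_def by simp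
  qed
  also have "\<dots> = (\<integral>\<^sup>+t. step_fun N (\<lambda>i. of_bool (l < ennreal (y i))) t * indicator {0<..real N / real N} t \<partial>I01)"
  proof (rule nn_integral_cong)
    fix t assume "t \<in> space I01"
    then have t: "0 < t" "t < 1" by auto
    obtain i where i: "i < N" "real i / real N < t" "t \<le> real (Suc i) / real N"
      using step_cell[OF N t(1) less_imp_le[OF t(2)]] by blast
    show "indicator {t \<in> space I01. l < step_fun N y t} t = step_fun N (\<lambda>i. of_bool (l < ennreal (y i))) t * indicator {0<..real N / real N} t"
      using t N by (simp add: step_fun_eq[OF i] indicator_def)
  qed
  also have "\<dots> = ennreal ((\<Sum>i<N. of_bool (l < ennreal (y i))) / real N)"
    using N by (intro nn_integral_step_fun) auto
  finally show ?thesis .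
qed

text \<open>The norm of \<open>step_fun N\<close> is a functional of the vector of values. The norm
  axioms make it monotone and convex; permuting the values leaves the number of cells above each
  level unchanged, so rearrangement invariance makes it symmetric.\<close>

lemma hardy_littlewood_polya_step:
  assumes ri: "ri_norm I01 \<rho>" and N: "0 < N"
    and x: "\<And>i. i < N \<Longrightarrow> 0 \<le> x i" "\<And>i k. i \<le> k \<Longrightarrow> k < N \<Longrightarrow> x k \<le> x i"
    and y: "\<And>i. i < N \<Longrightarrow> 0 \<le> y i"
    and sums: "\<And>k. k \<le> N \<Longrightarrow> (\<Sum>i<k. x i) \<le> (\<Sum>i<k. y i)"
  shows "\<rho> (step_fun N x) \<le> \<rho> (step_fun N y)"
proof (rule hardy_littlewood_polya_vector[of N "\<lambda>y. \<rho> (step_fun N y)"])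
  note bfn = ri_bfn[OF ri]
  have meas [measurable]: "step_fun N u \<in> borel_measurable I01" for u
    by (intro borel_measurable_I01 step_fun_measurable)
  show "\<rho> (step_fun N u) \<le> \<rho> (step_fun N v)" if "\<And>i. i < N \<Longrightarrow> 0 \<le> u i" "\<And>i. i < N \<Longrightarrow> u i \<le> v i" for u v
    using that by (intro bfn_mono[OF bfn] meas AE_I2) (auto simp: step_fun_def intro!: sum_mono mult_right_mono ennreal_leI)
  show "\<rho> (step_fun N (\<lambda>i. a * u i + b * v i)) \<le> ennreal a * \<rho> (step_fun N u) + ennreal b * \<rho> (step_fun N v)"
    if "\<And>i. i < N \<Longrightarrow> 0 \<le> u i" "\<And>i. i < N \<Longrightarrow> 0 \<le> v i" "0 \<le> a" "0 \<le> b" "a + b = 1" for u v a b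
  proof -
    have "step_fun N (\<lambda>i. a * u i + b * v i) = (\<lambda>t. ennreal a * step_fun N u t + ennreal b * step_fun N v t)"
      unfolding step_fun_def fun_eq_iff sum_distrib_left sum.distrib[symmetric]
      using that by (intro allI sum.cong refl) (simp add: ennreal_mult distrib_right mult.assoc)
    then have "\<rho> (step_fun N (\<lambda>i. a * u i + b * v i)) \<le> \<rho> (\<lambda>t. ennreal a * step_fun N u t) + \<rho> (\<lambda>t. ennreal b * step_fun N v t)"
      by (simp add: bfn_add[OF bfn])
    then show ?thesis using that by (simp add: bfn_cmult[OF bfn])
  qed
  show "\<rho> (step_fun N (u \<circ> Transposition.transpose i k)) = \<rho> (step_fun N u)"
    if u: "\<And>i. i < N \<Longrightarrow> 0 \<le> u i" and ik: "i < N" "k < N" for u i k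
  proof (rule ri_equimeasurable[OF ri])
    have fin: "step_fun N v t < \<infinity>" for v t
      by (auto simp: step_fun_def ennreal_mult_less_top less_top[symmetric])
    show "AE x in I01. step_fun N (u \<circ> Transposition.transpose i k) x < \<infinity>" "AE x in I01. step_fun N u x < \<infinity>"
      using fin by auto
    have tr: "Transposition.transpose i k j < N" if "j < N" for j
      using that ik by (auto simp: Transposition.transpose_def)
    have "(\<Sum>j<N. of_bool (l < ennreal ((u \<circ> Transposition.transpose i k) j)) :: real) = (\<Sum>j<N. of_bool (l < ennreal (u j)))" for l
      by (rule sum.reindex_bij_witness[of _ "Transposition.transpose i k" "Transposition.transpose i k"]) (auto intro: tr)
    then show "distr_fun I01 (step_fun N (u \<circ> Transposition.transpose i k)) l = distr_fun I01 (step_fun N u) l" for l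
      using N u tr by (simp add: distr_fun_step_fun)
  qed auto
qed (use assms in auto)

text \<open>The sets where f exceeds n decrease to a null set, so their measures fall below
  t.\<close>

lemma rearr_finite:
  assumes [measurable]: "f \<in> borel_measurable M" and M: "emeasure M (space M) = 1"
    and fin: "AE x in M. f x < \<infinity>" and t: "0 < t"
  shows "rearr M f t < \<infinity>"
proof (rule ccontr)
  assume "\<not> rearr M f t < \<infinity>"
  then have "of_nat n < rearr M f t" for n by (simp add: less_top[symmetric] not_less top_unique)
  then have *: "ennreal t \<le> distr_fun M f (of_nat n)" for n
    by (simp add: less_rearr_iff[OF assms(1)] less_imp_le)
  have "(INF n. emeasure M {x \<in> space M. of_nat n < f x}) = emeasure M (\<Inter>n. {x \<in> space M. of_nat n < f x})"
  proof (rule INF_emeasure_decseq)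
    show "decseq (\<lambda>n. {x \<in> space M. of_nat n < f x})"
      by (auto simp: decseq_def intro: order.strict_trans1[OF of_nat_mono])
    show "emeasure M {x \<in> space M. of_nat n < f x} \<noteq> \<infinity>" for n
      using emeasure_space[of M "{x \<in> space M. of_nat n < f x}"] M by (auto simp: top_unique)
  qed auto
  also have "\<dots> = 0"
  proof -
    have "AE x in M. x \<notin> (\<Inter>n. {x \<in> space M. of_nat n < f x})"
      using fin by eventually_elim (auto dest: ennreal_Ex_less_of_nat order.asym simp: less_top)
    moreover have S: "(\<Inter>n. {x \<in> space M. of_nat n < f x}) \<in> sets M" by measurable
    moreover have E: "{x \<in> space M. \<not> x \<notin> (\<Inter>n. {x \<in> space M. of_nat n < f x})} = (\<Inter>n. {x \<in> space M. of_nat n < f x})"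
      by auto
    ultimately show ?thesis by (simp only: AE_iff_measurable[OF S E])
  qed
  finally have "(INF n. distr_fun M f (of_nat n)) = 0" by (simp add: distr_fun_def)
  moreover have "ennreal t \<le> (INF n. distr_fun M f (of_nat n))"
    using * by (intro INF_greatest)
  ultimately show False using t by simp
qed

section \<open>Dyadic approximation of the rearrangement from below\<close>

definition lower_step :: "'a measure \<Rightarrow> ('a \<Rightarrow> ennreal) \<Rightarrow> nat \<Rightarrow> real \<Rightarrow> ennreal" where
  "lower_step M f m = step_fun (2 ^ m) (\<lambda>i. enn2real (rearr M f (real (Suc i) / 2 ^ m)))"

context
  fixes M :: "'a measure" and f :: "'a \<Rightarrow> ennreal"
  assumes meas: "f \<in> borel_measurable M" and prob: "emeasure M (space M) = 1" and fin: "AE x in M. f x < \<infinity>"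
begin

lemma ennreal_enn2real_rearr: "0 < t \<Longrightarrow> ennreal (enn2real (rearr M f t)) = rearr M f t"
  using rearr_finite[OF meas prob fin] by (simp add: less_top)

lemma lower_step_eq:
  assumes "0 < t" "t \<le> 1"
  shows "lower_step M f m t = rearr M f (of_int \<lceil>2 ^ m * t\<rceil> / 2 ^ m)"
proof -
  obtain i where i: "i < 2 ^ m" "real i / real (2 ^ m) < t" "t \<le> real (Suc i) / real (2 ^ m)"
    "real (Suc i) = of_int \<lceil>real (2 ^ m) * t\<rceil>"
    using step_cell[of "2 ^ m" t] assms by auto
  have "0 < real (Suc i) / 2 ^ m" by simp
  then show ?thesis
    unfolding lower_step_def step_fun_eq[OF i(1-3)] using i(4)
    by (simp only: ennreal_enn2real_rearr) simp
qed

lemma lower_step_le: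
  assumes "0 < t" "t \<le> 1"
  shows "lower_step M f m t \<le> rearr M f t"
  unfolding lower_step_eq[OF assms] by (intro rearr_antimono) (simp add: field_simps)

lemma lower_step_incseq:
  assumes "0 < t" "t \<le> 1"
  shows "incseq (\<lambda>m. lower_step M f m t)"
proof (rule incseq_SucI)
  fix m
  have "2 ^ Suc m * t \<le> of_int (2 * \<lceil>2 ^ m * t\<rceil>)"
    using le_of_int_ceiling[of "2 ^ m * t"] by simp
  then have "\<lceil>2 ^ Suc m * t\<rceil> \<le> 2 * \<lceil>2 ^ m * t\<rceil>" by (simp only: ceiling_le_iff)
  then have "real_of_int \<lceil>2 ^ Suc m * t\<rceil> \<le> 2 * real_of_int \<lceil>2 ^ m * t\<rceil>" by linarith
  then have "real_of_int \<lceil>2 ^ Suc m * t\<rceil> / 2 ^ Suc m \<le> real_of_int \<lceil>2 ^ m * t\<rceil> / 2 ^ m"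
    by (simp add: field_simps)
  then show "lower_step M f m t \<le> lower_step M f (Suc m) t"
    unfolding lower_step_eq[OF assms] by (rule rearr_antimono)
qed

text \<open>Right continuity: \<open>l < rearr M f t\<close> means that \<open>t\<close> lies
  strictly below the distribution function at \<open>l\<close>, which leaves room for the right end
  of the cell of \<open>t\<close> once the mesh is small.\<close>

lemma lower_step_SUP:
  assumes "0 < t" "t \<le> 1"
  shows "(SUP m. lower_step M f m t) = rearr M f t"
proof (rule antisym)
  show "(SUP m. lower_step M f m t) \<le> rearr M f t"
    using lower_step_le[OF assms] by (intro SUP_least)
  show "rearr M f t \<le> (SUP m. lower_step M f m t)"
  proof (rule le_SUP_iff[THEN iffD2], intro allI impI)
    fix l assume "l < rearr M f t"
    then have "ennreal t < distr_fun M f l" by (simp add: less_rearr_iff[OF meas])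
    then obtain s where s: "ennreal t < ennreal s" "ennreal s < distr_fun M f l"
      using dense[of "ennreal t" "distr_fun M f l"] by (metis ennreal_cases less_top top.extremum_strict not_less_iff_gr_or_eq)
    then have ts: "t < s" using assms by (simp add: ennreal_less_iff)
    obtain m where m: "(1/2)^m < s - t" using real_arch_pow_inv[of "s - t" "1/2"] ts by auto
    have "of_int \<lceil>2 ^ m * t\<rceil> \<le> 2 ^ m * t + 1" by linarith
    then have "of_int \<lceil>2 ^ m * t\<rceil> / 2 ^ m \<le> t + (1/2)^m" by (simp add: field_simps power_divide)
    also have "\<dots> \<le> s" using m by simp
    finally have "ennreal (of_int \<lceil>2 ^ m * t\<rceil> / 2 ^ m) \<le> ennreal s" by (rule ennreal_leI)
    with s have "l < lower_step M f m t" unfolding lower_step_eq[OF assms] by (simp add: less_rearr_iff[OF meas])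
    then show "\<exists>m\<in>UNIV. l < lower_step M f m t" by auto
  qed
qed

lemma lower_step_measurable: "lower_step M f m \<in> borel_measurable I01"
  unfolding lower_step_def by (intro borel_measurable_I01 step_fun_measurable)

lemma rearr_measurable_I01: "rearr M f \<in> borel_measurable I01"
  by (intro borel_measurable_I01 rearr_measurable meas)

end

section \<open>The principle on probability spaces\<close>

lemma nn_integral_I01_const_Ioc: "(\<integral>\<^sup>+s. c * indicator {0<..t} s \<partial>I01) = c * ennreal t" if "0 < t" "t \<le> 1"
proof -
  have "(\<integral>\<^sup>+s. c * indicator {0<..t} s \<partial>I01) = (\<integral>\<^sup>+s. c * indicator ({0<..<1} \<inter> {0<..t}) s \<partial>I01)"
    by (intro nn_integral_cong) (auto simp: indicator_def)
  also have "\<dots> = c * emeasure I01 ({0<..<1} \<inter> {0<..t})"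
    by (intro nn_integral_cmult_indicator) (auto simp: sets_restrict_space)
  also have "\<dots> = c * ennreal t"
    using emeasure_I01_Ioc[of 0 t] that by simp
  finally show ?thesis .
qed

lemma ennreal_le_diff_add: "x \<le> (x - y) + y" for x y :: ennreal
proof (cases "y \<le> x")
  case False
  then have "x \<le> y" by simp
  then show ?thesis by (rule order_trans) simp
qed (simp add: diff_add_cancel_ennreal)

text \<open>The integral of f* over (0,t] is the minimum over c of c t plus the integral of the
  positive part of f - c. For g the minimum is attained at the value of its rearrangement at t,
  which is the \<open>c\<close> chosen here.\<close>

lemma nn_integral_rearr_mono:
  assumes f: "f \<in> borel_measurable M" "emeasure M (space M) = 1" "AE x in M. f x < \<infinity>"
    and g: "g \<in> borel_measurable N" "emeasure N (space N) = 1" "AE x in N. g x < \<infinity>"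
    and le: "\<And>c::real. 0 \<le> c \<Longrightarrow> (\<integral>\<^sup>+x. f x - ennreal c \<partial>M) \<le> (\<integral>\<^sup>+x. g x - ennreal c \<partial>N)"
    and t: "0 < t" "t \<le> 1"
  shows "(\<integral>\<^sup>+s. rearr M f s * indicator {0<..t} s \<partial>I01) \<le> (\<integral>\<^sup>+s. rearr N g s * indicator {0<..t} s \<partial>I01)"
proof -
  define c where "c = enn2real (rearr N g t)"
  have c: "ennreal c = rearr N g t" "0 \<le> c" using ennreal_enn2real_rearr[OF g t(1)] by (auto simp: c_def)
  note [measurable] = rearr_measurable_I01[OF f] rearr_measurable_I01[OF g]
  have [measurable]: "(\<lambda>s. indicator {0<..t} s :: ennreal) \<in> borel_measurable I01"
    by (intro borel_measurable_I01) measurable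
  have "(\<integral>\<^sup>+s. rearr M f s * indicator {0<..t} s \<partial>I01) \<le>
      (\<integral>\<^sup>+s. (rearr M f s - ennreal c) + ennreal c * indicator {0<..t} s \<partial>I01)"
    by (intro nn_integral_mono) (auto simp: indicator_def ennreal_le_diff_add)
  also have "\<dots> = (\<integral>\<^sup>+s. rearr M f s - ennreal c \<partial>I01) + ennreal c * ennreal t"
    by (simp add: nn_integral_add nn_integral_I01_const_Ioc[OF t])
  also have "(\<integral>\<^sup>+s. rearr M f s - ennreal c \<partial>I01) = (\<integral>\<^sup>+x. f x - ennreal c \<partial>M)"
    by (rule nn_integral_rearr[OF f(1) _ f(2)]) measurable
  also have "\<dots> \<le> (\<integral>\<^sup>+x. g x - ennreal c \<partial>N)" by (rule le[OF c(2)])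
  also have "\<dots> = (\<integral>\<^sup>+s. rearr N g s - ennreal c \<partial>I01)"
    by (rule nn_integral_rearr[OF g(1) _ g(2), symmetric]) measurable
  also have "\<dots> + ennreal c * ennreal t = (\<integral>\<^sup>+s. (rearr N g s - ennreal c) + ennreal c * indicator {0<..t} s \<partial>I01)"
    by (simp add: nn_integral_add nn_integral_I01_const_Ioc[OF t])
  also have "\<dots> \<le> (\<integral>\<^sup>+s. rearr N g s * indicator {0<..t} s \<partial>I01)"
  proof (intro nn_integral_mono)
    fix s assume "s \<in> space I01"
    then have s: "0 < s" "s < 1" by auto
    show "(rearr N g s - ennreal c) + ennreal c * indicator {0<..t} s \<le> rearr N g s * indicator {0<..t} s"
    proof (cases "s \<le> t")
      case True
      then have "ennreal c \<le> rearr N g s" unfolding c by (rule rearr_antimono)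
      then show ?thesis using True s by (simp add: diff_add_cancel_ennreal)
    next
      case False
      then have "rearr N g s \<le> ennreal c" unfolding c by (intro rearr_antimono) auto
      then show ?thesis using False ennreal_minus_mono[of "rearr N g s" "ennreal c" "ennreal c" "ennreal c"] by simp
    qed
  qed
  finally show ?thesis by simp
qed

text \<open>Both rearrangements are approximated from below by dyadic steps, that of f on 2^m cells
  and that of g on the finer 2^(m+p) cells, so that the vector version applies. The integrals of the
  steps for g reach their limit only as p grows, so a factor \<theta> < 1 provides the slack for a
  finite p. Finally \<theta> tends to 1 and m to infinity.\<close>

theorem hardy_littlewood_polya:
  assumes ri: "ri_norm I01 \<rho>"
    and f: "f \<in> borel_measurable M" "emeasure M (space M) = 1" "AE x in M. f x < \<infinity>"
    and g: "g \<in> borel_measurable N" "emeasure N (space N) = 1" "AE x in N. g x < \<infinity>"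
    and le: "\<And>c::real. 0 \<le> c \<Longrightarrow> (\<integral>\<^sup>+x. f x - ennreal c \<partial>M) \<le> (\<integral>\<^sup>+x. g x - ennreal c \<partial>N)"
  shows "\<rho> (rearr M f) \<le> \<rho> (rearr N g)"
proof -
  note bfn = ri_bfn[OF ri]
  note [measurable] = rearr_measurable_I01[OF f] rearr_measurable_I01[OF g]
    lower_step_measurable[OF f] lower_step_measurable[OF g]
  define h where "h m i = enn2real (rearr M f (real (Suc i) / 2 ^ m))" for m i
  define k where "k m i = enn2real (rearr N g (real (Suc i) / 2 ^ m))" for m i
  have h0: "0 \<le> h m i" and k0: "0 \<le> k m i" for m i by (auto simp: h_def k_def)
  have hk_mono: "h m j \<le> h m i" "k m j \<le> k m i" if "i \<le> j" for m i j
    unfolding h_def k_def using that rearr_finite[OF f] rearr_finite[OF g]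
    by (auto intro!: enn2real_mono rearr_antimono divide_right_mono simp: less_top)
  have scaled: "ennreal \<theta> * \<rho> (lower_step M f m) \<le> \<rho> (rearr N g)" if \<theta>: "0 < \<theta>" "\<theta> < 1" for \<theta> m
  proof -
    have ev: "eventually (\<lambda>p. \<theta> * (\<Sum>i<a. h m i) / 2 ^ m \<le> (\<Sum>j<a * 2 ^ p. k (m + p) j) / 2 ^ (m + p)) sequentially"
      if a: "a \<le> 2 ^ m" for a
    proof (cases "(\<Sum>i<a. h m i) = 0")
      case True
      then show ?thesis by (auto intro!: always_eventually sum_nonneg divide_nonneg_nonneg k0)
    next
      case False
      then have pos: "0 < (\<Sum>i<a. h m i)" using h0 by (simp add: sum_nonneg less_le)
      then have "a \<noteq> 0" by (intro notI) simp
      let ?t = "real a / 2 ^ m"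
      have "real a \<le> 2 ^ m" using a by (metis of_nat_le_iff of_nat_numeral of_nat_power)
      then have t: "0 < ?t" "?t \<le> 1" using \<open>a \<noteq> 0\<close> by auto
      have [measurable]: "(\<lambda>s. indicator {0<..?t} s :: ennreal) \<in> borel_measurable I01"
        by (intro borel_measurable_I01) measurable
      have intk: "(\<integral>\<^sup>+s. lower_step N g (m + p) s * indicator {0<..?t} s \<partial>I01) = ennreal ((\<Sum>j<a * 2 ^ p. k (m + p) j) / 2 ^ (m + p))" for p
      proof -
        have "?t = real (a * 2 ^ p) / real (2 ^ (m + p))" by (simp add: power_add)
        moreover have "a * 2 ^ p \<le> 2 ^ (m + p)" using a by (simp add: power_add)
        ultimately show ?thesis
          using nn_integral_step_fun[of "2 ^ (m + p)" "a * 2 ^ p" "k (m + p)"] k0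
          unfolding lower_step_def k_def by simp
      qed
      \<comment> \<open>Strictness turns the supremum over p into a single p; monotonicity in p then
        keeps the inequality for all larger ones.\<close>
      have "\<theta> * (\<Sum>i<a. h m i) / 2 ^ m < (\<Sum>i<a. h m i) / 2 ^ m"
        using \<theta> pos by (simp add: divide_strict_right_mono)
      then have "ennreal (\<theta> * (\<Sum>i<a. h m i) / 2 ^ m) < ennreal ((\<Sum>i<a. h m i) / 2 ^ m)"
        using pos \<theta> by (intro ennreal_lessI) auto
      also have "\<dots> = (\<integral>\<^sup>+s. lower_step M f m s * indicator {0<..?t} s \<partial>I01)"
        using nn_integral_step_fun[of "2 ^ m" a "h m"] a h0 unfolding lower_step_def h_def by simp
      also have "\<dots> \<le> (\<integral>\<^sup>+s. rearr M f s * indicator {0<..?t} s \<partial>I01)"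
        by (intro nn_integral_mono mult_right_mono lower_step_le[OF f]) auto
      also have "\<dots> \<le> (\<integral>\<^sup>+s. rearr N g s * indicator {0<..?t} s \<partial>I01)"
        by (rule nn_integral_rearr_mono[OF f g le t])
      also have "\<dots> = (\<integral>\<^sup>+s. (SUP p. lower_step N g (m + p) s * indicator {0<..?t} s) \<partial>I01)"
      proof (intro nn_integral_cong)
        fix s assume "s \<in> space I01"
        then have s: "0 < s" "s \<le> 1" by auto
        have "(SUP p. lower_step N g (m + p) s) = (SUP p. lower_step N g p s)"
          using lower_step_incseq[OF g s] by (intro SUP_eq) (auto simp: incseq_def intro: le_add2)
        then show "rearr N g s * indicator {0<..?t} s = (SUP p. lower_step N g (m + p) s * indicator {0<..?t} s)"
          by (simp add: lower_step_SUP[OF g s] SUP_mult_right_ennreal[symmetric])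
      qed
      also have "\<dots> = (SUP p. \<integral>\<^sup>+s. lower_step N g (m + p) s * indicator {0<..?t} s \<partial>I01)"
      proof (rule nn_integral_monotone_convergence_SUP_AE)
        show "AE s in I01. lower_step N g (m + p) s * indicator {0<..?t} s \<le> lower_step N g (m + Suc p) s * indicator {0<..?t} s" for p
          by (rule AE_I01_I, rule mult_right_mono, rule incseqD[OF lower_step_incseq[OF g]]) auto
      qed auto
      finally obtain p where p: "ennreal (\<theta> * (\<Sum>i<a. h m i) / 2 ^ m) < ennreal ((\<Sum>j<a * 2 ^ p. k (m + p) j) / 2 ^ (m + p))"
        unfolding intk by (auto simp: less_SUP_iff)
      show ?thesis
      proof (rule eventually_sequentiallyI[of p])
        fix q assume "p \<le> q"
        have "ennreal ((\<Sum>j<a * 2 ^ p. k (m + p) j) / 2 ^ (m + p)) \<le> ennreal ((\<Sum>j<a * 2 ^ q. k (m + q) j) / 2 ^ (m + q))"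
          unfolding intk[symmetric]
          using \<open>p \<le> q\<close> by (intro nn_integral_mono mult_right_mono incseqD[OF lower_step_incseq[OF g]]) auto
        with p have "ennreal (\<theta> * (\<Sum>i<a. h m i) / 2 ^ m) \<le> ennreal ((\<Sum>j<a * 2 ^ q. k (m + q) j) / 2 ^ (m + q))" by simp
        then show "\<theta> * (\<Sum>i<a. h m i) / 2 ^ m \<le> (\<Sum>j<a * 2 ^ q. k (m + q) j) / 2 ^ (m + q)"
          by (subst (asm) ennreal_le_iff) (auto intro!: sum_nonneg divide_nonneg_nonneg k0)
      qed
    qed
    \<comment> \<open>There are finitely many nodes a / 2^m, so one p serves all of them.\<close>
    have "eventually (\<lambda>p. \<forall>a\<in>{..2 ^ m}. \<theta> * (\<Sum>i<a. h m i) / 2 ^ m \<le> (\<Sum>j<a * 2 ^ p. k (m + p) j) / 2 ^ (m + p)) sequentially"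
      using ev by (intro eventually_ball_finite) auto
    then obtain p where p: "\<And>a. a \<le> 2 ^ m \<Longrightarrow> \<theta> * (\<Sum>i<a. h m i) / 2 ^ m \<le> (\<Sum>j<a * 2 ^ p. k (m + p) j) / 2 ^ (m + p)"
      by (auto simp: eventually_sequentially)
    let ?N = "2 ^ (m + p) :: nat"
    \<comment> \<open>The coarse values, repeated on the 2^p fine cells of each coarse cell.\<close>
    define x where "x j = \<theta> * h m (j div 2 ^ p)" for j
    have "\<rho> (step_fun ?N x) \<le> \<rho> (step_fun ?N (k (m + p)))"
    proof (rule hardy_littlewood_polya_step[OF ri])
      show "x j \<le> x i" if "i \<le> j" for i j
        unfolding x_def using that \<theta> by (intro mult_left_mono hk_mono div_le_mono) auto
      fix l assume "l \<le> ?N"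
      then have l: "l \<le> 2 ^ m * 2 ^ p" by (simp add: power_add)
      have blk: "(\<Sum>j<a * B. u (j div B)) = real B * (\<Sum>i<a. u i)" if "0 < B" for a B and u :: "nat \<Rightarrow> real"
        using that
      proof (induction a)
        case (Suc a)
        have "(\<Sum>j=a*B..<Suc a*B. u (j div B)) = (\<Sum>j=a*B..<Suc a*B. u a)"
          using that by (intro sum.cong refl arg_cong[of _ _ u] div_nat_eqI) (auto simp: mult.commute)
        moreover have "(\<Sum>j<Suc a*B. u (j div B)) = (\<Sum>j<a*B. u (j div B)) + (\<Sum>j=a*B..<Suc a*B. u (j div B))"
          by (simp only: lessThan_atLeast0) (intro sum.atLeastLessThan_concat[symmetric], auto)
        ultimately show ?case using Suc by (simp add: algebra_simps)
      qed simp
      have "(\<Sum>j<l. \<theta> * h m (j div 2 ^ p)) \<le> (\<Sum>j<l. k (m + p) j)"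
      proof (rule partial_sums_le_from_blocks[OF _ _ _ l])
        show "(\<Sum>j<a * 2 ^ p. \<theta> * h m (j div 2 ^ p)) \<le> (\<Sum>j<a * 2 ^ p. k (m + p) j)" if a: "a \<le> 2 ^ m" for a
        proof -
          have "(\<Sum>j<a * 2 ^ p. \<theta> * h m (j div 2 ^ p)) = 2 ^ p * (\<theta> * (\<Sum>i<a. h m i))"
            using blk[of "2 ^ p" "\<lambda>i. \<theta> * h m i" a] by (simp add: sum_distrib_left)
          then show ?thesis using p[OF a] by (simp add: power_add field_simps)
        qed
      qed (use hk_mono in auto)
      then show "(\<Sum>j<l. x j) \<le> (\<Sum>j<l. k (m + p) j)" by (simp add: x_def)
    qed (use \<theta> h0 k0 in \<open>auto simp: x_def\<close>)
    also have "step_fun ?N (k (m + p)) = lower_step N g (m + p)"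
      by (simp add: lower_step_def k_def[abs_def])
    also have "\<rho> \<dots> \<le> \<rho> (rearr N g)"
      by (intro bfn_mono[OF bfn] AE_I01_I lower_step_le[OF g]) auto
    also have "\<rho> (step_fun ?N x) = \<rho> (\<lambda>t. ennreal \<theta> * lower_step M f m t)"
    proof (rule bfn_cong_AE[OF bfn])
      show "AE t in I01. step_fun ?N x t = ennreal \<theta> * lower_step M f m t"
      proof (rule AE_I01_I)
        fix t :: real assume t: "0 < t" "t < 1"
        obtain j where j: "j < ?N" "real j / real ?N < t" "t \<le> real (Suc j) / real ?N"
          using step_cell[of ?N t] t by auto
        define i where "i = j div 2 ^ p"
        have i1: "i < 2 ^ m" using j(1) by (simp add: i_def power_add less_mult_imp_div_less)
        have "i * 2 ^ p \<le> j" "Suc j \<le> Suc i * 2 ^ p"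
          unfolding i_def by (auto simp: Suc_le_eq dividend_less_div_times)
        then have "real (i * 2 ^ p) \<le> real j" "real (Suc j) \<le> real (Suc i * 2 ^ p)" by (simp_all only: of_nat_le_iff)
        then have "real (i * 2 ^ p) / real ?N \<le> real j / real ?N" "real (Suc j) / real ?N \<le> real (Suc i * 2 ^ p) / real ?N"
          by (intro divide_right_mono; simp)+
        then have "real i / real (2 ^ m) \<le> real j / real ?N" "real (Suc j) / real ?N \<le> real (Suc i) / real (2 ^ m)"
          by (simp_all add: power_add del: of_nat_Suc mult_Suc)
        then have i: "real i / real (2 ^ m) < t" "t \<le> real (Suc i) / real (2 ^ m)" using j by linarith+
        show "step_fun ?N x t = ennreal \<theta> * lower_step M f m t"
          unfolding lower_step_def step_fun_eq[OF j] step_fun_eq[OF i1 i]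
          using \<theta> h0[of m i] by (simp add: x_def i_def[symmetric] h_def ennreal_mult)
      qed
    qed (auto intro!: borel_measurable_I01 step_fun_measurable)
    finally show ?thesis using \<theta> by (simp add: bfn_cmult[OF bfn])
  qed
  have "\<rho> (lower_step M f m) \<le> \<rho> (rearr N g)" for m
  proof (cases "\<rho> (rearr N g)")
    case (real b)
    \<comment> \<open>One fixed \<theta> already shows that the left side is finite, so the limit in
      \<theta> is one of real numbers.\<close>
    have "ennreal (1/2) * \<rho> (lower_step M f m) \<le> ennreal b" using scaled[of "1/2" m] real by simp
    then have "\<rho> (lower_step M f m) \<noteq> top" by (auto simp: ennreal_mult_eq_top_iff top_unique)
    then obtain a where a: "\<rho> (lower_step M f m) = ennreal a" "0 \<le> a" by (cases "\<rho> (lower_step M f m)") auto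
    have "z * a \<le> b" if "0 < z" "z < 1" for z
      using scaled[OF that, of m] that a real by (simp flip: ennreal_mult)
    then have "a \<le> b" by (rule field_le_mult_one_interval)
    then show ?thesis using a real by (simp add: ennreal_leI)
  qed simp
  moreover have "\<rho> (rearr M f) = (SUP m. \<rho> (lower_step M f m))"
    by (rule bfn_SUP[OF bfn]) (auto intro!: AE_I01_I simp: lower_step_SUP[OF f] lower_step_incseq[OF f])
  ultimately show ?thesis by (simp add: SUP_least)
qed

section \<open>Translations and mollification\<close>

lemma lborel_integral_translation:
  fixes f :: "'a::euclidean_space \<Rightarrow> real"
  assumes [measurable]: "f \<in> borel_measurable borel"
  shows "(\<integral>x. f (x + h) \<partial>lborel) = (\<integral>x. f x \<partial>lborel)"
proof -
  have "(\<integral>x. f x \<partial>distr lborel borel ((+) h)) = (\<integral>x. f (h + x) \<partial>lborel)"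
    by (rule integral_distr) auto
  then show ?thesis by (simp add: lborel_distr_plus add.commute)
qed

lemma lborel_integrable_translation:
  fixes f :: "'a::euclidean_space \<Rightarrow> real"
  assumes "integrable lborel f"
  shows "integrable lborel (\<lambda>x. f (x + h))"
proof -
  have [measurable]: "f \<in> borel_measurable borel" using assms by auto
  have "integrable (distr lborel borel ((+) h)) f = integrable lborel (\<lambda>x. f (h + x))"
    by (rule integrable_distr_eq) auto
  then show ?thesis using assms by (simp add: lborel_distr_plus add.commute)
qed

text \<open>Translation preserves measure, so the quantity is twice the measure of the part of A
  that is moved out of A. An open T containing A with almost the same measure splits this part: what
  leaves T vanishes as the shift tends to 0, by dominated convergence, and what lands in T - A is at
  most the measure of T - A.\<close>

lemma lborel_L1_continuity_indicator:
  fixes A :: "'a::euclidean_space set"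
  assumes [measurable]: "A \<in> sets borel" and fin: "emeasure lborel A < \<infinity>" and h: "h \<longlonglongrightarrow> 0"
  shows "(\<lambda>n. \<integral>x. \<bar>indicator A (x + h n) - indicator A x\<bar> \<partial>lborel) \<longlonglongrightarrow> (0::real)"
proof -
  have int: "integrable lborel (indicator A :: 'a \<Rightarrow> real)" using fin by simp
  have intt: "integrable lborel (\<lambda>x. indicator A (x + c) :: real)" for c
    by (rule lborel_integrable_translation[OF int])
  define a where "a n = (\<integral>x. indicator A x * (1 - indicator A (x + h n)) \<partial>lborel :: real)" for n :: nat
  have split: "(\<integral>x. \<bar>indicator A (x + h n) - indicator A x :: real\<bar> \<partial>lborel) = 2 * a n" for n
  proof -
    have i1: "integrable lborel (\<lambda>x. indicator A x * indicator A (x + h n) :: real)"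
      by (rule Bochner_Integration.integrable_bound[OF int]) (auto simp: indicator_def)
    define p where "p = (\<integral>x. indicator A x * indicator A (x + h n) \<partial>lborel :: real)"
    define q where "q = integral\<^sup>L lborel (indicator A :: 'a \<Rightarrow> real)"
    have "(\<integral>x. indicator A (x + h n) \<partial>lborel :: real) = q"
      unfolding q_def by (rule lborel_integral_translation) auto
    then have "(\<integral>x. indicator A x + indicator A (x + h n) - 2 * (indicator A x * indicator A (x + h n)) \<partial>lborel :: real) = q + q - 2 * p"
      using int intt i1 by (simp add: p_def q_def)
    moreover have "a n = q - p"
      unfolding a_def p_def q_def using int i1
      by (subst Bochner_Integration.integral_diff[symmetric]) (auto simp: algebra_simps)
    moreover have "(\<integral>x. \<bar>indicator A (x + h n) - indicator A x :: real\<bar> \<partial>lborel) =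
      (\<integral>x. indicator A x + indicator A (x + h n) - 2 * (indicator A x * indicator A (x + h n)) \<partial>lborel)"
      by (intro Bochner_Integration.integral_cong) (auto simp: indicator_def)
    ultimately show ?thesis by simp
  qed
  have a0: "0 \<le> a n" for n unfolding a_def by (intro integral_nonneg_AE AE_I2) (auto simp: indicator_def)
  have "a \<longlonglongrightarrow> 0"
  proof (rule LIMSEQ_I)
    fix e :: real assume e: "0 < e"
    obtain T where T: "open T" "A \<subseteq> T" "T - A \<in> lmeasurable" "emeasure lebesgue (T - A) < ennreal (e / 2)"
      using sets_lebesgue_outer_open[of A "e / 2"] e assms(1) by auto
    have [measurable]: "T \<in> sets borel" using T by auto
    have TA: "emeasure lborel (T - A) < ennreal (e / 2)" using T(4) by simp
    have intTA: "integrable lborel (indicator (T - A) :: 'a \<Rightarrow> real)"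
      using TA by (simp add: order.strict_trans[OF TA])
    have mTA: "(\<integral>x. indicator (T - A) x \<partial>lborel) < e / 2"
    proof -
      have "emeasure lborel (T - A) = ennreal (measure lborel (T - A))"
        using TA by (intro emeasure_eq_ennreal_measure) auto
      then show ?thesis using TA e by (simp add: ennreal_less_iff)
    qed
    define b where "b n = (\<integral>x. indicator A x * (1 - indicator T (x + h n)) \<partial>lborel :: real)" for n
    have "b \<longlonglongrightarrow> integral\<^sup>L lborel (\<lambda>x::'a. 0)"
      unfolding b_def
    proof (rule integral_dominated_convergence[where w = "indicator A"])
      show "AE x in lborel. (\<lambda>n. indicator A x * (1 - indicator T (x + h n)) :: real) \<longlonglongrightarrow> 0"
      proof (rule AE_I2)
        fix x
        show "(\<lambda>n. indicator A x * (1 - indicator T (x + h n)) :: real) \<longlonglongrightarrow> 0"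
        proof (cases "x \<in> A")
          case True
          have "(\<lambda>n. x + h n) \<longlonglongrightarrow> x" using tendsto_add[OF tendsto_const h, of x] by simp
          then have "eventually (\<lambda>n. x + h n \<in> T) sequentially"
            using topological_tendstoD[OF _ T(1)] True T(2) by blast
          then show ?thesis by (intro tendsto_eventually) (erule eventually_mono, simp)
        qed simp
      qed
      show "integrable lborel (indicator A :: 'a \<Rightarrow> real)" by fact
    qed (auto simp: indicator_def)
    then have "eventually (\<lambda>n. b n < e / 2) sequentially"
      using e by (auto dest!: order_tendstoD(2)[of _ _ _ "e/2"])
    then obtain N where N: "\<And>n. n \<ge> N \<Longrightarrow> b n < e / 2" by (auto simp: eventually_sequentially)
    have ab: "a n \<le> b n + (\<integral>x. indicator (T - A) (x + h n) \<partial>lborel)" for n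
      unfolding a_def b_def
    proof (subst Bochner_Integration.integral_add[symmetric])
      show i1: "integrable lborel (\<lambda>x. indicator A x * (1 - indicator T (x + h n)) :: real)"
        by (rule Bochner_Integration.integrable_bound[OF int]) (auto simp: indicator_def)
      show i2: "integrable lborel (\<lambda>x. indicator (T - A) (x + h n) :: real)"
        by (rule lborel_integrable_translation[OF intTA])
      show "(\<integral>x. indicator A x * (1 - indicator A (x + h n)) \<partial>lborel) \<le>
         (\<integral>x. indicator A x * (1 - indicator T (x + h n)) + indicator (T - A) (x + h n) \<partial>lborel :: real)"
      proof (rule integral_mono)
        show "integrable lborel (\<lambda>x. indicator A x * (1 - indicator A (x + h n)) :: real)"
          by (rule Bochner_Integration.integrable_bound[OF int]) (auto simp: indicator_def)
      qed (use i1 i2 in \<open>auto simp: indicator_def\<close>)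
    qed
    have tr: "(\<integral>x. indicator (T - A) (x + h n) \<partial>lborel) = (\<integral>x. indicator (T - A) x \<partial>lborel :: real)" for n
      by (rule lborel_integral_translation) auto
    have "a n < e" if "n \<ge> N" for n using ab[of n] N[OF that] mTA unfolding tr by linarith
    then show "\<exists>no. \<forall>n\<ge>no. norm (a n - 0) < e" using a0 by auto
  qed
  then have "(\<lambda>n. 2 * a n) \<longlonglongrightarrow> 2 * 0" by (intro tendsto_mult tendsto_const)
  then show ?thesis unfolding split by simp
qed

theorem lborel_L1_continuity:
  fixes f :: "'a::euclidean_space \<Rightarrow> real"
  assumes "integrable lborel f" and h: "h \<longlonglongrightarrow> 0"
  shows "(\<lambda>n. \<integral>x. \<bar>f (x + h n) - f x\<bar> \<partial>lborel) \<longlonglongrightarrow> 0"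
  using assms(1)
proof (induction rule: integrable_induct)
  case (base A c)
  have A: "A \<in> sets borel" using base by simp
  have "(\<lambda>n. \<bar>c\<bar> * (\<integral>x. \<bar>indicator A (x + h n) - indicator A x\<bar> \<partial>lborel)) \<longlonglongrightarrow> \<bar>c\<bar> * 0"
    by (intro tendsto_mult tendsto_const lborel_L1_continuity_indicator[OF A base(2) h])
  moreover have "\<bar>indicator A (x + h n) *\<^sub>R c - indicator A x *\<^sub>R c\<bar> = \<bar>c\<bar> * \<bar>indicator A (x + h n) - indicator A x\<bar>" for x n
    by (auto simp: indicator_def)
  ultimately show ?case by simp
next
  case (add f g)
  have int: "integrable lborel (\<lambda>x. \<bar>u (x + h n) - u x\<bar>)" if "integrable lborel u" for u :: "'a \<Rightarrow> real" and n
    using that lborel_integrable_translation[OF that, of "h n"] by simp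
  have lim: "(\<lambda>n. (\<integral>x. \<bar>f (x + h n) - f x\<bar> \<partial>lborel) + (\<integral>x. \<bar>g (x + h n) - g x\<bar> \<partial>lborel)) \<longlonglongrightarrow> 0 + 0"
    using add by (intro tendsto_add)
  show ?case
  proof (rule tendsto_sandwich[OF _ _ tendsto_const])
    show "\<forall>\<^sub>F n in sequentially. (\<integral>x. \<bar>f (x + h n) + g (x + h n) - (f x + g x)\<bar> \<partial>lborel) \<le>
      (\<integral>x. \<bar>f (x + h n) - f x\<bar> \<partial>lborel) + (\<integral>x. \<bar>g (x + h n) - g x\<bar> \<partial>lborel)"
    proof (rule always_eventually, rule allI)
      fix n
      have "(\<integral>x. \<bar>f (x + h n) + g (x + h n) - (f x + g x)\<bar> \<partial>lborel) \<le> (\<integral>x. \<bar>f (x + h n) - f x\<bar> + \<bar>g (x + h n) - g x\<bar> \<partial>lborel)"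
        using int[of "\<lambda>x. f x + g x" n] int[of f n] int[of g n] add by (intro integral_mono) auto
      then show "(\<integral>x. \<bar>f (x + h n) + g (x + h n) - (f x + g x)\<bar> \<partial>lborel) \<le>
        (\<integral>x. \<bar>f (x + h n) - f x\<bar> \<partial>lborel) + (\<integral>x. \<bar>g (x + h n) - g x\<bar> \<partial>lborel)"
        using int[of f n] int[of g n] add by simp
    qed
  qed (use lim in auto)
next
  case (lim f s)
  have [measurable]: "f \<in> borel_measurable borel" "s i \<in> borel_measurable borel" for i using lim by auto
  have int: "integrable lborel (\<lambda>x. \<bar>u (x + h n) - u x\<bar>)" if "integrable lborel u" for u :: "'a \<Rightarrow> real" and n
    using that lborel_integrable_translation[OF that, of "h n"] by simp
  have "(\<lambda>i. \<integral>x. \<bar>f x - s i x\<bar> \<partial>lborel) \<longlonglongrightarrow> integral\<^sup>L lborel (\<lambda>x::'a. 0)"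
  \<comment> \<open>The induction rule supplies approximants bounded by 2|f|, hence the majorant
    3|f|.\<close>
  proof (rule integral_dominated_convergence[where w = "\<lambda>x. 3 * \<bar>f x\<bar>"])
    show "AE x in lborel. (\<lambda>i. \<bar>f x - s i x\<bar>) \<longlonglongrightarrow> 0"
    proof (rule AE_I2)
      fix x
      have "(\<lambda>i. s i x) \<longlonglongrightarrow> f x" using lim by simp
      then have "(\<lambda>i. \<bar>f x - s i x\<bar>) \<longlonglongrightarrow> \<bar>f x - f x\<bar>"
        by (intro tendsto_intros)
      then show "(\<lambda>i. \<bar>f x - s i x\<bar>) \<longlonglongrightarrow> 0" by simp
    qed
    show "AE x in lborel. norm \<bar>f x - s i x\<bar> \<le> 3 * \<bar>f x\<bar>" for i
    proof (rule AE_I2)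
      fix x
      show "norm \<bar>f x - s i x\<bar> \<le> 3 * \<bar>f x\<bar>" using lim.hyps(3)[of x i] by simp
    qed
  qed (use lim in auto)
  then have conv: "(\<lambda>i. \<integral>x. \<bar>f x - s i x\<bar> \<partial>lborel) \<longlonglongrightarrow> 0" by simp
  show ?case
  proof (rule LIMSEQ_I)
    fix e :: real assume e: "0 < e"
    obtain i where i: "(\<integral>x. \<bar>f x - s i x\<bar> \<partial>lborel) < e / 3"
      using order_tendstoD(2)[OF conv, of "e/3"] e by (auto simp: eventually_sequentially)
    obtain N where N: "\<And>n. n \<ge> N \<Longrightarrow> (\<integral>x. \<bar>s i (x + h n) - s i x\<bar> \<partial>lborel) < e / 3"
      using order_tendstoD(2)[OF lim.IH[of i], of "e/3"] e by (auto simp: eventually_sequentially)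
    have id: "integrable lborel (\<lambda>x. \<bar>f x - s i x\<bar>)" using lim by simp
    have "norm ((\<integral>x. \<bar>f (x + h n) - f x\<bar> \<partial>lborel) - 0) < e" if "n \<ge> N" for n
    proof -
      have id2: "integrable lborel (\<lambda>x. \<bar>f (x + h n) - s i (x + h n)\<bar>)"
        by (rule lborel_integrable_translation[OF id])
      have "(\<integral>x. \<bar>f (x + h n) - f x\<bar> \<partial>lborel) \<le>
        (\<integral>x. \<bar>f (x + h n) - s i (x + h n)\<bar> + \<bar>s i (x + h n) - s i x\<bar> + \<bar>f x - s i x\<bar> \<partial>lborel)"
        using id id2 int[of "s i" n] int[of f n] lim by (intro integral_mono) auto
      also have "\<dots> = (\<integral>x. \<bar>f (x + h n) - s i (x + h n)\<bar> \<partial>lborel) + (\<integral>x. \<bar>s i (x + h n) - s i x\<bar> \<partial>lborel) + (\<integral>x. \<bar>f x - s i x\<bar> \<partial>lborel)"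
        using id id2 int[of "s i" n] lim by simp
      also have "(\<integral>x. \<bar>f (x + h n) - s i (x + h n)\<bar> \<partial>lborel) = (\<integral>x. \<bar>f x - s i x\<bar> \<partial>lborel)"
        by (rule lborel_integral_translation) auto
      finally show ?thesis using i N[OF that] by (simp add: integral_nonneg_AE)
    qed
    then show "\<exists>no. \<forall>n\<ge>no. norm ((\<integral>x. \<bar>f (x + h n) - f x\<bar> \<partial>lborel) - 0) < e" by blast
  qed
qed

text \<open>The difference quotients along \<open>e\<close> have integral 0 by translation
  invariance. The mean value theorem bounds them by B and the support condition confines them to a
  fixed ball, so the integral of their limit is 0 by dominated convergence; measurability of
  \<open>F'\<close> comes from the same limit.\<close>

lemma integral_directional_derivative_eq_0:
  fixes F F' :: "'a::euclidean_space \<Rightarrow> real" and e :: 'a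
  assumes [measurable]: "F \<in> borel_measurable borel"
    and supp: "bounded S" "\<And>x. x \<notin> S \<Longrightarrow> F x = 0"
    and deriv: "\<And>x. ((\<lambda>t. F (x + t *\<^sub>R e)) has_real_derivative F' x) (at 0)"
    and bound: "\<And>x. \<bar>F' x\<bar> \<le> B"
  shows "(\<integral>x. F' x \<partial>lborel) = 0"
proof -
  obtain R where R: "\<And>x. x \<in> S \<Longrightarrow> norm x \<le> R" using supp(1) by (auto simp: bounded_iff)
  have B0: "0 \<le> B" using bound[of 0] by linarith
  have deriv': "((\<lambda>t. F (x + t *\<^sub>R e)) has_real_derivative F' (x + s *\<^sub>R e)) (at s)" for x s
  proof -
    have "((\<lambda>t. F ((x + s *\<^sub>R e) + (t - s) *\<^sub>R e)) has_real_derivative F' (x + s *\<^sub>R e) * 1) (at s)"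
      by (rule DERIV_chain'[where g = "\<lambda>t. F ((x + s *\<^sub>R e) + t *\<^sub>R e)"])
        (use deriv[of "x + s *\<^sub>R e"] in \<open>auto intro!: derivative_eq_intros\<close>)
    then show ?thesis by (simp add: algebra_simps)
  qed
  have mvt: "\<bar>F (x + t *\<^sub>R e) - F x\<bar> \<le> B * t" if "0 < t" for x t
  proof -
    have "\<exists>z>0. z < t \<and> F (x + t *\<^sub>R e) - F (x + 0 *\<^sub>R e) = (t - 0) * F' (x + z *\<^sub>R e)"
      by (rule MVT2[OF that deriv'])
    then obtain z where "0 < z" "z < t" "F (x + t *\<^sub>R e) - F (x + 0 *\<^sub>R e) = (t - 0) * F' (x + z *\<^sub>R e)"
      by blast
    then have "\<bar>F (x + t *\<^sub>R e) - F x\<bar> = t * \<bar>F' (x + z *\<^sub>R e)\<bar>" using that by (simp add: abs_mult)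
    also have "\<dots> \<le> t * B" using that bound by (intro mult_left_mono) auto
    finally show ?thesis by (simp add: mult.commute)
  qed
  define Q where "Q n x = real (Suc n) * (F (x + (1 / real (Suc n)) *\<^sub>R e) - F x)" for n x
  let ?w = "\<lambda>x::'a. B * indicator (cball 0 (R + norm e)) x :: real"
  have intw: "integrable lborel ?w"
    by (intro integrable_mult_right integrable_real_indicator) (simp_all add: emeasure_lborel_cball_finite[unfolded infinity_ennreal_def])
  \<comment> \<open>Integrability of F needs a bound on F. From a point of S the line in direction
    \<open>e\<close> has left S, where F vanishes, after time (2|R| + |e| + 1) / |e|, and the mean
    value bound applies up to there.\<close>
  have Fbd: "\<bar>F x\<bar> \<le> B * (2 * \<bar>R\<bar> + norm e + 1) / norm e" if "e \<noteq> 0" for x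
  proof (cases "x \<in> S")
    case True
    define t where "t = (2 * \<bar>R\<bar> + norm e + 1) / norm e"
    have t: "0 < t" using that by (auto simp: t_def add_pos_nonneg add_nonneg_pos)
    have "norm (t *\<^sub>R e) = 2 * \<bar>R\<bar> + norm e + 1" using that t by (simp add: t_def)
    moreover have "norm (t *\<^sub>R e) \<le> norm (x + t *\<^sub>R e) + norm x"
      using norm_triangle_ineq4[of "x + t *\<^sub>R e" x] by simp
    ultimately have "norm (x + t *\<^sub>R e) > R"
      using R[OF True] norm_ge_zero[of e] abs_ge_self[of R] by linarith
    then have "F (x + t *\<^sub>R e) = 0" using R supp(2) by force
    then show ?thesis using mvt[OF t, of x] by (simp add: t_def)
  next
    case False
    then show ?thesis using supp(2) B0 by simp
  qed
  show ?thesis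
  proof (cases "e = 0")
    case True
    then have "F' x = 0" for x
      using DERIV_unique[OF deriv[of x], of 0] by simp
    then show ?thesis by simp
  next
    case False
    have intF: "integrable lborel F"
    proof (rule Bochner_Integration.integrable_bound)
      show "integrable lborel (\<lambda>x. B * (2 * \<bar>R\<bar> + norm e + 1) / norm e * indicator (cball 0 R) x :: real)"
        by (intro integrable_mult_right integrable_real_indicator) (simp_all add: emeasure_lborel_cball_finite[unfolded infinity_ennreal_def])
      show "AE x in lborel. norm (F x) \<le> norm (B * (2 * \<bar>R\<bar> + norm e + 1) / norm e * indicator (cball 0 R) x :: real)"
      proof (rule AE_I2)
        fix x
        show "norm (F x) \<le> norm (B * (2 * \<bar>R\<bar> + norm e + 1) / norm e * indicator (cball 0 R) x :: real)"
        proof (cases "x \<in> cball 0 R")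
          case True
          then show ?thesis using order_trans[OF Fbd[OF False, of x] abs_ge_self] by simp
        next
          case F: False
          then have "F x = 0" using R supp(2) by force
          then show ?thesis by simp
        qed
      qed
    qed simp
    have Q0: "(\<integral>x. Q n x \<partial>lborel) = 0" for n
      unfolding Q_def using intF lborel_integrable_translation[OF intF] lborel_integral_translation[of F]
      by simp
    have lim: "(\<lambda>n. Q n x) \<longlonglongrightarrow> F' x" for x
    proof -
      have "((\<lambda>t. (F (x + t *\<^sub>R e) - F (x + 0 *\<^sub>R e)) / (t - 0)) \<longlongrightarrow> F' x) (at 0)"
        using deriv[of x] by (simp add: has_field_derivative_iff)
      moreover have "filterlim (\<lambda>n. 1 / real (Suc n)) (at 0) sequentially"
        unfolding filterlim_at using LIMSEQ_Suc[OF lim_1_over_n] by auto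
      ultimately have "(\<lambda>n. (F (x + (1 / real (Suc n)) *\<^sub>R e) - F (x + 0 *\<^sub>R e)) / (1 / real (Suc n) - 0)) \<longlonglongrightarrow> F' x"
        by (rule filterlim_compose)
      then show ?thesis by (simp add: Q_def mult.commute)
    qed
    have [measurable]: "F' \<in> borel_measurable borel"
      by (rule borel_measurable_LIMSEQ_real[OF lim]) (simp add: Q_def)
    have "(\<lambda>n. \<integral>x. Q n x \<partial>lborel) \<longlonglongrightarrow> (\<integral>x. F' x \<partial>lborel)"
    proof (rule integral_dominated_convergence[OF _ _ intw])
      show "AE x in lborel. norm (Q n x) \<le> ?w x" for n
      proof (rule AE_I2)
        fix x
        show "norm (Q n x) \<le> ?w x"
        proof (cases "x \<in> cball 0 (R + norm e)")
          case True
          have "\<bar>Q n x\<bar> \<le> real (Suc n) * (B * (1 / real (Suc n)))"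
            unfolding Q_def abs_mult by (simp only: abs_of_nat) (intro mult_left_mono mvt, auto)
          then show ?thesis using True by simp
        next
          case F: False
          have "norm ((1 / real (Suc n)) *\<^sub>R e) \<le> norm e"
            by (simp add: divide_le_eq mult_left_le_one_le mult_right_le_one_le field_simps)
          then have "norm (x + (1 / real (Suc n)) *\<^sub>R e) > R"
            using F norm_triangle_ineq4[of "x + (1 / real (Suc n)) *\<^sub>R e" "(1 / real (Suc n)) *\<^sub>R e"] by auto
          moreover have "norm x > R"
          proof -
            have "R + norm e < norm x" using F by simp
            then show ?thesis using norm_ge_zero[of e] by linarith
          qed
          ultimately have "F (x + (1 / real (Suc n)) *\<^sub>R e) = 0" "F x = 0" using R supp(2) by force+
          then show ?thesis by (simp add: Q_def B0)
        qed
      qed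
    qed (use lim in \<open>auto simp: Q_def\<close>)
    then show ?thesis by (simp add: Q0 LIMSEQ_const_iff)
  qed
qed

section \<open>Smooth functions and mollifiers\<close>

lemma partial_deriv_eq: "(\<phi> has_derivative D) (at x) \<Longrightarrow> partial_deriv i \<phi> x = D (axis i 1)"
  unfolding partial_deriv_def by (simp add: frechet_derivative_at[symmetric])

lemma C_diff_SucD: "C_diff (Suc k) \<phi> \<Longrightarrow> C_diff k \<phi>"
proof (induction k arbitrary: \<phi>)
  case 0
  then show ?case
    by (auto intro!: continuous_at_imp_continuous_on differentiable_imp_continuous_within)
next
  case (Suc k)
  then show ?case by simp
qed

lemma C_diff_const: "C_diff k (\<lambda>x. c)"
proof (induction k arbitrary: c)
  case (Suc k)
  have "partial_deriv i (\<lambda>x. c) = (\<lambda>x. 0)" for i :: 'a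
    by (rule ext, subst partial_deriv_eq[where D = "\<lambda>_. 0"]) auto
  then show ?case using Suc by auto
qed simp

lemma partial_deriv_add:
  assumes "\<And>x. f differentiable (at x)" "\<And>x. g differentiable (at x)"
  shows "partial_deriv i (\<lambda>x. f x + g x) = (\<lambda>x. partial_deriv i f x + partial_deriv i g x)"
proof
  fix x
  show "partial_deriv i (\<lambda>x. f x + g x) x = partial_deriv i f x + partial_deriv i g x"
    unfolding partial_deriv_def[of i f] partial_deriv_def[of i g]
    by (rule partial_deriv_eq) (use assms in \<open>auto intro!: has_derivative_add simp: frechet_derivative_works[symmetric]\<close>)
qed

lemma partial_deriv_mult:
  assumes "\<And>x. f differentiable (at x)" "\<And>x. g differentiable (at x)"
  shows "partial_deriv i (\<lambda>x. f x * g x) = (\<lambda>x. f x * partial_deriv i g x + partial_deriv i f x * g x)"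
proof
  fix x
  show "partial_deriv i (\<lambda>x. f x * g x) x = f x * partial_deriv i g x + partial_deriv i f x * g x"
    unfolding partial_deriv_def[of i f] partial_deriv_def[of i g]
    by (rule partial_deriv_eq) (use assms in \<open>auto intro!: has_derivative_mult simp: frechet_derivative_works[symmetric]\<close>)
qed

lemma C_diff_add: "C_diff k f \<Longrightarrow> C_diff k g \<Longrightarrow> C_diff k (\<lambda>x. f x + g x)"
proof (induction k arbitrary: f g)
  case (Suc k)
  then show ?case by (simp add: partial_deriv_add)
qed (auto intro: continuous_intros)

lemma C_diff_mult: "C_diff k f \<Longrightarrow> C_diff k g \<Longrightarrow> C_diff k (\<lambda>x. f x * g x)"
proof (induction k arbitrary: f g)
  case (Suc k)
  have "C_diff k f" "C_diff k g" using Suc.prems by (auto intro: C_diff_SucD)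
  then show ?case using Suc by (simp add: partial_deriv_mult C_diff_add)
qed (auto intro: continuous_intros)

lemma C_diff_prod: "finite A \<Longrightarrow> (\<And>i. i \<in> A \<Longrightarrow> C_diff k (f i)) \<Longrightarrow> C_diff k (\<lambda>x. \<Prod>i\<in>A. f i x)"
  by (induction A rule: finite_induct) (auto intro: C_diff_const C_diff_mult)

lemma partial_deriv_translate:
  assumes "\<And>x. f differentiable (at x)"
  shows "partial_deriv i (\<lambda>y. f (y - a)) = (\<lambda>y. partial_deriv i f (y - a))"
proof
  fix y
  have 1: "(f has_derivative frechet_derivative f (at (y - a))) (at (y - a))"
    using assms by (simp add: frechet_derivative_works[symmetric])
  have 2: "((\<lambda>y. y - a) has_derivative (\<lambda>v. v)) (at y)" by (auto intro!: derivative_eq_intros)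
  have "((\<lambda>y. f (y - a)) has_derivative (\<lambda>v. frechet_derivative f (at (y - a)) v)) (at y)"
    by (rule has_derivative_compose[OF 2 1])
  then show "partial_deriv i (\<lambda>y. f (y - a)) y = partial_deriv i f (y - a)"
    by (subst partial_deriv_eq) (auto simp: partial_deriv_def)
qed

lemma C_diff_translate: "C_diff k f \<Longrightarrow> C_diff k (\<lambda>y. f (y - a))"
proof (induction k arbitrary: f)
  case 0
  then show ?case by (auto intro!: continuous_on_compose2[of UNIV f] continuous_intros)
next
  case (Suc k)
  have "(\<lambda>y. f (y - a)) differentiable (at x)" for x
    using Suc.prems by (intro differentiable_compose[of f "\<lambda>y. y - a"]) (auto intro!: derivative_intros)
  then show ?case using Suc by (simp add: partial_deriv_translate)
qed

lemma partial_deriv_outside_support: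
  assumes "x \<notin> closure {y. f y \<noteq> 0}"
  shows "partial_deriv i f x = 0"
proof -
  have "(f has_derivative (\<lambda>_. 0)) (at x)"
    by (rule has_derivative_transform_within_open[of "\<lambda>_. 0" _ _ _ "- closure {y. f y \<noteq> 0}"])
      (use assms closure_subset[of "{y. f y \<noteq> 0}"] in auto)
  then show ?thesis by (simp add: partial_deriv_eq)
qed

lemma power_le_fact_exp:
  fixes u :: real
  assumes "0 \<le> u"
  shows "u ^ m \<le> fact m * exp u"
proof -
  have "(\<Sum>n\<in>{m}. u ^ n /\<^sub>R fact n) \<le> (\<Sum>n. u ^ n /\<^sub>R fact n)"
    using assms by (intro sum_le_suminf sums_summable[OF exp_converges]) auto
  then have "u ^ m / fact m \<le> exp u"
    using sums_unique[OF exp_converges[of u]] by (simp add: divide_inverse mult.commute)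
  then show ?thesis by (simp add: divide_le_eq mult.commute)
qed

text \<open>The standard function exp(-1/x) extended by 0, together with its multiples by powers of
  1/x. The family is closed under differentiation up to linear combinations, so smoothness is an
  induction with \<open>k\<close> arbitrary.\<close>

definition flat :: "nat \<Rightarrow> real \<Rightarrow> real" where
  "flat k x = (if 0 < x then inverse x ^ k * exp (- inverse x) else 0)"

lemma flat_nonneg: "0 \<le> flat k x"
  by (simp add: flat_def)

text \<open>The bound u^m \<le> m! exp u at u = 1/x and m = k + 2. The square on the right makes the
  difference quotients at 0 vanish in the limit.\<close>

lemma flat_le: "flat k x \<le> fact (k + 2) * x\<^sup>2"
proof (cases "0 < x")
  case True
  have "inverse x ^ (k + 2) * exp (- inverse x) \<le> fact (k + 2)"
    using power_le_fact_exp[of "inverse x" "k + 2"] True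
    by (simp add: exp_minus divide_inverse[symmetric] divide_le_eq)
  then have "x\<^sup>2 * (inverse x ^ (k + 2) * exp (- inverse x)) \<le> x\<^sup>2 * fact (k + 2)"
    by (intro mult_left_mono) auto
  moreover have "x\<^sup>2 * (inverse x ^ (k + 2) * exp (- inverse x)) = flat k x"
    using True by (simp add: flat_def power2_eq_square field_simps)
  ultimately show ?thesis by (simp add: mult.commute)
qed (simp add: flat_def)

lemma flat_deriv: "(flat k has_real_derivative (flat (k + 2) x - real k * flat (k + 1) x)) (at x)"
proof -
  consider "0 < x" | "x < 0" | "x = 0" by linarith
  then show ?thesis
  proof cases
    case 1
    let ?u = "inverse x"
    have u: "(inverse has_real_derivative - ?u\<^sup>2) (at x)"
      using 1 DERIV_inverse[of x] by (simp add: numeral_2_eq_2)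
    have "((\<lambda>x. inverse x ^ k * exp (- inverse x)) has_real_derivative
        real k * (- ?u\<^sup>2 * ?u ^ (k - 1)) * exp (- ?u) + exp (- ?u) * - (- ?u\<^sup>2) * ?u ^ k) (at x)"
      using DERIV_mult[OF DERIV_power[OF u, of k] DERIV_fun_exp[OF DERIV_minus[OF u]]]
      by (simp add: mult_ac)
    also have "real k * (- ?u\<^sup>2 * ?u ^ (k - 1)) * exp (- ?u) + exp (- ?u) * - (- ?u\<^sup>2) * ?u ^ k =
        flat (k + 2) x - real k * flat (k + 1) x"
      using 1 by (cases k) (simp_all add: flat_def power2_eq_square)
    finally have "((\<lambda>x. inverse x ^ k * exp (- inverse x)) has_real_derivative
        (flat (k + 2) x - real k * flat (k + 1) x)) (at x)" .
    then show ?thesis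
      by (rule has_field_derivative_transform_within_open[where S = "{0<..}"]) (use 1 in \<open>auto simp: flat_def\<close>)
  next
    case 2
    have "((\<lambda>x. 0) has_real_derivative (flat (k + 2) x - real k * flat (k + 1) x)) (at x)"
      using 2 by (simp add: flat_def)
    then show ?thesis
      by (rule has_field_derivative_transform_within_open[where S = "{..<0}"]) (use 2 in \<open>auto simp: flat_def\<close>)
  next
    case 3
    have "((\<lambda>y. (flat k y - flat k 0) / (y - 0)) \<longlongrightarrow> 0) (at 0)"
    proof (rule Lim_null_comparison)
      show "\<forall>\<^sub>F y in at 0. norm ((flat k y - flat k 0) / (y - 0)) \<le> fact (k + 2) * \<bar>y\<bar>"
      proof (rule always_eventually, rule allI)
        fix y :: real
        have "\<bar>flat k y\<bar> \<le> fact (k + 2) * \<bar>y\<bar> * \<bar>y\<bar>"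
          using flat_le[of k y] flat_nonneg[of k y] by (simp add: power2_eq_square)
        then show "norm ((flat k y - flat k 0) / (y - 0)) \<le> fact (k + 2) * \<bar>y\<bar>"
          by (cases "y = 0") (auto simp: flat_def[of k 0] abs_divide divide_le_eq)
      qed
      have "((\<lambda>y. fact (k + 2) * \<bar>y\<bar>) \<longlongrightarrow> fact (k + 2) * \<bar>0::real\<bar>) (at 0)"
        by (intro tendsto_intros)
      then show "((\<lambda>y. fact (k + 2) * \<bar>y::real\<bar>) \<longlongrightarrow> 0) (at 0)" by simp
    qed
    then show ?thesis using 3 by (simp add: has_field_derivative_iff flat_def[of _ 0])
  qed
qed

lemma C_diff_flat: "C_diff m (\<lambda>y::real^'n::finite. flat k (s * (y $ i) + c))"
proof (induction m arbitrary: k)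
  case 0
  have "continuous_on UNIV (flat k)"
    by (intro continuous_at_imp_continuous_on ballI DERIV_isCont[OF flat_deriv])
  then show ?case by (auto intro!: continuous_on_compose2[of UNIV "flat k"] continuous_intros)
next
  case (Suc m)
  let ?g = "\<lambda>y::real^'n. flat k (s * (y $ i) + c)"
  let ?d = "\<lambda>y::real^'n. flat (k + 2) (s * (y $ i) + c) - real k * flat (k + 1) (s * (y $ i) + c)"
  have D: "(?g has_derivative (\<lambda>v. ?d y * (s * (v $ i)))) (at y)" for y
    by (rule has_derivative_compose[of "\<lambda>y. s * (y $ i) + c" "\<lambda>v. s * (v $ i)", OF _ flat_deriv[unfolded has_field_derivative_def]])
      (auto intro!: derivative_eq_intros bounded_linear_imp_has_derivative[OF bounded_linear_vec_nth])
  have "partial_deriv j ?g = (\<lambda>y. (if j = i then s else 0) * (flat (k + 2) (s * (y $ i) + c) + (- real k) * flat (k + 1) (s * (y $ i) + c)))" for j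
    by (rule ext, subst partial_deriv_eq[OF D]) (auto simp: axis_def)
  moreover have "C_diff m (\<lambda>y::real^'n. (if j = i then s else 0) * (flat (k + 2) (s * (y $ i) + c) + (- real k) * flat (k + 1) (s * (y $ i) + c)))" for j
    by (intro C_diff_mult C_diff_add C_diff_const Suc.IH)
  ultimately show ?case using D by (auto simp: differentiable_def)
qed

lemma continuous_compact_support:
  fixes g :: "'a::euclidean_space \<Rightarrow> real"
  assumes "continuous_on UNIV g" "\<And>x. R < norm x \<Longrightarrow> g x = 0"
  shows "integrable lborel g" "\<exists>B. \<forall>x. \<bar>g x\<bar> \<le> B"
proof -
  have "integrable lborel (\<lambda>x. indicator (cball 0 R) x *\<^sub>R g x)"
    by (intro borel_integrable_compact continuous_on_subset[OF assms(1)]) auto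
  moreover have "(\<lambda>x. indicator (cball 0 R) x *\<^sub>R g x) = g"
    using assms(2) by (force simp: indicator_def)
  ultimately show "integrable lborel g" by simp
  have "compact (g ` cball 0 R)"
    by (intro compact_continuous_image continuous_on_subset[OF assms(1)]) auto
  then obtain B where B: "\<And>y. y \<in> g ` cball 0 R \<Longrightarrow> norm y \<le> B"
    using compact_imp_bounded bounded_iff by metis
  have "\<bar>g x\<bar> \<le> max B 0" for x
    using B[of "g x"] assms(2)[of x] by (cases "x \<in> cball 0 R") auto
  then show "\<exists>B. \<forall>x. \<bar>g x\<bar> \<le> B" by blast
qed

lemma mollifier_exists:
  assumes "0 < \<delta>"
  obtains b :: "real^'n::finite \<Rightarrow> real" where "\<And>k. C_diff k b" "\<And>y. 0 \<le> b y" "\<And>y. b y \<noteq> 0 \<Longrightarrow> norm y < \<delta>"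
    "integrable lborel b" "(\<integral>y. b y \<partial>lborel) = 1"
proof -
  \<comment> \<open>The bump is a product over the coordinates, supported in a cube of half side
    \<open>e\<close>. Dividing by the dimension puts the cube into the ball of radius \<delta>,
    because the norm is at most the sum of the absolute coordinates.\<close>
  define e where "e = \<delta> / real CARD('n)"
  have e: "0 < e" using assms by (simp add: e_def)
  define b0 :: "real^'n \<Rightarrow> real" where "b0 y = (\<Prod>i\<in>UNIV. flat 0 (1 * (y $ i) + e) * flat 0 (-1 * (y $ i) + e))" for y
  have C: "C_diff k b0" for k
    unfolding b0_def[abs_def] by (intro C_diff_prod C_diff_mult C_diff_flat) auto
  have nonneg: "0 \<le> b0 y" for y unfolding b0_def by (intro prod_nonneg) (simp add: flat_nonneg)
  have supp: "norm y < \<delta>" if "b0 y \<noteq> 0" for y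
  proof -
    have "\<bar>y $ i\<bar> < e" for i
    proof -
      have "flat 0 (y $ i + e) * flat 0 (e - y $ i) \<noteq> 0" using that by (auto simp: b0_def)
      then show ?thesis by (auto simp: flat_def split: if_splits)
    qed
    then have "(\<Sum>i\<in>UNIV. \<bar>y $ i\<bar>) < (\<Sum>i\<in>(UNIV::'n set). e)" by (intro sum_strict_mono) auto
    also have "\<dots> = \<delta>" by (simp add: e_def)
    finally show ?thesis using norm_le_l1_cart[of y] by linarith
  qed
  have cont: "continuous_on UNIV b0" using C[of 0] by simp
  have int: "integrable lborel b0"
    by (rule continuous_compact_support(1)[OF cont, of \<delta>]) (use supp in force)
  have "0 < b0 0" using e by (simp add: b0_def flat_def prod_pos)
  \<comment> \<open>Otherwise the nonempty open set where \<open>b0\<close> does not vanish would be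
    null.\<close>
  have "(\<integral>y. b0 y \<partial>lborel) \<noteq> 0"
  proof
    assume "(\<integral>y. b0 y \<partial>lborel) = 0"
    then have "AE y in lborel. b0 y = 0"
      using int nonneg by (simp add: integral_nonneg_eq_0_iff_AE)
    then have "AE y in lebesgue. y \<notin> {y. b0 y \<noteq> 0}" by (intro AE_completion) simp
    moreover have op: "open {y. b0 y \<noteq> 0}" using cont by (intro open_Collect_neq continuous_on_const)
    ultimately have "negligible {y. b0 y \<noteq> 0}"
      by (subst negligible_iff_null_sets, subst AE_iff_null_sets) auto
    with op show False using open_not_negligible \<open>0 < b0 0\<close> by (metis empty_iff less_irrefl mem_Collect_eq)
  qed
  then have pos: "0 < (\<integral>y. b0 y \<partial>lborel)" using nonneg by (simp add: less_le integral_nonneg_AE)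
  define c where "c = 1 / (\<integral>y. b0 y \<partial>lborel)"
  show thesis
  proof (rule that[of "\<lambda>y. c * b0 y"])
    show "C_diff k (\<lambda>y. c * b0 y)" for k by (intro C_diff_mult C_diff_const C)
    show "0 \<le> c * b0 y" for y using nonneg pos by (simp add: c_def)
    show "norm y < \<delta>" if "c * b0 y \<noteq> 0" for y using that supp by auto
    show "integrable lborel (\<lambda>y. c * b0 y)" using int by simp
    show "(\<integral>y. c * b0 y \<partial>lborel) = 1" using pos by (simp add: c_def)
  qed
qed

section \<open>Mollification\<close>

definition mollify :: "('a::euclidean_space \<Rightarrow> real) \<Rightarrow> ('a \<Rightarrow> real) \<Rightarrow> 'a \<Rightarrow> real" where
  "mollify b f x = (\<integral>z. f (x + z) * b z \<partial>lborel)"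

lemma mollify_measurable [measurable]:
  assumes [measurable]: "f \<in> borel_measurable borel" "b \<in> borel_measurable borel"
  shows "mollify b f \<in> borel_measurable borel"
  unfolding mollify_def[abs_def] by measurable

text \<open>The sign convention x + z in \<open>mollify\<close> makes the kernel appear here as the
  translate of \<open>b\<close> to the point x, without reflection. This translate is what is
  inserted as a test function.\<close>

lemma mollify_alt:
  assumes [measurable]: "f \<in> borel_measurable borel" "b \<in> borel_measurable borel"
  shows "mollify b f x = (\<integral>y. f y * b (y - x) \<partial>lborel)"
  using lborel_integral_translation[of "\<lambda>y. f y * b (y - x)" x] by (simp add: mollify_def add.commute)

lemma integrable_mult_bounded:
  fixes f g :: "'a \<Rightarrow> real"
  assumes "integrable M f" "g \<in> borel_measurable M" "\<And>x. \<bar>g x\<bar> \<le> B"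
  shows "integrable M (\<lambda>x. f x * g x)"
proof (rule Bochner_Integration.integrable_bound[OF integrable_mult_right[OF assms(1), of B]])
  show "AE x in M. norm (f x * g x) \<le> norm (B * f x)"
  proof (rule AE_I2)
    fix x
    have "\<bar>f x\<bar> * \<bar>g x\<bar> \<le> \<bar>f x\<bar> * \<bar>B\<bar>" using assms(3)[of x] by (intro mult_left_mono) auto
    then show "norm (f x * g x) \<le> norm (B * f x)" by (simp add: abs_mult mult.commute)
  qed
qed (use assms in measurable)

lemma mollify_bounded:
  fixes f :: "'a::euclidean_space \<Rightarrow> real"
  assumes f: "integrable lborel f" and b: "b \<in> borel_measurable borel" "\<And>z. \<bar>b z\<bar> \<le> B"
  shows "\<bar>mollify b f x\<bar> \<le> B * (\<integral>y. \<bar>f y\<bar> \<partial>lborel)"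
proof -
  have [measurable]: "f \<in> borel_measurable borel" using f by auto
  have i: "integrable lborel (\<lambda>z. f (x + z))" using lborel_integrable_translation[OF f, of x] by (simp add: add.commute)
  have "\<bar>mollify b f x\<bar> \<le> (\<integral>z. \<bar>f (x + z) * b z\<bar> \<partial>lborel)"
    unfolding mollify_def by (rule integral_abs_bound)
  also have "\<dots> \<le> (\<integral>z. B * \<bar>f (x + z)\<bar> \<partial>lborel)"
  proof (rule integral_mono)
    show "integrable lborel (\<lambda>z. \<bar>f (x + z) * b z\<bar>)"
      using integrable_mult_bounded[OF i, of b B] b by simp
    show "\<bar>f (x + z) * b z\<bar> \<le> B * \<bar>f (x + z)\<bar>" for z
      using mult_right_mono[OF b(2)[of z], of "\<bar>f (x + z)\<bar>"] by (simp add: abs_mult mult.commute)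
  qed (use i in simp)
  also have "\<dots> = B * (\<integral>z. \<bar>f (x + z)\<bar> \<partial>lborel)" by simp
  also have "(\<integral>z. \<bar>f (x + z)\<bar> \<partial>lborel) = (\<integral>y. \<bar>f y\<bar> \<partial>lborel)"
    using lborel_integral_translation[of "\<lambda>y. \<bar>f y\<bar>" x] by (simp add: add.commute)
  finally show ?thesis .
qed

lemma lborel_L1_continuity_eps:
  fixes f :: "'a::euclidean_space \<Rightarrow> real"
  assumes "integrable lborel f" "0 < e"
  obtains d where "0 < d" "\<And>h. norm h < d \<Longrightarrow> (\<integral>x. \<bar>f (x + h) - f x\<bar> \<partial>lborel) \<le> e"
proof -
  have "\<exists>d>0. \<forall>h. norm h < d \<longrightarrow> (\<integral>x. \<bar>f (x + h) - f x\<bar> \<partial>lborel) \<le> e"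
  proof (rule ccontr)
    assume neg: "\<not> ?thesis"
    have "\<exists>h. norm h < 1 / real (Suc n) \<and> (\<integral>x. \<bar>f (x + h) - f x\<bar> \<partial>lborel) > e" for n
      using neg by (auto simp: not_le dest!: spec[of _ "1 / real (Suc n)"])
    then obtain h where h: "\<And>n. norm (h n) < 1 / real (Suc n)" "\<And>n. (\<integral>x. \<bar>f (x + h n) - f x\<bar> \<partial>lborel) > e"
      by metis
    have "h \<longlonglongrightarrow> 0"
      by (rule Lim_null_comparison[OF _ LIMSEQ_Suc[OF lim_1_over_n]]) (use h(1) in \<open>auto intro!: always_eventually less_imp_le\<close>)
    from order_tendstoD(2)[OF lborel_L1_continuity[OF assms(1) this] assms(2)] h(2)
    show False by (auto simp: eventually_sequentially not_less dest: less_imp_le) (meson less_asym order_refl)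
  qed
  then show thesis using that by blast
qed

text \<open>The difference between the mollification and f is an average of f(x + z) - f(x) with
  weight b z, so Tonelli bounds its L1 norm by the same average of the L1 norms of the translation
  differences.\<close>

lemma mollify_L1_le:
  fixes f :: "'a::euclidean_space \<Rightarrow> real"
  assumes f: "integrable lborel f" and e: "0 \<le> e" "\<And>h. norm h < d \<Longrightarrow> (\<integral>x. \<bar>f (x + h) - f x\<bar> \<partial>lborel) \<le> e"
    and b: "integrable lborel b" "\<And>z. \<bar>b z\<bar> \<le> B" "\<And>z. 0 \<le> b z" "\<And>z. b z \<noteq> 0 \<Longrightarrow> norm z < d" "(\<integral>z. b z \<partial>lborel) = 1"
  shows "integrable lborel (\<lambda>x. mollify b f x - f x)" "(\<integral>x. \<bar>mollify b f x - f x\<bar> \<partial>lborel) \<le> e"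
proof -
  have [measurable]: "f \<in> borel_measurable borel" "b \<in> borel_measurable borel" using f b by auto
  have i: "integrable lborel (\<lambda>z. f (x + z) * b z)" for x
    using lborel_integrable_translation[OF f, of x] b(2)
    by (intro integrable_mult_bounded[where B = B]) (auto simp: add.commute)
  have ib: "integrable lborel (\<lambda>z. f x * b z)" for x using b(1) by simp
  have pw: "\<bar>mollify b f x - f x\<bar> \<le> (\<integral>z. \<bar>f (x + z) - f x\<bar> * b z \<partial>lborel)" for x
  proof -
    have "mollify b f x - f x = (\<integral>z. f (x + z) * b z \<partial>lborel) - (\<integral>z. f x * b z \<partial>lborel)"
      using b(5) by (simp add: mollify_def)
    also have "\<dots> = (\<integral>z. (f (x + z) - f x) * b z \<partial>lborel)"
      using i[of x] ib[of x] by (subst Bochner_Integration.integral_diff[symmetric]) (auto simp: algebra_simps)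
    also have "\<bar>\<dots>\<bar> \<le> (\<integral>z. \<bar>(f (x + z) - f x) * b z\<bar> \<partial>lborel)" by (rule integral_abs_bound)
    finally show ?thesis using b(3) by (simp add: abs_mult)
  qed
  have nn: "(\<integral>\<^sup>+x. ennreal \<bar>f (x + z) - f x\<bar> \<partial>lborel) * ennreal (b z) \<le> ennreal e * ennreal (b z)" for z
  proof (cases "b z = 0")
    case False
    have "(\<integral>\<^sup>+x. ennreal \<bar>f (x + z) - f x\<bar> \<partial>lborel) = ennreal (\<integral>x. \<bar>f (x + z) - f x\<bar> \<partial>lborel)"
      using f lborel_integrable_translation[OF f, of z] by (intro nn_integral_eq_integral) auto
    also have "\<dots> \<le> ennreal e" by (intro ennreal_leI e(2) b(4) False)
    finally show ?thesis by (intro mult_right_mono) auto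
  qed simp
  have "(\<integral>\<^sup>+x. ennreal \<bar>mollify b f x - f x\<bar> \<partial>lborel) \<le> (\<integral>\<^sup>+x. (\<integral>\<^sup>+z. ennreal (\<bar>f (x + z) - f x\<bar> * b z) \<partial>lborel) \<partial>lborel)"
  proof (intro nn_integral_mono)
    fix x
    have "integrable lborel (\<lambda>z. \<bar>f (x + z) - f x\<bar> * b z)"
    proof -
      have "integrable lborel (\<lambda>z. \<bar>f (x + z) * b z - f x * b z\<bar>)" using i[of x] ib[of x] by simp
      moreover have "\<bar>f (x + z) * b z - f x * b z\<bar> = \<bar>f (x + z) - f x\<bar> * b z" for z
        using b(3)[of z] by (simp add: abs_mult flip: left_diff_distrib)
      ultimately show ?thesis by simp
    qed
    then have "(\<integral>\<^sup>+z. ennreal (\<bar>f (x + z) - f x\<bar> * b z) \<partial>lborel) = ennreal (\<integral>z. \<bar>f (x + z) - f x\<bar> * b z \<partial>lborel)"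
      using b(3) by (intro nn_integral_eq_integral) auto
    then show "ennreal \<bar>mollify b f x - f x\<bar> \<le> (\<integral>\<^sup>+z. ennreal (\<bar>f (x + z) - f x\<bar> * b z) \<partial>lborel)"
      using pw[of x] by (simp add: ennreal_leI)
  qed
  also have "\<dots> = (\<integral>\<^sup>+z. (\<integral>\<^sup>+x. ennreal (\<bar>f (x + z) - f x\<bar> * b z) \<partial>lborel) \<partial>lborel)"
    by (rule lborel_pair.Fubini'[symmetric]) measurable
  also have "\<dots> = (\<integral>\<^sup>+z. (\<integral>\<^sup>+x. ennreal \<bar>f (x + z) - f x\<bar> \<partial>lborel) * ennreal (b z) \<partial>lborel)"
    using b(3) by (intro nn_integral_cong) (simp add: ennreal_mult nn_integral_multc)
  also have "\<dots> \<le> (\<integral>\<^sup>+z. ennreal e * ennreal (b z) \<partial>lborel)"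
    by (intro nn_integral_mono nn)
  also have "\<dots> = ennreal e * ennreal (\<integral>z. b z \<partial>lborel)"
    using b by (simp add: nn_integral_cmult nn_integral_eq_integral)
  also have "\<dots> = ennreal e" using b(5) by simp
  finally have le: "(\<integral>\<^sup>+x. ennreal \<bar>mollify b f x - f x\<bar> \<partial>lborel) \<le> ennreal e" .
  show int: "integrable lborel (\<lambda>x. mollify b f x - f x)"
    by (rule integrableI_bounded) (use le in \<open>auto intro: le_less_trans\<close>)
  have "ennreal (\<integral>x. \<bar>mollify b f x - f x\<bar> \<partial>lborel) = (\<integral>\<^sup>+x. ennreal \<bar>mollify b f x - f x\<bar> \<partial>lborel)"
    using int by (intro nn_integral_eq_integral[symmetric]) auto
  with le have "ennreal (\<integral>x. \<bar>mollify b f x - f x\<bar> \<partial>lborel) \<le> ennreal e" by (rule ord_eq_le_trans[rotated])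
  then show "(\<integral>x. \<bar>mollify b f x - f x\<bar> \<partial>lborel) \<le> e" using e(1) by (simp only: ennreal_le_iff)
qed

lemma has_real_derivative_under_integral:
  fixes k k' :: "real \<Rightarrow> 'a::euclidean_space \<Rightarrow> real"
  assumes f: "integrable lborel f"
    and k: "\<And>t y. ((\<lambda>t. k t y) has_real_derivative k' t y) (at t)" "\<And>t y. \<bar>k' t y\<bar> \<le> C"
    and [measurable]: "\<And>t. k t \<in> borel_measurable borel" and int: "\<And>t. integrable lborel (\<lambda>y. f y * k t y)"
  shows "((\<lambda>t. \<integral>y. f y * k t y \<partial>lborel) has_real_derivative (\<integral>y. f y * k' 0 y \<partial>lborel)) (at 0)"
  unfolding has_field_derivative_iff tendsto_at_iff_sequentially
proof (intro allI impI)
  fix t :: "nat \<Rightarrow> real" assume t: "\<forall>i. t i \<in> UNIV - {0}" "t \<longlonglongrightarrow> 0"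
  have [measurable]: "f \<in> borel_measurable borel" using f by auto
  have lip: "\<bar>k s y - k 0 y\<bar> \<le> C * \<bar>s\<bar>" for s y
    using field_differentiable_bound[of UNIV "\<lambda>t. k t y" "\<lambda>t. k' t y" C s 0] k by (auto simp: has_field_derivative_at_within)
  define q where "q n y = f y * ((k (t n) y - k 0 y) / t n)" for n y
  have lim: "(\<lambda>n. (k (t n) y - k 0 y) / t n) \<longlonglongrightarrow> k' 0 y" for y
    using k(1)[of y 0, unfolded has_field_derivative_iff tendsto_at_iff_sequentially] t by (simp add: o_def)
  have [measurable]: "k' 0 \<in> borel_measurable borel"
    by (rule borel_measurable_LIMSEQ_real[OF lim]) simp
  have "(\<lambda>n. \<integral>y. q n y \<partial>lborel) \<longlonglongrightarrow> (\<integral>y. f y * k' 0 y \<partial>lborel)"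
  proof (rule integral_dominated_convergence[where w = "\<lambda>y. C * \<bar>f y\<bar>"])
    show "AE y in lborel. (\<lambda>n. q n y) \<longlonglongrightarrow> f y * k' 0 y"
      unfolding q_def by (intro AE_I2 tendsto_mult tendsto_const lim)
    show "AE y in lborel. norm (q n y) \<le> C * \<bar>f y\<bar>" for n
    proof (rule AE_I2)
      fix y
      have "\<bar>(k (t n) y - k 0 y) / t n\<bar> \<le> C" using lip[of "t n" y] t(1) by (simp add: abs_divide divide_le_eq)
      then show "norm (q n y) \<le> C * \<bar>f y\<bar>"
        unfolding q_def using mult_left_mono[of "\<bar>(k (t n) y - k 0 y) / t n\<bar>" C "\<bar>f y\<bar>"]
        by (simp only: real_norm_def abs_mult abs_ge_zero mult.commute)
    qed
  qed (use f in \<open>auto simp: q_def\<close>)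
  moreover have "(\<integral>y. q n y \<partial>lborel) = ((\<integral>y. f y * k (t n) y \<partial>lborel) - (\<integral>y. f y * k 0 y \<partial>lborel)) / (t n - 0)" for n
    using int by (simp add: q_def right_diff_distrib flip: Bochner_Integration.integral_diff)
  ultimately show "((\<lambda>y. ((\<integral>z. f z * k y z \<partial>lborel) - (\<integral>z. f z * k 0 z \<partial>lborel)) / (y - 0)) \<circ> t) \<longlonglongrightarrow> (\<integral>y. f y * k' 0 y \<partial>lborel)"
    by (simp add: o_def)
qed

lemma partial_deriv_line:
  assumes "\<And>x. g differentiable (at x)"
  shows "((\<lambda>t. g (a + (c * t) *\<^sub>R axis i 1)) has_real_derivative c * partial_deriv i g (a + (c * s) *\<^sub>R axis i 1)) (at s)"
proof -
  let ?l = "\<lambda>t. a + (c * t) *\<^sub>R axis i (1::real)"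
  have g: "(g has_derivative frechet_derivative g (at (?l s))) (at (?l s))"
    using assms by (simp add: frechet_derivative_works[symmetric])
  have l: "(?l has_derivative (\<lambda>v. (c * v) *\<^sub>R axis i 1)) (at s)"
    by (auto intro!: derivative_eq_intros)
  have "((\<lambda>t. g (?l t)) has_derivative (\<lambda>v. frechet_derivative g (at (?l s)) ((c * v) *\<^sub>R axis i 1))) (at s)"
    by (rule has_derivative_compose[OF l g])
  moreover have "frechet_derivative g (at (?l s)) ((c * v) *\<^sub>R axis i 1) = c * partial_deriv i g (?l s) * v" for v
    using linear_frechet_derivative[OF assms, of "?l s"] unfolding partial_deriv_def
    by (simp add: linear_cmul)
  ultimately show ?thesis by (simp add: has_field_derivative_def)
qed

text \<open>The derivative falls on the kernel under the integral, and the weak derivative identity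
  W for the kernel translated to x turns f into D. The minus sign from differentiating b(y - x) in x
  cancels the one in W.\<close>

lemma mollify_deriv:
  fixes f D b :: "real^'n::finite \<Rightarrow> real"
  assumes f: "integrable lborel f" and D: "integrable lborel D"
    and b: "\<And>k. C_diff k b" "\<And>y. b y \<noteq> 0 \<Longrightarrow> norm y < \<delta>"
    and W: "(\<integral>y. f y * partial_deriv i b (y - x) \<partial>lborel) = - (\<integral>y. D y * b (y - x) \<partial>lborel)"
  shows "((\<lambda>t. mollify b f (x + t *\<^sub>R axis i 1)) has_real_derivative mollify b D x) (at 0)"
proof -
  have diff: "b differentiable (at y)" for y using b(1)[of 1] by simp
  have cont: "continuous_on UNIV b" "continuous_on UNIV (partial_deriv i b)" using b(1)[of 0] b(1)[of 1] by auto
  have [measurable]: "b \<in> borel_measurable borel" "f \<in> borel_measurable borel" "D \<in> borel_measurable borel"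
    using f D borel_measurable_continuous_onI[OF cont(1)] by auto
  have "{y. b y \<noteq> 0} \<subseteq> cball 0 \<delta>" using less_imp_le[OF b(2)] by auto
  then have "closure {y. b y \<noteq> 0} \<subseteq> cball 0 \<delta>" by (intro closure_minimal) auto
  then have "y \<notin> closure {y. b y \<noteq> 0}" if "\<delta> < norm y" for y using that by force
  then have supp': "\<delta> < norm y \<Longrightarrow> partial_deriv i b y = 0" for y
    by (intro partial_deriv_outside_support) auto
  obtain C where C: "\<And>y. \<bar>partial_deriv i b y\<bar> \<le> C"
    using continuous_compact_support(2)[OF cont(2) supp'] by blast
  obtain B where B: "\<And>y. \<bar>b y\<bar> \<le> B"
    using continuous_compact_support(2)[OF cont(1), of \<delta>] b(2) by force
  have "((\<lambda>t. \<integral>y. f y * b ((y - x) + (-1 * t) *\<^sub>R axis i 1) \<partial>lborel) has_real_derivative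
      (\<integral>y. f y * (-1 * partial_deriv i b ((y - x) + (-1 * 0) *\<^sub>R axis i 1)) \<partial>lborel)) (at 0)"
  proof (rule has_real_derivative_under_integral[OF f])
    show "((\<lambda>t. b (y - x + (- 1 * t) *\<^sub>R axis i 1)) has_real_derivative - 1 * partial_deriv i b (y - x + (- 1 * t) *\<^sub>R axis i 1)) (at t)" for t y
      by (rule partial_deriv_line[OF diff])
    show "\<bar>- 1 * partial_deriv i b (y - x + (- 1 * t) *\<^sub>R axis i 1)\<bar> \<le> C" for t y using C by simp
    show "integrable lborel (\<lambda>y. f y * b (y - x + (- 1 * t) *\<^sub>R axis i 1))" for t
      by (rule integrable_mult_bounded[OF f, where B = B]) (use B in auto)
  qed measurable
  moreover have "mollify b f (x + t *\<^sub>R axis i 1) = (\<integral>y. f y * b ((y - x) + (-1 * t) *\<^sub>R axis i 1) \<partial>lborel)" for t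
    by (subst mollify_alt) (auto simp: algebra_simps)
  moreover have "mollify b D x = (\<integral>y. f y * (-1 * partial_deriv i b ((y - x) + (-1 * 0) *\<^sub>R axis i 1)) \<partial>lborel)"
    using W by (simp add: mollify_alt)
  ultimately show ?thesis by simp
qed

lemma smooth_compact_support:
  fixes \<phi> :: "real^'n::finite \<Rightarrow> real"
  assumes C: "\<And>k. C_diff k \<phi>" and S: "compact (closure {x. \<phi> x \<noteq> 0})"
  shows "\<phi> \<in> borel_measurable borel" "partial_deriv i \<phi> \<in> borel_measurable borel"
    "integrable lborel \<phi>" "integrable lborel (partial_deriv i \<phi>)"
    "\<exists>B. \<forall>x. \<bar>\<phi> x\<bar> \<le> B" "\<exists>B. \<forall>x. \<bar>partial_deriv i \<phi> x\<bar> \<le> B"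
proof -
  have cont: "continuous_on UNIV \<phi>" "continuous_on UNIV (partial_deriv i \<phi>)" using C[of 0] C[of 1] by auto
  obtain R where R: "\<And>x. x \<in> closure {x. \<phi> x \<noteq> 0} \<Longrightarrow> norm x \<le> R"
    using compact_imp_bounded[OF S] by (auto simp: bounded_iff)
  have out: "x \<notin> closure {x. \<phi> x \<noteq> 0}" if "R < norm x" for x using R[of x] that by force
  then have z: "R < norm x \<Longrightarrow> \<phi> x = 0" for x using closure_subset[of "{x. \<phi> x \<noteq> 0}"] by auto
  have z': "R < norm x \<Longrightarrow> partial_deriv i \<phi> x = 0" for x
    by (intro partial_deriv_outside_support out)
  show "\<phi> \<in> borel_measurable borel" "partial_deriv i \<phi> \<in> borel_measurable borel"
    using cont by (auto intro: borel_measurable_continuous_onI)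
  show "integrable lborel \<phi>" "\<exists>B. \<forall>x. \<bar>\<phi> x\<bar> \<le> B"
    using continuous_compact_support[OF cont(1) z] by auto
  show "integrable lborel (partial_deriv i \<phi>)" "\<exists>B. \<forall>x. \<bar>partial_deriv i \<phi> x\<bar> \<le> B"
    using continuous_compact_support[OF cont(2) z'] by auto
qed

lemma mollifier_sequence:
  assumes "0 < \<delta>"
  obtains b :: "nat \<Rightarrow> real^'n::finite \<Rightarrow> real" where "\<And>m k. C_diff k (b m)" "\<And>m y. 0 \<le> b m y"
    "\<And>m y. b m y \<noteq> 0 \<Longrightarrow> norm y < \<delta>" "\<And>m y. b m y \<noteq> 0 \<Longrightarrow> norm y < 1 / real (Suc m)"
    "\<And>m. integrable lborel (b m)" "\<And>m. (\<integral>y. b m y \<partial>lborel) = 1" "\<And>m. \<exists>B. \<forall>y. \<bar>b m y\<bar> \<le> B"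
proof -
  have "\<exists>b :: real^'n \<Rightarrow> real. (\<forall>k. C_diff k b) \<and> (\<forall>y. 0 \<le> b y) \<and> (\<forall>y. b y \<noteq> 0 \<longrightarrow> norm y < \<delta> \<and> norm y < 1 / real (Suc m)) \<and>
     integrable lborel b \<and> (\<integral>y. b y \<partial>lborel) = 1 \<and> (\<exists>B. \<forall>y. \<bar>b y\<bar> \<le> B)" for m
  proof -
    have "0 < min \<delta> (1 / real (Suc m))" using assms by simp
    then obtain b :: "real^'n \<Rightarrow> real" where b: "\<And>k. C_diff k b" "\<And>y. 0 \<le> b y" "\<And>y. b y \<noteq> 0 \<Longrightarrow> norm y < min \<delta> (1 / real (Suc m))"
      "integrable lborel b" "(\<integral>y. b y \<partial>lborel) = 1" by (rule mollifier_exists) blast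
    have "continuous_on UNIV b" using b(1)[of 0] by simp
    then have "\<exists>B. \<forall>y. \<bar>b y\<bar> \<le> B"
      by (rule continuous_compact_support(2)[where R = \<delta>]) (use b(3) in force)
    then show ?thesis using b by (intro exI[of _ b]) auto
  qed
  then obtain b :: "nat \<Rightarrow> real^'n \<Rightarrow> real" where "\<And>m. (\<forall>k. C_diff k (b m)) \<and> (\<forall>y. 0 \<le> b m y) \<and> (\<forall>y. b m y \<noteq> 0 \<longrightarrow> norm y < \<delta> \<and> norm y < 1 / real (Suc m)) \<and>
     integrable lborel (b m) \<and> (\<integral>y. b m y \<partial>lborel) = 1 \<and> (\<exists>B. \<forall>y. \<bar>b m y\<bar> \<le> B)" by metis
  then show thesis by (intro that[of b]) blast+
qed

lemma mollify_L1_tendsto: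
  fixes f :: "real^'n::finite \<Rightarrow> real"
  assumes f: "integrable lborel f"
    and b: "\<And>m y. 0 \<le> b m y" "\<And>m y. b m y \<noteq> 0 \<Longrightarrow> norm y < 1 / real (Suc m)"
    "\<And>m. integrable lborel (b m)" "\<And>m. (\<integral>y. b m y \<partial>lborel) = 1" "\<And>m. \<exists>B. \<forall>y. \<bar>b m y\<bar> \<le> B"
  shows "\<And>m. integrable lborel (\<lambda>x. mollify (b m) f x - f x)"
    "(\<lambda>m. \<integral>x. \<bar>mollify (b m) f x - f x\<bar> \<partial>lborel) \<longlonglongrightarrow> 0"
proof -
  show int: "integrable lborel (\<lambda>x. mollify (b m) f x - f x)" for m
  proof -
    obtain B where B: "\<And>y. \<bar>b m y\<bar> \<le> B" using b(5)[of m] by blast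
    \<comment> \<open>For integrability alone the crude bound by twice the L1 norm of f, valid for
      every shift, is enough as a modulus of continuity.\<close>
    have ind: "(\<integral>x. \<bar>f (x + h) - f x\<bar> \<partial>lborel) \<le> 2 * (\<integral>x. \<bar>f x\<bar> \<partial>lborel)" for h
    proof -
      have "(\<integral>x. \<bar>f (x + h) - f x\<bar> \<partial>lborel) \<le> (\<integral>x. \<bar>f (x + h)\<bar> + \<bar>f x\<bar> \<partial>lborel)"
        using f lborel_integrable_translation[OF f, of h] by (intro integral_mono) auto
      also have "\<dots> = (\<integral>x. \<bar>f (x + h)\<bar> \<partial>lborel) + (\<integral>x. \<bar>f x\<bar> \<partial>lborel)"
        using f lborel_integrable_translation[OF f, of h] by simp
      also have "(\<integral>x. \<bar>f (x + h)\<bar> \<partial>lborel) = (\<integral>x. \<bar>f x\<bar> \<partial>lborel)"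
        using f by (intro lborel_integral_translation) auto
      finally show ?thesis by simp
    qed
    show ?thesis
      by (rule mollify_L1_le(1)[OF f _ ind b(3) B b(1) b(2) b(4)]) simp
  qed
  show "(\<lambda>m. \<integral>x. \<bar>mollify (b m) f x - f x\<bar> \<partial>lborel) \<longlonglongrightarrow> 0"
  proof (rule LIMSEQ_I)
    fix e :: real assume "0 < e"
    then have e2: "0 < e / 2" by simp
    obtain d where d: "0 < d" "\<And>h. norm h < d \<Longrightarrow> (\<integral>x. \<bar>f (x + h) - f x\<bar> \<partial>lborel) \<le> e / 2"
      using lborel_L1_continuity_eps[OF f e2] by blast
    obtain N where N: "1 / real (Suc N) < d" using d(1) by (meson nat_approx_posE)
    have "norm ((\<integral>x. \<bar>mollify (b m) f x - f x\<bar> \<partial>lborel) - 0) < e" if "m \<ge> N" for m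
    proof -
      obtain B where B: "\<And>y. \<bar>b m y\<bar> \<le> B" using b(5)[of m] by blast
      have "1 / real (Suc m) \<le> 1 / real (Suc N)" using that by (intro divide_left_mono) auto
      then have "b m y \<noteq> 0 \<Longrightarrow> norm y < d" for y using b(2)[of m y] N by linarith
      then have "(\<integral>x. \<bar>mollify (b m) f x - f x\<bar> \<partial>lborel) \<le> e / 2"
        using e2 by (intro mollify_L1_le(2)[OF f _ d(2) b(3) B b(1) _ b(4)]) auto
      moreover have "0 \<le> (\<integral>x. \<bar>mollify (b m) f x - f x\<bar> \<partial>lborel)" by (intro integral_nonneg_AE) simp
      ultimately show ?thesis using e2 by simp
    qed
    then show "\<exists>no. \<forall>n\<ge>no. norm ((\<integral>x. \<bar>mollify (b n) f x - f x\<bar> \<partial>lborel) - 0) < e" by blast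
  qed
qed

section \<open>Calculus of weak gradients\<close>

text \<open>Here f and D are functions on the whole space, and D is a weak derivative of f only near
  the support of \<phi>: this is what W says, for kernels of radius \<delta> at points of the
  support. For the mollified functions the formula is the classical chain rule followed by
  integration by parts; L1 convergence of the mollifications gives the limit.\<close>

theorem weak_chain_rule_C1:
  fixes f D \<phi> :: "real^'n::finite \<Rightarrow> real" and \<psi> \<psi>' :: "real \<Rightarrow> real"
  assumes f: "integrable lborel f" and D: "integrable lborel D"
    and \<phi>: "\<And>k. C_diff k \<phi>" "compact (closure {x. \<phi> x \<noteq> 0})" and \<delta>: "0 < \<delta>"
    and W: "\<And>x b. x \<in> closure {x. \<phi> x \<noteq> 0} \<Longrightarrow> (\<And>k. C_diff k b) \<Longrightarrow> (\<And>y. b y \<noteq> 0 \<Longrightarrow> norm y < \<delta>) \<Longrightarrow>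
        (\<integral>y. f y * partial_deriv i b (y - x) \<partial>lborel) = - (\<integral>y. D y * b (y - x) \<partial>lborel)"
    and \<psi>: "\<And>s. (\<psi> has_real_derivative \<psi>' s) (at s)" "continuous_on UNIV \<psi>'" "\<And>s. \<bar>\<psi>' s\<bar> \<le> L"
  shows "(\<integral>x. \<psi> (f x) * partial_deriv i \<phi> x \<partial>lborel) = - (\<integral>x. \<psi>' (f x) * D x * \<phi> x \<partial>lborel)"
proof -
  let ?S = "closure {x. \<phi> x \<noteq> 0}"
  note sc = smooth_compact_support[OF \<phi>]
  have L0: "0 \<le> L" using \<psi>(3)[of 0] by linarith
  have contpsi: "continuous_on UNIV \<psi>"
    by (intro continuous_at_imp_continuous_on ballI DERIV_isCont[OF \<psi>(1)])
  have [measurable]: "\<phi> \<in> borel_measurable borel" "partial_deriv i \<phi> \<in> borel_measurable borel"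
    "f \<in> borel_measurable borel" "D \<in> borel_measurable borel" "\<psi> \<in> borel_measurable borel" "\<psi>' \<in> borel_measurable borel"
    using sc f D contpsi \<psi>(2) by (auto intro: borel_measurable_continuous_onI)
  obtain P where P: "\<And>x. \<bar>\<phi> x\<bar> \<le> P" using sc(5) by blast
  obtain P' where P': "\<And>x. \<bar>partial_deriv i \<phi> x\<bar> \<le> P'" using sc(6) by blast
  have P0: "0 \<le> P" "0 \<le> P'" using P[of 0] P'[of 0] by linarith+
  have lip: "\<bar>\<psi> s - \<psi> t\<bar> \<le> L * \<bar>s - t\<bar>" for s t
    using field_differentiable_bound[of UNIV \<psi> \<psi>' L s t] \<psi> by (auto simp: has_field_derivative_at_within)
  obtain b :: "nat \<Rightarrow> real^'n \<Rightarrow> real" where b: "\<And>m k. C_diff k (b m)" "\<And>m y. 0 \<le> b m y"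
    "\<And>m y. b m y \<noteq> 0 \<Longrightarrow> norm y < \<delta>" "\<And>m y. b m y \<noteq> 0 \<Longrightarrow> norm y < 1 / real (Suc m)"
    "\<And>m. integrable lborel (b m)" "\<And>m. (\<integral>y. b m y \<partial>lborel) = 1" "\<And>m. \<exists>B. \<forall>y. \<bar>b m y\<bar> \<le> B"
    using mollifier_sequence[OF \<delta>, where 'n = 'n] by blast
  have [measurable]: "b m \<in> borel_measurable borel" for m using b(5)[of m] by auto
  define fm where "fm m = mollify (b m) f" for m
  define Dm where "Dm m = mollify (b m) D" for m
  have [measurable]: "fm m \<in> borel_measurable borel" "Dm m \<in> borel_measurable borel" for m
    unfolding fm_def Dm_def by measurable
  note Lf = mollify_L1_tendsto[of f b, OF f b(2) b(4) b(5) b(6) b(7), folded fm_def]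
  note LD = mollify_L1_tendsto[of D b, OF D b(2) b(4) b(5) b(6) b(7), folded Dm_def]
  have fbd: "\<exists>B. \<forall>x. \<bar>fm m x\<bar> \<le> B" and Dbd: "\<exists>B. \<forall>x. \<bar>Dm m x\<bar> \<le> B" for m
  proof -
    obtain B where B: "\<And>y. \<bar>b m y\<bar> \<le> B" using b(7) by blast
    show "\<exists>B. \<forall>x. \<bar>fm m x\<bar> \<le> B" unfolding fm_def using mollify_bounded[of f "b m" B, OF f _ B] by auto
    show "\<exists>B. \<forall>x. \<bar>Dm m x\<bar> \<le> B" unfolding Dm_def using mollify_bounded[of D "b m" B, OF D _ B] by auto
  qed
  have psibd: "\<exists>B. \<forall>x. \<bar>\<psi> (fm m x)\<bar> \<le> B" for m
  proof -
    obtain B where B: "\<And>x. \<bar>fm m x\<bar> \<le> B" using fbd by blast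
    have "\<bar>\<psi> (fm m x)\<bar> \<le> \<bar>\<psi> 0\<bar> + L * B" for x
      using lip[of "fm m x" 0] mult_left_mono[OF B[of x] L0] by simp
    then show ?thesis by blast
  qed
  define A where "A m = (\<integral>x. \<psi> (fm m x) * partial_deriv i \<phi> x \<partial>lborel)" for m
  define E where "E m = (\<integral>x. \<psi>' (fm m x) * Dm m x * \<phi> x \<partial>lborel)" for m
  have intA: "integrable lborel (\<lambda>x. \<psi> (fm m x) * partial_deriv i \<phi> x)" for m
  proof -
    obtain B where "\<And>x. \<bar>\<psi> (fm m x)\<bar> \<le> B" using psibd by blast
    then show ?thesis using integrable_mult_bounded[OF sc(4), of "\<lambda>x. \<psi> (fm m x)" B] by (simp add: mult.commute)
  qed
  have pdbd: "\<exists>B. \<forall>x. \<bar>\<psi>' (fm m x) * Dm m x\<bar> \<le> B" for m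
  proof -
    obtain B where B: "\<And>x. \<bar>Dm m x\<bar> \<le> B" using Dbd by blast
    have "\<bar>\<psi>' (fm m x) * Dm m x\<bar> \<le> L * B" for x
      unfolding abs_mult using \<psi>(3) B L0 by (intro mult_mono) auto
    then show ?thesis by blast
  qed
  have intE: "integrable lborel (\<lambda>x. \<psi>' (fm m x) * Dm m x * \<phi> x)" for m
  proof -
    obtain B where "\<And>x. \<bar>\<psi>' (fm m x) * Dm m x\<bar> \<le> B" using pdbd by blast
    then show ?thesis using integrable_mult_bounded[OF sc(3), of "\<lambda>x. \<psi>' (fm m x) * Dm m x" B] by (simp add: mult.commute)
  qed
  have AE0: "A m + E m = 0" for m
  proof -
    let ?F' = "\<lambda>x. \<psi> (fm m x) * partial_deriv i \<phi> x + \<psi>' (fm m x) * Dm m x * \<phi> x"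
    obtain B1 where B1: "\<And>x. \<bar>\<psi> (fm m x)\<bar> \<le> B1" using psibd by blast
    obtain B2 where B2: "\<And>x. \<bar>\<psi>' (fm m x) * Dm m x\<bar> \<le> B2" using pdbd by blast
    have "(\<integral>x. ?F' x \<partial>lborel) = 0"
    proof (rule integral_directional_derivative_eq_0[where F = "\<lambda>x. \<psi> (fm m x) * \<phi> x" and S = ?S and e = "axis i 1" and B = "B1 * P' + B2 * P"])
      show "bounded ?S" by (rule compact_imp_bounded[OF \<phi>(2)])
      show "\<psi> (fm m x) * \<phi> x = 0" if "x \<notin> ?S" for x using that closure_subset[of "{x. \<phi> x \<noteq> 0}"] by auto
      show "((\<lambda>t. \<psi> (fm m (x + t *\<^sub>R axis i 1)) * \<phi> (x + t *\<^sub>R axis i 1)) has_real_derivative ?F' x) (at 0)" for x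
      \<comment> \<open>Off the support \<open>Dm m\<close> need not be the derivative of
        \<open>fm m\<close>, but there the product with \<phi> vanishes on a neighbourhood.\<close>
      proof (cases "x \<in> ?S")
        case True
        have dphi: "((\<lambda>t. \<phi> (x + t *\<^sub>R axis i 1)) has_real_derivative partial_deriv i \<phi> x) (at 0)"
          using partial_deriv_line[of \<phi> x 1 i 0] \<phi>(1)[of 1] by simp
        have df: "((\<lambda>t. fm m (x + t *\<^sub>R axis i 1)) has_real_derivative Dm m x) (at 0)"
          unfolding fm_def Dm_def by (rule mollify_deriv[OF f D b(1) b(3) W[OF True b(1) b(3)]])
        have "((\<lambda>t. \<psi> (fm m (x + t *\<^sub>R axis i 1))) has_real_derivative \<psi>' (fm m x) * Dm m x) (at 0)"
          using DERIV_chain'[OF df \<psi>(1)] by simp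
        from DERIV_mult[OF this dphi] show ?thesis by (simp add: algebra_simps)
      next
        case False
        have z: "\<phi> x = 0" "partial_deriv i \<phi> x = 0"
          using False closure_subset[of "{x. \<phi> x \<noteq> 0}"] partial_deriv_outside_support[OF False] by auto
        have "open ((\<lambda>t. x + t *\<^sub>R axis i (1::real)) -` (- ?S))"
          by (intro open_vimage) (auto intro!: continuous_intros)
        moreover have "\<phi> (x + t *\<^sub>R axis i 1) = 0" if "t \<in> (\<lambda>t. x + t *\<^sub>R axis i (1::real)) -` (- ?S)" for t
          using that closure_subset[of "{x. \<phi> x \<noteq> 0}"] by auto
        ultimately have "((\<lambda>t. \<psi> (fm m (x + t *\<^sub>R axis i 1)) * \<phi> (x + t *\<^sub>R axis i 1)) has_real_derivative 0) (at 0)"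
          by (intro has_field_derivative_transform_within_open[OF DERIV_const[of 0], where S = "(\<lambda>t. x + t *\<^sub>R axis i (1::real)) -` (- ?S)"])
            (use False in auto)
        then show ?thesis using z by simp
      qed
      show "\<bar>?F' x\<bar> \<le> B1 * P' + B2 * P" for x
      proof -
        have "0 \<le> B1" "0 \<le> B2" using B1[of 0] B2[of 0] by linarith+
        then have "\<bar>\<psi> (fm m x) * partial_deriv i \<phi> x\<bar> \<le> B1 * P'" "\<bar>(\<psi>' (fm m x) * Dm m x) * \<phi> x\<bar> \<le> B2 * P"
          unfolding abs_mult[of "\<psi> _"] abs_mult[of "_ * _"] using B1 B2 P P' P0 by (intro mult_mono; simp)+
        then show ?thesis by linarith
      qed
    qed measurable
    then show ?thesis using intA intE by (simp add: A_def E_def)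
  qed
  have ipf: "integrable lborel (\<lambda>x. \<psi> (f x) * partial_deriv i \<phi> x)"
  proof (rule Bochner_Integration.integrable_bound)
    show "integrable lborel (\<lambda>x. \<bar>\<psi> 0\<bar> * \<bar>partial_deriv i \<phi> x\<bar> + L * P' * \<bar>f x\<bar>)" using sc(4) f by simp
    show "AE x in lborel. norm (\<psi> (f x) * partial_deriv i \<phi> x) \<le> norm (\<bar>\<psi> 0\<bar> * \<bar>partial_deriv i \<phi> x\<bar> + L * P' * \<bar>f x\<bar>)"
    proof (rule AE_I2)
      fix x
      have "\<bar>\<psi> (f x)\<bar> * \<bar>partial_deriv i \<phi> x\<bar> \<le> (\<bar>\<psi> 0\<bar> + L * \<bar>f x\<bar>) * \<bar>partial_deriv i \<phi> x\<bar>"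
        using lip[of "f x" 0] by (intro mult_right_mono) auto
      also have "\<dots> \<le> \<bar>\<psi> 0\<bar> * \<bar>partial_deriv i \<phi> x\<bar> + L * \<bar>f x\<bar> * P'"
        using P'[of x] L0 by (simp add: distrib_right mult_left_mono)
      finally show "norm (\<psi> (f x) * partial_deriv i \<phi> x) \<le> norm (\<bar>\<psi> 0\<bar> * \<bar>partial_deriv i \<phi> x\<bar> + L * P' * \<bar>f x\<bar>)"
        unfolding real_norm_def by (intro order_trans[OF _ abs_ge_self]) (simp add: abs_mult mult_ac)
    qed
  qed simp
  have limA: "A \<longlonglongrightarrow> (\<integral>x. \<psi> (f x) * partial_deriv i \<phi> x \<partial>lborel)"
  proof (rule LIM_zero_cancel, rule Lim_null_comparison)
    have "(\<lambda>m. L * P' * (\<integral>x. \<bar>fm m x - f x\<bar> \<partial>lborel)) \<longlonglongrightarrow> L * P' * 0"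
      by (intro tendsto_mult tendsto_const Lf)
    then show "(\<lambda>m. L * P' * (\<integral>x. \<bar>fm m x - f x\<bar> \<partial>lborel)) \<longlonglongrightarrow> 0" by simp
    show "\<forall>\<^sub>F m in sequentially. norm (A m - (\<integral>x. \<psi> (f x) * partial_deriv i \<phi> x \<partial>lborel)) \<le> L * P' * (\<integral>x. \<bar>fm m x - f x\<bar> \<partial>lborel)"
    proof (rule always_eventually, rule allI)
      fix m
      have "A m - (\<integral>x. \<psi> (f x) * partial_deriv i \<phi> x \<partial>lborel) = (\<integral>x. \<psi> (fm m x) * partial_deriv i \<phi> x - \<psi> (f x) * partial_deriv i \<phi> x \<partial>lborel)"
        unfolding A_def using intA ipf by simp
      also have "norm \<dots> \<le> (\<integral>x. L * P' * \<bar>fm m x - f x\<bar> \<partial>lborel)"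
      proof (rule order_trans[OF integral_norm_bound integral_mono])
        show "norm (\<psi> (fm m x) * partial_deriv i \<phi> x - \<psi> (f x) * partial_deriv i \<phi> x) \<le> L * P' * \<bar>fm m x - f x\<bar>" for x
        proof -
          have "\<bar>\<psi> (fm m x) - \<psi> (f x)\<bar> * \<bar>partial_deriv i \<phi> x\<bar> \<le> (L * \<bar>fm m x - f x\<bar>) * P'"
            using lip P' L0 by (intro mult_mono) auto
          moreover have "norm (\<psi> (fm m x) * partial_deriv i \<phi> x - \<psi> (f x) * partial_deriv i \<phi> x) = \<bar>\<psi> (fm m x) - \<psi> (f x)\<bar> * \<bar>partial_deriv i \<phi> x\<bar>"
            by (simp add: abs_mult flip: left_diff_distrib)
          ultimately show ?thesis by (simp add: mult_ac)
        qed
      qed (use intA ipf Lf(1)[of m] in auto)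
      also have "\<dots> = L * P' * (\<integral>x. \<bar>fm m x - f x\<bar> \<partial>lborel)" by simp
      finally show "norm (A m - (\<integral>x. \<psi> (f x) * partial_deriv i \<phi> x \<partial>lborel)) \<le> L * P' * (\<integral>x. \<bar>fm m x - f x\<bar> \<partial>lborel)" .
    qed
  qed
  \<comment> \<open>\<psi>' is merely continuous, so its values at the mollified function converge
    only where that function does; L1 convergence gives this almost everywhere along a subsequence.
    The factor D is kept fixed in that limit, and replacing \<open>Dm m\<close> by D is estimated
    separately in L1.\<close>
  obtain r :: "nat \<Rightarrow> nat" where r: "strict_mono r" "AE x in lborel. (\<lambda>n. fm (r n) x - f x) \<longlonglongrightarrow> 0"
    using tendsto_L1_AE_subseq[of lborel "\<lambda>m x. fm m x - f x"] Lf by auto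
  have iD\<phi>: "integrable lborel (\<lambda>x. D x * \<phi> x)" by (rule integrable_mult_bounded[OF D]) (use P in auto)
  have limH: "(\<lambda>n. \<integral>x. \<psi>' (fm (r n) x) * (D x * \<phi> x) \<partial>lborel) \<longlonglongrightarrow> (\<integral>x. \<psi>' (f x) * (D x * \<phi> x) \<partial>lborel)"
  proof (rule integral_dominated_convergence[where w = "\<lambda>x. L * \<bar>D x * \<phi> x\<bar>"])
    show "AE x in lborel. (\<lambda>n. \<psi>' (fm (r n) x) * (D x * \<phi> x)) \<longlonglongrightarrow> \<psi>' (f x) * (D x * \<phi> x)"
      using r(2)
    proof eventually_elim
      case (elim x)
      then have 1: "(\<lambda>n. fm (r n) x) \<longlonglongrightarrow> f x" by (rule LIM_zero_cancel)
      have 2: "isCont \<psi>' (f x)" using \<psi>(2) by (simp add: continuous_on_eq_continuous_at)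
      show ?case by (rule tendsto_mult[OF isCont_tendsto_compose[OF 2 1] tendsto_const])
    qed
    show "AE x in lborel. norm (\<psi>' (fm (r n) x) * (D x * \<phi> x)) \<le> L * \<bar>D x * \<phi> x\<bar>" for n
      unfolding real_norm_def abs_mult[of "\<psi>' _"] using \<psi>(3) by (intro AE_I2 mult_right_mono) auto
  qed (use iD\<phi> in auto)
  have intH: "integrable lborel (\<lambda>x. \<psi>' (fm m x) * (D x * \<phi> x))" for m
    using integrable_mult_bounded[OF iD\<phi>, of "\<lambda>x. \<psi>' (fm m x)" L] \<psi>(3) by (simp add: mult_ac)
  have limG: "(\<lambda>m. E m - (\<integral>x. \<psi>' (fm m x) * (D x * \<phi> x) \<partial>lborel)) \<longlonglongrightarrow> 0"
  proof (rule Lim_null_comparison)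
    have "(\<lambda>m. L * P * (\<integral>x. \<bar>Dm m x - D x\<bar> \<partial>lborel)) \<longlonglongrightarrow> L * P * 0"
      by (intro tendsto_mult tendsto_const LD)
    then show "(\<lambda>m. L * P * (\<integral>x. \<bar>Dm m x - D x\<bar> \<partial>lborel)) \<longlonglongrightarrow> 0" by simp
    show "\<forall>\<^sub>F m in sequentially. norm (E m - (\<integral>x. \<psi>' (fm m x) * (D x * \<phi> x) \<partial>lborel)) \<le> L * P * (\<integral>x. \<bar>Dm m x - D x\<bar> \<partial>lborel)"
    proof (rule always_eventually, rule allI)
      fix m
      have "E m - (\<integral>x. \<psi>' (fm m x) * (D x * \<phi> x) \<partial>lborel) = (\<integral>x. \<psi>' (fm m x) * Dm m x * \<phi> x - \<psi>' (fm m x) * (D x * \<phi> x) \<partial>lborel)"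
        unfolding E_def using intE intH by simp
      also have "norm \<dots> \<le> (\<integral>x. L * P * \<bar>Dm m x - D x\<bar> \<partial>lborel)"
      proof (rule order_trans[OF integral_norm_bound integral_mono])
        show "norm (\<psi>' (fm m x) * Dm m x * \<phi> x - \<psi>' (fm m x) * (D x * \<phi> x)) \<le> L * P * \<bar>Dm m x - D x\<bar>" for x
        proof -
          have "\<psi>' (fm m x) * Dm m x * \<phi> x - \<psi>' (fm m x) * (D x * \<phi> x) = \<psi>' (fm m x) * \<phi> x * (Dm m x - D x)"
            by (simp add: algebra_simps)
          also have "norm \<dots> = \<bar>\<psi>' (fm m x)\<bar> * \<bar>\<phi> x\<bar> * \<bar>Dm m x - D x\<bar>" by (simp add: abs_mult)
          also have "\<dots> \<le> L * P * \<bar>Dm m x - D x\<bar>" using \<psi>(3) P L0 P0 by (intro mult_mono) auto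
          finally show ?thesis .
        qed
      qed (use intE intH LD(1)[of m] in auto)
      also have "\<dots> = L * P * (\<integral>x. \<bar>Dm m x - D x\<bar> \<partial>lborel)" by simp
      finally show "norm (E m - (\<integral>x. \<psi>' (fm m x) * (D x * \<phi> x) \<partial>lborel)) \<le> L * P * (\<integral>x. \<bar>Dm m x - D x\<bar> \<partial>lborel)" .
    qed
  qed
  have "(\<lambda>n. A (r n) + ((E (r n) - (\<integral>x. \<psi>' (fm (r n) x) * (D x * \<phi> x) \<partial>lborel)) + (\<integral>x. \<psi>' (fm (r n) x) * (D x * \<phi> x) \<partial>lborel)))
     \<longlonglongrightarrow> (\<integral>x. \<psi> (f x) * partial_deriv i \<phi> x \<partial>lborel) + (0 + (\<integral>x. \<psi>' (f x) * (D x * \<phi> x) \<partial>lborel))"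
    by (intro tendsto_add limH LIMSEQ_subseq_LIMSEQ[OF limA r(1), unfolded o_def] LIMSEQ_subseq_LIMSEQ[OF limG r(1), unfolded o_def])
  then have "(\<integral>x. \<psi> (f x) * partial_deriv i \<phi> x \<partial>lborel) + (\<integral>x. \<psi>' (f x) * (D x * \<phi> x) \<partial>lborel) = 0"
    using AE0 by (simp add: LIMSEQ_const_iff)
  then show ?thesis by (simp add: mult_ac)
qed

section \<open>From Lebesgue to Borel measurable functions\<close>

lemma borel_version:
  fixes F :: "'a::euclidean_space \<Rightarrow> real"
  assumes F: "integrable lebesgue F"
  obtains g where "integrable lborel g" "AE x in lebesgue. F x = g x"
proof -
  obtain g where g: "g \<in> borel_measurable lborel" "AE x in lborel. F x = g x"
    using completion_ex_borel_measurable_real[of F lborel] F by auto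
  then have ae: "AE x in lebesgue. F x = g x" by (intro AE_completion)
  have "g \<in> borel_measurable lebesgue" using g(1) by (rule measurable_completion)
  then have "integrable lebesgue g" using ae F integrable_cong_AE[of F lebesgue g] by auto
  then have "integrable lborel g" using integrable_completion[of g lborel] g(1) by simp
  then show thesis using that ae by blast
qed

lemma lebesgue_on_integral_eq_lborel:
  fixes u v :: "'a::euclidean_space \<Rightarrow> real"
  assumes \<Omega>: "\<Omega> \<in> sets lebesgue" and v: "v \<in> borel_measurable borel"
    and meas: "u \<in> borel_measurable (lebesgue_on \<Omega>)"
    and ae: "AE x in lebesgue. indicator \<Omega> x * u x = v x"
  shows "(LINT x|lebesgue_on \<Omega>. u x) = (LINT x|lborel. v x)"
proof -
  have "(LINT x|lebesgue_on \<Omega>. u x) = (LINT x|lebesgue. indicator \<Omega> x *\<^sub>R u x)"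
    using \<Omega> by (intro integral_restrict_space) auto
  also have "\<dots> = (LINT x|lebesgue. v x)"
  proof (rule integral_cong_AE)
    show "(\<lambda>x. indicator \<Omega> x *\<^sub>R u x) \<in> borel_measurable lebesgue"
      using meas \<Omega> by (subst (asm) borel_measurable_restrict_space_iff) auto
    show "v \<in> borel_measurable lebesgue" using v by (intro measurable_completion) simp
  qed (use ae in auto)
  also have "\<dots> = (LINT x|lborel. v x)" using v by (intro integral_completion) simp
  finally show ?thesis .
qed

lemma lebesgue_on_integral_eq_lebesgue:
  fixes u v :: "'a::euclidean_space \<Rightarrow> real"
  assumes \<Omega>: "\<Omega> \<in> sets lebesgue" and v: "v \<in> borel_measurable borel"
    and ae: "AE x in lebesgue. indicator \<Omega> x * u x = v x"
  shows "(LINT x|lebesgue_on \<Omega>. u x) = (LINT x|lborel. v x)"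
proof (rule lebesgue_on_integral_eq_lborel[OF \<Omega> v _ ae])
  have vl: "v \<in> borel_measurable lebesgue" using v by (intro measurable_completion) simp
  have "(\<lambda>x. indicator \<Omega> x * u x) \<in> borel_measurable lebesgue"
    by (rule borel_measurable_AE[OF vl]) (use ae in \<open>auto elim: eventually_mono\<close>)
  then show "u \<in> borel_measurable (lebesgue_on \<Omega>)"
    using \<Omega> by (subst borel_measurable_restrict_space_iff) auto
qed

text \<open>A smooth approximation of the positive part. The shift c = 1/(m+1) is of larger order
  than the smoothing parameter c^2, so the derivative at 0 tends to 0 instead of 1/2, and the
  derivatives converge to the indicator of s > 0 everywhere, also at s = 0.\<close>

definition smooth_pos :: "nat \<Rightarrow> real \<Rightarrow> real" where
  "smooth_pos m s = (let c = 1 / real (Suc m) in ((s - c) + sqrt ((s - c)\<^sup>2 + (c\<^sup>2)\<^sup>2)) / 2)"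

definition smooth_pos' :: "nat \<Rightarrow> real \<Rightarrow> real" where
  "smooth_pos' m s = (let c = 1 / real (Suc m) in (1 + (s - c) / sqrt ((s - c)\<^sup>2 + (c\<^sup>2)\<^sup>2)) / 2)"

lemma smooth_pos_props:
  shows "(smooth_pos m has_real_derivative smooth_pos' m s) (at s)"
    and "continuous_on UNIV (smooth_pos' m)"
    and "\<bar>smooth_pos' m s\<bar> \<le> 1"
    and "\<bar>smooth_pos m s\<bar> \<le> \<bar>s\<bar> + 2"
proof -
  define c where "c = 1 / real (Suc m)"
  have c: "0 < c" "c \<le> 1" by (auto simp: c_def)
  have pos: "0 < (s - c)\<^sup>2 + (c\<^sup>2)\<^sup>2" for s using c by (intro add_nonneg_pos) auto
  have eq: "smooth_pos m = (\<lambda>s. ((s - c) + sqrt ((s - c)\<^sup>2 + (c\<^sup>2)\<^sup>2)) / 2)"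
     "smooth_pos' m = (\<lambda>s. (1 + (s - c) / sqrt ((s - c)\<^sup>2 + (c\<^sup>2)\<^sup>2)) / 2)"
    by (auto simp: fun_eq_iff smooth_pos_def smooth_pos'_def c_def Let_def)
  show "(smooth_pos m has_real_derivative smooth_pos' m s) (at s)"
    unfolding eq using pos[of s] by (auto intro!: derivative_eq_intros simp: field_simps)
  show "continuous_on UNIV (smooth_pos' m)"
    unfolding eq using pos by (intro continuous_intros) (auto simp: less_imp_neq[symmetric])
  have "\<bar>s - c\<bar> \<le> sqrt ((s - c)\<^sup>2 + (c\<^sup>2)\<^sup>2)" using real_sqrt_le_mono[of "(s - c)\<^sup>2" "(s - c)\<^sup>2 + (c\<^sup>2)\<^sup>2"] by simp
  then have "\<bar>(s - c) / sqrt ((s - c)\<^sup>2 + (c\<^sup>2)\<^sup>2)\<bar> \<le> 1"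
    using pos[of s] by (simp add: abs_divide divide_le_eq)
  moreover have "\<bar>(1 + q) / 2\<bar> \<le> 1" if "\<bar>q\<bar> \<le> 1" for q :: real using that by (simp add: abs_le_iff)
  ultimately show "\<bar>smooth_pos' m s\<bar> \<le> 1" unfolding eq by blast
  define q where "q = sqrt ((s - c)\<^sup>2 + (c\<^sup>2)\<^sup>2)"
  have "q \<le> \<bar>s - c\<bar> + \<bar>c\<^sup>2\<bar>" unfolding q_def by (rule sqrt_sum_squares_le_sum_abs)
  moreover have "\<bar>c\<^sup>2\<bar> \<le> 1" using c by (simp add: power_le_one)
  ultimately have q: "q \<le> \<bar>s - c\<bar> + 1" "0 \<le> q" by (auto simp: q_def)
  have sc: "\<bar>s - c\<bar> \<le> \<bar>s\<bar> + c" using abs_triangle_ineq4[of s c] c by simp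
  have lin: "s - c + q \<le> 2 * (A + 2) \<and> - (s - c + q) \<le> 2 * (A + 2)"
    if "q \<le> B + 1" "B \<le> A + c" "s \<le> A" "- s \<le> A" for A B
    using that q(2) c by argo
  have "s - c + q \<le> 2 * (\<bar>s\<bar> + 2)" "- (s - c + q) \<le> 2 * (\<bar>s\<bar> + 2)"
    using lin[OF q(1) sc abs_ge_self abs_ge_minus_self] by simp_all
  then show "\<bar>smooth_pos m s\<bar> \<le> \<bar>s\<bar> + 2"
    unfolding eq q_def[symmetric] by (intro abs_leI; argo)
qed

lemma smooth_pos_limit: "(\<lambda>m. smooth_pos m s) \<longlonglongrightarrow> max 0 s"
proof -
  have c: "(\<lambda>m. 1 / real (Suc m)) \<longlonglongrightarrow> 0" using LIMSEQ_Suc[OF lim_1_over_n] by simp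
  have "(\<lambda>m. ((s - 1 / real (Suc m)) + sqrt ((s - 1 / real (Suc m))\<^sup>2 + ((1 / real (Suc m))\<^sup>2)\<^sup>2)) / 2)
     \<longlonglongrightarrow> ((s - 0) + sqrt ((s - 0)\<^sup>2 + (0\<^sup>2)\<^sup>2)) / 2"
    by (intro tendsto_intros c) auto
  moreover have "((s - 0) + sqrt ((s - 0)\<^sup>2 + (0\<^sup>2)\<^sup>2)) / 2 = max 0 s" by (auto simp: max_def)
  ultimately show ?thesis by (simp add: smooth_pos_def Let_def)
qed

lemma smooth_pos'_limit: "(\<lambda>m. smooth_pos' m s) \<longlonglongrightarrow> (if 0 < s then 1 else 0)"
proof -
  have c: "(\<lambda>m. 1 / real (Suc m)) \<longlonglongrightarrow> 0" using LIMSEQ_Suc[OF lim_1_over_n] by simp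
  show ?thesis
  proof (cases "s = 0")
    case False
    have "(\<lambda>m. (1 + (s - 1 / real (Suc m)) / sqrt ((s - 1 / real (Suc m))\<^sup>2 + ((1 / real (Suc m))\<^sup>2)\<^sup>2)) / 2)
       \<longlonglongrightarrow> (1 + (s - 0) / sqrt ((s - 0)\<^sup>2 + (0\<^sup>2)\<^sup>2)) / 2"
      using False by (intro tendsto_intros c) auto
    moreover have "(1 + (s - 0) / sqrt ((s - 0)\<^sup>2 + (0\<^sup>2)\<^sup>2)) / 2 = (if 0 < s then 1 else 0)"
      using False by auto
    ultimately show ?thesis by (simp add: smooth_pos'_def Let_def)
  next
    case True
    have "(\<lambda>m. (1 - 1 / sqrt (1 + (1 / real (Suc m))\<^sup>2)) / 2) \<longlonglongrightarrow> (1 - 1 / sqrt (1 + 0\<^sup>2)) / 2"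
      by (intro tendsto_intros c) auto
    moreover have eq: "smooth_pos' m 0 = (1 - 1 / sqrt (1 + (1 / real (Suc m))\<^sup>2)) / 2" for m
    proof -
      define c where "c = 1 / real (Suc m)"
      have c: "0 < c" by (simp add: c_def)
      \<comment> \<open>With c^2 factored out, the quotient in the derivative is -1/sqrt(1 + c^2),
        which tends to -1.\<close>
      have "(0 - c)\<^sup>2 + (c\<^sup>2)\<^sup>2 = c\<^sup>2 * (1 + c\<^sup>2)" by (simp add: power2_eq_square algebra_simps)
      then have "sqrt ((0 - c)\<^sup>2 + (c\<^sup>2)\<^sup>2) = c * sqrt (1 + c\<^sup>2)" using c by (simp add: real_sqrt_mult)
      then show ?thesis using c unfolding smooth_pos'_def c_def[symmetric] Let_def by (simp add: field_simps)
    qed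
    ultimately show ?thesis unfolding True eq by simp
  qed
qed

lemma locally_integrable_components:
  fixes Df :: "real^'n::finite \<Rightarrow> real^'n"
  assumes "locally_integrable \<Omega> Df" "compact K" "K \<subseteq> \<Omega>"
  shows "integrable lebesgue (\<lambda>x. indicator K x * Df x $ i)"
proof -
  have "integrable lebesgue (\<lambda>x. indicator K x *\<^sub>R Df x)"
    using assms by (auto simp: locally_integrable_def set_integrable_def)
  then have "integrable lebesgue (\<lambda>x. (indicator K x *\<^sub>R Df x) \<bullet> axis i 1)" by (rule integrable_inner_left)
  then show ?thesis by (simp add: inner_axis)
qed

text \<open>Localisation: multiplying f and its gradient by the indicator of a compact neighbourhood
  K of the support of \<phi> gives integrable functions on the whole space, and kernels of radius
  \<delta> at points of the support are test functions living in K. The C1 chain rule then applies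
  with \<open>smooth_pos\<close>, and m tends to infinity.\<close>

theorem has_weak_gradient_pos_part:
  fixes f :: "real^'n::finite \<Rightarrow> real"
  assumes \<Omega>: "open \<Omega>" and f: "has_weak_gradient f Df \<Omega>"
  shows "has_weak_gradient (\<lambda>x. max 0 (f x - a)) (\<lambda>x. if a < f x then Df x else 0) \<Omega>"
proof -
  have li: "locally_integrable \<Omega> f" "locally_integrable \<Omega> Df"
    and wk: "\<And>\<phi> i. \<phi> \<in> test_functions \<Omega> \<Longrightarrow> (LINT x|lebesgue_on \<Omega>. f x * partial_deriv i \<phi> x) = - (LINT x|lebesgue_on \<Omega>. (Df x $ i) * \<phi> x)"
    using f by (auto simp: has_weak_gradient_def)
  have \<Omega>l: "\<Omega> \<in> sets lebesgue" using \<Omega> by auto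
  show ?thesis
    unfolding has_weak_gradient_def
  proof (intro conjI ballI allI)
    show "locally_integrable \<Omega> (\<lambda>x. max 0 (f x - a))"
      unfolding locally_integrable_def
    proof (intro allI impI)
      fix K assume K: "compact K \<and> K \<subseteq> \<Omega>"
      then have "integrable lebesgue (\<lambda>x. indicator K x *\<^sub>R f x)" using li by (auto simp: locally_integrable_def set_integrable_def)
      moreover have "integrable lebesgue (\<lambda>x. a * indicator K x :: real)"
        using K lmeasurable_compact[of K]
        by (intro integrable_mult_right integrable_real_indicator) (auto simp: fmeasurable_def)
      ultimately have "integrable lebesgue (\<lambda>x. max 0 (indicator K x *\<^sub>R f x - a * indicator K x))" by (intro integrable_max) auto
      moreover have "max 0 (indicator K x *\<^sub>R f x - a * indicator K x) = indicator K x *\<^sub>R max 0 (f x - a)" for x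
        by (auto simp: indicator_def)
      ultimately show "(\<lambda>x. max 0 (f x - a)) absolutely_integrable_on K" by (simp add: set_integrable_def)
    qed
    show "locally_integrable \<Omega> (\<lambda>x. if a < f x then Df x else 0)"
      unfolding locally_integrable_def
    proof (intro allI impI)
      fix K assume K: "compact K \<and> K \<subseteq> \<Omega>"
      then have i1: "integrable lebesgue (\<lambda>x. indicator K x *\<^sub>R f x)" "integrable lebesgue (\<lambda>x. indicator K x *\<^sub>R Df x)"
        using li by (auto simp: locally_integrable_def set_integrable_def)
      then have [measurable]: "(\<lambda>x. indicator K x *\<^sub>R f x) \<in> borel_measurable lebesgue" "(\<lambda>x. indicator K x *\<^sub>R Df x) \<in> borel_measurable lebesgue"
        by auto
      have "integrable lebesgue (\<lambda>x. if a < indicator K x *\<^sub>R f x then indicator K x *\<^sub>R Df x else 0)"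
      proof (rule Bochner_Integration.integrable_bound[OF i1(2)])
        have "(\<lambda>x. if a < u x then w x else 0) \<in> borel_measurable lebesgue"
          if [measurable]: "u \<in> borel_measurable lebesgue" "w \<in> borel_measurable lebesgue" for u :: "_ \<Rightarrow> real" and w :: "_ \<Rightarrow> real^'n"
          by measurable
        then show "(\<lambda>x. if a < indicator K x *\<^sub>R f x then indicator K x *\<^sub>R Df x else 0) \<in> borel_measurable lebesgue"
          using i1[THEN borel_measurable_integrable] by blast
      qed auto
      moreover have "(if a < indicator K x *\<^sub>R f x then indicator K x *\<^sub>R Df x else 0) = indicator K x *\<^sub>R (if a < f x then Df x else 0)" for x
        by (auto simp: indicator_def)
      ultimately show "(\<lambda>x. if a < f x then Df x else 0) absolutely_integrable_on K" by (simp add: set_integrable_def)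
    qed
    fix \<phi> i assume \<phi>T: "\<phi> \<in> test_functions \<Omega>"
    let ?S = "closure {x. \<phi> x \<noteq> 0}"
    have \<phi>: "\<And>k. C_diff k \<phi>" "compact ?S" "?S \<subseteq> \<Omega>" using \<phi>T by (auto simp: test_functions_def)
    note sc = smooth_compact_support[OF \<phi>(1,2)]
    obtain e where e: "0 < e" "(\<Union>x\<in>?S. ball x e) \<subseteq> \<Omega>"
      using compact_subset_open_imp_ball_epsilon_subset[OF \<phi>(2) \<Omega> \<phi>(3)] by blast
    \<comment> \<open>Half of \<open>e\<close>, so that the closed \<delta>-neighbourhood K of the
      support still lies in \<Omega>.\<close>
    define \<delta> where "\<delta> = e / 2"
    have \<delta>: "0 < \<delta>" using e by (simp add: \<delta>_def)
    define K where "K = {x + y | x y. x \<in> ?S \<and> y \<in> cball 0 \<delta>}"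
    have K: "compact K" unfolding K_def by (intro compact_sums \<phi>(2)) auto
    have cb: "cball x \<delta> \<subseteq> K" if "x \<in> ?S" for x
    proof
      fix y assume "y \<in> cball x \<delta>"
      then have "y = x + (y - x)" "y - x \<in> cball 0 \<delta>" by (auto simp: dist_norm norm_minus_commute)
      then show "y \<in> K" using that unfolding K_def by blast
    qed
    have SK: "?S \<subseteq> K" using cb \<delta> by force
    have K\<Omega>: "K \<subseteq> \<Omega>"
    proof
      fix z assume "z \<in> K"
      then obtain x y where "z = x + y" "x \<in> ?S" "norm y \<le> \<delta>" by (auto simp: K_def)
      moreover have "x + y \<in> ball x e" using \<open>norm y \<le> \<delta>\<close> e by (simp add: \<delta>_def dist_norm)
      ultimately show "z \<in> \<Omega>" using e(2) by blast
    qed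
    obtain g where g: "integrable lborel g" "AE x in lebesgue. indicator K x * f x = g x"
    proof (rule borel_version)
      show "integrable lebesgue (\<lambda>x. indicator K x * f x)"
        using li(1) K K\<Omega> by (auto simp: locally_integrable_def set_integrable_def)
    qed
    obtain D where D: "integrable lborel D" "AE x in lebesgue. indicator K x * Df x $ i = D x"
      using borel_version[OF locally_integrable_components[OF li(2) K K\<Omega>]] by blast
    have [measurable]: "g \<in> borel_measurable borel" "D \<in> borel_measurable borel" using g D by auto
    note [measurable] = sc(1,2)
    have W: "(\<integral>y. g y * partial_deriv i b (y - x) \<partial>lborel) = - (\<integral>y. D y * b (y - x) \<partial>lborel)"
      if x: "x \<in> ?S" and b: "\<And>k. C_diff k b" "\<And>y. b y \<noteq> 0 \<Longrightarrow> norm y < \<delta>" for x b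
    proof -
      let ?b = "\<lambda>y. b (y - x)"
      have Cb: "C_diff k ?b" for k using b(1) by (rule C_diff_translate)
      have "{y. ?b y \<noteq> 0} \<subseteq> cball x \<delta>"
        using less_imp_le[OF b(2)] by (force simp: dist_norm norm_minus_commute)
      then have cl: "closure {y. ?b y \<noteq> 0} \<subseteq> cball x \<delta>" by (intro closure_minimal) auto
      have comp: "compact (closure {y. ?b y \<noteq> 0})"
        by (rule compact_Int_closed[of "cball x \<delta>" "closure {y. ?b y \<noteq> 0}", simplified Int_absorb1[OF cl]]) auto
      have test: "?b \<in> test_functions \<Omega>" using Cb comp cl cb[OF x] K\<Omega> by (auto simp: test_functions_def)
      have pb: "partial_deriv i ?b = (\<lambda>y. partial_deriv i b (y - x))"
        using b(1)[of 1] by (intro partial_deriv_translate) simp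
      have z1: "?b y = 0" if "y \<notin> K" for y
        using that cl cb[OF x] closure_subset[of "{y. ?b y \<noteq> 0}"] by blast
      have z2: "partial_deriv i ?b y = 0" if "y \<notin> K" for y
        using that cl cb[OF x] by (intro partial_deriv_outside_support) blast
      note scb = smooth_compact_support[OF Cb comp]
      have "(LINT y|lebesgue_on \<Omega>. f y * partial_deriv i ?b y) = (LINT y|lborel. g y * partial_deriv i ?b y)"
      proof (rule lebesgue_on_integral_eq_lebesgue[OF \<Omega>l])
        show "(\<lambda>y. g y * partial_deriv i ?b y) \<in> borel_measurable borel" using scb by measurable
        show "AE y in lebesgue. indicator \<Omega> y * (f y * partial_deriv i ?b y) = g y * partial_deriv i ?b y"
          using g(2) by eventually_elim (use z2 K\<Omega> in \<open>force simp: indicator_def split: if_splits\<close>)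
      qed
      moreover have "(LINT y|lebesgue_on \<Omega>. Df y $ i * ?b y) = (LINT y|lborel. D y * ?b y)"
      proof (rule lebesgue_on_integral_eq_lebesgue[OF \<Omega>l])
        show "(\<lambda>y. D y * ?b y) \<in> borel_measurable borel" using scb by measurable
        show "AE y in lebesgue. indicator \<Omega> y * (Df y $ i * ?b y) = D y * ?b y"
          using D(2) by eventually_elim (use z1 K\<Omega> in \<open>force simp: indicator_def split: if_splits\<close>)
      qed
      ultimately show ?thesis using wk[OF test, of i] by (simp add: pb)
    qed
    have chain: "(\<integral>x. smooth_pos m (g x - a) * partial_deriv i \<phi> x \<partial>lborel) = - (\<integral>x. smooth_pos' m (g x - a) * D x * \<phi> x \<partial>lborel)" for m
    proof (rule weak_chain_rule_C1[OF g(1) D(1) \<phi>(1,2) \<delta> W, where \<psi> = "\<lambda>s. smooth_pos m (s - a)" and \<psi>' = "\<lambda>s. smooth_pos' m (s - a)" and L = 1])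
      show "((\<lambda>s. smooth_pos m (s - a)) has_real_derivative smooth_pos' m (s - a)) (at s)" for s
      proof -
        have "((\<lambda>s. s - a) has_real_derivative 1) (at s)" by (auto intro!: derivative_eq_intros)
        from DERIV_chain'[OF this smooth_pos_props(1)[of m]] show ?thesis by simp
      qed
      show "continuous_on UNIV (\<lambda>s. smooth_pos' m (s - a))"
        by (auto intro!: continuous_on_compose2[OF smooth_pos_props(2)] continuous_intros)
    qed (auto simp: smooth_pos_props(3))
    have [measurable]: "smooth_pos m \<in> borel_measurable borel" "smooth_pos' m \<in> borel_measurable borel" for m
      using smooth_pos_props(2)[of m] DERIV_isCont[OF smooth_pos_props(1)[of m]]
      by (auto intro!: borel_measurable_continuous_onI continuous_at_imp_continuous_on)
    obtain P where P: "\<And>x. \<bar>\<phi> x\<bar> \<le> P" using sc(5) by blast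
    obtain P' where P': "\<And>x. \<bar>partial_deriv i \<phi> x\<bar> \<le> P'" using sc(6) by blast
    have ig: "integrable lborel (\<lambda>x. g x * partial_deriv i \<phi> x)" by (rule integrable_mult_bounded[OF g(1) _ P']) measurable
    have iD: "integrable lborel (\<lambda>x. D x * \<phi> x)" by (rule integrable_mult_bounded[OF D(1) _ P]) measurable
    have l1: "(\<lambda>m. \<integral>x. smooth_pos m (g x - a) * partial_deriv i \<phi> x \<partial>lborel) \<longlonglongrightarrow> (\<integral>x. max 0 (g x - a) * partial_deriv i \<phi> x \<partial>lborel)"
    proof (rule integral_dominated_convergence[where w = "\<lambda>x. \<bar>g x * partial_deriv i \<phi> x\<bar> + (\<bar>a\<bar> + 2) * \<bar>partial_deriv i \<phi> x\<bar>"])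
      show "AE x in lborel. (\<lambda>m. smooth_pos m (g x - a) * partial_deriv i \<phi> x) \<longlonglongrightarrow> max 0 (g x - a) * partial_deriv i \<phi> x"
        by (intro AE_I2 tendsto_mult tendsto_const smooth_pos_limit)
      show "AE x in lborel. norm (smooth_pos m (g x - a) * partial_deriv i \<phi> x) \<le> \<bar>g x * partial_deriv i \<phi> x\<bar> + (\<bar>a\<bar> + 2) * \<bar>partial_deriv i \<phi> x\<bar>" for m
      proof (rule AE_I2)
        fix x
        have "\<bar>smooth_pos m (g x - a)\<bar> \<le> \<bar>g x\<bar> + (\<bar>a\<bar> + 2)" using smooth_pos_props(4)[of m "g x - a"] by linarith
        then have "\<bar>smooth_pos m (g x - a)\<bar> * \<bar>partial_deriv i \<phi> x\<bar> \<le> (\<bar>g x\<bar> + (\<bar>a\<bar> + 2)) * \<bar>partial_deriv i \<phi> x\<bar>"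
          by (intro mult_right_mono) auto
        then show "norm (smooth_pos m (g x - a) * partial_deriv i \<phi> x) \<le> \<bar>g x * partial_deriv i \<phi> x\<bar> + (\<bar>a\<bar> + 2) * \<bar>partial_deriv i \<phi> x\<bar>"
          by (simp add: abs_mult distrib_right)
      qed
    qed (use ig sc(4) in auto)
    have l2: "(\<lambda>m. \<integral>x. smooth_pos' m (g x - a) * D x * \<phi> x \<partial>lborel) \<longlonglongrightarrow> (\<integral>x. (if 0 < g x - a then 1 else 0) * D x * \<phi> x \<partial>lborel)"
    proof (rule integral_dominated_convergence[where w = "\<lambda>x. \<bar>D x * \<phi> x\<bar>"])
      show "AE x in lborel. (\<lambda>m. smooth_pos' m (g x - a) * D x * \<phi> x) \<longlonglongrightarrow> (if 0 < g x - a then 1 else 0) * D x * \<phi> x"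
        by (intro AE_I2 tendsto_mult tendsto_const smooth_pos'_limit)
      show "AE x in lborel. norm (smooth_pos' m (g x - a) * D x * \<phi> x) \<le> \<bar>D x * \<phi> x\<bar>" for m
      proof (rule AE_I2)
        fix x
        have "\<bar>smooth_pos' m (g x - a)\<bar> * \<bar>D x * \<phi> x\<bar> \<le> 1 * \<bar>D x * \<phi> x\<bar>"
          by (intro mult_right_mono smooth_pos_props(3)) auto
        then show "norm (smooth_pos' m (g x - a) * D x * \<phi> x) \<le> \<bar>D x * \<phi> x\<bar>" by (simp add: abs_mult mult.assoc)
      qed
    qed (use iD in auto)
    have "(\<lambda>m. - (\<integral>x. smooth_pos' m (g x - a) * D x * \<phi> x \<partial>lborel)) \<longlonglongrightarrow> (\<integral>x. max 0 (g x - a) * partial_deriv i \<phi> x \<partial>lborel)"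
      using l1 by (simp only: chain)
    then have key: "(\<integral>x. max 0 (g x - a) * partial_deriv i \<phi> x \<partial>lborel) = - (\<integral>x. (if 0 < g x - a then 1 else 0) * D x * \<phi> x \<partial>lborel)"
      using tendsto_minus[OF l2] LIMSEQ_unique by blast
    have z1: "\<phi> y = 0" if "y \<notin> K" for y using that SK closure_subset[of "{y. \<phi> y \<noteq> 0}"] by blast
    have z2: "partial_deriv i \<phi> y = 0" if "y \<notin> K" for y using that SK by (intro partial_deriv_outside_support) blast
    have "(LINT x|lebesgue_on \<Omega>. max 0 (f x - a) * partial_deriv i \<phi> x) = (LINT x|lborel. max 0 (g x - a) * partial_deriv i \<phi> x)"
    proof (rule lebesgue_on_integral_eq_lebesgue[OF \<Omega>l])
      show "AE x in lebesgue. indicator \<Omega> x * (max 0 (f x - a) * partial_deriv i \<phi> x) = max 0 (g x - a) * partial_deriv i \<phi> x"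
        using g(2)
      proof eventually_elim
        case (elim x)
        then show ?case using z2[of x] K\<Omega> by (cases "x \<in> K") auto
      qed
    qed measurable
    moreover have "(LINT x|lebesgue_on \<Omega>. (if a < f x then Df x else 0) $ i * \<phi> x) = (LINT x|lborel. (if 0 < g x - a then 1 else 0) * D x * \<phi> x)"
    proof (rule lebesgue_on_integral_eq_lebesgue[OF \<Omega>l])
      show "AE x in lebesgue. indicator \<Omega> x * ((if a < f x then Df x else 0) $ i * \<phi> x) = (if 0 < g x - a then 1 else 0) * D x * \<phi> x"
        using g(2) D(2)
      proof eventually_elim
        case (elim x)
        then show ?case using z1[of x] K\<Omega> by (cases "x \<in> K") auto
      qed
    qed measurable
    ultimately show "(LINT x|lebesgue_on \<Omega>. max 0 (f x - a) * partial_deriv i \<phi> x) = - (LINT x|lebesgue_on \<Omega>. (if a < f x then Df x else 0) $ i * \<phi> x)"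
      using key by simp
  qed
qed

section \<open>Linearity, truncations and classical gradients\<close>

lemma integrable_lebesgue_on_local:
  fixes u h :: "real^'n::finite \<Rightarrow> real"
  assumes \<Omega>: "open \<Omega>" and K: "K \<subseteq> \<Omega>" and u: "integrable lebesgue (\<lambda>x. indicator K x * u x)"
    and h: "h \<in> borel_measurable borel" "\<And>x. \<bar>h x\<bar> \<le> B" "\<And>x. x \<notin> K \<Longrightarrow> h x = 0"
  shows "integrable (lebesgue_on \<Omega>) (\<lambda>x. u x * h x)"
proof -
  have "h \<in> borel_measurable lebesgue" using h(1) by (intro measurable_completion) simp
  then have "integrable lebesgue (\<lambda>x. (indicator K x * u x) * h x)"
    by (intro integrable_mult_bounded[OF u _ h(2)])
  moreover have "(\<lambda>x. (indicator K x * u x) * h x) = (\<lambda>x. indicator \<Omega> x *\<^sub>R (u x * h x))"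
    using h(3) K by (force simp: indicator_def)
  ultimately show ?thesis using \<Omega> by (subst integrable_restrict_space) auto
qed

lemma test_function_integrable:
  fixes f :: "real^'n::finite \<Rightarrow> real"
  assumes \<Omega>: "open \<Omega>" and li: "locally_integrable \<Omega> f" "locally_integrable \<Omega> Df" and \<phi>: "\<phi> \<in> test_functions \<Omega>"
  shows "integrable (lebesgue_on \<Omega>) (\<lambda>x. f x * partial_deriv i \<phi> x)"
    "integrable (lebesgue_on \<Omega>) (\<lambda>x. (Df x $ i) * \<phi> x)"
proof -
  let ?S = "closure {x. \<phi> x \<noteq> 0}"
  have t: "\<And>k. C_diff k \<phi>" "compact ?S" "?S \<subseteq> \<Omega>" using \<phi> by (auto simp: test_functions_def)
  note sc = smooth_compact_support[OF t(1,2)]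
  obtain P where P: "\<And>x. \<bar>\<phi> x\<bar> \<le> P" using sc(5) by blast
  obtain P' where P': "\<And>x. \<bar>partial_deriv i \<phi> x\<bar> \<le> P'" using sc(6) by blast
  have "integrable lebesgue (\<lambda>x. indicator ?S x * f x)"
    using li(1) t by (auto simp: locally_integrable_def set_integrable_def)
  then show "integrable (lebesgue_on \<Omega>) (\<lambda>x. f x * partial_deriv i \<phi> x)"
    by (rule integrable_lebesgue_on_local[OF \<Omega> t(3) _ sc(2) P']) (rule partial_deriv_outside_support)
  show "integrable (lebesgue_on \<Omega>) (\<lambda>x. (Df x $ i) * \<phi> x)"
    by (rule integrable_lebesgue_on_local[OF \<Omega> t(3) locally_integrable_components[OF li(2) t(2,3)] sc(1) P])
      (use closure_subset[of "{x. \<phi> x \<noteq> 0}"] in auto)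
qed

lemma has_weak_gradient_add:
  fixes f g :: "real^'n::finite \<Rightarrow> real"
  assumes \<Omega>: "open \<Omega>" and f: "has_weak_gradient f Df \<Omega>" and g: "has_weak_gradient g Dg \<Omega>"
  shows "has_weak_gradient (\<lambda>x. f x + g x) (\<lambda>x. Df x + Dg x) \<Omega>"
proof -
  have li: "locally_integrable \<Omega> f" "locally_integrable \<Omega> Df" "locally_integrable \<Omega> g" "locally_integrable \<Omega> Dg"
    using f g by (auto simp: has_weak_gradient_def)
  show ?thesis
    unfolding has_weak_gradient_def
  proof (intro conjI ballI allI)
    show "locally_integrable \<Omega> (\<lambda>x. f x + g x)" "locally_integrable \<Omega> (\<lambda>x. Df x + Dg x)"
      using li by (auto simp: locally_integrable_def intro: set_integral_add)
    fix \<phi> i assume \<phi>: "\<phi> \<in> test_functions \<Omega>"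
    note tf = test_function_integrable[OF \<Omega> li(1,2) \<phi>, of i] test_function_integrable[OF \<Omega> li(3,4) \<phi>, of i]
    have "(LINT x|lebesgue_on \<Omega>. f x * partial_deriv i \<phi> x) = - (LINT x|lebesgue_on \<Omega>. Df x $ i * \<phi> x)"
      "(LINT x|lebesgue_on \<Omega>. g x * partial_deriv i \<phi> x) = - (LINT x|lebesgue_on \<Omega>. Dg x $ i * \<phi> x)"
      using f g \<phi> by (auto simp: has_weak_gradient_def)
    then show "(LINT x|lebesgue_on \<Omega>. (f x + g x) * partial_deriv i \<phi> x) = - (LINT x|lebesgue_on \<Omega>. (Df x + Dg x) $ i * \<phi> x)"
      using tf by (simp add: distrib_right)
  qed
qed

lemma has_weak_gradient_cmult:
  fixes f :: "real^'n::finite \<Rightarrow> real"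
  assumes f: "has_weak_gradient f Df \<Omega>"
  shows "has_weak_gradient (\<lambda>x. c * f x) (\<lambda>x. c *\<^sub>R Df x) \<Omega>"
  unfolding has_weak_gradient_def
proof (intro conjI ballI allI)
  show "locally_integrable \<Omega> (\<lambda>x. c * f x)" "locally_integrable \<Omega> (\<lambda>x. c *\<^sub>R Df x)"
    using f by (auto simp: locally_integrable_def has_weak_gradient_def intro: absolutely_integrable_scaleR_left absolutely_integrable_scaleR_right set_integrable_mult_right)
  fix \<phi> i assume "\<phi> \<in> test_functions \<Omega>"
  then have "(LINT x|lebesgue_on \<Omega>. f x * partial_deriv i \<phi> x) = - (LINT x|lebesgue_on \<Omega>. Df x $ i * \<phi> x)"
    using f by (auto simp: has_weak_gradient_def)
  then show "(LINT x|lebesgue_on \<Omega>. c * f x * partial_deriv i \<phi> x) = - (LINT x|lebesgue_on \<Omega>. (c *\<^sub>R Df x) $ i * \<phi> x)"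
    by (simp add: mult.assoc)
qed

lemma has_weak_gradient_0: "has_weak_gradient (\<lambda>x. 0) (\<lambda>x. 0) \<Omega>"
  by (simp add: has_weak_gradient_def locally_integrable_def)

lemma has_weak_gradient_sum:
  fixes f :: "'a \<Rightarrow> real^'n::finite \<Rightarrow> real"
  assumes "open \<Omega>" "finite A" "\<And>j. j \<in> A \<Longrightarrow> has_weak_gradient (f j) (Df j) \<Omega>"
  shows "has_weak_gradient (\<lambda>x. \<Sum>j\<in>A. f j x) (\<lambda>x. \<Sum>j\<in>A. Df j x) \<Omega>"
  using assms(2,3)
  by (induction A rule: finite_induct) (auto intro: has_weak_gradient_0 has_weak_gradient_add[OF assms(1)])

text \<open>For t \<ge> 0 the positive part of |f - c| - t is the sum of those of f - (c + t) and of
  -f - (t - c), whose gradients live on disjoint sets. With the lower inequality strict and the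
  upper one weak, the strips of consecutive levels are disjoint.\<close>

lemma has_weak_gradient_abs_truncation:
  fixes f :: "real^'n::finite \<Rightarrow> real"
  assumes \<Omega>: "open \<Omega>" and f: "has_weak_gradient f Df \<Omega>" and ab: "0 \<le> a" "a \<le> b"
  shows "\<exists>G. has_weak_gradient (\<lambda>x. max 0 (\<bar>f x - c\<bar> - a) - max 0 (\<bar>f x - c\<bar> - b)) G \<Omega> \<and>
    (\<forall>x. norm (G x) = (if a < \<bar>f x - c\<bar> \<and> \<bar>f x - c\<bar> \<le> b then norm (Df x) else 0))"
proof -
  let ?g = "\<lambda>x. -1 * f x" and ?Dg = "\<lambda>x. -1 *\<^sub>R Df x"
  have g: "has_weak_gradient ?g ?Dg \<Omega>" by (rule has_weak_gradient_cmult[OF f])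
  define U where "U t = (\<lambda>x. max 0 (f x - (c + t)) + max 0 (?g x - (t - c)))" for t
  define DU where "DU t = (\<lambda>x. (if c + t < f x then Df x else 0) + (if t - c < ?g x then ?Dg x else 0))" for t
  have U: "has_weak_gradient (U t) (DU t) \<Omega>" for t
    unfolding U_def DU_def by (intro has_weak_gradient_add has_weak_gradient_pos_part \<Omega> f g)
  have "has_weak_gradient (\<lambda>x. U a x + -1 * U b x) (\<lambda>x. DU a x + -1 *\<^sub>R DU b x) \<Omega>"
    by (intro has_weak_gradient_add has_weak_gradient_cmult \<Omega> U)
  moreover have "(\<lambda>x. U a x + -1 * U b x) = (\<lambda>x. max 0 (\<bar>f x - c\<bar> - a) - max 0 (\<bar>f x - c\<bar> - b))"
    using ab by (intro ext) (auto simp: U_def max_def abs_if)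
  moreover have "norm (DU a x + -1 *\<^sub>R DU b x) = (if a < \<bar>f x - c\<bar> \<and> \<bar>f x - c\<bar> \<le> b then norm (Df x) else 0)" for x
  proof -
    consider "c + b < f x" | "c + a < f x" "f x \<le> c + b" | "c - a \<le> f x" "f x \<le> c + a" | "c - b \<le> f x" "f x < c - a" | "f x < c - b"
      by linarith
    then show ?thesis using ab by cases (auto simp: DU_def abs_if)
  qed
  ultimately show ?thesis by (intro exI[of _ "\<lambda>x. DU a x + -1 *\<^sub>R DU b x"] conjI allI) simp_all
qed

lemma locally_integrable_continuous:
  fixes f :: "real^'n::finite \<Rightarrow> 'b::euclidean_space"
  assumes "continuous_on UNIV f"
  shows "locally_integrable \<Omega> f"
  unfolding locally_integrable_def
proof (intro allI impI)
  fix K assume "compact K \<and> K \<subseteq> \<Omega>"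
  then have "integrable lborel (\<lambda>x. indicator K x *\<^sub>R f x)"
    by (intro borel_integrable_compact continuous_on_subset[OF assms]) auto
  then have "integrable lebesgue (\<lambda>x. indicator K x *\<^sub>R f x)"
    by (subst integrable_completion) auto
  then show "f absolutely_integrable_on K" by (simp add: set_integrable_def)
qed

text \<open>Integration by parts: the directional derivative of the compactly supported product of p
  and \<phi> has integral 0.\<close>

lemma has_weak_gradient_classical:
  fixes p :: "real^'n::finite \<Rightarrow> real"
  assumes \<Omega>: "open \<Omega>" and p: "continuous_on UNIV p" and Dp: "continuous_on UNIV Dp"
    and deriv: "\<And>x i. ((\<lambda>t. p (x + t *\<^sub>R axis i 1)) has_real_derivative Dp x $ i) (at 0)"
  shows "has_weak_gradient p Dp \<Omega>"
  unfolding has_weak_gradient_def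
proof (intro conjI ballI allI)
  show "locally_integrable \<Omega> p" "locally_integrable \<Omega> Dp"
    using p Dp by (auto intro: locally_integrable_continuous)
  fix \<phi> i assume "\<phi> \<in> test_functions \<Omega>"
  then have \<phi>: "\<And>k. C_diff k \<phi>" "compact (closure {x. \<phi> x \<noteq> 0})" "closure {x. \<phi> x \<noteq> 0} \<subseteq> \<Omega>"
    by (auto simp: test_functions_def)
  let ?S = "closure {x. \<phi> x \<noteq> 0}"
  have cont: "continuous_on UNIV \<phi>" "continuous_on UNIV (partial_deriv i \<phi>)" using \<phi>(1)[of 0] \<phi>(1)[of 1] by auto
  have cDi: "continuous_on UNIV (\<lambda>x. Dp x $ i)" using Dp by (intro continuous_intros)
  have \<phi>0: "\<phi> x = 0" if "x \<notin> ?S" for x using that closure_subset[of "{x. \<phi> x \<noteq> 0}"] by auto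
  have \<phi>'0: "partial_deriv i \<phi> x = 0" if "x \<notin> ?S" for x using that by (rule partial_deriv_outside_support)
  obtain R where R: "\<And>x. x \<in> ?S \<Longrightarrow> norm x \<le> R" using compact_imp_bounded[OF \<phi>(2)] by (auto simp: bounded_iff)
  have c1: "continuous_on UNIV (\<lambda>x. p x * partial_deriv i \<phi> x)" "continuous_on UNIV (\<lambda>x. Dp x $ i * \<phi> x)"
    using p cont cDi by (auto intro: continuous_intros)
  have z: "R < norm x \<Longrightarrow> p x * partial_deriv i \<phi> x = 0" "R < norm x \<Longrightarrow> Dp x $ i * \<phi> x = 0" for x
    using R[of x] \<phi>0[of x] \<phi>'0[of x] by force+
  note int = continuous_compact_support(1)[OF c1(1) z(1)] continuous_compact_support(1)[OF c1(2) z(2)]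
  obtain B1 where B1: "\<And>x. \<bar>p x * partial_deriv i \<phi> x\<bar> \<le> B1" using continuous_compact_support(2)[OF c1(1) z(1)] by blast
  obtain B2 where B2: "\<And>x. \<bar>Dp x $ i * \<phi> x\<bar> \<le> B2" using continuous_compact_support(2)[OF c1(2) z(2)] by blast
  have "(\<integral>x. p x * partial_deriv i \<phi> x + Dp x $ i * \<phi> x \<partial>lborel) = 0"
  proof (rule integral_directional_derivative_eq_0[where F = "\<lambda>x. p x * \<phi> x" and S = ?S and e = "axis i 1" and B = "B1 + B2"])
    show "(\<lambda>x. p x * \<phi> x) \<in> borel_measurable borel"
      using p cont by (intro borel_measurable_continuous_onI continuous_intros)
    show "bounded ?S" by (rule compact_imp_bounded[OF \<phi>(2)])
    show "((\<lambda>t. p (x + t *\<^sub>R axis i 1) * \<phi> (x + t *\<^sub>R axis i 1)) has_real_derivative p x * partial_deriv i \<phi> x + Dp x $ i * \<phi> x) (at 0)" for x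
    proof -
      have "((\<lambda>t. \<phi> (x + t *\<^sub>R axis i 1)) has_real_derivative partial_deriv i \<phi> x) (at 0)"
        using partial_deriv_line[of \<phi> x 1 i 0] \<phi>(1)[of 1] by simp
      from DERIV_mult[OF deriv[of x i] this] show ?thesis by (simp add: algebra_simps)
    qed
    show "\<bar>p x * partial_deriv i \<phi> x + Dp x $ i * \<phi> x\<bar> \<le> B1 + B2" for x using B1[of x] B2[of x] by linarith
    show "p x * \<phi> x = 0" if "x \<notin> ?S" for x using \<phi>0[OF that] by simp
  qed
  then have eq: "(\<integral>x. p x * partial_deriv i \<phi> x \<partial>lborel) = - (\<integral>x. Dp x $ i * \<phi> x \<partial>lborel)" using int by simp
  have \<Omega>l: "\<Omega> \<in> sets lebesgue" using \<Omega> by auto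
  have "(LINT x|lebesgue_on \<Omega>. p x * partial_deriv i \<phi> x) = (LINT x|lborel. p x * partial_deriv i \<phi> x)"
  proof (rule lebesgue_on_integral_eq_lebesgue[OF \<Omega>l borel_measurable_continuous_onI[OF c1(1)]], rule AE_I2)
    fix x
    show "indicator \<Omega> x * (p x * partial_deriv i \<phi> x) = p x * partial_deriv i \<phi> x"
    proof (cases "x \<in> ?S")
      case True
      then show ?thesis using \<phi>(3) by auto
    next
      case False
      then show ?thesis using \<phi>'0[of x] by simp
    qed
  qed
  moreover have "(LINT x|lebesgue_on \<Omega>. Dp x $ i * \<phi> x) = (LINT x|lborel. Dp x $ i * \<phi> x)"
  proof (rule lebesgue_on_integral_eq_lebesgue[OF \<Omega>l borel_measurable_continuous_onI[OF c1(2)]], rule AE_I2)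
    fix x
    show "indicator \<Omega> x * (Dp x $ i * \<phi> x) = Dp x $ i * \<phi> x"
    proof (cases "x \<in> ?S")
      case True
      then show ?thesis using \<phi>(3) by auto
    next
      case False
      then show ?thesis using \<phi>0[of x] by simp
    qed
  qed
  ultimately show "(LINT x|lebesgue_on \<Omega>. p x * partial_deriv i \<phi> x) = - (LINT x|lebesgue_on \<Omega>. Dp x $ i * \<phi> x)"
    using eq by simp
qed

section \<open>The Hardy operator and the oscillation of the rearrangement\<close>

lemma bfn_L1:
  assumes "banach_function_norm M \<rho>" "emeasure M (space M) < \<infinity>"
  obtains c :: real where "0 < c" "\<And>f. f \<in> borel_measurable M \<Longrightarrow> (\<integral>\<^sup>+x. f x \<partial>M) \<le> ennreal c * \<rho> f"
proof -
  obtain C :: real where C: "\<And>f. f \<in> borel_measurable M \<Longrightarrow> (\<integral>\<^sup>+x\<in>space M. f x \<partial>M) \<le> ennreal C * \<rho> f"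
    using assms sets.top[of M] unfolding banach_function_norm_def by metis
  have "(\<integral>\<^sup>+x. f x \<partial>M) \<le> ennreal (max C 1) * \<rho> f" if "f \<in> borel_measurable M" for f
  proof -
    have "(\<integral>\<^sup>+x. f x \<partial>M) = (\<integral>\<^sup>+x\<in>space M. f x \<partial>M)" by (intro nn_integral_cong) auto
    also have "\<dots> \<le> ennreal C * \<rho> f" by (rule C[OF that])
    also have "\<dots> \<le> ennreal (max C 1) * \<rho> f" by (intro mult_right_mono ennreal_leI) auto
    finally show ?thesis .
  qed
  then show thesis by (intro that[of "max C 1"]) auto
qed

lemma bfn_finite_AE:
  assumes "banach_function_norm M \<rho>" "emeasure M (space M) < \<infinity>" "f \<in> borel_measurable M" "\<rho> f < \<infinity>"
  shows "AE x in M. f x < \<infinity>"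
proof -
  obtain c :: real where c: "0 < c" "(\<integral>\<^sup>+x. f x \<partial>M) \<le> ennreal c * \<rho> f" using bfn_L1[OF assms(1,2)] assms(3) by metis
  have "ennreal c * \<rho> f < \<infinity>" using assms(4) by (simp add: ennreal_mult_less_top)
  with c have "(\<integral>\<^sup>+x. f x \<partial>M) \<noteq> \<infinity>" by auto
  then show ?thesis using nn_integral_noteq_infinite[OF assms(3)] by (auto simp: less_top)
qed

lemma bfn_one_finite:
  assumes "banach_function_norm M \<rho>" "emeasure M (space M) < \<infinity>"
  shows "\<rho> (\<lambda>x. 1) < \<infinity>"
proof -
  have "\<rho> (\<lambda>x. 1) = \<rho> (indicator (space M))"
    by (rule bfn_cong_AE[OF assms(1)]) auto
  also have "\<dots> < \<infinity>" using assms unfolding banach_function_norm_def by blast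
  finally show ?thesis .
qed

lemma ri_rearr:
  assumes "ri_norm I01 \<rho>" "f \<in> borel_measurable I01" "AE x in I01. f x < \<infinity>"
  shows "\<rho> (rearr I01 f) = \<rho> f"
proof (rule ri_equimeasurable[OF assms(1) _ assms(2) _ assms(3)])
  have p: "emeasure I01 (space I01) = 1" by simp
  show "rearr I01 f \<in> borel_measurable I01" by (rule rearr_measurable_I01[OF assms(2) p assms(3)])
  show "AE x in I01. rearr I01 f x < \<infinity>" by (intro AE_I01_I rearr_finite[OF assms(2) p assms(3)])
  show "distr_fun I01 (rearr I01 f) l = distr_fun I01 f l" for l by (rule distr_fun_I01_rearr[OF assms(2) p])
qed

section \<open>Kernel operators on the unit interval\<close>

lemma borel_pair_I01:
  assumes "K \<in> borel_measurable (borel \<Otimes>\<^sub>M borel)"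
  shows "K \<in> borel_measurable (I01 \<Otimes>\<^sub>M I01)"
proof -
  have id: "(\<lambda>x. x) \<in> measurable I01 borel" by (intro borel_measurable_I01) simp
  have "(\<lambda>p. (fst p, snd p)) \<in> measurable (I01 \<Otimes>\<^sub>M I01) (borel \<Otimes>\<^sub>M borel)"
    by (intro measurable_Pair measurable_compose[OF measurable_fst id] measurable_compose[OF measurable_snd id])
  then show ?thesis using measurable_compose[OF _ assms] by simp
qed

lemma finite_measure_I01: "finite_measure I01"
  by (rule finite_measureI) simp

lemma kernel_measurable_I01:
  fixes K :: "real \<Rightarrow> real \<Rightarrow> ennreal"
  assumes K: "case_prod K \<in> borel_measurable (borel \<Otimes>\<^sub>M borel)" and k: "k \<in> borel_measurable I01"
  shows "(\<lambda>(x, s). K x s * k s) \<in> borel_measurable (I01 \<Otimes>\<^sub>M I01)"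
proof -
  have "(\<lambda>p. K (fst p) (snd p)) \<in> borel_measurable (I01 \<Otimes>\<^sub>M I01)"
    using borel_pair_I01[OF K] by (simp add: case_prod_beta')
  then have "(\<lambda>p. K (fst p) (snd p) * k (snd p)) \<in> borel_measurable (I01 \<Otimes>\<^sub>M I01)"
    by (rule borel_measurable_times_ennreal) (rule measurable_compose[OF measurable_snd k])
  then show ?thesis by (simp add: case_prod_beta')
qed

lemma kernel_integral_measurable_I01:
  fixes K :: "real \<Rightarrow> real \<Rightarrow> ennreal"
  assumes "case_prod K \<in> borel_measurable (borel \<Otimes>\<^sub>M borel)" "k \<in> borel_measurable I01"
  shows "(\<lambda>x. \<integral>\<^sup>+s. K x s * k s \<partial>I01) \<in> borel_measurable I01"
proof -
  interpret finite_measure I01 by (rule finite_measure_I01)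
  show ?thesis using kernel_measurable_I01[OF assms] by (rule borel_measurable_nn_integral)
qed

lemma Tonelli_I01:
  fixes K :: "real \<Rightarrow> real \<Rightarrow> ennreal"
  assumes K: "case_prod K \<in> borel_measurable (borel \<Otimes>\<^sub>M borel)" and k: "k \<in> borel_measurable I01"
  shows "(\<integral>\<^sup>+x. (\<integral>\<^sup>+s. K x s * k s \<partial>I01) \<partial>I01) = (\<integral>\<^sup>+s. (\<integral>\<^sup>+x. K x s \<partial>I01) * k s \<partial>I01)"
proof -
  interpret finite_measure I01 by (rule finite_measure_I01)
  interpret pair_sigma_finite I01 I01 by unfold_locales
  note m = kernel_measurable_I01[OF K k]
  have "(\<integral>\<^sup>+x. (\<integral>\<^sup>+s. K x s * k s \<partial>I01) \<partial>I01) = (\<integral>\<^sup>+s. (\<integral>\<^sup>+x. K x s * k s \<partial>I01) \<partial>I01)"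
    using Fubini'[OF m] by simp
  also have "\<dots> = (\<integral>\<^sup>+s. (\<integral>\<^sup>+x. K x s \<partial>I01) * k s \<partial>I01)"
  proof (intro nn_integral_cong nn_integral_multc)
    fix s
    have "(\<lambda>x. K x s) \<in> borel_measurable borel" using K by measurable
    then show "(\<lambda>x. K x s) \<in> borel_measurable I01" by (rule borel_measurable_I01)
  qed
  finally show ?thesis .
qed

lemma nn_integral_I01_Ioo:
  assumes "0 \<le> t"
  shows "(\<integral>\<^sup>+s\<in>{t<..<1}. u s \<partial>lebesgue) = (\<integral>\<^sup>+s. u s * indicator {t<..} s \<partial>I01)"
  using assms by (subst nn_integral_restrict_space) (auto intro!: nn_integral_cong simp: indicator_def)

lemma nn_integral_I01_Ioo':
  assumes "t \<le> 1"
  shows "(\<integral>\<^sup>+s\<in>{0<..<t}. u s \<partial>lebesgue) = (\<integral>\<^sup>+s. u s * indicator {..<t} s \<partial>I01)"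
  using assms by (subst nn_integral_restrict_space) (auto intro!: nn_integral_cong simp: indicator_def)

lemma nn_integral_I01_borel:
  assumes "u \<in> borel_measurable borel"
  shows "(\<integral>\<^sup>+s. u s \<partial>I01) = (\<integral>\<^sup>+s. u s * indicator {0<..<1} s \<partial>lborel)"
  by (subst nn_integral_restrict_space) (auto simp: nn_integral_completion)

lemma nn_integral_I01_FTC:
  fixes F f :: "real \<Rightarrow> real"
  assumes m: "0 < m" "m \<le> 1" and [measurable]: "f \<in> borel_measurable borel"
    and F: "\<And>x. m \<le> x \<Longrightarrow> x \<le> 1 \<Longrightarrow> (F has_real_derivative f x) (at x)" "\<And>x. m \<le> x \<Longrightarrow> x \<le> 1 \<Longrightarrow> 0 \<le> f x"
  shows "(\<integral>\<^sup>+s. ennreal (f s) * indicator {m<..} s \<partial>I01) = ennreal (F 1 - F m)"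
proof -
  have "(\<integral>\<^sup>+s. ennreal (f s) * indicator {m<..} s \<partial>I01) = (\<integral>\<^sup>+s. ennreal (f s) * indicator {m<..} s * indicator {0<..<1} s \<partial>lborel)"
    by (rule nn_integral_I01_borel) measurable
  also have "\<dots> = (\<integral>\<^sup>+s. ennreal (f s) * indicator {m..1} s \<partial>lborel)"
  proof (rule nn_integral_cong_AE)
    show "AE s in lborel. ennreal (f s) * indicator {m<..} s * indicator {0<..<1} s = ennreal (f s) * indicator {m..1} s"
      using AE_lborel_singleton[of m] AE_lborel_singleton[of 1]
      by eventually_elim (use m in \<open>auto simp: indicator_def\<close>)
  qed
  also have "\<dots> = ennreal (F 1 - F m)"
    using F m by (intro nn_integral_FTC_Icc) auto
  finally show ?thesis .
qed

text \<open>The operator Q of (ii), with \<alpha> in the role of 1/n and extended nonnegative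
  arguments; the exponent \<alpha> - 1 absorbs the factor 1/s of the measure ds/s.\<close>

definition hardy :: "real \<Rightarrow> (real \<Rightarrow> ennreal) \<Rightarrow> real \<Rightarrow> ennreal" where
  "hardy \<alpha> k t = (\<integral>\<^sup>+s. ennreal (s powr (\<alpha> - 1)) * indicator {t<..} s * k s \<partial>I01)"

lemma hardy_measurable:
  assumes "k \<in> borel_measurable I01"
  shows "hardy \<alpha> k \<in> borel_measurable I01"
proof -
  have "(\<lambda>(t, s). ennreal (s powr (\<alpha> - 1)) * indicator {t<..} s) \<in> borel_measurable (borel \<Otimes>\<^sub>M borel)"
    unfolding indicator_def of_bool_def greaterThan_iff by measurable
  from kernel_integral_measurable_I01[OF this assms] show ?thesis by (simp add: hardy_def[abs_def])
qed

lemma hardy_cong_AE: "AE s in I01. k s = k' s \<Longrightarrow> hardy \<alpha> k t = hardy \<alpha> k' t"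
  unfolding hardy_def by (intro nn_integral_cong_AE) auto

lemma hardy_antimono: "s \<le> t \<Longrightarrow> hardy \<alpha> k t \<le> hardy \<alpha> k s"
  unfolding hardy_def by (intro nn_integral_mono mult_right_mono mult_left_mono) (auto simp: indicator_def)

lemma hardy_eq:
  assumes "0 < t" "\<And>s. 0 < s \<Longrightarrow> s < 1 \<Longrightarrow> 0 \<le> f s"
  shows "(\<integral>\<^sup>+ s \<in> {t<..<1}. ennreal (s powr \<alpha> * f s / s) \<partial>lebesgue) = hardy \<alpha> (\<lambda>s. ennreal (f s)) t"
proof -
  have "(\<integral>\<^sup>+ s \<in> {t<..<1}. ennreal (s powr \<alpha> * f s / s) \<partial>lebesgue) = (\<integral>\<^sup>+ s. ennreal (s powr \<alpha> * f s / s) * indicator {t<..} s \<partial>I01)"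
    using assms by (intro nn_integral_I01_Ioo) auto
  also have "\<dots> = hardy \<alpha> (\<lambda>s. ennreal (f s)) t"
    unfolding hardy_def
  proof (intro nn_integral_cong)
    fix s assume "s \<in> space I01"
    then have s: "0 < s" "s < 1" by auto
    have "s powr \<alpha> * f s / s = s powr (\<alpha> - 1) * f s" using s by (simp add: powr_diff)
    then show "ennreal (s powr \<alpha> * f s / s) * indicator {t<..} s = ennreal (s powr (\<alpha> - 1)) * indicator {t<..} s * ennreal (f s)"
      using assms(2)[OF s] by (simp add: ennreal_mult mult_ac)
  qed
  finally show ?thesis .
qed

definition hardy_bounded :: "real \<Rightarrow> real fun_norm \<Rightarrow> real fun_norm \<Rightarrow> bool" where
  "hardy_bounded \<alpha> \<rho>X \<rho>Y \<longleftrightarrow> (\<exists>C::real. 0 < C \<and> (\<forall>k \<in> borel_measurable I01. \<rho>Y (hardy \<alpha> k) \<le> ennreal C * \<rho>X k))"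

text \<open>Connects the form with extended-valued functions, which is the convenient one, with (ii)
  for real functions. A finite norm forces finiteness almost everywhere, so such a function has a
  real version; an infinite norm makes the bound trivial.\<close>

lemma hardy_bounded_iff:
  assumes X: "ri_norm I01 \<rho>X" and Y: "ri_norm I01 \<rho>Y"
  shows "hardy_bounded \<alpha> \<rho>X \<rho>Y \<longleftrightarrow> (\<exists>C::real. C > 0 \<and> (\<forall>f \<in> fspace I01 \<rho>X. (\<forall>s \<in> {0<..<1}. 0 \<le> f s) \<longrightarrow>
            \<rho>Y (\<lambda>t. \<integral>\<^sup>+ s \<in> {t<..<1}. ennreal (s powr \<alpha> * f s / s) \<partial>lebesgue)
              \<le> ennreal C * fnorm \<rho>X f))" (is "_ \<longleftrightarrow> (\<exists>C. C > 0 \<and> ?P C)")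
proof -
  note bX = ri_bfn[OF X] and bY = ri_bfn[OF Y]
  have fin: "emeasure I01 (space I01) < \<infinity>" by simp
  have eqY: "\<rho>Y (\<lambda>t. \<integral>\<^sup>+ s \<in> {t<..<1}. ennreal (s powr \<alpha> * f s / s) \<partial>lebesgue) = \<rho>Y (hardy \<alpha> (\<lambda>s. ennreal (f s)))"
    if f: "f \<in> borel_measurable I01" "\<forall>s \<in> {0<..<1}. 0 \<le> f s" for f
  proof (rule bfn_cong_AE[OF bY])
    have [measurable]: "(\<lambda>s. ennreal (f s)) \<in> borel_measurable I01" using f by measurable
    show H: "hardy \<alpha> (\<lambda>s. ennreal (f s)) \<in> borel_measurable I01" by (rule hardy_measurable) measurable
    have eq: "(\<integral>\<^sup>+ s \<in> {t<..<1}. ennreal (s powr \<alpha> * f s / s) \<partial>lebesgue) = hardy \<alpha> (\<lambda>s. ennreal (f s)) t" if "t \<in> space I01" for t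
      using that f(2) by (intro hardy_eq) auto
    then show "AE t in I01. (\<integral>\<^sup>+ s \<in> {t<..<1}. ennreal (s powr \<alpha> * f s / s) \<partial>lebesgue) = hardy \<alpha> (\<lambda>s. ennreal (f s)) t"
      by (intro AE_I2)
    show "(\<lambda>t. \<integral>\<^sup>+ s \<in> {t<..<1}. ennreal (s powr \<alpha> * f s / s) \<partial>lebesgue) \<in> borel_measurable I01"
      using H eq by (subst measurable_cong[where g = "hardy \<alpha> (\<lambda>s. ennreal (f s))"]) auto
  qed
  have eqX: "fnorm \<rho>X f = \<rho>X (\<lambda>s. ennreal (f s))" if f: "f \<in> borel_measurable I01" "\<forall>s \<in> {0<..<1}. 0 \<le> f s" for f
    unfolding fnorm_def
  proof (rule bfn_cong_AE[OF bX])
    show "(\<lambda>s. ennreal (f s)) \<in> borel_measurable I01" "(\<lambda>s. ennreal \<bar>f s\<bar>) \<in> borel_measurable I01" using f by measurable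
    show "AE s in I01. ennreal \<bar>f s\<bar> = ennreal (f s)" by (rule AE_I01_I) (use f(2) in auto)
  qed
  show ?thesis
  proof
    assume "hardy_bounded \<alpha> \<rho>X \<rho>Y"
    then obtain C :: real where C: "0 < C" "\<And>k. k \<in> borel_measurable I01 \<Longrightarrow> \<rho>Y (hardy \<alpha> k) \<le> ennreal C * \<rho>X k"
      by (auto simp: hardy_bounded_def)
    have "?P C"
    proof (intro ballI impI)
      fix f assume f: "f \<in> fspace I01 \<rho>X" "\<forall>s \<in> {0<..<1}. 0 \<le> f s"
      then have m: "f \<in> borel_measurable I01" by (simp add: fspace_def)
      then have "(\<lambda>s. ennreal (f s)) \<in> borel_measurable I01" by measurable
      from C(2)[OF this] show "\<rho>Y (\<lambda>t. \<integral>\<^sup>+ s \<in> {t<..<1}. ennreal (s powr \<alpha> * f s / s) \<partial>lebesgue) \<le> ennreal C * fnorm \<rho>X f"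
        by (simp only: eqY[OF m f(2)] eqX[OF m f(2)])
    qed
    with C(1) show "\<exists>C>0. ?P C" by blast
  next
    assume "\<exists>C>0. ?P C"
    then obtain C where C: "0 < C" "?P C" by blast
    have "\<rho>Y (hardy \<alpha> k) \<le> ennreal C * \<rho>X k" if k: "k \<in> borel_measurable I01" for k
    proof (cases "\<rho>X k < \<infinity>")
      case True
      define f where "f s = enn2real (k s)" for s
      have m: "f \<in> borel_measurable I01" unfolding f_def[abs_def] using k by measurable
      have nn: "\<forall>s \<in> {0<..<1}. 0 \<le> f s" by (simp add: f_def)
      have ae: "AE s in I01. ennreal (f s) = k s"
        using bfn_finite_AE[OF bX fin k True] by eventually_elim (simp add: f_def less_top)
      have mf: "(\<lambda>s. ennreal (f s)) \<in> borel_measurable I01" using m by measurable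
      have eq: "\<rho>X (\<lambda>s. ennreal (f s)) = \<rho>X k" by (rule bfn_cong_AE[OF bX k mf ae])
      then have "f \<in> fspace I01 \<rho>X" using True m eqX[OF m nn] by (simp add: fspace_def)
      then have "\<rho>Y (hardy \<alpha> (\<lambda>s. ennreal (f s))) \<le> ennreal C * fnorm \<rho>X f"
        using C(2) nn eqY[OF m nn] by force
      moreover have "hardy \<alpha> (\<lambda>s. ennreal (f s)) = hardy \<alpha> k" by (rule ext, rule hardy_cong_AE[OF ae])
      ultimately show ?thesis by (simp add: eqX[OF m nn] eq)
    next
      case False
      then show ?thesis using C(1) by (simp add: less_top[symmetric] ennreal_mult_eq_top_iff)
    qed
    then show "hardy_bounded \<alpha> \<rho>X \<rho>Y" using C(1) by (auto simp: hardy_bounded_def)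
  qed
qed

text \<open>The integrated form of the derivative formula for f**. With \<phi> = f* and \<Phi> its
  primitive, Tonelli turns the integral of \<Phi>/s^2 over (t,1) into that of (1/max(r,t) - 1)
  \<phi>(r) over (0,1). Adding the integral of \<phi> gives at least \<phi>(t) + B, where B is the
  integral of \<phi>/s over (t,1). Subtracting B leaves the Hardy operator of the
  oscillation.\<close>

lemma hardy_dominates_rearr:
  assumes f: "f \<in> borel_measurable M" "emeasure M (space M) = 1" "AE x in M. f x < \<infinity>"
    and int: "(\<integral>\<^sup>+x. f x \<partial>M) < \<infinity>" and t: "0 < t" "t < 1"
  shows "rearr M f t \<le> hardy \<alpha> (\<lambda>s. ennreal (s powr (- \<alpha>)) * (max_rearr M f s - rearr M f s)) t + (\<integral>\<^sup>+x. f x \<partial>M)"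
proof -
  define \<phi> where "\<phi> = rearr M f"
  define \<Phi> where "\<Phi> s = (\<integral>\<^sup>+r. \<phi> r * indicator {..<s} r \<partial>I01)" for s
  have [measurable]: "\<phi> \<in> borel_measurable I01" unfolding \<phi>_def by (rule rearr_measurable_I01[OF f])
  have mb: "(\<lambda>s. u s) \<in> borel_measurable I01" if "u \<in> borel_measurable borel" for u :: "real \<Rightarrow> ennreal"
    using that by (rule borel_measurable_I01)
  have [measurable]: "(\<lambda>s. ennreal (1 / s)) \<in> borel_measurable I01" "(\<lambda>s. indicator {t<..} s :: ennreal) \<in> borel_measurable I01"
    "(\<lambda>s. indicator {..t} s :: ennreal) \<in> borel_measurable I01" "(\<lambda>s. ennreal (1 / max s t)) \<in> borel_measurable I01"
    "(\<lambda>s. ennreal (1 / max s t - 1)) \<in> borel_measurable I01"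
    by (intro borel_measurable_I01; measurable)+
  have \<Phi>_eq: "\<Phi> s = (\<integral>\<^sup>+r. indicator {..<s} r * \<phi> r \<partial>I01)" for s by (simp add: \<Phi>_def mult.commute)
  have "(\<lambda>(s :: real, r). indicator {..<s} r :: ennreal) \<in> borel_measurable (borel \<Otimes>\<^sub>M borel)"
    unfolding indicator_def of_bool_def lessThan_iff by measurable
  from kernel_integral_measurable_I01[OF this] have \<Phi>_meas [measurable]: "\<Phi> \<in> borel_measurable I01"
    unfolding \<Phi>_eq[abs_def] by simp
  have F: "(\<integral>\<^sup>+r. \<phi> r \<partial>I01) = (\<integral>\<^sup>+x. f x \<partial>M)"
    unfolding \<phi>_def using nn_integral_rearr[OF f(1) _ f(2), of "\<lambda>x. x"] by simp
  have mr: "max_rearr M f s = \<Phi> s / ennreal s" if "s \<le> 1" for s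
    unfolding max_rearr_def \<Phi>_def \<phi>_def using that by (subst nn_integral_I01_Ioo') auto
  define A where "A = hardy \<alpha> (\<lambda>s. ennreal (s powr (- \<alpha>)) * (max_rearr M f s - rearr M f s)) t"
  define B where "B = (\<integral>\<^sup>+s. ennreal (1 / s) * indicator {t<..} s * \<phi> s \<partial>I01)"
  have A_eq: "A = (\<integral>\<^sup>+s. ennreal (1 / s) * indicator {t<..} s * (\<Phi> s / ennreal s - \<phi> s) \<partial>I01)"
    unfolding A_def hardy_def
  proof (intro nn_integral_cong)
    fix s assume "s \<in> space I01"
    then have s: "0 < s" "s < 1" by auto
    have "s powr (\<alpha> - 1) * s powr (- \<alpha>) = s powr ((\<alpha> - 1) + (- \<alpha>))" by (rule powr_add[symmetric])
    also have "\<dots> = 1 / s" using s by (simp add: powr_minus_divide)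
    finally have "s powr (\<alpha> - 1) * s powr (- \<alpha>) = 1 / s" .
    then have "ennreal (s powr (\<alpha> - 1)) * ennreal (s powr (- \<alpha>)) = ennreal (1 / s)" by (simp flip: ennreal_mult)
    moreover have "ennreal (s powr (\<alpha> - 1)) * indicator {t<..} s * (ennreal (s powr (- \<alpha>)) * (max_rearr M f s - rearr M f s)) =
      (ennreal (s powr (\<alpha> - 1)) * ennreal (s powr (- \<alpha>))) * indicator {t<..} s * (max_rearr M f s - rearr M f s)"
      by (simp add: mult_ac)
    ultimately show "ennreal (s powr (\<alpha> - 1)) * indicator {t<..} s * (ennreal (s powr (- \<alpha>)) * (max_rearr M f s - rearr M f s)) =
       ennreal (1 / s) * indicator {t<..} s * (\<Phi> s / ennreal s - \<phi> s)"
      using s by (simp add: mr \<phi>_def)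
  qed
  \<comment> \<open>Finiteness of B, from t > 0 and the integrability of f, permits its cancellation
    at the end.\<close>
  have Bfin: "B < \<infinity>"
  proof -
    have "B \<le> (\<integral>\<^sup>+s. ennreal (1 / t) * \<phi> s \<partial>I01)"
      unfolding B_def using t by (intro nn_integral_mono mult_right_mono) (auto simp: indicator_def intro!: ennreal_leI divide_left_mono)
    also have "\<dots> = ennreal (1 / t) * (\<integral>\<^sup>+x. f x \<partial>M)" by (simp add: nn_integral_cmult F)
    also have "\<dots> < \<infinity>" using int by (simp add: ennreal_mult_less_top)
    finally show ?thesis .
  qed
  let ?K = "\<lambda>s r. ennreal (1 / s\<^sup>2) * indicator {t<..} s * indicator {..<s} r :: ennreal"
  have K: "case_prod ?K \<in> borel_measurable (borel \<Otimes>\<^sub>M borel)"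
    unfolding indicator_def of_bool_def lessThan_iff greaterThan_iff by measurable
  have inner: "(\<integral>\<^sup>+s. ?K s r \<partial>I01) = ennreal (1 / max r t - 1)" if r: "r < 1" for r
  proof -
    let ?m = "max r t"
    have "(\<integral>\<^sup>+s. ?K s r \<partial>I01) = (\<integral>\<^sup>+s. ennreal (1 / s\<^sup>2) * indicator {?m<..} s \<partial>I01)"
      by (intro nn_integral_cong) (auto simp: indicator_def)
    also have "\<dots> = ennreal (- (1 / 1) - - (1 / ?m))"
      by (rule nn_integral_I01_FTC[where F = "\<lambda>s. - (1 / s)"])
        (use r t in \<open>auto intro!: derivative_eq_intros simp: power2_eq_square\<close>)
    finally show ?thesis by simp
  qed
  \<comment> \<open>Since f* is decreasing, its mean over (0,t] is at least its value at t; on (t,1)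
    the weight 1/max(r,t) reproduces B.\<close>
  have "rearr M f t + B \<le> (\<integral>\<^sup>+r. ennreal (1 / max r t) * \<phi> r \<partial>I01)"
  proof -
    have "rearr M f t = (\<integral>\<^sup>+r. \<phi> t * ennreal (1 / t) * indicator {0<..t} r \<partial>I01)"
      using nn_integral_I01_const_Ioc[of t "\<phi> t * ennreal (1 / t)"] t
      by (simp add: \<phi>_def mult.assoc flip: ennreal_mult)
    also have "\<dots> \<le> (\<integral>\<^sup>+r. ennreal (1 / max r t) * indicator {..t} r * \<phi> r \<partial>I01)"
    proof (intro nn_integral_mono)
      fix r
      show "\<phi> t * ennreal (1 / t) * indicator {0<..t} r \<le> ennreal (1 / max r t) * indicator {..t} r * \<phi> r"
        using rearr_antimono[of r t M f] by (auto simp: indicator_def \<phi>_def max_def mult.commute intro: mult_left_mono mult_right_mono)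
    qed
    finally have "rearr M f t + B \<le> (\<integral>\<^sup>+r. ennreal (1 / max r t) * indicator {..t} r * \<phi> r \<partial>I01) + B" by (rule add_right_mono)
    also have "\<dots> = (\<integral>\<^sup>+r. ennreal (1 / max r t) * indicator {..t} r * \<phi> r + ennreal (1 / r) * indicator {t<..} r * \<phi> r \<partial>I01)"
      unfolding B_def by (rule nn_integral_add[symmetric]) measurable
    also have "\<dots> = (\<integral>\<^sup>+r. ennreal (1 / max r t) * \<phi> r \<partial>I01)"
      by (intro nn_integral_cong) (auto simp: indicator_def)
    finally show ?thesis .
  qed
  also have "\<dots> = (\<integral>\<^sup>+r. ennreal (1 / max r t - 1) * \<phi> r + \<phi> r \<partial>I01)"
  proof (intro nn_integral_cong)
    fix r assume "r \<in> space I01"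
    then have "ennreal (1 / max r t) = ennreal (1 / max r t - 1) + 1"
      using t by (subst ennreal_1[symmetric], subst ennreal_plus[symmetric]) (auto simp: max_def)
    then show "ennreal (1 / max r t) * \<phi> r = ennreal (1 / max r t - 1) * \<phi> r + \<phi> r" by (simp add: distrib_right)
  qed
  also have "\<dots> = (\<integral>\<^sup>+r. ennreal (1 / max r t - 1) * \<phi> r \<partial>I01) + (\<integral>\<^sup>+x. f x \<partial>M)"
    by (simp add: nn_integral_add F)
  also have "(\<integral>\<^sup>+r. ennreal (1 / max r t - 1) * \<phi> r \<partial>I01) = (\<integral>\<^sup>+r. (\<integral>\<^sup>+s. ?K s r \<partial>I01) * \<phi> r \<partial>I01)"
    by (intro nn_integral_cong) (simp add: inner)
  also have "\<dots> = (\<integral>\<^sup>+s. (\<integral>\<^sup>+r. ?K s r * \<phi> r \<partial>I01) \<partial>I01)"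
    by (rule Tonelli_I01[OF K, symmetric]) measurable
  also have "\<dots> = (\<integral>\<^sup>+s. ennreal (1 / s) * indicator {t<..} s * (\<Phi> s / ennreal s) \<partial>I01)"
  proof (intro nn_integral_cong)
    fix s assume "s \<in> space I01"
    then have s: "0 < s" "s < 1" by auto
    have [measurable]: "(\<lambda>r. indicator {..<s} r :: ennreal) \<in> borel_measurable I01" by (intro mb) measurable
    have "(\<integral>\<^sup>+r. ?K s r * \<phi> r \<partial>I01) = (ennreal (1 / s\<^sup>2) * indicator {t<..} s) * \<Phi> s"
      unfolding \<Phi>_eq by (subst nn_integral_cmult[symmetric]) (auto simp: mult.assoc)
    also have "\<dots> = ennreal (1 / s) * indicator {t<..} s * (\<Phi> s * ennreal (1 / s))"
    proof -
      have "ennreal (1 / s\<^sup>2) = ennreal (1 / s) * ennreal (1 / s)"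
        using s by (simp add: power2_eq_square flip: ennreal_mult)
      then show ?thesis by (simp add: mult_ac)
    qed
    also have "\<Phi> s * ennreal (1 / s) = \<Phi> s / ennreal s"
      using s by (simp add: divide_ennreal_def inverse_ennreal inverse_eq_divide)
    finally show "(\<integral>\<^sup>+r. ?K s r * \<phi> r \<partial>I01) = ennreal (1 / s) * indicator {t<..} s * (\<Phi> s / ennreal s)" .
  qed
  \<comment> \<open>Subtraction is truncated at 0, and x \<le> (x - y) + y holds for either order of
    x and y.\<close>
  also have "\<dots> \<le> (\<integral>\<^sup>+s. ennreal (1 / s) * indicator {t<..} s * (\<Phi> s / ennreal s - \<phi> s) + ennreal (1 / s) * indicator {t<..} s * \<phi> s \<partial>I01)"
    unfolding distrib_left[symmetric] by (intro nn_integral_mono mult_left_mono ennreal_le_diff_add) auto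
  also have "\<dots> = A + B"
    unfolding A_eq B_def
  proof (rule nn_integral_add)
    have [measurable]: "(\<lambda>s. \<Phi> s / ennreal s) \<in> borel_measurable I01"
      unfolding divide_ennreal_def by (intro borel_measurable_times_ennreal[OF \<Phi>_meas] borel_measurable_I01) measurable
    show "(\<lambda>s. ennreal (1 / s) * indicator {t<..} s * (\<Phi> s / ennreal s - \<phi> s)) \<in> borel_measurable I01" by measurable
  qed measurable
  finally have "rearr M f t + B \<le> (A + (\<integral>\<^sup>+x. f x \<partial>M)) + B" by (simp add: add_ac)
  then have "rearr M f t \<le> A + (\<integral>\<^sup>+x. f x \<partial>M)"
    using Bfin by (auto simp: ennreal_add_left_cancel_le add.commute[of _ B])
  then show ?thesis by (simp add: A_def)
qed

text \<open>The operator P has norm at most 1/\<alpha> on integrable functions and at most 1 on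
  bounded ones. As P k - a is at most P applied to the positive part of k - a, the two bounds
  together give the hypothesis of the Hardy-Littlewood-Polya principle for P k and
  k/\<alpha>.\<close>

lemma hardy_dual_bound:
  assumes X: "ri_norm I01 \<rho>" and \<alpha>: "0 < \<alpha>" "\<alpha> \<le> 1" and k: "k \<in> borel_measurable I01"
  shows "\<rho> (\<lambda>t. ennreal (t powr (- \<alpha>)) * ((\<integral>\<^sup>+s. ennreal (s powr \<alpha>) * indicator {..<t} s * k s \<partial>I01) * ennreal (1 / t)))
    \<le> ennreal (1 / \<alpha>) * \<rho> k"
proof (cases "\<rho> k < \<infinity>")
  case False
  then show ?thesis using \<alpha> by (simp add: less_top[symmetric] ennreal_mult_eq_top_iff)
next
  case True
  note b = ri_bfn[OF X]
  have fin1: "emeasure I01 (space I01) < \<infinity>" and p1: "emeasure I01 (space I01) = 1" by simp_all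
  let ?K = "\<lambda>t s. ennreal (t powr (- \<alpha> - 1)) * ennreal (s powr \<alpha>) * indicator {..<t} s :: ennreal"
  have K: "case_prod ?K \<in> borel_measurable (borel \<Otimes>\<^sub>M borel)"
    unfolding indicator_def of_bool_def lessThan_iff by measurable
  define P where "P u t = (\<integral>\<^sup>+s. ?K t s * u s \<partial>I01)" for u t
  have Pm: "P u \<in> borel_measurable I01" if "u \<in> borel_measurable I01" for u
    unfolding P_def[abs_def] by (rule kernel_integral_measurable_I01[OF K that])
  have mK: "(\<lambda>s. ?K t s) \<in> borel_measurable I01" for t by (intro borel_measurable_I01) measurable
  have eq: "ennreal (t powr (- \<alpha>)) * ((\<integral>\<^sup>+s. ennreal (s powr \<alpha>) * indicator {..<t} s * k s \<partial>I01) * ennreal (1 / t)) = P k t"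
    if t: "0 < t" for t
  proof -
    have [measurable]: "(\<lambda>s. ennreal (s powr \<alpha>) * indicator {..<t} s) \<in> borel_measurable I01" by (intro borel_measurable_I01) measurable
    have "t powr (- \<alpha>) * (1 / t) = t powr (- \<alpha> - 1)" using t by (simp add: powr_diff)
    then have "ennreal (t powr (- \<alpha>)) * ennreal (1 / t) = ennreal (t powr (- \<alpha> - 1))" using t by (simp flip: ennreal_mult)
    moreover have "P k t = ennreal (t powr (- \<alpha> - 1)) * (\<integral>\<^sup>+s. ennreal (s powr \<alpha>) * indicator {..<t} s * k s \<partial>I01)"
    proof -
      have "(\<lambda>s. ennreal (s powr \<alpha>) * indicator {..<t} s * k s) \<in> borel_measurable I01" using k by measurable
      from nn_integral_cmult[OF this, of "ennreal (t powr (- \<alpha> - 1))", symmetric] show ?thesis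
        by (simp add: P_def mult.assoc)
    qed
    moreover have "x * (y * z) = (x * z) * y" for x y z :: ennreal by (simp add: mult_ac)
    ultimately show ?thesis by metis
  qed
  have intP: "(\<integral>\<^sup>+t. P u t \<partial>I01) \<le> ennreal (1 / \<alpha>) * (\<integral>\<^sup>+s. u s \<partial>I01)" if u: "u \<in> borel_measurable I01" for u
  proof -
    have "(\<integral>\<^sup>+t. P u t \<partial>I01) = (\<integral>\<^sup>+s. (\<integral>\<^sup>+t. ?K t s \<partial>I01) * u s \<partial>I01)"
      unfolding P_def by (rule Tonelli_I01[OF K u])
    also have "\<dots> \<le> (\<integral>\<^sup>+s. ennreal (1 / \<alpha>) * u s \<partial>I01)"
    proof (intro nn_integral_mono mult_right_mono)
      fix s assume "s \<in> space I01"
      then have s: "0 < s" "s < 1" by auto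
      have "(\<integral>\<^sup>+t. ?K t s \<partial>I01) = (\<integral>\<^sup>+t. ennreal (t powr (- \<alpha> - 1) * s powr \<alpha>) * indicator {s<..} t \<partial>I01)"
        by (intro nn_integral_cong) (auto simp: indicator_def ennreal_mult)
      also have "\<dots> = ennreal (- (1 powr (- \<alpha>) / \<alpha>) * s powr \<alpha> - (- (s powr (- \<alpha>) / \<alpha>) * s powr \<alpha>))"
      proof (rule nn_integral_I01_FTC[where F = "\<lambda>t. - (t powr (- \<alpha>) / \<alpha>) * s powr \<alpha>"])
        fix t assume "s \<le> t" "t \<le> 1"
        then have "0 < t" using s by simp
        then show "((\<lambda>t. - (t powr (- \<alpha>) / \<alpha>) * s powr \<alpha>) has_real_derivative t powr (- \<alpha> - 1) * s powr \<alpha>) (at t)"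
          using \<alpha> by (auto intro!: derivative_eq_intros simp: powr_diff)
      qed (use s in auto)
      also have "\<dots> \<le> ennreal (1 / \<alpha>)"
        using s \<alpha> by (intro ennreal_leI) (simp add: powr_minus field_simps)
      finally show "(\<integral>\<^sup>+t. ?K t s \<partial>I01) \<le> ennreal (1 / \<alpha>)" .
    qed simp
    also have "\<dots> = ennreal (1 / \<alpha>) * (\<integral>\<^sup>+s. u s \<partial>I01)" using u by (rule nn_integral_cmult)
    finally show ?thesis .
  qed
  \<comment> \<open>The bound on bounded functions, that is, on the constant 1; estimating s powr
    \<alpha> by t powr \<alpha> on (0,t) suffices.\<close>
  have K1: "(\<integral>\<^sup>+s. ?K t s \<partial>I01) \<le> 1" if t: "0 < t" "t < 1" for t
  proof -
    have "(\<integral>\<^sup>+s. ?K t s \<partial>I01) \<le> (\<integral>\<^sup>+s. ennreal (1 / t) * indicator {0<..t} s \<partial>I01)"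
    proof (intro nn_integral_mono)
      fix s assume "s \<in> space I01"
      then have s: "0 < s" "s < 1" by auto
      show "?K t s \<le> ennreal (1 / t) * indicator {0<..t} s"
      proof (cases "s < t")
        case True
        have "t powr (- \<alpha> - 1) * s powr \<alpha> \<le> t powr (- \<alpha> - 1) * t powr \<alpha>"
          using True s \<alpha> by (intro mult_left_mono powr_mono2) auto
        also have "\<dots> = 1 / t" using t by (simp add: powr_add[symmetric] powr_minus_divide)
        finally show ?thesis using True s by (simp flip: ennreal_mult add: ennreal_leI)
      qed simp
    qed
    also have "\<dots> = ennreal (1 / t) * ennreal t" using t by (intro nn_integral_I01_const_Ioc) auto
    also have "\<dots> = 1" using t by (simp flip: ennreal_mult)
    finally show ?thesis .
  qed
  have kAE: "AE s in I01. k s < \<infinity>" by (rule bfn_finite_AE[OF b fin1 k True])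
  obtain c where c: "0 < c" "(\<integral>\<^sup>+s. k s \<partial>I01) \<le> ennreal c * \<rho> k" using bfn_L1[OF b fin1] k by metis
  have intk: "(\<integral>\<^sup>+s. k s \<partial>I01) < \<infinity>" using c True by (auto simp: ennreal_mult_less_top intro: le_less_trans)
  have PAE: "AE t in I01. P k t < \<infinity>"
  proof -
    have "ennreal (1 / \<alpha>) * (\<integral>\<^sup>+s. k s \<partial>I01) < \<infinity>" using intk by (simp add: ennreal_mult_less_top)
    then have "(\<integral>\<^sup>+t. P k t \<partial>I01) \<noteq> \<infinity>" using intP[OF k] by auto
    then show ?thesis using nn_integral_noteq_infinite[OF Pm[OF k]] by (auto simp: less_top)
  qed
  define g where "g s = ennreal (1 / \<alpha>) * k s" for s
  have g: "g \<in> borel_measurable I01" unfolding g_def[abs_def] using k by measurable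
  have gAE: "AE s in I01. g s < \<infinity>" using kAE by eventually_elim (simp add: g_def ennreal_mult_less_top)
  have "\<rho> (rearr I01 (P k)) \<le> \<rho> (rearr I01 g)"
  proof (rule hardy_littlewood_polya[OF X Pm[OF k] p1 PAE g p1 gAE])
    fix a :: real assume a: "0 \<le> a"
    let ?u = "\<lambda>s. k s - ennreal a"
    have u: "?u \<in> borel_measurable I01" using k by measurable
    have "(\<integral>\<^sup>+t. P k t - ennreal a \<partial>I01) \<le> (\<integral>\<^sup>+t. P ?u t \<partial>I01)"
    proof (intro nn_integral_mono)
      fix t assume "t \<in> space I01"
      then have t: "0 < t" "t < 1" by auto
      \<comment> \<open>k is at most the positive part of k - a plus a, and by K1 the constant
        contributes at most a.\<close>
      have "P k t \<le> (\<integral>\<^sup>+s. ?K t s * ?u s + ennreal a * ?K t s \<partial>I01)"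
        unfolding P_def
      proof (intro nn_integral_mono)
        fix s
        have "?K t s * k s \<le> ?K t s * (?u s + ennreal a)" by (intro mult_left_mono ennreal_le_diff_add) auto
        then show "?K t s * k s \<le> ?K t s * ?u s + ennreal a * ?K t s" by (simp add: distrib_left mult_ac)
      qed
      also have "\<dots> = P ?u t + ennreal a * (\<integral>\<^sup>+s. ?K t s \<partial>I01)"
      proof -
        have "(\<lambda>s. ?K t s * ?u s) \<in> borel_measurable I01" by (rule borel_measurable_times_ennreal[OF mK u])
        moreover have "(\<lambda>s. ennreal a * ?K t s) \<in> borel_measurable I01"
          by (rule borel_measurable_times_ennreal[OF measurable_const mK]) simp
        ultimately show ?thesis
          unfolding P_def nn_integral_cmult[OF mK, symmetric] by (rule nn_integral_add)
      qed
      also have "\<dots> \<le> P ?u t + ennreal a * 1" by (intro add_left_mono mult_left_mono K1 t) auto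
      finally show "P k t - ennreal a \<le> P ?u t" by (simp add: ennreal_minus_le_iff add.commute)
    qed
    also have "\<dots> \<le> ennreal (1 / \<alpha>) * (\<integral>\<^sup>+s. ?u s \<partial>I01)" by (rule intP[OF u])
    also have "\<dots> = (\<integral>\<^sup>+s. ennreal (1 / \<alpha>) * ?u s \<partial>I01)" using u by (rule nn_integral_cmult[symmetric])
    also have "\<dots> \<le> (\<integral>\<^sup>+s. g s - ennreal a \<partial>I01)"
    proof (intro nn_integral_mono)
      fix s
      \<comment> \<open>Here \<alpha> \<le> 1 enters: subtracting a/\<alpha> from k/\<alpha> leaves
        no more than subtracting a.\<close>
      have "a \<le> 1 / \<alpha> * a" using \<alpha> a by (simp add: field_simps mult_left_le_one_le mult_left_le)
      then have "ennreal a \<le> ennreal (1 / \<alpha>) * ennreal a" using \<alpha> a by (simp flip: ennreal_mult add: ennreal_leI)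
      then have "g s - ennreal (1 / \<alpha>) * ennreal a \<le> g s - ennreal a" by (intro ennreal_minus_mono) auto
      moreover have "ennreal (1 / \<alpha>) * ?u s = g s - ennreal (1 / \<alpha>) * ennreal a"
        unfolding g_def by (intro ennreal_right_diff_distrib) auto
      ultimately show "ennreal (1 / \<alpha>) * ?u s \<le> g s - ennreal a" by simp
    qed
    finally show "(\<integral>\<^sup>+t. P k t - ennreal a \<partial>I01) \<le> (\<integral>\<^sup>+s. g s - ennreal a \<partial>I01)" .
  qed
  then have "\<rho> (P k) \<le> \<rho> g" unfolding ri_rearr[OF X Pm[OF k] PAE] ri_rearr[OF X g gAE] .
  also have "\<rho> g = ennreal (1 / \<alpha>) * \<rho> k" unfolding g_def[abs_def] using \<alpha> by (intro bfn_cmult[OF b k]) auto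
  also have "\<rho> (P k) = \<rho> (\<lambda>t. ennreal (t powr (- \<alpha>)) * ((\<integral>\<^sup>+s. ennreal (s powr \<alpha>) * indicator {..<t} s * k s \<partial>I01) * ennreal (1 / t)))"
  proof (rule bfn_cong_AE[OF b _ Pm[OF k]])
    let ?R = "\<lambda>t. ennreal (t powr (- \<alpha>)) * ((\<integral>\<^sup>+s. ennreal (s powr \<alpha>) * indicator {..<t} s * k s \<partial>I01) * ennreal (1 / t))"
    show "AE t in I01. P k t = ?R t" by (rule AE_I01_I) (simp add: eq)
    show "?R \<in> borel_measurable I01"
      using Pm[OF k] eq by (subst measurable_cong[where g = "P k"]) auto
  qed
  finally show ?thesis .
qed

text \<open>Q k is decreasing and right continuous, hence its own rearrangement. Interchanging
  integrals, the integral of Q k over (0,t) is that of s powr (\<alpha> - 1) min(s,t) k(s), which is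
  V plus t times the value of Q k at t; dividing by t isolates the oscillation.\<close>

lemma hardy_oscillation:
  assumes \<alpha>: "0 < \<alpha>" and k: "k \<in> borel_measurable I01" and fin: "\<And>t. 0 < t \<Longrightarrow> hardy \<alpha> k t < \<infinity>"
    and f: "\<And>t. 0 < t \<Longrightarrow> t < 1 \<Longrightarrow> f t = hardy \<alpha> k t" "f \<in> borel_measurable I01"
  shows "\<And>t. 0 < t \<Longrightarrow> t < 1 \<Longrightarrow> rearr I01 f t = hardy \<alpha> k t"
    "\<And>t. 0 < t \<Longrightarrow> t < 1 \<Longrightarrow> max_rearr I01 f t - rearr I01 f t \<le> (\<integral>\<^sup>+s. ennreal (s powr \<alpha>) * indicator {..<t} s * k s \<partial>I01) * ennreal (1 / t)"
proof -
  show eq: "rearr I01 f t = hardy \<alpha> k t" if t: "0 < t" "t < 1" for t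
  proof (rule antisym)
    have "distr_fun I01 f (hardy \<alpha> k t) \<le> emeasure I01 ({0<..<1} \<inter> {0<..t})"
      unfolding distr_fun_def
    proof (rule emeasure_mono)
      show "{x \<in> space I01. hardy \<alpha> k t < f x} \<subseteq> {0<..<1} \<inter> {0<..t}"
      proof
        fix x assume x: "x \<in> {x \<in> space I01. hardy \<alpha> k t < f x}"
        then have "hardy \<alpha> k t < hardy \<alpha> k x" "0 < x" "x < 1" using f(1) by auto
        then show "x \<in> {0<..<1} \<inter> {0<..t}" using hardy_antimono[of t x \<alpha> k] by (auto simp: not_less[symmetric])
      qed
    qed (auto simp: sets_restrict_space)
    also have "\<dots> = ennreal t" using emeasure_I01_Ioc[of 0 t] t by simp
    finally show "rearr I01 f t \<le> hardy \<alpha> k t" unfolding rearr_def by (intro Inf_lower) simp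
    show "hardy \<alpha> k t \<le> rearr I01 f t"
    proof (rule dense_le)
      fix l assume l: "l < hardy \<alpha> k t"
      \<comment> \<open>Right continuity of Q k at t, by monotone convergence along t +
        1/(m+1).\<close>
      define w where "w s = ennreal (s powr (\<alpha> - 1)) * k s" for s
      have "(\<lambda>s. ennreal (s powr (\<alpha> - 1))) \<in> borel_measurable I01" by (intro borel_measurable_I01) measurable
      then have w: "w \<in> borel_measurable I01" unfolding w_def[abs_def] using k by measurable
      have hw: "hardy \<alpha> k t' = (\<integral>\<^sup>+s. w s * indicator {t'<..} s \<partial>I01)" for t'
        unfolding hardy_def w_def by (simp add: mult_ac)
      have "hardy \<alpha> k t = (\<integral>\<^sup>+s. (SUP m. w s * indicator {t + 1 / real (Suc m)<..} s) \<partial>I01)"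
        unfolding hw
      proof (intro nn_integral_cong antisym)
        fix s
        show "w s * indicator {t<..} s \<le> (SUP m. w s * indicator {t + 1 / real (Suc m)<..} s)"
        proof (cases "t < s")
          case True
          then obtain m where "1 / real (Suc m) < s - t" by (meson nat_approx_posE diff_gt_0_iff_gt)
          then have "w s * indicator {t<..} s \<le> w s * indicator {t + 1 / real (Suc m)<..} s" by (simp add: indicator_def)
          then show ?thesis by (rule SUP_upper2[OF UNIV_I])
        qed simp
        show "(SUP m. w s * indicator {t + 1 / real (Suc m)<..} s) \<le> w s * indicator {t<..} s"
          by (intro SUP_least mult_left_mono) (auto simp: indicator_def add_pos_pos intro: order.strict_trans[rotated])
      qed
      also have "\<dots> = (SUP m. \<integral>\<^sup>+s. w s * indicator {t + 1 / real (Suc m)<..} s \<partial>I01)"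
      proof (rule nn_integral_monotone_convergence_SUP)
        show "incseq (\<lambda>m s. w s * indicator {t + 1 / real (Suc m)<..} s)"
        proof (intro incseq_SucI le_funI mult_left_mono)
          fix m s
          have "1 / real (Suc (Suc m)) \<le> 1 / real (Suc m)" by (intro divide_left_mono) auto
          then show "indicator {t + 1 / real (Suc m)<..} s \<le> (indicator {t + 1 / real (Suc (Suc m))<..} s :: ennreal)"
            by (auto simp: indicator_def)
        qed simp
        show "(\<lambda>s. w s * indicator {t + 1 / real (Suc m)<..} s) \<in> borel_measurable I01" for m
        proof -
          have "(\<lambda>s. indicator {t + 1 / real (Suc m)<..} s :: ennreal) \<in> borel_measurable I01" by (intro borel_measurable_I01) measurable
          then show ?thesis using w by measurable
        qed
      qed
      finally have "l < (SUP m. hardy \<alpha> k (t + 1 / real (Suc m)))" using l by (simp add: hw)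
      then obtain m where m: "l < hardy \<alpha> k (t + 1 / real (Suc m))" by (auto simp: less_SUP_iff)
      \<comment> \<open>The midpoint of t and 1 keeps t' inside the unit interval.\<close>
      define t' where "t' = min (t + 1 / real (Suc m)) ((1 + t) / 2)"
      have t': "t < t'" "t' < 1" using t by (auto simp: t'_def min_less_iff_disj)
      have "l < hardy \<alpha> k t'" using m hardy_antimono[of t' "t + 1 / real (Suc m)" \<alpha> k] by (simp add: t'_def)
      have "ennreal t < ennreal (t' - 0)" using t t' by (intro ennreal_lessI) auto
      also have "\<dots> = emeasure I01 ({0<..<1} \<inter> {0<..t'})" using t t' by (subst emeasure_I01_Ioc) auto
      also have "\<dots> \<le> distr_fun I01 f l"
        unfolding distr_fun_def
      proof (rule emeasure_mono)
        show "{0<..<1} \<inter> {0<..t'} \<subseteq> {x \<in> space I01. l < f x}"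
        proof
          fix x assume "x \<in> {0<..<1} \<inter> {0<..t'}"
          then have x: "0 < x" "x < 1" "x \<le> t'" by auto
          then have "l < hardy \<alpha> k x" using \<open>l < hardy \<alpha> k t'\<close> hardy_antimono[of x t' \<alpha> k] by simp
          then show "x \<in> {x \<in> space I01. l < f x}" using x f(1) by simp
        qed
        show "{x \<in> space I01. l < f x} \<in> sets I01" using f(2) by measurable
      qed
      finally have "l < rearr I01 f t" by (simp add: less_rearr_iff[OF f(2)])
      then show "l \<le> rearr I01 f t" by simp
    qed
  qed
  fix t :: real assume t: "0 < t" "t < 1"
  define V where "V = (\<integral>\<^sup>+s. ennreal (s powr \<alpha>) * indicator {..<t} s * k s \<partial>I01)"
  let ?K = "\<lambda>x s. ennreal (s powr (\<alpha> - 1)) * indicator {x<..} s * indicator {..<t} x :: ennreal"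
  have K: "case_prod ?K \<in> borel_measurable (borel \<Otimes>\<^sub>M borel)"
    unfolding indicator_def of_bool_def lessThan_iff greaterThan_iff by measurable
  have [measurable]: "(\<lambda>s. ennreal (s powr \<alpha>)) \<in> borel_measurable I01" "(\<lambda>s. ennreal (s powr (\<alpha> - 1))) \<in> borel_measurable I01"
    "(\<lambda>s. indicator {..<t} s :: ennreal) \<in> borel_measurable I01" "(\<lambda>s. indicator {t<..} s :: ennreal) \<in> borel_measurable I01"
    by (intro borel_measurable_I01; measurable)+
  note [measurable] = k
  have "(\<integral>\<^sup>+r. rearr I01 f r * indicator {..<t} r \<partial>I01) = (\<integral>\<^sup>+x. (\<integral>\<^sup>+s. ?K x s * k s \<partial>I01) \<partial>I01)"
  proof (intro nn_integral_cong)
    fix x assume "x \<in> space I01"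
    then have "rearr I01 f x = hardy \<alpha> k x" by (intro eq) auto
    then show "rearr I01 f x * indicator {..<t} x = (\<integral>\<^sup>+s. ?K x s * k s \<partial>I01)"
      by (cases "x < t") (auto simp: hardy_def)
  qed
  also have "\<dots> = (\<integral>\<^sup>+s. (\<integral>\<^sup>+x. ?K x s \<partial>I01) * k s \<partial>I01)" by (rule Tonelli_I01[OF K k])
  also have "\<dots> \<le> (\<integral>\<^sup>+s. ennreal (s powr \<alpha>) * indicator {..<t} s * k s + ennreal t * (ennreal (s powr (\<alpha> - 1)) * indicator {t<..} s * k s) \<partial>I01)"
  proof (rule nn_integral_mono_AE)
    \<comment> \<open>At s = t both indicators on the right vanish, so this point is excluded as a
      null set.\<close>
    have ne: "AE s in I01. s \<noteq> t"
    proof -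
      have "AE s in lebesgue. s \<noteq> t" using AE_lborel_singleton[of t] by (rule AE_completion)
      then show ?thesis by (auto simp: AE_restrict_space_iff elim: eventually_mono)
    qed
    have sp: "AE s in I01. 0 < s \<and> s < 1" by (rule AE_I01_I) auto
    show "AE s in I01. (\<integral>\<^sup>+x. ?K x s \<partial>I01) * k s \<le>
      ennreal (s powr \<alpha>) * indicator {..<t} s * k s + ennreal t * (ennreal (s powr (\<alpha> - 1)) * indicator {t<..} s * k s)"
      using ne sp
    proof eventually_elim
      case (elim s)
      have "(\<integral>\<^sup>+x. ?K x s \<partial>I01) \<le> (\<integral>\<^sup>+x. ennreal (s powr (\<alpha> - 1)) * indicator {0<..min s t} x \<partial>I01)"
        by (intro nn_integral_mono) (auto simp: indicator_def)
      also have "\<dots> = ennreal (s powr (\<alpha> - 1)) * ennreal (min s t)"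
        using elim t by (intro nn_integral_I01_const_Ioc) auto
      finally have *: "(\<integral>\<^sup>+x. ?K x s \<partial>I01) * k s \<le> ennreal (s powr (\<alpha> - 1)) * ennreal (min s t) * k s" by (intro mult_right_mono) auto
      show ?case
      proof (cases "s < t")
        case True
        have "s powr (\<alpha> - 1) * s = s powr \<alpha>" using elim by (simp add: powr_diff)
        then have "ennreal (s powr (\<alpha> - 1)) * ennreal (min s t) = ennreal (s powr \<alpha>)"
          using True elim by (simp add: min_def flip: ennreal_mult)
        then show ?thesis using * True by simp
      next
        case False
        then have "t < s" using elim by simp
        then show ?thesis using * by (simp add: min_def mult_ac)
      qed
    qed
  qed
  also have "\<dots> = V + ennreal t * hardy \<alpha> k t"
    unfolding V_def hardy_def by (simp add: nn_integral_add nn_integral_cmult)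
  finally have "max_rearr I01 f t \<le> (V + ennreal t * hardy \<alpha> k t) * ennreal (1 / t)"
    unfolding max_rearr_def using t
    by (subst nn_integral_I01_Ioo') (auto simp: divide_ennreal_def inverse_ennreal inverse_eq_divide intro!: mult_right_mono)
  also have "\<dots> = V * ennreal (1 / t) + (ennreal t * ennreal (1 / t)) * hardy \<alpha> k t" by (simp add: distrib_left distrib_right mult_ac)
  also have "ennreal t * ennreal (1 / t) = 1" using t by (simp flip: ennreal_mult)
  finally show "max_rearr I01 f t - rearr I01 f t \<le> (\<integral>\<^sup>+s. ennreal (s powr \<alpha>) * indicator {..<t} s * k s \<partial>I01) * ennreal (1 / t)"
    using fin[OF t(1)] by (auto simp: eq[OF t] V_def ennreal_minus_le_iff add.commute)
qed

section \<open>Equivalence of (i) and (ii)\<close>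

definition oscillation_bounded :: "real \<Rightarrow> real fun_norm \<Rightarrow> real fun_norm \<Rightarrow> bool" where
  "oscillation_bounded \<alpha> \<rho>X \<rho>Y \<longleftrightarrow> (\<exists>C::real. C > 0 \<and> (\<forall>f \<in> fspace I01 (L1_norm I01).
            fnorm \<rho>Y f \<le> ennreal C *
              (\<rho>X (\<lambda>s. ennreal (s powr (- \<alpha>)) *
                 (max_rearr I01 (\<lambda>x. ennreal \<bar>f x\<bar>) s - rearr I01 (\<lambda>x. ennreal \<bar>f x\<bar>) s))
               + fnorm (L1_norm I01) f)))"

lemma max_rearr_measurable:
  assumes f: "f \<in> borel_measurable M" "emeasure M (space M) = 1" "AE x in M. f x < \<infinity>"
  shows "max_rearr M f \<in> borel_measurable I01"
proof -
  have "(\<lambda>(s :: real, r). indicator {..<s} r :: ennreal) \<in> borel_measurable (borel \<Otimes>\<^sub>M borel)"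
    unfolding indicator_def of_bool_def lessThan_iff by measurable
  from kernel_integral_measurable_I01[OF this rearr_measurable_I01[OF f]]
  have m1: "(\<lambda>s. \<integral>\<^sup>+r. indicator {..<s} r * rearr M f r \<partial>I01) \<in> borel_measurable I01" by simp
  have m2: "(\<lambda>s. inverse (ennreal s)) \<in> borel_measurable I01" by (intro borel_measurable_I01) measurable
  have "max_rearr M f s = (\<integral>\<^sup>+r. indicator {..<s} r * rearr M f r \<partial>I01) * inverse (ennreal s)" if "s \<in> space I01" for s
    unfolding max_rearr_def divide_ennreal_def using that by (subst nn_integral_I01_Ioo') (auto simp: mult.commute)
  then show ?thesis
    using borel_measurable_times_ennreal[OF m1 m2] by (subst measurable_cong) auto
qed

text \<open>The pointwise bound of the rearrangement is fed into the norm. The L1 norm enters it as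
  a constant function, and the norm of the constant 1 is finite by the axioms.\<close>

theorem hardy_bounded_imp_oscillation_bounded:
  assumes X: "ri_norm I01 \<rho>X" and Y: "ri_norm I01 \<rho>Y" and H: "hardy_bounded \<alpha> \<rho>X \<rho>Y"
  shows "oscillation_bounded \<alpha> \<rho>X \<rho>Y"
proof -
  note bY = ri_bfn[OF Y]
  have fin1: "emeasure I01 (space I01) < \<infinity>" and p1: "emeasure I01 (space I01) = 1" by simp_all
  obtain C :: real where C: "0 < C" "\<And>k. k \<in> borel_measurable I01 \<Longrightarrow> \<rho>Y (hardy \<alpha> k) \<le> ennreal C * \<rho>X k"
    using H by (auto simp: hardy_bounded_def)
  obtain c where c: "\<rho>Y (\<lambda>x. 1) = ennreal c" "0 \<le> c"
    using bfn_one_finite[OF bY fin1] by (cases "\<rho>Y (\<lambda>x. 1)") auto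
  show ?thesis
    unfolding oscillation_bounded_def
  proof (intro exI[of _ "max C c"] conjI ballI)
    show "0 < max C c" using C by simp
    fix f assume "f \<in> fspace I01 (L1_norm I01)"
    then have fm: "f \<in> borel_measurable I01" and fi: "fnorm (L1_norm I01) f < \<infinity>" by (auto simp: fspace_def)
    let ?g = "\<lambda>x. ennreal \<bar>f x\<bar>"
    let ?k = "\<lambda>s. ennreal (s powr (- \<alpha>)) * (max_rearr I01 ?g s - rearr I01 ?g s)"
    let ?I = "fnorm (L1_norm I01) f"
    have g: "?g \<in> borel_measurable I01" using fm by measurable
    have gAE: "AE x in I01. ?g x < \<infinity>" by simp
    have m0: "(\<lambda>s. ennreal (s powr (- \<alpha>))) \<in> borel_measurable I01" by (intro borel_measurable_I01) measurable
    have k: "?k \<in> borel_measurable I01"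
      using m0 max_rearr_measurable[OF g p1 gAE] rearr_measurable_I01[OF g p1 gAE] by measurable
    have Hm: "hardy \<alpha> ?k \<in> borel_measurable I01" by (rule hardy_measurable[OF k])
    obtain I where I: "?I = ennreal I" "0 \<le> I" using fi by (cases "fnorm (L1_norm I01) f") auto
    have "fnorm \<rho>Y f = \<rho>Y (rearr I01 ?g)"
      unfolding fnorm_def by (rule ri_rearr[OF Y g gAE, symmetric])
    also have "\<dots> \<le> \<rho>Y (\<lambda>t. hardy \<alpha> ?k t + ennreal I * 1)"
    proof (rule bfn_mono[OF bY])
      show "AE t in I01. rearr I01 ?g t \<le> hardy \<alpha> ?k t + ennreal I * 1"
      proof (rule AE_I01_I)
        fix t :: real assume t: "0 < t" "t < 1"
        show "rearr I01 ?g t \<le> hardy \<alpha> ?k t + ennreal I * 1"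
          using hardy_dominates_rearr[OF g p1 gAE _ t, of \<alpha>] fi I by (simp add: fnorm_def)
      qed
    qed (use Hm rearr_measurable_I01[OF g p1 gAE] in measurable)
    also have "\<dots> \<le> \<rho>Y (hardy \<alpha> ?k) + \<rho>Y (\<lambda>t. ennreal I * 1)"
      by (rule bfn_add[OF bY Hm]) measurable
    also have "\<rho>Y (\<lambda>t. ennreal I * 1) = ennreal I * \<rho>Y (\<lambda>t. 1)"
      by (rule bfn_cmult[OF bY _ I(2)]) measurable
    also have "\<rho>Y (hardy \<alpha> ?k) + ennreal I * \<rho>Y (\<lambda>t. 1) \<le> ennreal C * \<rho>X ?k + ennreal c * ?I"
      unfolding c I using C(2)[OF k] by (simp add: mult.commute add_right_mono)
    also have "\<dots> \<le> ennreal (max C c) * \<rho>X ?k + ennreal (max C c) * ?I"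
      by (intro add_mono mult_right_mono ennreal_leI) auto
    also have "\<dots> = ennreal (max C c) * (\<rho>X ?k + ?I)" by (simp add: distrib_left)
    finally show "fnorm \<rho>Y f \<le> ennreal (max C c) * (\<rho>X ?k + ?I)" .
  qed
qed

theorem oscillation_bounded_imp_hardy_bounded:
  assumes X: "ri_norm I01 \<rho>X" and Y: "ri_norm I01 \<rho>Y" and \<alpha>: "0 < \<alpha>" "\<alpha> \<le> 1"
    and O: "oscillation_bounded \<alpha> \<rho>X \<rho>Y"
  shows "hardy_bounded \<alpha> \<rho>X \<rho>Y"
proof -
  note bX = ri_bfn[OF X] and bY = ri_bfn[OF Y]
  have fin1: "emeasure I01 (space I01) < \<infinity>" and p1: "emeasure I01 (space I01) = 1" by simp_all
  obtain C :: real where C: "0 < C" "\<And>f. f \<in> fspace I01 (L1_norm I01) \<Longrightarrow>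
     fnorm \<rho>Y f \<le> ennreal C * (\<rho>X (\<lambda>s. ennreal (s powr (- \<alpha>)) *
                 (max_rearr I01 (\<lambda>x. ennreal \<bar>f x\<bar>) s - rearr I01 (\<lambda>x. ennreal \<bar>f x\<bar>) s)) + fnorm (L1_norm I01) f)"
    using O unfolding oscillation_bounded_def by blast
  obtain c where c: "0 < c" "\<And>f. f \<in> borel_measurable I01 \<Longrightarrow> (\<integral>\<^sup>+x. f x \<partial>I01) \<le> ennreal c * \<rho>X f"
    using bfn_L1[OF bX fin1] by blast
  have "\<rho>Y (hardy \<alpha> k) \<le> ennreal (C * (1 / \<alpha> + c)) * \<rho>X k" if k: "k \<in> borel_measurable I01" for k
  proof (cases "\<rho>X k < \<infinity>")
    case False
    then have "\<rho>X k = top" by (simp add: less_top[symmetric])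
    moreover have "0 < C * (1 / \<alpha> + c)" using C c \<alpha> by (simp add: add_pos_pos)
    then have "ennreal (C * (1 / \<alpha> + c)) \<noteq> 0" by (simp only: ennreal_eq_0_iff not_le)
    ultimately have "ennreal (C * (1 / \<alpha> + c)) * \<rho>X k = top"
      by (simp only: ennreal_mult_eq_top_iff) simp
    then show ?thesis by simp
  next
    case True
    have "ennreal c * \<rho>X k < \<infinity>" using True by (simp add: ennreal_mult_less_top)
    then have intk: "(\<integral>\<^sup>+x. k x \<partial>I01) < \<infinity>" using c(2)[OF k] by (rule le_less_trans[rotated])
    have hfin: "hardy \<alpha> k t < \<infinity>" if t: "0 < t" for t
    proof -
      have "hardy \<alpha> k t \<le> (\<integral>\<^sup>+s. ennreal (t powr (\<alpha> - 1)) * k s \<partial>I01)"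
        unfolding hardy_def
      proof (intro nn_integral_mono mult_right_mono)
        fix s
        show "ennreal (s powr (\<alpha> - 1)) * indicator {t<..} s \<le> ennreal (t powr (\<alpha> - 1))"
          using t \<alpha> by (cases "t < s") (auto intro!: ennreal_leI powr_mono2')
      qed simp
      also have "\<dots> = ennreal (t powr (\<alpha> - 1)) * (\<integral>\<^sup>+s. k s \<partial>I01)" using k by (rule nn_integral_cmult)
      also have "\<dots> < \<infinity>" using intk by (simp add: ennreal_mult_less_top)
      finally show ?thesis .
    qed
    have Hm: "hardy \<alpha> k \<in> borel_measurable I01" by (rule hardy_measurable[OF k])
    \<comment> \<open>The Hardy operator is known to be finite only for t > 0; the value 0 elsewhere
      is a default outside the space.\<close>
    define f where "f t = (if 0 < t then enn2real (hardy \<alpha> k t) else 0)" for t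
    have f_eq: "ennreal \<bar>f t\<bar> = hardy \<alpha> k t" if "0 < t" for t
      using hfin[OF that] that by (simp add: f_def less_top)
    have fm: "f \<in> borel_measurable I01"
    proof -
      have "f t = enn2real (hardy \<alpha> k t)" if "t \<in> space I01" for t using that by (auto simp: f_def)
      then show ?thesis using Hm by (subst measurable_cong[where g = "\<lambda>t. enn2real (hardy \<alpha> k t)"]) auto
    qed
    have gm: "(\<lambda>t. ennreal \<bar>f t\<bar>) \<in> borel_measurable I01" using fm by measurable
    have "fnorm (L1_norm I01) f = (\<integral>\<^sup>+t. hardy \<alpha> k t \<partial>I01)"
      unfolding fnorm_def by (intro nn_integral_cong f_eq) auto
    \<comment> \<open>By Tonelli the L1 norm of Q k is at most the integral of s powr \<alpha> times
      k(s). Thus the L1 term of (i) is absorbed by the embedding of the space into L1.\<close>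
    also have "\<dots> \<le> (\<integral>\<^sup>+s. k s \<partial>I01)"
    proof -
      let ?K = "\<lambda>t s. ennreal (s powr (\<alpha> - 1)) * indicator {t<..} s :: ennreal"
      have K: "case_prod ?K \<in> borel_measurable (borel \<Otimes>\<^sub>M borel)"
        unfolding indicator_def of_bool_def greaterThan_iff by measurable
      have "(\<integral>\<^sup>+t. hardy \<alpha> k t \<partial>I01) = (\<integral>\<^sup>+s. (\<integral>\<^sup>+t. ?K t s \<partial>I01) * k s \<partial>I01)"
        unfolding hardy_def by (rule Tonelli_I01[OF K k])
      also have "\<dots> \<le> (\<integral>\<^sup>+s. 1 * k s \<partial>I01)"
      proof (intro nn_integral_mono mult_right_mono)
        fix s assume "s \<in> space I01"
        then have s: "0 < s" "s < 1" by auto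
        have "(\<integral>\<^sup>+t. ?K t s \<partial>I01) \<le> (\<integral>\<^sup>+t. ennreal (s powr (\<alpha> - 1)) * indicator {0<..s} t \<partial>I01)"
          by (intro nn_integral_mono) (auto simp: indicator_def)
        also have "\<dots> = ennreal (s powr (\<alpha> - 1)) * ennreal s" using s by (intro nn_integral_I01_const_Ioc) auto
        also have "\<dots> = ennreal (s powr \<alpha>)" using s by (simp add: powr_diff flip: ennreal_mult)
        also have "\<dots> \<le> 1" using s \<alpha> powr_mono2[of \<alpha> s 1] by simp
        finally show "(\<integral>\<^sup>+t. ?K t s \<partial>I01) \<le> 1" .
      qed simp
      finally show ?thesis by simp
    qed
    finally have L1: "fnorm (L1_norm I01) f \<le> ennreal c * \<rho>X k" using c(2)[OF k] by (rule order_trans)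
    have "fnorm (L1_norm I01) f < \<infinity>" using L1 \<open>ennreal c * \<rho>X k < \<infinity>\<close> by (rule le_less_trans)
    then have "f \<in> fspace I01 (L1_norm I01)" using fm by (simp add: fspace_def)
    note main = C(2)[OF this]
    let ?g = "\<lambda>t. ennreal \<bar>f t\<bar>"
    note osc = hardy_oscillation[OF \<alpha>(1) k hfin f_eq gm]
    let ?P = "\<lambda>t. ennreal (t powr (- \<alpha>)) * ((\<integral>\<^sup>+s. ennreal (s powr \<alpha>) * indicator {..<t} s * k s \<partial>I01) * ennreal (1 / t))"
    have m0: "(\<lambda>s. ennreal (s powr (- \<alpha>))) \<in> borel_measurable I01" "(\<lambda>s. ennreal (1 / s)) \<in> borel_measurable I01"
      by (intro borel_measurable_I01; measurable)+
    have mP: "?P \<in> borel_measurable I01"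
    proof -
      have "(\<lambda>(t, s). ennreal (s powr \<alpha>) * indicator {..<t} s) \<in> borel_measurable (borel \<Otimes>\<^sub>M borel)"
        unfolding indicator_def of_bool_def lessThan_iff by measurable
      from kernel_integral_measurable_I01[OF this k] show ?thesis using m0 by (intro borel_measurable_times_ennreal)
    qed
    have "\<rho>X (\<lambda>s. ennreal (s powr (- \<alpha>)) * (max_rearr I01 ?g s - rearr I01 ?g s)) \<le> \<rho>X ?P"
    proof (rule bfn_mono[OF bX mP])
      have gAE: "AE x in I01. ?g x < \<infinity>" by simp
      show "(\<lambda>s. ennreal (s powr (- \<alpha>)) * (max_rearr I01 ?g s - rearr I01 ?g s)) \<in> borel_measurable I01"
        using m0 max_rearr_measurable[OF gm p1 gAE] rearr_measurable_I01[OF gm p1 gAE] by measurable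
      show "AE s in I01. ennreal (s powr (- \<alpha>)) * (max_rearr I01 ?g s - rearr I01 ?g s) \<le> ?P s"
        by (intro AE_I01_I mult_left_mono osc(2)) auto
    qed
    also have "\<dots> \<le> ennreal (1 / \<alpha>) * \<rho>X k" by (rule hardy_dual_bound[OF X \<alpha> k])
    finally have "fnorm \<rho>Y f \<le> ennreal C * (ennreal (1 / \<alpha>) * \<rho>X k + ennreal c * \<rho>X k)"
      using L1 by (intro order_trans[OF main] mult_left_mono add_mono) auto
    also have "\<dots> = ennreal (C * (1 / \<alpha> + c)) * \<rho>X k"
      using C c \<alpha> by (simp add: distrib_right[symmetric] ennreal_mult mult.assoc flip: ennreal_plus)
    also have "fnorm \<rho>Y f = \<rho>Y (hardy \<alpha> k)"
      unfolding fnorm_def by (rule bfn_cong_AE[OF bY Hm gm]) (intro AE_I01_I f_eq)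
    finally show ?thesis .
  qed
  moreover have "0 < C * (1 / \<alpha> + c)" using C c \<alpha> by (simp add: add_pos_pos)
  ultimately show ?thesis unfolding hardy_bounded_def by blast
qed

section \<open>Averages over dyadic cells\<close>

text \<open>The cells are numbered towards 0, with cell 0 next to 1. They are closed on the left, so
  a decreasing function on cell j is at most its value at 2^-(j+1).\<close>

definition dyadic_cell :: "nat \<Rightarrow> real set" where
  "dyadic_cell j = {(1/2)^(Suc j)..<(1/2)^j}"

lemma dyadic_cell_sub: "dyadic_cell j \<subseteq> {0<..<1}"
proof
  fix x assume x: "x \<in> dyadic_cell j"
  have "(1/2)^j \<le> (1::real)" by (simp add: power_le_one)
  moreover have "0 < x"
  proof (rule less_le_trans)
    show "0 < (1/2 :: real)^(Suc j)" by simp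
    show "(1/2)^(Suc j) \<le> x" using x by (simp add: dyadic_cell_def)
  qed
  ultimately show "x \<in> {0<..<1}" using x unfolding dyadic_cell_def by auto
qed

lemma dyadic_cell_disjoint: "disjoint_family dyadic_cell"
proof -
  have "dyadic_cell i \<inter> dyadic_cell j = {}" if "i < j" for i j
  proof -
    have "(1/2::real)^j \<le> (1/2)^(Suc i)" using that by (intro power_decreasing) auto
    then show ?thesis unfolding dyadic_cell_def by auto
  qed
  then show ?thesis unfolding disjoint_family_on_def by (metis inf_commute linorder_neqE_nat)
qed

lemma dyadic_cell_cover:
  assumes "0 < t" "t < 1"
  obtains j where "t \<in> dyadic_cell j"
proof -
  obtain m where m: "(1/2)^m < t" using real_arch_pow_inv[of t "1/2"] assms by auto
  define j where "j = (LEAST j. (1/2)^(Suc j) \<le> t)"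
  have "(1/2)^(Suc m) \<le> t"
    by (rule order_trans[OF power_decreasing[of m "Suc m" "1/2::real"] less_imp_le[OF m]]) auto
  then have j1: "(1/2)^(Suc j) \<le> t" unfolding j_def by (rule LeastI)
  have "t < (1/2)^j"
  proof (cases j)
    case (Suc i)
    then have "\<not> (1/2)^(Suc i) \<le> t" using not_less_Least[of i "\<lambda>j. (1/2)^(Suc j) \<le> t"] by (simp add: j_def)
    then show ?thesis using Suc by simp
  qed (use assms in simp)
  then show thesis using j1 that[of j] by (simp add: dyadic_cell_def)
qed

lemma dyadic_cell_sets [measurable]: "dyadic_cell j \<in> sets borel" "dyadic_cell j \<in> sets I01"
proof -
  show "dyadic_cell j \<in> sets borel" by (simp add: dyadic_cell_def)
  then show "dyadic_cell j \<in> sets I01"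
    using dyadic_cell_sub[of j] by (subst sets_restrict_space_iff) auto
qed

lemma emeasure_dyadic_cell: "emeasure I01 (dyadic_cell j) = ennreal ((1/2)^(Suc j))"
proof -
  have "emeasure I01 (dyadic_cell j) = emeasure I01 ({0<..<1} \<inter> dyadic_cell j)"
    using dyadic_cell_sub[of j] by (simp add: Int_absorb1)
  also have "\<dots> = emeasure lebesgue (dyadic_cell j)"
    using dyadic_cell_sub[of j] by (subst emeasure_I01) (auto simp: Int_absorb1)
  also have "\<dots> = ennreal ((1/2)^j - (1/2)^(Suc j))"
    unfolding dyadic_cell_def by (simp add: power_decreasing)
  also have "(1/2)^j - (1/2)^(Suc j) = (1/2::real)^(Suc j)" by simp
  finally show ?thesis .
qed

lemma suminf_indicator_disjoint:
  fixes H :: "nat \<Rightarrow> ennreal"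
  assumes "disjoint_family A" "x \<in> A i"
  shows "(\<Sum>j. H j * indicator (A j) x) = H i"
  using assms by (rule suminf_cmult_indicator)

text \<open>Averaging does not increase an r.i. norm. Both A j and E j have measure at most m j, and
  H j is at most the mass of g on E j divided by m j; hence the positive part of H j - c times m j
  is at most the integral over E j of the positive part of g - c, and disjointness allows summation
  over j. This carries functions between \<Omega> and the unit interval in both directions.\<close>

lemma averaging_bound:
  fixes g :: "'a \<Rightarrow> ennreal" and A :: "nat \<Rightarrow> 'b set" and E :: "nat \<Rightarrow> 'a set" and H m :: "nat \<Rightarrow> real"
  assumes ri: "ri_norm I01 \<rho>"
    and g: "g \<in> borel_measurable M" "emeasure M (space M) = 1" "AE x in M. g x < \<infinity>"
    and N: "emeasure N (space N) = 1"
    and E: "\<And>j. E j \<in> sets M" "disjoint_family E" "\<And>j. emeasure M (E j) \<le> ennreal (m j)"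
    and A: "\<And>j. A j \<in> sets N" "disjoint_family A" "\<And>j. emeasure N (A j) \<le> ennreal (m j)"
    and m: "\<And>j. 0 \<le> m j" and H: "\<And>j. ennreal (H j) * ennreal (m j) \<le> (\<integral>\<^sup>+x. g x * indicator (E j) x \<partial>M)"
  shows "\<rho> (rearr N (\<lambda>x. \<Sum>j. ennreal (H j) * indicator (A j) x)) \<le> \<rho> (rearr M g)"
proof (rule hardy_littlewood_polya[OF ri _ N _ g])
  note [measurable] = A(1) E(1) g(1)
  let ?w = "\<lambda>x. \<Sum>j. ennreal (H j) * indicator (A j) x"
  show "?w \<in> borel_measurable N" by measurable
  have w0: "?w x = 0" if "x \<notin> (\<Union>j. A j)" for x using that by simp
  show "AE x in N. ?w x < \<infinity>"
  proof (rule AE_I2)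
    fix x show "?w x < \<infinity>"
    proof (cases "x \<in> (\<Union>j. A j)")
      case True
      then obtain i where "x \<in> A i" by auto
      then show ?thesis by (simp add: suminf_indicator_disjoint[OF A(2)])
    qed (simp add: w0)
  qed
  fix c :: real assume c: "0 \<le> c"
  have "(\<integral>\<^sup>+x. ?w x - ennreal c \<partial>N) = (\<integral>\<^sup>+x. (\<Sum>j. (ennreal (H j) - ennreal c) * indicator (A j) x) \<partial>N)"
  proof (rule nn_integral_cong)
    fix x show "?w x - ennreal c = (\<Sum>j. (ennreal (H j) - ennreal c) * indicator (A j) x)"
    proof (cases "x \<in> (\<Union>j. A j)")
      case True
      then obtain i where "x \<in> A i" by auto
      then show ?thesis by (simp add: suminf_indicator_disjoint[OF A(2)])
    qed simp
  qed
  also have "\<dots> = (\<Sum>j. (ennreal (H j) - ennreal c) * emeasure N (A j))"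
    by (subst nn_integral_suminf) (auto intro!: suminf_cong nn_integral_cmult_indicator)
  also have "\<dots> \<le> (\<Sum>j. (\<integral>\<^sup>+x. (g x - ennreal c) * indicator (E j) x \<partial>M))"
  proof (intro suminf_le allI)
    fix j
    have "(ennreal (H j) - ennreal c) * emeasure N (A j) \<le> (ennreal (H j) - ennreal c) * ennreal (m j)"
      using A(3) by (intro mult_left_mono) auto
    also have "\<dots> = ennreal (m j) * ennreal (H j) - ennreal (m j) * ennreal c"
      by (subst mult.commute, intro ennreal_right_diff_distrib) auto
    \<comment> \<open>Replacing m j by the measure of E j in the second term only decreases what is
      subtracted.\<close>
    also have "\<dots> \<le> (\<integral>\<^sup>+x. g x * indicator (E j) x \<partial>M) - ennreal c * emeasure M (E j)"
      using H[of j] E(3)[of j] by (intro ennreal_minus_mono) (auto simp: mult.commute intro: mult_left_mono mult_right_mono)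
    also have "\<dots> \<le> (\<integral>\<^sup>+x. (g x - ennreal c) * indicator (E j) x \<partial>M)"
    proof -
      have "(\<integral>\<^sup>+x. g x * indicator (E j) x \<partial>M) \<le> (\<integral>\<^sup>+x. (g x - ennreal c) * indicator (E j) x + ennreal c * indicator (E j) x \<partial>M)"
        unfolding distrib_right[symmetric] by (intro nn_integral_mono mult_right_mono ennreal_le_diff_add) auto
      also have "\<dots> = (\<integral>\<^sup>+x. (g x - ennreal c) * indicator (E j) x \<partial>M) + ennreal c * emeasure M (E j)"
        by (subst nn_integral_add) (auto simp: nn_integral_cmult_indicator)
      finally have *: "(\<integral>\<^sup>+x. g x * indicator (E j) x \<partial>M) \<le> (\<integral>\<^sup>+x. (g x - ennreal c) * indicator (E j) x \<partial>M) + ennreal c * emeasure M (E j)" .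
      have "emeasure M (E j) < \<infinity>" using E(3)[of j] by (rule le_less_trans) simp
      then have "ennreal c * emeasure M (E j) < \<infinity>" by (simp add: ennreal_mult_less_top)
      then show ?thesis using * by (auto simp: ennreal_minus_le_iff add.commute)
    qed
    finally show "(ennreal (H j) - ennreal c) * emeasure N (A j) \<le> (\<integral>\<^sup>+x. (g x - ennreal c) * indicator (E j) x \<partial>M)" .
  qed auto
  also have "\<dots> = (\<integral>\<^sup>+x. (\<Sum>j. (g x - ennreal c) * indicator (E j) x) \<partial>M)"
    by (rule nn_integral_suminf[symmetric]) measurable
  also have "\<dots> \<le> (\<integral>\<^sup>+x. g x - ennreal c \<partial>M)"
  proof (rule nn_integral_mono)
    fix x show "(\<Sum>j. (g x - ennreal c) * indicator (E j) x) \<le> g x - ennreal c"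
    proof (cases "x \<in> (\<Union>j. E j)")
      case True
      then obtain i where "x \<in> E i" by auto
      then show ?thesis using suminf_indicator_disjoint[OF E(2), of x i "\<lambda>_. g x - ennreal c"] by simp
    qed simp
  qed
  finally show "(\<integral>\<^sup>+x. ?w x - ennreal c \<partial>N) \<le> (\<integral>\<^sup>+x. g x - ennreal c \<partial>M)" .
qed

text \<open>The cells j < k lie to the right of t, and on cell j the decreasing weight is at least
  its value at the right end 2^-j. Cell k itself contains t and is dropped.\<close>

lemma hardy_lower_bound:
  assumes \<alpha>: "\<alpha> \<le> 1" and t: "t \<in> dyadic_cell k" and H: "\<And>j. 0 \<le> H j"
  shows "(\<Sum>j<k. ennreal (((1/2)^j) powr (\<alpha> - 1) * (H j * (1/2)^(Suc j))))
    \<le> hardy \<alpha> (\<lambda>s. \<Sum>j. ennreal (H j) * indicator (dyadic_cell j) s) t"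
proof -
  have "(\<Sum>j<k. ennreal (((1/2)^j) powr (\<alpha> - 1) * (H j * (1/2)^(Suc j)))) =
    (\<Sum>j<k. \<integral>\<^sup>+s. ennreal (((1/2)^j) powr (\<alpha> - 1) * H j) * indicator (dyadic_cell j) s \<partial>I01)"
  proof (intro sum.cong refl)
    fix j
    show "ennreal (((1/2)^j) powr (\<alpha> - 1) * (H j * (1/2)^(Suc j))) = (\<integral>\<^sup>+s. ennreal (((1/2)^j) powr (\<alpha> - 1) * H j) * indicator (dyadic_cell j) s \<partial>I01)"
      using H[of j] by (simp add: nn_integral_cmult_indicator emeasure_dyadic_cell mult.assoc flip: ennreal_mult)
  qed
  also have "\<dots> = (\<integral>\<^sup>+s. (\<Sum>j<k. ennreal (((1/2)^j) powr (\<alpha> - 1) * H j) * indicator (dyadic_cell j) s) \<partial>I01)"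
    by (rule nn_integral_sum[symmetric]) measurable
  also have "\<dots> \<le> hardy \<alpha> (\<lambda>s. \<Sum>j. ennreal (H j) * indicator (dyadic_cell j) s) t"
    unfolding hardy_def
  proof (rule nn_integral_mono)
    fix s assume "s \<in> space I01"
    then have "0 < s" "s < 1" by auto
    then obtain i where i: "s \<in> dyadic_cell i" by (rule dyadic_cell_cover)
    have eq: "s \<in> dyadic_cell j \<longleftrightarrow> j = i" for j
      using i dyadic_cell_disjoint by (auto simp: disjoint_family_on_def)
    have "(\<Sum>j<k. ennreal (((1/2)^j) powr (\<alpha> - 1) * H j) * indicator (dyadic_cell j) s) =
       (\<Sum>j<k. if j = i then ennreal (((1/2)^j) powr (\<alpha> - 1) * H j) else 0)"
      by (intro sum.cong) (auto simp: indicator_def eq)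
    also have "\<dots> \<le> ennreal (s powr (\<alpha> - 1)) * indicator {t<..} s * (\<Sum>j. ennreal (H j) * indicator (dyadic_cell j) s)"
    proof (cases "i < k")
      case True
      have "(1/2::real)^k \<le> (1/2)^(Suc i)" using True by (intro power_decreasing) auto
      then have ts: "t < s" using t i unfolding dyadic_cell_def by auto
      have "s \<le> (1/2)^i" using i by (simp add: dyadic_cell_def)
      then have "((1/2)^i) powr (\<alpha> - 1) \<le> s powr (\<alpha> - 1)" using \<alpha> \<open>0 < s\<close> by (intro powr_mono2') auto
      then have "ennreal (((1/2)^i) powr (\<alpha> - 1) * H i) \<le> ennreal (s powr (\<alpha> - 1)) * ennreal (H i)"
        using H[of i] by (simp add: ennreal_leI mult_right_mono flip: ennreal_mult)
      then show ?thesis using True ts by (simp add: suminf_indicator_disjoint[OF dyadic_cell_disjoint i])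
    qed simp
    finally show "(\<Sum>j<k. ennreal (((1/2)^j) powr (\<alpha> - 1) * H j) * indicator (dyadic_cell j) s)
      \<le> ennreal (s powr (\<alpha> - 1)) * indicator {t<..} s * (\<Sum>j. ennreal (H j) * indicator (dyadic_cell j) s)" .
  qed
  finally show ?thesis .
qed

text \<open>The counterpart of the lower bound: cell k is kept whole, and the weight is taken at the
  left ends of the cells.\<close>

lemma hardy_upper_bound:
  assumes \<alpha>: "\<alpha> \<le> 1" and t: "t \<in> dyadic_cell k" and f: "f \<in> borel_measurable I01"
  shows "hardy \<alpha> f t \<le> (\<Sum>j\<le>k. ennreal (((1/2)^(Suc j)) powr (\<alpha> - 1)) * (\<integral>\<^sup>+s. f s * indicator (dyadic_cell j) s \<partial>I01))"
proof -
  note [measurable] = f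
  have "hardy \<alpha> f t \<le> (\<integral>\<^sup>+s. (\<Sum>j\<le>k. ennreal (((1/2)^(Suc j)) powr (\<alpha> - 1)) * (f s * indicator (dyadic_cell j) s)) \<partial>I01)"
    unfolding hardy_def
  proof (rule nn_integral_mono)
    fix s assume "s \<in> space I01"
    then have s: "0 < s" "s < 1" by auto
    then obtain i where i: "s \<in> dyadic_cell i" by (rule dyadic_cell_cover)
    show "ennreal (s powr (\<alpha> - 1)) * indicator {t<..} s * f s \<le> (\<Sum>j\<le>k. ennreal (((1/2)^(Suc j)) powr (\<alpha> - 1)) * (f s * indicator (dyadic_cell j) s))"
    proof (cases "t < s")
      case True
      have "i \<le> k"
      proof (rule ccontr)
        assume "\<not> i \<le> k"
        then have "(1/2::real)^i \<le> (1/2)^(Suc k)" by (intro power_decreasing) auto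
        then show False using True t i unfolding dyadic_cell_def by auto
      qed
      have "(1/2)^(Suc i) \<le> s" using i unfolding dyadic_cell_def by simp
      then have "s powr (\<alpha> - 1) \<le> ((1/2)^(Suc i)) powr (\<alpha> - 1)"
        using \<alpha> by (intro powr_mono2') auto
      then have "ennreal (s powr (\<alpha> - 1)) * f s \<le> ennreal (((1/2)^(Suc i)) powr (\<alpha> - 1)) * (f s * indicator (dyadic_cell i) s)"
        using i by (simp add: ennreal_leI mult_right_mono del: power_Suc)
      also have "\<dots> \<le> (\<Sum>j\<le>k. ennreal (((1/2)^(Suc j)) powr (\<alpha> - 1)) * (f s * indicator (dyadic_cell j) s))"
        using \<open>i \<le> k\<close> by (intro member_le_sum) auto
      finally show ?thesis using True by simp
    qed simp
  qed
  also have "\<dots> = (\<Sum>j\<le>k. ennreal (((1/2)^(Suc j)) powr (\<alpha> - 1)) * (\<integral>\<^sup>+s. f s * indicator (dyadic_cell j) s \<partial>I01))"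
    by (subst nn_integral_sum) (auto simp: nn_integral_cmult)
  finally show ?thesis .
qed

section \<open>From the Hardy operator to the Sobolev inequality\<close>

lemma lebesgue_on_prob:
  fixes \<Omega> :: "(real^'n::finite) set"
  assumes "open \<Omega>" "emeasure lebesgue \<Omega> = 1"
  shows "emeasure (lebesgue_on \<Omega>) (space (lebesgue_on \<Omega>)) = 1" "finite_measure (lebesgue_on \<Omega>)" "\<Omega> \<in> sets lebesgue"
proof -
  show 1: "\<Omega> \<in> sets lebesgue" using assms by auto
  show 2: "emeasure (lebesgue_on \<Omega>) (space (lebesgue_on \<Omega>)) = 1"
    using assms 1 by (subst emeasure_restrict_space) auto
  show "finite_measure (lebesgue_on \<Omega>)" by (rule finite_measureI) (simp only: 2, simp)
qed

text \<open>Chebyshev's inequality for the exponent p = n/(n - 1); since p (1 - \<alpha>) = 1, the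
  level appears to the first power. It is meant for truncations, which take their extreme values on
  sets of controlled measure.\<close>

lemma poincare_weak_type:
  fixes \<Omega> :: "(real^'n::finite) set"
  assumes n: "CARD('n) \<ge> 2" and \<alpha>: "\<alpha> = 1 / real CARD('n)"
    and \<Omega>: "open \<Omega>" "emeasure lebesgue \<Omega> = 1" and P: "sobolev_poincare \<Omega>"
  obtains C :: real where "0 < C" "\<And>f Df l. (f, Df) \<in> sobolev_W1 \<Omega> (L1_norm (lebesgue_on \<Omega>)) \<Longrightarrow> 0 \<le> l \<Longrightarrow>
    l * (measure (lebesgue_on \<Omega>) {x \<in> \<Omega>. l \<le> \<bar>f x - mean \<Omega> f\<bar>}) powr (1 - \<alpha>) \<le> C * (LINT x|lebesgue_on \<Omega>. norm (Df x))"
proof -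
  let ?n = "real CARD('n)"
  let ?p = "?n / (?n - 1)"
  have n2: "2 \<le> ?n" using n by simp
  have q: "(?n - 1) / ?n = 1 - \<alpha>" using n2 by (simp add: \<alpha> field_simps)
  have p: "0 < ?p" "?p * (1 - \<alpha>) = 1" using n2 by (auto simp: \<alpha> field_simps)
  interpret finite_measure "lebesgue_on \<Omega>" by (rule lebesgue_on_prob(2)[OF \<Omega>])
  obtain C where C: "0 < C" "\<And>f Df. (f, Df) \<in> sobolev_W1 \<Omega> (L1_norm (lebesgue_on \<Omega>)) \<Longrightarrow>
       integrable (lebesgue_on \<Omega>) (\<lambda>x. \<bar>f x - mean \<Omega> f\<bar> powr ?p) \<and>
       (LINT x|lebesgue_on \<Omega>. \<bar>f x - mean \<Omega> f\<bar> powr ?p) powr ((?n - 1) / ?n) \<le> C * (LINT x|lebesgue_on \<Omega>. norm (Df x))"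
    using P unfolding sobolev_poincare_def Let_def by blast
  show thesis
  proof (rule that[OF C(1)])
    fix f Df and l :: real assume W: "(f, Df) \<in> sobolev_W1 \<Omega> (L1_norm (lebesgue_on \<Omega>))" and l: "0 \<le> l"
    have [measurable]: "f \<in> borel_measurable (lebesgue_on \<Omega>)" using W by (auto simp: sobolev_W1_def fspace_def)
    let ?S = "{x \<in> \<Omega>. l \<le> \<bar>f x - mean \<Omega> f\<bar>}"
    have "{x \<in> space (lebesgue_on \<Omega>). l \<le> \<bar>f x - mean \<Omega> f\<bar>} \<in> sets (lebesgue_on \<Omega>)" by measurable
    then have S: "?S \<in> sets (lebesgue_on \<Omega>)" by simp
    have int: "integrable (lebesgue_on \<Omega>) (\<lambda>x. \<bar>f x - mean \<Omega> f\<bar> powr ?p)" using C(2)[OF W] by simp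
    have "l powr ?p * measure (lebesgue_on \<Omega>) ?S = (LINT x|lebesgue_on \<Omega>. l powr ?p * indicator ?S x)"
    proof -
      have "?S \<inter> \<Omega> = ?S" by auto
      then show ?thesis using S by simp
    qed
    also have "\<dots> \<le> (LINT x|lebesgue_on \<Omega>. \<bar>f x - mean \<Omega> f\<bar> powr ?p)"
    proof (rule integral_mono[OF _ int])
      show "integrable (lebesgue_on \<Omega>) (\<lambda>x. l powr ?p * indicator ?S x)"
        using S by (intro integrable_mult_right integrable_real_indicator) (auto simp: less_top[symmetric])
      show "l powr ?p * indicator ?S x \<le> \<bar>f x - mean \<Omega> f\<bar> powr ?p" for x
        using l p(1) by (auto simp: indicator_def intro!: powr_mono2)
    qed
    finally have "(l powr ?p * measure (lebesgue_on \<Omega>) ?S) powr (1 - \<alpha>) \<le> (LINT x|lebesgue_on \<Omega>. \<bar>f x - mean \<Omega> f\<bar> powr ?p) powr (1 - \<alpha>)"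
      using n2 by (intro powr_mono2) (auto simp: \<alpha>)
    also have "\<dots> \<le> C * (LINT x|lebesgue_on \<Omega>. norm (Df x))" using C(2)[OF W] by (simp add: q)
    also have "(l powr ?p * measure (lebesgue_on \<Omega>) ?S) powr (1 - \<alpha>) = l * (measure (lebesgue_on \<Omega>) ?S) powr (1 - \<alpha>)"
      using l p by (simp add: powr_mult powr_powr)
    finally show "l * (measure (lebesgue_on \<Omega>) ?S) powr (1 - \<alpha>) \<le> C * (LINT x|lebesgue_on \<Omega>. norm (Df x))" .
  qed
qed

lemma truncation_in_W11:
  fixes \<Omega> :: "(real^'n::finite) set"
  assumes \<Omega>: "open \<Omega>" "emeasure lebesgue \<Omega> = 1"
    and W: "(f, Df) \<in> sobolev_W1 \<Omega> (L1_norm (lebesgue_on \<Omega>))" and ab: "0 \<le> a" "a \<le> b"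
  obtains G where "((\<lambda>x. max 0 (\<bar>f x - c\<bar> - a) - max 0 (\<bar>f x - c\<bar> - b)), G) \<in> sobolev_W1 \<Omega> (L1_norm (lebesgue_on \<Omega>))"
    "\<And>x. norm (G x) = (if a < \<bar>f x - c\<bar> \<and> \<bar>f x - c\<bar> \<le> b then norm (Df x) else 0)"
proof -
  let ?T = "\<lambda>x. max 0 (\<bar>f x - c\<bar> - a) - max 0 (\<bar>f x - c\<bar> - b)"
  have [measurable]: "f \<in> borel_measurable (lebesgue_on \<Omega>)" "(\<lambda>x. norm (Df x)) \<in> borel_measurable (lebesgue_on \<Omega>)"
    and wg: "has_weak_gradient f Df \<Omega>" and fin: "(\<integral>\<^sup>+x. ennreal (norm (Df x)) \<partial>lebesgue_on \<Omega>) < \<infinity>"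
    using W by (auto simp: sobolev_W1_def fspace_def fnorm_def)
  obtain G where G: "has_weak_gradient ?T G \<Omega>" "\<And>x. norm (G x) = (if a < \<bar>f x - c\<bar> \<and> \<bar>f x - c\<bar> \<le> b then norm (Df x) else 0)"
    using has_weak_gradient_abs_truncation[OF \<Omega>(1) wg ab, of c] by blast
  have "(\<integral>\<^sup>+x. ennreal \<bar>?T x\<bar> \<partial>lebesgue_on \<Omega>) \<le> (\<integral>\<^sup>+x. ennreal (b - a) \<partial>lebesgue_on \<Omega>)"
    using ab by (intro nn_integral_mono ennreal_leI) auto
  also have "\<dots> < \<infinity>" using lebesgue_on_prob(1)[OF \<Omega>] by simp
  finally have "?T \<in> fspace (lebesgue_on \<Omega>) (L1_norm (lebesgue_on \<Omega>))" by (simp add: fspace_def fnorm_def)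
  moreover have "(\<lambda>x. norm (G x)) \<in> fspace (lebesgue_on \<Omega>) (L1_norm (lebesgue_on \<Omega>))"
  proof -
    have "(\<integral>\<^sup>+x. ennreal \<bar>norm (G x)\<bar> \<partial>lebesgue_on \<Omega>) \<le> (\<integral>\<^sup>+x. ennreal (norm (Df x)) \<partial>lebesgue_on \<Omega>)"
      by (intro nn_integral_mono ennreal_leI) (simp add: G(2))
    also note fin
    finally show ?thesis unfolding fspace_def fnorm_def G(2) by simp
  qed
  ultimately show thesis using that[of G] G by (auto simp: sobolev_W1_def)
qed

text \<open>
  The truncation takes each of the values 0 and b - a on a set of measure at least \<open>\<mu>\<close>, and one
  of the two values is at distance at least (b - a) / 2 from its mean.
\<close>

lemma level_gap_estimate:
  fixes \<Omega> :: "(real^'n::finite) set"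
  assumes \<Omega>: "open \<Omega>" "emeasure lebesgue \<Omega> = 1" and \<alpha>: "\<alpha> \<le> 1"
    and C: "0 < C" "\<And>f Df l. (f, Df) \<in> sobolev_W1 \<Omega> (L1_norm (lebesgue_on \<Omega>)) \<Longrightarrow> 0 \<le> l \<Longrightarrow>
      l * (measure (lebesgue_on \<Omega>) {x \<in> \<Omega>. l \<le> \<bar>f x - mean \<Omega> f\<bar>}) powr (1 - \<alpha>) \<le> C * (LINT x|lebesgue_on \<Omega>. norm (Df x))"
    and W: "(f, Df) \<in> sobolev_W1 \<Omega> (L1_norm (lebesgue_on \<Omega>))" and ab: "0 \<le> a" "a \<le> b"
    and \<mu>: "0 \<le> \<mu>" "\<mu> \<le> measure (lebesgue_on \<Omega>) {x \<in> \<Omega>. b < \<bar>f x - c\<bar>}" "\<mu> \<le> 1 - measure (lebesgue_on \<Omega>) {x \<in> \<Omega>. a < \<bar>f x - c\<bar>}"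
  shows "(b - a) / 2 * \<mu> powr (1 - \<alpha>) \<le> C * (LINT x|lebesgue_on \<Omega>. indicator {x. a < \<bar>f x - c\<bar> \<and> \<bar>f x - c\<bar> \<le> b} x * norm (Df x))"
proof -
  interpret finite_measure "lebesgue_on \<Omega>" by (rule lebesgue_on_prob(2)[OF \<Omega>])
  have m1: "measure (lebesgue_on \<Omega>) \<Omega> = 1" using lebesgue_on_prob(1)[OF \<Omega>] by (simp add: measure_def)
  have fm: "f \<in> borel_measurable (lebesgue_on \<Omega>)" using W by (auto simp: sobolev_W1_def fspace_def)
  obtain T G where T: "\<And>x. b < \<bar>f x - c\<bar> \<Longrightarrow> T x = b - a" "\<And>x. \<bar>f x - c\<bar> \<le> a \<Longrightarrow> T x = 0"
    and G: "(T, G) \<in> sobolev_W1 \<Omega> (L1_norm (lebesgue_on \<Omega>))"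
    "\<And>x. norm (G x) = (if a < \<bar>f x - c\<bar> \<and> \<bar>f x - c\<bar> \<le> b then norm (Df x) else 0)"
  proof -
    let ?T = "\<lambda>x. max 0 (\<bar>f x - c\<bar> - a) - max 0 (\<bar>f x - c\<bar> - b)"
    obtain G where G: "(?T, G) \<in> sobolev_W1 \<Omega> (L1_norm (lebesgue_on \<Omega>))"
      "\<And>x. norm (G x) = (if a < \<bar>f x - c\<bar> \<and> \<bar>f x - c\<bar> \<le> b then norm (Df x) else 0)"
      using truncation_in_W11[OF \<Omega> W ab] by blast
    show thesis by (rule that[OF _ _ G]) (use ab in auto)
  qed
  have Tm: "T \<in> borel_measurable (lebesgue_on \<Omega>)" using G(1) by (auto simp: sobolev_W1_def fspace_def)
  define \<tau> where "\<tau> = mean \<Omega> T"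
  let ?l = "(b - a) / 2"
  let ?S = "{x \<in> \<Omega>. ?l \<le> \<bar>T x - \<tau>\<bar>}"
  have "{x \<in> space (lebesgue_on \<Omega>). ?l \<le> \<bar>T x - \<tau>\<bar>} \<in> sets (lebesgue_on \<Omega>)" using Tm by measurable
  then have Sm: "?S \<in> sets (lebesgue_on \<Omega>)" by simp
  have "{x \<in> space (lebesgue_on \<Omega>). a < \<bar>f x - c\<bar>} \<in> sets (lebesgue_on \<Omega>)" using fm by measurable
  then have am: "{x \<in> \<Omega>. a < \<bar>f x - c\<bar>} \<in> sets (lebesgue_on \<Omega>)" by simp
  have "\<mu> \<le> measure (lebesgue_on \<Omega>) ?S"
  proof (cases "\<tau> \<le> ?l")
    case True
    have "{x \<in> \<Omega>. b < \<bar>f x - c\<bar>} \<subseteq> ?S"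
    proof
      fix x assume x: "x \<in> {x \<in> \<Omega>. b < \<bar>f x - c\<bar>}"
      then have "T x = b - a" using T(1) by simp
      then have "?l \<le> T x - \<tau>" using True by (simp add: field_simps)
      then have "?l \<le> \<bar>T x - \<tau>\<bar>" by (rule order_trans[OF _ abs_ge_self])
      then show "x \<in> ?S" using x by simp
    qed
    then have "measure (lebesgue_on \<Omega>) {x \<in> \<Omega>. b < \<bar>f x - c\<bar>} \<le> measure (lebesgue_on \<Omega>) ?S"
      by (rule finite_measure_mono[OF _ Sm])
    then show ?thesis using \<mu> by simp
  next
    case False
    have "\<Omega> - {x \<in> \<Omega>. a < \<bar>f x - c\<bar>} \<subseteq> ?S"
    proof
      fix x assume x: "x \<in> \<Omega> - {x \<in> \<Omega>. a < \<bar>f x - c\<bar>}"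
      then have "\<bar>f x - c\<bar> \<le> a" by auto
      then have "T x = 0" by (rule T(2))
      then have "?l \<le> \<bar>T x - \<tau>\<bar>" using False by simp
      then show "x \<in> ?S" using x by simp
    qed
    then have "measure (lebesgue_on \<Omega>) (\<Omega> - {x \<in> \<Omega>. a < \<bar>f x - c\<bar>}) \<le> measure (lebesgue_on \<Omega>) ?S"
      by (rule finite_measure_mono[OF _ Sm])
    moreover have "measure (lebesgue_on \<Omega>) (\<Omega> - {x \<in> \<Omega>. a < \<bar>f x - c\<bar>}) = 1 - measure (lebesgue_on \<Omega>) {x \<in> \<Omega>. a < \<bar>f x - c\<bar>}"
      using finite_measure_compl[OF am] m1 by simp
    ultimately show ?thesis using \<mu> by simp
  qed
  then have "?l * \<mu> powr (1 - \<alpha>) \<le> ?l * (measure (lebesgue_on \<Omega>) ?S) powr (1 - \<alpha>)"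
    using ab \<mu> \<alpha> by (intro mult_left_mono powr_mono2) auto
  also have "\<dots> \<le> C * (LINT x|lebesgue_on \<Omega>. norm (G x))" using C(2)[OF G(1), of ?l] ab by (simp add: \<tau>_def)
  also have "(\<lambda>x. norm (G x)) = (\<lambda>x. indicator {x. a < \<bar>f x - c\<bar> \<and> \<bar>f x - c\<bar> \<le> b} x * norm (Df x))"
    by (auto simp: fun_eq_iff G(2))
  finally show ?thesis .
qed

definition sobolev_bounded :: "(real^'n::finite) set \<Rightarrow> (real^'n) fun_norm \<Rightarrow> (real^'n) fun_norm \<Rightarrow> bool" where
  "sobolev_bounded \<Omega> \<rho>X \<rho>Y \<longleftrightarrow> (\<exists>C::real. C > 0 \<and> (\<forall>(f, Df) \<in> sobolev_W1 \<Omega> \<rho>X.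
            fnorm \<rho>Y (\<lambda>x. f x - mean \<Omega> f) \<le> ennreal C * fnorm \<rho>X (\<lambda>x. norm (Df x))))"

text \<open>E k is the strip between the values of the rearrangement of u at 2^-(k+1) and at
  2^-(k+2). The mass of the gradient on E k is spread evenly over dyadic cell k, whose length
  2^-(k+1) explains the factor in H. The increments of the rearrangement up to the cell of t then
  add up to a discrete Hardy operator applied to H.\<close>

lemma rearr_gradient_bound:
  fixes \<Omega> :: "(real^'n::finite) set" and f :: "real^'n \<Rightarrow> real" and Df :: "real^'n \<Rightarrow> real^'n" and c :: real
  defines "u \<equiv> \<lambda>x. ennreal \<bar>f x - c\<bar>"
  defines "A \<equiv> \<lambda>k. enn2real (rearr (lebesgue_on \<Omega>) u ((1/2)^(Suc k)))"
  defines "E \<equiv> \<lambda>k. {x \<in> \<Omega>. A k < \<bar>f x - c\<bar> \<and> \<bar>f x - c\<bar> \<le> A (Suc k)}"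
  defines "H \<equiv> \<lambda>k. 2 ^ Suc k * (LINT x|lebesgue_on \<Omega>. indicator (E k) x * norm (Df x))"
  assumes \<Omega>: "open \<Omega>" "emeasure lebesgue \<Omega> = 1" and \<alpha>: "0 \<le> \<alpha>" "\<alpha> \<le> 1"
    and C: "0 < C" "\<And>f Df l. (f, Df) \<in> sobolev_W1 \<Omega> (L1_norm (lebesgue_on \<Omega>)) \<Longrightarrow> 0 \<le> l \<Longrightarrow>
      l * (measure (lebesgue_on \<Omega>) {x \<in> \<Omega>. l \<le> \<bar>f x - mean \<Omega> f\<bar>}) powr (1 - \<alpha>) \<le> C * (LINT x|lebesgue_on \<Omega>. norm (Df x))"
    and W: "(f, Df) \<in> sobolev_W1 \<Omega> (L1_norm (lebesgue_on \<Omega>))" and t: "0 < t" "t < 1"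
  shows "rearr (lebesgue_on \<Omega>) u t \<le> ennreal (A 0) + ennreal (8 * C) * hardy \<alpha> (\<lambda>s. \<Sum>j. ennreal (H j) * indicator (dyadic_cell j) s) t"
proof -
  let ?M = "lebesgue_on \<Omega>"
  interpret finite_measure ?M by (rule lebesgue_on_prob(2)[OF \<Omega>])
  note p1 = lebesgue_on_prob(1)[OF \<Omega>]
  have fm [measurable]: "f \<in> borel_measurable ?M" "(\<lambda>x. norm (Df x)) \<in> borel_measurable ?M"
    and fin: "(\<integral>\<^sup>+x. ennreal (norm (Df x)) \<partial>?M) < \<infinity>"
    using W by (auto simp: sobolev_W1_def fspace_def fnorm_def)
  have intD: "integrable ?M (\<lambda>x. norm (Df x))" using fin by (intro integrableI_bounded) auto
  have um: "u \<in> borel_measurable ?M" unfolding u_def by measurable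
  have uAE: "AE x in ?M. u x < \<infinity>" by (simp add: u_def)
  note uf = um p1 uAE
  have A_eq: "ennreal (A k) = rearr ?M u ((1/2)^(Suc k))" for k
    unfolding A_def by (rule ennreal_enn2real_rearr[OF uf]) simp
  have A0: "0 \<le> A k" for k by (simp add: A_def)
  have lev: "distr_fun ?M u (ennreal b) = ennreal (measure ?M {x \<in> \<Omega>. b < \<bar>f x - c\<bar>})" if "0 \<le> b" for b
    using that unfolding distr_fun_def u_def by (simp add: ennreal_less_iff emeasure_eq_measure)
  have upper: "measure ?M {x \<in> \<Omega>. A k < \<bar>f x - c\<bar>} \<le> (1/2)^(Suc k)" for k
  proof -
    have "ennreal (measure ?M {x \<in> \<Omega>. A k < \<bar>f x - c\<bar>}) \<le> ennreal ((1/2)^(Suc k))"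
      using distr_fun_rearr_le[OF um, of "(1/2)^(Suc k)"] by (simp only: lev[OF A0, symmetric] A_eq)
    then show ?thesis by (simp del: power_Suc)
  qed
  have lower: "(1/2)^(Suc k) \<le> measure ?M {x \<in> \<Omega>. b < \<bar>f x - c\<bar>}" if "0 \<le> b" "b < A k" for b k
  proof -
    have "ennreal b < rearr ?M u ((1/2)^(Suc k))" unfolding A_eq[symmetric] using that by (intro ennreal_lessI) auto
    then have "ennreal ((1/2)^(Suc k)) < ennreal (measure ?M {x \<in> \<Omega>. b < \<bar>f x - c\<bar>})"
      by (simp only: less_rearr_iff[OF um] lev[OF that(1)])
    then show ?thesis by (simp add: ennreal_less_iff del: power_Suc)
  qed
  have Em: "E k \<in> sets ?M" for k
  proof -
    have "{x \<in> space ?M. A k < \<bar>f x - c\<bar> \<and> \<bar>f x - c\<bar> \<le> A (Suc k)} \<in> sets ?M" by measurable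
    then show ?thesis by (simp add: E_def)
  qed
  have intE: "integrable ?M (\<lambda>x. indicator (E k) x * norm (Df x))" for k
    using integrable_mult_bounded[OF intD, of "indicator (E k)" 1] Em[of k] by (simp add: mult.commute indicator_def)
  have H0: "0 \<le> H k" for k unfolding H_def by (intro mult_nonneg_nonneg integral_nonneg_AE) auto
  \<comment> \<open>The factor 8 is 2, from the half height of the truncation, times 4, from (1/4)
    powr (1 - \<alpha>) \<ge> 1/4: the level sets are only known to have measure at least 2^-(k+2),
    while the weight is taken at 2^-k.\<close>
  have gap: "A (Suc k) - A k \<le> 8 * C * (((1/2)^k) powr (\<alpha> - 1) * (H k * (1/2)^(Suc k)))" for k
  proof -
    let ?G = "LINT x|?M. indicator (E k) x * norm (Df x)"
    have G0: "0 \<le> ?G" by (intro integral_nonneg_AE) auto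
    have HG: "H k * (1/2)^(Suc k) = ?G" by (simp add: H_def power_divide)
    define q where "q = ((1/2::real)^k) powr (1 - \<alpha>)"
    have q0: "0 < q" by (simp add: q_def)
    have qinv: "((1/2::real)^k) powr (\<alpha> - 1) = 1 / q" unfolding q_def by (subst powr_minus_divide[symmetric]) simp
    \<comment> \<open>Levels strictly below \<open>A (Suc k)\<close> are exceeded on a set of
      measure at least 2^-(k+2); the level itself may be exceeded on a smaller set, hence the
      passage to the limit in b.\<close>
    have "b \<le> A k + 8 * C * (1 / q * ?G)" if b: "b < A (Suc k)" for b
    proof (cases "A k \<le> b")
      case True
      have b0: "0 \<le> b" using True A0[of k] by linarith
      \<comment> \<open>The truncation vanishes on a set of measure at least 1 - 2^-(k+1), which is
        at least 1/2.\<close>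
      have "(1/2::real)^(Suc (Suc k)) \<le> 1 - measure ?M {x \<in> \<Omega>. A k < \<bar>f x - c\<bar>}"
      proof -
        have "(1/2::real)^k \<le> 1" by (simp add: power_le_one)
        then have "(1/2::real)^(Suc (Suc k)) \<le> 1/2" "(1/2::real)^(Suc k) \<le> 1/2" by simp_all
        then show ?thesis using upper[of k] by linarith
      qed
      then have "(b - A k) / 2 * ((1/2)^(Suc (Suc k))) powr (1 - \<alpha>) \<le>
        C * (LINT x|?M. indicator {x. A k < \<bar>f x - c\<bar> \<and> \<bar>f x - c\<bar> \<le> b} x * norm (Df x))"
        by (intro level_gap_estimate[OF \<Omega> \<alpha>(2) C W A0 True _ lower[OF b0 b]]) auto
      also have "(LINT x|?M. indicator {x. A k < \<bar>f x - c\<bar> \<and> \<bar>f x - c\<bar> \<le> b} x * norm (Df x)) \<le> ?G"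
      proof (rule integral_mono[OF _ intE])
        have "{x \<in> space ?M. A k < \<bar>f x - c\<bar> \<and> \<bar>f x - c\<bar> \<le> b} \<in> sets ?M" by measurable
        then have "integrable ?M (\<lambda>x. norm (Df x) * indicator {x \<in> \<Omega>. A k < \<bar>f x - c\<bar> \<and> \<bar>f x - c\<bar> \<le> b} x)"
          by (intro integrable_mult_bounded[OF intD, where B = 1] borel_measurable_indicator) (simp_all add: indicator_def)
        then show "integrable ?M (\<lambda>x. indicator {x. A k < \<bar>f x - c\<bar> \<and> \<bar>f x - c\<bar> \<le> b} x * norm (Df x))"
          by (rule Bochner_Integration.integrable_cong[OF refl, THEN iffD1, rotated]) (auto simp: indicator_def)
        show "indicator {x. A k < \<bar>f x - c\<bar> \<and> \<bar>f x - c\<bar> \<le> b} x * norm (Df x) \<le> indicator (E k) x * norm (Df x)"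
          if "x \<in> space ?M" for x using that b by (auto simp: indicator_def E_def)
      qed
      finally have 1: "(b - A k) / 2 * ((1/2)^(Suc (Suc k))) powr (1 - \<alpha>) \<le> C * ?G" using C(1) by simp
      have "((1/2)^(Suc (Suc k))) powr (1 - \<alpha>) = q * (1/4) powr (1 - \<alpha>)"
        by (simp add: q_def powr_mult[symmetric])
      moreover have "(1/4 :: real) powr 1 \<le> (1/4) powr (1 - \<alpha>)" using \<alpha> by (intro powr_mono') auto
      ultimately have "q / 4 \<le> ((1/2)^(Suc (Suc k))) powr (1 - \<alpha>)"
        using mult_left_mono[of "1/4" "(1/4) powr (1 - \<alpha>)" q] q0 by simp
      then have "(b - A k) / 2 * (q / 4) \<le> (b - A k) / 2 * ((1/2)^(Suc (Suc k))) powr (1 - \<alpha>)"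
        using True by (intro mult_left_mono) auto
      with 1 have "(b - A k) / 2 * (q / 4) \<le> C * ?G" by linarith
      then have "b - A k \<le> 8 * C * (1 / q * ?G)" using q0 by (simp add: field_simps)
      then show ?thesis by simp
    next
      case False
      have "0 \<le> 8 * C * (1 / q * ?G)" using C(1) q0 G0 by simp
      then show ?thesis using False by linarith
    qed
    then have "A (Suc k) \<le> A k + 8 * C * (1 / q * ?G)" by (rule dense_le)
    then show ?thesis unfolding HG qinv by linarith
  qed
  obtain k where k: "t \<in> dyadic_cell k" using dyadic_cell_cover[OF t] by blast
  \<comment> \<open>Telescoping down to the reference level \<open>A 0\<close>, the value of the
    rearrangement at 1/2. The gaps carry no information on it, so it stays in the bound.\<close>
  have sumA: "A k = A 0 + (\<Sum>j<k. A (Suc j) - A j)" by (simp add: sum_lessThan_telescope)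
  have "rearr ?M u t \<le> rearr ?M u ((1/2)^(Suc k))" using k by (intro rearr_antimono) (simp add: dyadic_cell_def)
  also have "\<dots> = ennreal (A k)" by (rule A_eq[symmetric])
  also have "\<dots> \<le> ennreal (A 0 + (\<Sum>j<k. 8 * C * (((1/2)^j) powr (\<alpha> - 1) * (H j * (1/2)^(Suc j)))))"
    unfolding sumA by (intro ennreal_leI add_left_mono sum_mono gap)
  also have "\<dots> = ennreal (A 0) + ennreal (8 * C) * ennreal (\<Sum>j<k. ((1/2)^j) powr (\<alpha> - 1) * (H j * (1/2)^(Suc j)))"
  proof -
    have "0 \<le> (\<Sum>j<k. ((1/2)^j) powr (\<alpha> - 1) * (H j * (1/2)^(Suc j)))"
      by (intro sum_nonneg mult_nonneg_nonneg H0) auto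
    then show ?thesis using A0[of 0] C(1) unfolding sum_distrib_left[symmetric]
      by (subst ennreal_plus, simp, simp, subst ennreal_mult, simp_all)
  qed
  also have "ennreal (\<Sum>j<k. ((1/2)^j) powr (\<alpha> - 1) * (H j * (1/2)^(Suc j))) =
      (\<Sum>j<k. ennreal (((1/2)^j) powr (\<alpha> - 1) * (H j * (1/2)^(Suc j))))"
    by (intro sum_ennreal[symmetric] mult_nonneg_nonneg H0) auto
  also have "ennreal (A 0) + ennreal (8 * C) * (\<Sum>j<k. ennreal (((1/2)^j) powr (\<alpha> - 1) * (H j * (1/2)^(Suc j)))) \<le>
      ennreal (A 0) + ennreal (8 * C) * hardy \<alpha> (\<lambda>s. \<Sum>j. ennreal (H j) * indicator (dyadic_cell j) s) t"
    by (intro add_left_mono mult_left_mono hardy_lower_bound \<alpha> k H0) auto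
  finally show ?thesis .
qed

theorem hardy_bounded_imp_sobolev_bounded:
  fixes \<Omega> :: "(real^'n::finite) set"
  assumes n: "CARD('n) \<ge> 2" and \<alpha>: "\<alpha> = 1 / real CARD('n)"
    and \<Omega>: "open \<Omega>" "emeasure lebesgue \<Omega> = 1" and P: "sobolev_poincare \<Omega>"
    and X: "ri_norm (lebesgue_on \<Omega>) \<rho>X" and Xh: "represents (lebesgue_on \<Omega>) \<rho>Xh \<rho>X" and Yh: "represents (lebesgue_on \<Omega>) \<rho>Yh \<rho>Y"
    and Hd: "hardy_bounded \<alpha> \<rho>Xh \<rho>Yh"
  shows "sobolev_bounded \<Omega> \<rho>X \<rho>Y"
proof -
  let ?M = "lebesgue_on \<Omega>"
  interpret finite_measure ?M by (rule lebesgue_on_prob(2)[OF \<Omega>])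
  note p1 = lebesgue_on_prob(1)[OF \<Omega>]
  have finM: "emeasure ?M (space ?M) < \<infinity>" unfolding p1 by simp
  have fin1: "emeasure I01 (space I01) < \<infinity>" by simp
  have \<alpha>01: "0 \<le> \<alpha>" "\<alpha> \<le> 1" using n by (auto simp: \<alpha>)
  note bX = ri_bfn[OF X]
  have riX: "ri_norm I01 \<rho>Xh" and riY: "ri_norm I01 \<rho>Yh"
    and repX: "\<And>f. f \<in> borel_measurable ?M \<Longrightarrow> \<rho>X f = \<rho>Xh (rearr ?M f)"
    and repY: "\<And>f. f \<in> borel_measurable ?M \<Longrightarrow> \<rho>Y f = \<rho>Yh (rearr ?M f)"
    using Xh Yh by (auto simp: represents_def)
  note bYh = ri_bfn[OF riY]
  obtain C :: real where C: "0 < C" "\<And>f Df l. (f, Df) \<in> sobolev_W1 \<Omega> (L1_norm ?M) \<Longrightarrow> 0 \<le> l \<Longrightarrow>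
    l * (measure ?M {x \<in> \<Omega>. l \<le> \<bar>f x - mean \<Omega> f\<bar>}) powr (1 - \<alpha>) \<le> C * (LINT x|?M. norm (Df x))"
    using poincare_weak_type[OF n \<alpha> \<Omega> P] by blast
  obtain c1 :: real where c1: "0 < c1" "\<And>f. f \<in> borel_measurable ?M \<Longrightarrow> (\<integral>\<^sup>+x. f x \<partial>?M) \<le> ennreal c1 * \<rho>X f"
    using bfn_L1[OF bX finM] by blast
  obtain C2 :: real where C2: "0 < C2" "\<And>k. k \<in> borel_measurable I01 \<Longrightarrow> \<rho>Yh (hardy \<alpha> k) \<le> ennreal C2 * \<rho>Xh k"
    using Hd by (auto simp: hardy_bounded_def)
  obtain c where c: "\<rho>Yh (\<lambda>x. 1) = ennreal c" "0 \<le> c"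
    using bfn_one_finite[OF bYh fin1] by (cases "\<rho>Yh (\<lambda>x. 1)") auto
  have "fnorm \<rho>Y (\<lambda>x. f x - mean \<Omega> f) \<le> ennreal (2 * C * c1 * c + 8 * C * C2) * fnorm \<rho>X (\<lambda>x. norm (Df x))"
    if WX: "(f, Df) \<in> sobolev_W1 \<Omega> \<rho>X" for f Df
  proof -
    have fm [measurable]: "f \<in> borel_measurable ?M" "(\<lambda>x. norm (Df x)) \<in> borel_measurable ?M"
      and fX: "fnorm \<rho>X f < \<infinity>" and DX: "\<rho>X (\<lambda>x. ennreal (norm (Df x))) < \<infinity>" and wg: "has_weak_gradient f Df \<Omega>"
      using WX by (auto simp: sobolev_W1_def fspace_def fnorm_def)
    let ?g = "\<lambda>x. ennreal (norm (Df x))"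
    have gm: "?g \<in> borel_measurable ?M" by measurable
    have "(\<integral>\<^sup>+x. ennreal \<bar>f x\<bar> \<partial>?M) < \<infinity>"
      using c1(2)[of "\<lambda>x. ennreal \<bar>f x\<bar>"] fX by (auto simp: fnorm_def ennreal_mult_less_top intro: le_less_trans)
    moreover have g1: "(\<integral>\<^sup>+x. ?g x \<partial>?M) \<le> ennreal c1 * \<rho>X ?g" by (rule c1(2)[OF gm])
    moreover have gfin: "(\<integral>\<^sup>+x. ?g x \<partial>?M) < \<infinity>"
    proof -
      have "ennreal c1 * \<rho>X ?g < \<infinity>" using DX by (simp add: ennreal_mult_less_top)
      with g1 show ?thesis by (rule le_less_trans)
    qed
    \<comment> \<open>The space embeds into L1, which makes the Poincare inequality for L1 gradients
      available.\<close>
    ultimately have W: "(f, Df) \<in> sobolev_W1 \<Omega> (L1_norm ?M)"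
      using wg by (auto simp: sobolev_W1_def fspace_def fnorm_def)
    have intD: "integrable ?M (\<lambda>x. norm (Df x))" using gfin by (intro integrableI_bounded) auto
    have D_eq: "ennreal (LINT x|?M. norm (Df x)) = (\<integral>\<^sup>+x. ?g x \<partial>?M)"
      using intD by (intro nn_integral_eq_integral[symmetric]) auto
    define u where "u = (\<lambda>x. ennreal \<bar>f x - mean \<Omega> f\<bar>)"
    define A where "A k = enn2real (rearr ?M u ((1/2)^(Suc k)))" for k
    define E where "E k = {x \<in> \<Omega>. A k < \<bar>f x - mean \<Omega> f\<bar> \<and> \<bar>f x - mean \<Omega> f\<bar> \<le> A (Suc k)}" for k
    define H where "H k = 2 ^ Suc k * (LINT x|?M. indicator (E k) x * norm (Df x))" for k
    define h where "h s = (\<Sum>j. ennreal (H j) * indicator (dyadic_cell j) s)" for s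
    have um: "u \<in> borel_measurable ?M" unfolding u_def by measurable
    have uAE: "AE x in ?M. u x < \<infinity>" by (simp add: u_def)
    note bound = rearr_gradient_bound[OF \<Omega> \<alpha>01 C W, of _ "mean \<Omega> f", folded u_def, folded A_def, folded E_def, folded H_def, folded h_def]
    have A_eq: "ennreal (A k) = rearr ?M u ((1/2)^(Suc k))" for k
      unfolding A_def by (rule ennreal_enn2real_rearr[OF um p1 uAE]) simp
    have A0: "0 \<le> A k" for k by (simp add: A_def)
    have Amono: "A j \<le> A k" if "j \<le> k" for j k
    proof -
      have "ennreal (A j) \<le> ennreal (A k)" unfolding A_eq using that by (intro rearr_antimono power_decreasing) auto
      then show ?thesis using A0 by simp
    qed
    have E: "E k \<in> sets ?M" for k
    proof -
      have "{x \<in> space ?M. A k < \<bar>f x - mean \<Omega> f\<bar> \<and> \<bar>f x - mean \<Omega> f\<bar> \<le> A (Suc k)} \<in> sets ?M" by measurable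
      then show ?thesis by (simp add: E_def)
    qed
    have Edisj: "disjoint_family E"
    proof -
      have "E i \<inter> E j = {}" if "i < j" for i j using Amono[of "Suc i" j] that by (auto simp: E_def)
      then show ?thesis unfolding disjoint_family_on_def by (metis inf_commute linorder_neqE_nat)
    qed
    \<comment> \<open>The strip lies in the superlevel set of u for its rearranged value at
      2^-(k+1), hence is no larger than dyadic cell k, as the averaging bound demands.\<close>
    have Emeas: "emeasure ?M (E k) \<le> ennreal ((1/2)^(Suc k))" for k
    proof -
      have "emeasure ?M (E k) \<le> distr_fun ?M u (ennreal (A k))"
        unfolding distr_fun_def
      proof (rule emeasure_mono)
        show "E k \<subseteq> {x \<in> space ?M. ennreal (A k) < u x}" using A0 by (auto simp: E_def u_def ennreal_less_iff)
        show "{x \<in> space ?M. ennreal (A k) < u x} \<in> sets ?M" using um by measurable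
      qed
      also have "\<dots> \<le> ennreal ((1/2)^(Suc k))" unfolding A_eq by (rule distr_fun_rearr_le[OF um])
      finally show ?thesis .
    qed
    have H0: "0 \<le> H k" for k unfolding H_def by (intro mult_nonneg_nonneg integral_nonneg_AE) auto
    have HE: "ennreal (H k) * ennreal ((1/2)^(Suc k)) = (\<integral>\<^sup>+x. ?g x * indicator (E k) x \<partial>?M)" for k
    proof -
      have "integrable ?M (\<lambda>x. indicator (E k) x * norm (Df x))"
        using integrable_mult_bounded[OF intD, of "indicator (E k)" 1] E[of k] by (simp add: mult.commute indicator_def)
      then have "(\<integral>\<^sup>+x. ennreal (indicator (E k) x * norm (Df x)) \<partial>?M) = ennreal (LINT x|?M. indicator (E k) x * norm (Df x))"
        by (intro nn_integral_eq_integral) auto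
      moreover have "(\<integral>\<^sup>+x. ?g x * indicator (E k) x \<partial>?M) = (\<integral>\<^sup>+x. ennreal (indicator (E k) x * norm (Df x)) \<partial>?M)"
        by (intro nn_integral_cong) (auto simp: indicator_def)
      moreover have "H k * (1/2)^(Suc k) = (LINT x|?M. indicator (E k) x * norm (Df x))"
        by (simp add: H_def power_divide)
      ultimately show ?thesis using H0[of k] by (simp flip: ennreal_mult del: power_Suc)
    qed
    have hm: "h \<in> borel_measurable I01" unfolding h_def[abs_def] by measurable
    have hAE: "AE s in I01. h s < \<infinity>"
    proof (rule AE_I01_I)
      fix s :: real assume "0 < s" "s < 1"
      then obtain i where "s \<in> dyadic_cell i" by (rule dyadic_cell_cover)
      then show "h s < \<infinity>" by (simp add: h_def suminf_indicator_disjoint[OF dyadic_cell_disjoint])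
    qed
    have "\<rho>Xh h = \<rho>Xh (rearr I01 h)" by (rule ri_rearr[OF riX hm hAE, symmetric])
    also have "\<dots> \<le> \<rho>Xh (rearr ?M ?g)"
      unfolding h_def[abs_def]
    proof (rule averaging_bound[OF riX gm p1, where E = E and m = "\<lambda>j. (1/2)^(Suc j)"])
      show "emeasure I01 (dyadic_cell j) \<le> ennreal ((1/2)^(Suc j))" for j
        by (simp only: emeasure_dyadic_cell order_refl)
      show "ennreal (H j) * ennreal ((1/2)^(Suc j)) \<le> (\<integral>\<^sup>+x. ?g x * indicator (E j) x \<partial>?M)" for j
        by (simp only: HE order_refl)
    qed (use E Edisj Emeas dyadic_cell_disjoint in auto)
    also have "\<dots> = \<rho>X ?g" by (rule repX[OF gm, symmetric])
    finally have hX: "\<rho>Xh h \<le> \<rho>X ?g" .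
    \<comment> \<open>Levels below \<open>A 0\<close> are exceeded on a set of measure at least 1/2,
      and (1/2) powr (1 - \<alpha>) \<ge> 1/2 gives the factor 2. Here the weak-type inequality is
      applied to f itself.\<close>
    have A0_bound: "A 0 \<le> 2 * C * (LINT x|?M. norm (Df x))"
    proof (rule dense_le)
      fix l assume l: "l < A 0"
      have I0: "0 \<le> (LINT x|?M. norm (Df x))" by (intro integral_nonneg_AE) auto
      show "l \<le> 2 * C * (LINT x|?M. norm (Df x))"
      proof (cases "0 \<le> l")
        case True
        have "ennreal l < rearr ?M u ((1/2)^(Suc 0))" unfolding A_eq[symmetric] using True l by (intro ennreal_lessI) auto
        then have "ennreal (1/2) < distr_fun ?M u (ennreal l)" by (simp add: less_rearr_iff[OF um])
        also have "\<dots> = emeasure ?M {x \<in> \<Omega>. l < \<bar>f x - mean \<Omega> f\<bar>}"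
          using True unfolding distr_fun_def u_def by (simp add: ennreal_less_iff)
        also have "\<dots> \<le> emeasure ?M {x \<in> \<Omega>. l \<le> \<bar>f x - mean \<Omega> f\<bar>}"
        proof (rule emeasure_mono)
          have "{x \<in> space ?M. l \<le> \<bar>f x - mean \<Omega> f\<bar>} \<in> sets ?M" by measurable
          then show "{x \<in> \<Omega>. l \<le> \<bar>f x - mean \<Omega> f\<bar>} \<in> sets ?M" by simp
        qed auto
        finally have "ennreal (1/2) < ennreal (measure ?M {x \<in> \<Omega>. l \<le> \<bar>f x - mean \<Omega> f\<bar>})"
          by (simp only: emeasure_eq_measure)
        then have half: "1/2 \<le> measure ?M {x \<in> \<Omega>. l \<le> \<bar>f x - mean \<Omega> f\<bar>}"
          by (subst (asm) ennreal_less_iff) auto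
        have "(1/2::real) powr 1 \<le> (1/2) powr (1 - \<alpha>)" using \<alpha>01 by (intro powr_mono') auto
        also have "\<dots> \<le> (measure ?M {x \<in> \<Omega>. l \<le> \<bar>f x - mean \<Omega> f\<bar>}) powr (1 - \<alpha>)"
          using half \<alpha>01 by (intro powr_mono2) auto
        finally have "l * (1/2) \<le> l * (measure ?M {x \<in> \<Omega>. l \<le> \<bar>f x - mean \<Omega> f\<bar>}) powr (1 - \<alpha>)"
          using True by (intro mult_left_mono) auto
        also have "\<dots> \<le> C * (LINT x|?M. norm (Df x))" by (rule C(2)[OF W True])
        finally show ?thesis by simp
      next
        case False
        have "0 \<le> 2 * C * (LINT x|?M. norm (Df x))" using C(1) I0 by simp
        then show ?thesis using False by linarith
      qed
    qed
    have Hm: "hardy \<alpha> h \<in> borel_measurable I01" by (rule hardy_measurable[OF hm])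
    have Hm8: "(\<lambda>t. ennreal (8 * C) * hardy \<alpha> h t) \<in> borel_measurable I01" using Hm by measurable
    have "fnorm \<rho>Y (\<lambda>x. f x - mean \<Omega> f) = \<rho>Yh (rearr ?M u)"
      unfolding fnorm_def using repY[OF um] by (simp add: u_def)
    also have "\<dots> \<le> \<rho>Yh (\<lambda>t. ennreal (A 0) * 1 + ennreal (8 * C) * hardy \<alpha> h t)"
    proof (rule bfn_mono[OF bYh])
      show "AE t in I01. rearr ?M u t \<le> ennreal (A 0) * 1 + ennreal (8 * C) * hardy \<alpha> h t"
        by (rule AE_I01_I) (simp add: bound)
      show "rearr ?M u \<in> borel_measurable I01" by (rule rearr_measurable_I01[OF um p1 uAE])
    qed (use Hm8 in measurable)
    also have "\<dots> \<le> \<rho>Yh (\<lambda>t. ennreal (A 0) * 1) + \<rho>Yh (\<lambda>t. ennreal (8 * C) * hardy \<alpha> h t)"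
      by (rule bfn_add[OF bYh _ Hm8]) simp
    also have "\<dots> = ennreal (A 0) * ennreal c + ennreal (8 * C) * \<rho>Yh (hardy \<alpha> h)"
      using C(1) A0[of 0] by (simp only: bfn_cmult[OF bYh Hm] bfn_cmult[OF bYh borel_measurable_const A0[of 0]] c(1)[symmetric])
    also have "\<dots> \<le> ennreal (2 * C * (LINT x|?M. norm (Df x))) * ennreal c + ennreal (8 * C) * (ennreal C2 * \<rho>X ?g)"
      using A0_bound order_trans[OF C2(2)[OF hm] mult_left_mono[OF hX]]
      by (intro add_mono mult_right_mono mult_left_mono ennreal_leI) auto
    also have "ennreal (2 * C * (LINT x|?M. norm (Df x))) * ennreal c = ennreal (2 * C * c) * (\<integral>\<^sup>+x. ?g x \<partial>?M)"
      using C(1) c(2) by (simp add: D_eq[symmetric] ennreal_mult[symmetric] integral_nonneg_AE mult_ac)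
    also have "ennreal (2 * C * c) * (\<integral>\<^sup>+x. ?g x \<partial>?M) + ennreal (8 * C) * (ennreal C2 * \<rho>X ?g) \<le>
       ennreal (2 * C * c) * (ennreal c1 * \<rho>X ?g) + ennreal (8 * C) * (ennreal C2 * \<rho>X ?g)"
      by (intro add_right_mono mult_left_mono g1) auto
    also have "\<dots> = ennreal (2 * C * c1 * c + 8 * C * C2) * \<rho>X ?g"
    proof -
      have "ennreal (2 * C * c) * (ennreal c1 * \<rho>X ?g) = ennreal (2 * C * c1 * c) * \<rho>X ?g"
        using C(1) c1(1) c(2) by (subst mult.assoc[symmetric], subst ennreal_mult[symmetric]) (auto simp: mult_ac)
      moreover have "ennreal (8 * C) * (ennreal C2 * \<rho>X ?g) = ennreal (8 * C * C2) * \<rho>X ?g"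
        using C(1) C2(1) by (subst mult.assoc[symmetric], subst ennreal_mult[symmetric]) auto
      moreover have "ennreal (2 * C * c1 * c + 8 * C * C2) = ennreal (2 * C * c1 * c) + ennreal (8 * C * C2)"
        using C(1) C2(1) c1(1) c(2) by (intro ennreal_plus) auto
      ultimately show ?thesis by (simp only: distrib_right)
    qed
    finally show ?thesis by (simp add: fnorm_def)
  qed
  moreover have "0 < 2 * C * c1 * c + 8 * C * C2" using C(1) C2(1) c1(1) c(2) by (simp add: add_nonneg_pos)
  ultimately show ?thesis unfolding sobolev_bounded_def by blast
qed

section \<open>From the Sobolev inequality to the Hardy operator\<close>

text \<open>T is r^2 - |x - x0|^2 truncated at the heights 0 and d = r^2 - s^2 and divided by d. The
  squared distance is a polynomial, so it has a classical gradient everywhere, including the centre,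
  and the rule for positive parts yields the gradient of the truncation.\<close>

lemma radial_cutoff:
  fixes \<Omega> :: "(real^'n::finite) set"
  assumes \<Omega>: "open \<Omega>" and sr: "0 < s" "s < r"
  obtains T :: "real^'n \<Rightarrow> real" and G :: "real^'n \<Rightarrow> real^'n" where
    "has_weak_gradient T G \<Omega>" "T \<in> borel_measurable borel" "G \<in> borel_measurable borel"
    "\<And>x. 0 \<le> T x" "\<And>x. T x \<le> 1" "\<And>x. x \<in> ball x0 s \<Longrightarrow> T x = 1" "\<And>x. x \<notin> ball x0 r \<Longrightarrow> T x = 0"
    "\<And>x. norm (G x) \<le> 2 * r / (r\<^sup>2 - s\<^sup>2) * indicator (ball x0 r - ball x0 s) x"
proof -
  define p where "p x = r\<^sup>2 - (x - x0) \<bullet> (x - x0)" for x :: "real^'n"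
  define d where "d = r\<^sup>2 - s\<^sup>2"
  have d: "0 < d" using sr by (simp add: d_def power_strict_mono)
  have cp: "continuous_on UNIV p" unfolding p_def[abs_def] by (intro continuous_intros)
  have cD: "continuous_on UNIV (\<lambda>x. -2 *\<^sub>R (x - x0))" by (intro continuous_intros)
  have "((\<lambda>t. p (x + t *\<^sub>R axis i 1)) has_real_derivative (-2 *\<^sub>R (x - x0)) $ i) (at 0)" for x i
  proof -
    have e: "p (x + t *\<^sub>R axis i 1) = p x - 2 * t * ((x - x0) $ i) - t * t" for t
    proof -
      have "(x + t *\<^sub>R axis i 1 - x0) \<bullet> (x + t *\<^sub>R axis i 1 - x0) = ((x - x0) + t *\<^sub>R axis i 1) \<bullet> ((x - x0) + t *\<^sub>R axis i 1)"
        by (simp add: algebra_simps)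
      also have "\<dots> = (x - x0) \<bullet> (x - x0) + 2 * t * ((x - x0) $ i) + t * t"
        by (simp only: inner_add_left inner_add_right inner_scaleR_left inner_scaleR_right inner_axis inner_commute[of "axis i 1"] axis_nth) (simp add: algebra_simps)
      finally show ?thesis by (simp add: p_def)
    qed
    show ?thesis unfolding e by (auto intro!: derivative_eq_intros)
  qed
  then have wp: "has_weak_gradient p (\<lambda>x. -2 *\<^sub>R (x - x0)) \<Omega>"
    by (rule has_weak_gradient_classical[OF \<Omega> cp cD])
  let ?P = "\<lambda>a x. max 0 (p x - a)" and ?G = "\<lambda>a x. if a < p x then -2 *\<^sub>R (x - x0) else 0"
  have wP: "has_weak_gradient (?P a) (?G a) \<Omega>" for a by (rule has_weak_gradient_pos_part[OF \<Omega> wp])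
  define T where "T x = (1/d) * (?P 0 x + -1 * ?P d x)" for x
  define G where "G x = (1/d) *\<^sub>R (?G 0 x + -1 *\<^sub>R ?G d x)" for x
  have in_ball: "x \<in> ball x0 \<rho> \<longleftrightarrow> r\<^sup>2 - \<rho>\<^sup>2 < p x" if "0 < \<rho>" for \<rho> x
  proof -
    have "x \<in> ball x0 \<rho> \<longleftrightarrow> (norm (x - x0))\<^sup>2 < \<rho>\<^sup>2"
      using that by (auto simp: dist_norm norm_minus_commute power_strict_mono dest: power_less_imp_less_base)
    then show ?thesis by (simp add: p_def power2_norm_eq_inner)
  qed
  have r_iff: "x \<in> ball x0 r \<longleftrightarrow> 0 < p x" and s_iff: "x \<in> ball x0 s \<longleftrightarrow> d < p x" for x
    using in_ball[of r x] in_ball[of s x] sr by (auto simp: d_def)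
  show thesis
  proof (rule that[of T G])
    show "has_weak_gradient T G \<Omega>"
      unfolding T_def[abs_def] G_def[abs_def] by (intro has_weak_gradient_cmult has_weak_gradient_add \<Omega> wP)
    have [measurable]: "p \<in> borel_measurable borel" by (rule borel_measurable_continuous_onI[OF cp])
    show "T \<in> borel_measurable borel" "G \<in> borel_measurable borel"
      unfolding T_def[abs_def] G_def[abs_def] by measurable
    show "0 \<le> T x" "T x \<le> 1" for x using d by (auto simp: T_def divide_simps max_def)
    show "T x = 1" if "x \<in> ball x0 s" for x
    proof -
      have "d < p x" using that s_iff by blast
      then show ?thesis using d by (simp add: T_def)
    qed
    show "T x = 0" if "x \<notin> ball x0 r" for x
    proof -
      have "\<not> 0 < p x" using that r_iff by blast
      then show ?thesis using d by (simp add: T_def)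
    qed
    show "norm (G x) \<le> 2 * r / (r\<^sup>2 - s\<^sup>2) * indicator (ball x0 r - ball x0 s) x" for x
    proof (cases "x \<in> ball x0 r - ball x0 s")
      case True
      then have "norm (x - x0) \<le> r" by (simp add: dist_norm norm_minus_commute)
      moreover have "0 < p x" "\<not> d < p x" using True by (auto simp: r_iff[symmetric] s_iff[symmetric])
      then have "norm (G x) = 2 * norm (x - x0) / d" using d by (simp add: G_def)
      ultimately show ?thesis using True d by (simp add: d_def[symmetric] divide_right_mono)
    next
      case False
      then have "\<not> 0 < p x \<or> d < p x" using r_iff s_iff by blast
      then have "G x = 0" using d by (auto simp: G_def)
      then show ?thesis using False by simp
    qed
  qed
qed

theorem sobolev_bounded_imp_hardy_bounded:
  fixes \<Omega> :: "(real^'n::finite) set"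
  assumes \<alpha>: "\<alpha> = 1 / real CARD('n)"
    and \<Omega>: "open \<Omega>" "emeasure lebesgue \<Omega> = 1"
    and X: "ri_norm (lebesgue_on \<Omega>) \<rho>X" and Y: "ri_norm (lebesgue_on \<Omega>) \<rho>Y"
    and Xh: "represents (lebesgue_on \<Omega>) \<rho>Xh \<rho>X" and Yh: "represents (lebesgue_on \<Omega>) \<rho>Yh \<rho>Y"
    and Sb: "sobolev_bounded \<Omega> \<rho>X \<rho>Y"
  shows "hardy_bounded \<alpha> \<rho>Xh \<rho>Yh"
proof -
  let ?M = "lebesgue_on \<Omega>"
  interpret finite_measure ?M by (rule lebesgue_on_prob(2)[OF \<Omega>])
  note p1 = lebesgue_on_prob(1)[OF \<Omega>]
  have \<Omega>l: "\<Omega> \<in> sets lebesgue" by (rule lebesgue_on_prob(3)[OF \<Omega>])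
  have finM: "emeasure ?M (space ?M) < \<infinity>" unfolding p1 by simp
  have fin1: "emeasure I01 (space I01) < \<infinity>" and p01: "emeasure I01 (space I01) = 1" by simp_all
  have \<alpha>01: "0 < \<alpha>" "\<alpha> \<le> 1" by (auto simp: \<alpha>)
  note bX = ri_bfn[OF X] and bY = ri_bfn[OF Y]
  have riX: "ri_norm I01 \<rho>Xh" and riY: "ri_norm I01 \<rho>Yh"
    and repX: "\<And>f. f \<in> borel_measurable ?M \<Longrightarrow> \<rho>X f = \<rho>Xh (rearr ?M f)"
    and repY: "\<And>f. f \<in> borel_measurable ?M \<Longrightarrow> \<rho>Y f = \<rho>Yh (rearr ?M f)"
    using Xh Yh by (auto simp: represents_def)
  note bXh = ri_bfn[OF riX] and bYh = ri_bfn[OF riY]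
  obtain C :: real where C: "0 < C" "\<And>f Df. (f, Df) \<in> sobolev_W1 \<Omega> \<rho>X \<Longrightarrow>
    fnorm \<rho>Y (\<lambda>x. f x - mean \<Omega> f) \<le> ennreal C * fnorm \<rho>X (\<lambda>x. norm (Df x))"
    using Sb unfolding sobolev_bounded_def by blast
  obtain c1 :: real where c1: "0 < c1" "\<And>f. f \<in> borel_measurable I01 \<Longrightarrow> (\<integral>\<^sup>+x. f x \<partial>I01) \<le> ennreal c1 * \<rho>Xh f"
    using bfn_L1[OF bXh fin1] by blast
  obtain cY where cY: "\<rho>Y (\<lambda>x. 1) = ennreal cY" "0 \<le> cY"
    using bfn_one_finite[OF bY finM] by (cases "\<rho>Y (\<lambda>x. 1)") auto
  obtain x0 where "x0 \<in> \<Omega>" using \<Omega>(2) by fastforce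
  then obtain R where R: "0 < R" "ball x0 R \<subseteq> \<Omega>" using \<Omega>(1) openE by blast
  define \<beta> where "\<beta> = measure lebesgue (ball x0 R)"
  \<comment> \<open>Radii for which the balls have volume \<beta> 2^-j, so that the annulus
    \<open>A j\<close> corresponds to dyadic cell j up to the factor \<beta>.\<close>
  define r where "r j = R * ((1/2)^j) powr \<alpha>" for j :: nat
  have r0: "0 < r j" for j using R by (simp add: r_def)
  have r_dec: "r (Suc j) < r j" for j
    using R \<alpha>01 by (auto simp: r_def intro!: mult_strict_left_mono powr_less_mono2)
  have r_le: "r j \<le> R" for j
  proof -
    have "((1/2::real)^j) powr \<alpha> \<le> 1 powr \<alpha>" using \<alpha>01 by (intro powr_mono2) (auto simp: power_le_one)
    then show ?thesis using R by (simp add: r_def mult_left_le)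
  qed
  have r_mono: "r j \<le> r i" if "i \<le> j" for i j
    by (rule lift_Suc_antimono_le[of r i j, OF less_imp_le[OF r_dec] that])
  have vol: "measure lebesgue (ball x0 (r j)) = \<beta> * (1/2)^j" for j
  proof -
    have "(r j)^CARD('n) = R^CARD('n) * (1/2)^j"
    proof -
      have "(((1/2::real)^j) powr \<alpha>)^CARD('n) = (((1/2)^j) powr \<alpha>) powr real CARD('n)"
        by (rule powr_realpow[symmetric]) simp
      also have "\<dots> = ((1/2)^j) powr (\<alpha> * real CARD('n))" by (rule powr_powr)
      also have "\<dots> = (1/2)^j" by (simp add: \<alpha>)
      finally show ?thesis by (simp add: r_def power_mult_distrib)
    qed
    then show ?thesis using R r0[of j] by (simp add: \<beta>_def content_ball)
  qed
  have \<beta>0: "0 < \<beta>" using R by (simp add: \<beta>_def)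
  have \<beta>1: "\<beta> \<le> 1"
  proof -
    have "emeasure lebesgue (ball x0 R) \<noteq> top" using emeasure_lborel_ball_finite[of x0 R] by simp
    then have "ennreal \<beta> = emeasure lebesgue (ball x0 R)"
      unfolding \<beta>_def by (rule emeasure_eq_ennreal_measure[symmetric])
    also have "\<dots> \<le> emeasure lebesgue \<Omega>" using R \<Omega>l by (intro emeasure_mono) auto
    finally show ?thesis using \<Omega>(2) by simp
  qed
  have vol_M: "measure ?M (ball x0 (r j)) = \<beta> * (1/2)^j" for j
  proof -
    have "ball x0 (r j) \<subseteq> \<Omega>" using R r_le[of j] by (meson order_trans subset_ball)
    then show ?thesis using \<Omega>l by (subst measure_restrict_space) (auto simp: vol)
  qed
  have ballM: "ball x0 (r j) \<in> sets ?M" for j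
  proof -
    have "ball x0 (r j) \<subseteq> \<Omega>" using R r_le[of j] by (meson order_trans subset_ball)
    then show ?thesis using \<Omega>l by (subst sets_restrict_space_iff) auto
  qed
  define A where "A j = ball x0 (r j) - ball x0 (r (Suc j))" for j
  have AM: "A j \<in> sets ?M" for j using ballM by (auto simp: A_def)
  have A_meas: "emeasure ?M (A j) = ennreal (\<beta> * (1/2)^(Suc j))" for j
  proof -
    have "measure ?M (A j) = \<beta> * (1/2)^j - \<beta> * (1/2)^(Suc j)"
      unfolding A_def using ballM r_dec[of j] by (subst finite_measure_Diff) (auto simp: vol_M less_imp_le)
    also have "\<dots> = \<beta> * (1/2)^(Suc j)" by simp
    finally show ?thesis by (simp only: emeasure_eq_measure)
  qed
  have A_disj: "disjoint_family A"
  proof -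
    have "A i \<inter> A j = {}" if "i < j" for i j using r_mono[of "Suc i" j] that by (auto simp: A_def)
    then show ?thesis unfolding disjoint_family_on_def by (metis inf_commute linorder_neqE_nat)
  qed
  \<comment> \<open>The bound 2 r/(r^2 - s^2) for the gradient of the cutoff between two consecutive
    radii, multiplied by the larger radius. The radii are geometric with ratio (1/2) powr \<alpha>,
    so this number does not depend on j.\<close>
  define \<kappa> where "\<kappa> = 2 / (1 - (1/2) powr (2 * \<alpha>))"
  have \<kappa>d: "0 < 1 - (1/2::real) powr (2 * \<alpha>)" using \<alpha>01 powr_less_mono'[of "1/2" 0 "2 * \<alpha>"] by simp
  have \<kappa>0: "0 < \<kappa>" using \<kappa>d by (simp add: \<kappa>_def)
  have \<kappa>: "2 * r j / ((r j)\<^sup>2 - (r (Suc j))\<^sup>2) = \<kappa> / r j" for j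
  proof -
    have "r (Suc j) = r j * (1/2) powr \<alpha>" by (simp add: r_def powr_mult[symmetric])
    then have "(r (Suc j))\<^sup>2 = (r j)\<^sup>2 * ((1/2) powr \<alpha>)\<^sup>2" by (simp add: power_mult_distrib)
    also have "((1/2::real) powr \<alpha>)\<^sup>2 = (1/2) powr (2 * \<alpha>)" by (simp add: power2_eq_square powr_add[symmetric])
    finally have "(r j)\<^sup>2 - (r (Suc j))\<^sup>2 = (r j)\<^sup>2 * (1 - (1/2) powr (2 * \<alpha>))" by (simp add: algebra_simps)
    then have "2 * r j / ((r j)\<^sup>2 - (r (Suc j))\<^sup>2) = 2 * r j / ((r j)\<^sup>2 * (1 - (1/2) powr (2 * \<alpha>)))" by (rule arg_cong)
    also have "\<dots> = \<kappa> / r j" using r0[of j] unfolding \<kappa>_def power2_eq_square by simp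
    finally show ?thesis .
  qed
  have "\<exists>T G. has_weak_gradient T G \<Omega> \<and> T \<in> borel_measurable borel \<and> G \<in> borel_measurable borel \<and>
    (\<forall>x. 0 \<le> T x) \<and> (\<forall>x. T x \<le> 1) \<and> (\<forall>x. x \<in> ball x0 (r (Suc j)) \<longrightarrow> T x = 1) \<and> (\<forall>x. x \<notin> ball x0 (r j) \<longrightarrow> T x = 0) \<and>
    (\<forall>x. norm (G x) \<le> \<kappa> / r j * indicator (A j) x)" for j
    using radial_cutoff[OF \<Omega>(1) r0[of "Suc j"] r_dec[of j], of x0] unfolding \<kappa> A_def by metis
  then obtain T G where TG: "\<And>j. has_weak_gradient (T j) (G j) \<Omega>" "\<And>j. T j \<in> borel_measurable borel" "\<And>j. G j \<in> borel_measurable borel"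
    "\<And>j x. 0 \<le> T j x" "\<And>j x. T j x \<le> 1" "\<And>j x. x \<in> ball x0 (r (Suc j)) \<Longrightarrow> T j x = 1" "\<And>j x. x \<notin> ball x0 (r j) \<Longrightarrow> T j x = 0"
    "\<And>j x. norm (G j x) \<le> \<kappa> / r j * indicator (A j) x"
    by metis
  \<comment> \<open>The term C \<kappa>/R comes from the gradient, 2 c1 cY from the mean, and
    2/\<beta> from the comparison of annuli with dyadic cells.\<close>
  let ?C = "2 / \<beta> * (C * (\<kappa> / R) + 2 * c1 * cY)"
  have "\<rho>Yh (hardy \<alpha> k) \<le> ennreal ?C * \<rho>Xh k" if k: "k \<in> borel_measurable I01" for k
  proof (cases "\<rho>Xh k < \<infinity>")
    case False
    moreover have "0 < ?C" using \<beta>0 C(1) \<kappa>0 R c1(1) cY(2) by (intro mult_pos_pos add_pos_nonneg) auto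
    ultimately have "ennreal ?C * \<rho>Xh k = top"
      by (auto simp: less_top[symmetric] ennreal_mult_eq_top_iff)
    then show ?thesis by simp
  next
    case True
    note [measurable] = k
    have kAE: "AE s in I01. k s < \<infinity>" by (rule bfn_finite_AE[OF bXh fin1 k True])
    have k1: "(\<integral>\<^sup>+s. k s \<partial>I01) \<le> ennreal c1 * \<rho>Xh k" by (rule c1(2)[OF k])
    have "ennreal c1 * \<rho>Xh k < \<infinity>" using True by (simp add: ennreal_mult_less_top)
    with k1 have intk: "(\<integral>\<^sup>+s. k s \<partial>I01) < \<infinity>" by (rule le_less_trans)
    define I where "I j = enn2real (\<integral>\<^sup>+s. k s * indicator (dyadic_cell j) s \<partial>I01)" for j
    have I0: "0 \<le> I j" for j by (simp add: I_def)
    have I_eq: "ennreal (I j) = (\<integral>\<^sup>+s. k s * indicator (dyadic_cell j) s \<partial>I01)" for j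
    proof -
      have "(\<integral>\<^sup>+s. k s * indicator (dyadic_cell j) s \<partial>I01) \<le> (\<integral>\<^sup>+s. k s \<partial>I01)"
        by (intro nn_integral_mono) (auto simp: indicator_def)
      then have "(\<integral>\<^sup>+s. k s * indicator (dyadic_cell j) s \<partial>I01) < top" using intk by (simp add: le_less_trans)
      then show ?thesis by (simp add: I_def)
    qed
    \<comment> \<open>\<open>b j\<close> is the mean of k over dyadic cell j and \<open>c j\<close>
      the contribution of that cell to the upper bound for Q k. Their ratio is (2^-(j+1)) powr
      \<alpha>, of the order of the radius \<open>r j\<close>, so \<open>c j\<close> times the slope
      \<kappa>/r j of the cutoff is at most a constant times \<open>b j\<close>.\<close>
    define b where "b j = 2^(Suc j) * I j" for j
    define c where "c j = ((1/2)^(Suc j)) powr (\<alpha> - 1) * I j" for j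
    have b0: "0 \<le> b j" and c0: "0 \<le> c j" for j using I0[of j] by (auto simp: b_def c_def)
    have c_eq: "c j = ((1/2)^(Suc j)) powr \<alpha> * b j" for j
    proof -
      have "((1/2::real)^(Suc j)) powr (\<alpha> - 1) = ((1/2)^(Suc j)) powr \<alpha> * 2^(Suc j)"
        by (subst powr_diff) (simp add: power_divide)
      then show ?thesis by (simp add: c_def b_def)
    qed
    have cb: "c j \<le> b j" "c j * (\<kappa> / r j) \<le> \<kappa> / R * b j" for j
    proof -
      have "((1/2::real)^(Suc j)) powr \<alpha> \<le> 1 powr \<alpha>" using \<alpha>01 by (intro powr_mono2 power_le_one) auto
      then show "c j \<le> b j" unfolding c_eq using b0[of j] by (simp add: mult_left_le_one_le del: power_Suc)
      have "((1/2::real)^(Suc j)) powr \<alpha> \<le> ((1/2)^j) powr \<alpha>" using \<alpha>01 by (intro powr_mono2 power_decreasing) auto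
      then have "c j \<le> ((1/2)^j) powr \<alpha> * b j" unfolding c_eq using b0[of j] by (intro mult_right_mono) auto
      then have "c j \<le> r j / R * b j" using R by (simp add: r_def)
      then have "c j * (\<kappa> / r j) \<le> r j / R * b j * (\<kappa> / r j)" using \<kappa>0 r0[of j] by (intro mult_right_mono) auto
      then show "c j * (\<kappa> / r j) \<le> \<kappa> / R * b j" using r0[of j] by (simp add: field_simps)
    qed
    define w where "w x = (\<Sum>j. ennreal (b j) * indicator (A j) x)" for x
    have wm: "w \<in> borel_measurable ?M" unfolding w_def[abs_def] using AM by measurable
    have wX: "\<rho>X w \<le> \<rho>Xh k"
    proof -
      have "\<rho>X w = \<rho>Xh (rearr ?M w)" by (rule repX[OF wm])
      also have "\<dots> \<le> \<rho>Xh (rearr I01 k)"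
        unfolding w_def[abs_def]
      proof (rule averaging_bound[OF riX k p01 kAE p1, where E = dyadic_cell and m = "\<lambda>j. (1/2)^(Suc j)"])
        show "emeasure I01 (dyadic_cell j) \<le> ennreal ((1/2)^(Suc j))" for j by (simp only: emeasure_dyadic_cell order_refl)
        show "emeasure ?M (A j) \<le> ennreal ((1/2)^(Suc j))" for j
          unfolding A_meas using \<beta>1 \<beta>0 by (intro ennreal_leI mult_left_le_one_le) auto
        show "ennreal (b j) * ennreal ((1/2)^(Suc j)) \<le> (\<integral>\<^sup>+s. k s * indicator (dyadic_cell j) s \<partial>I01)" for j
        proof -
          have "b j * (1/2)^(Suc j) = I j" by (simp add: b_def power_divide)
          then show ?thesis using b0[of j] by (simp add: I_eq[symmetric] ennreal_mult[symmetric] del: power_Suc)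
        qed
      qed (use dyadic_cell_disjoint AM A_disj in auto)
      also have "\<dots> = \<rho>Xh k" by (rule ri_rearr[OF riX k kAE])
      finally show ?thesis .
    qed
    \<comment> \<open>The value on cell m of the discretised Q k, with the sum cut off after index
      K. The cut-off makes the Sobolev function below a finite sum, with a weak gradient and a
      finite norm.\<close>
    define D where "D K m = (\<Sum>j\<le>min m K. c j)" for K m
    have D0: "0 \<le> D K m" for K m unfolding D_def by (intro sum_nonneg c0)
    define F where "F K t = (\<Sum>m. ennreal (D K m) * indicator (dyadic_cell m) t)" for K t
    have Fm: "F K \<in> borel_measurable I01" for K unfolding F_def[abs_def] by measurable
    have F_eq: "F K t = ennreal (D K m)" if "t \<in> dyadic_cell m" for K m t
      unfolding F_def using suminf_indicator_disjoint[OF dyadic_cell_disjoint that] .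
    have FAE: "AE t in I01. F K t < \<infinity>" for K
    proof (rule AE_I01_I)
      fix t :: real assume "0 < t" "t < 1"
      then obtain i where "t \<in> dyadic_cell i" by (rule dyadic_cell_cover)
      then show "F K t < \<infinity>" by (simp add: F_eq)
    qed
    have FK: "\<rho>Yh (F K) \<le> ennreal ?C * \<rho>Xh k" for K
    proof -
      \<comment> \<open>Each cutoff climbs from 0 to 1 across its own annulus, so on
        \<open>A j\<close> at most the j-th term has a gradient, while u collects every
        \<open>c j\<close> with j \<le> K whose annulus is crossed on the way to the centre.\<close>
      define u where "u x = (\<Sum>j\<le>K. c j * T j x)" for x
      define Du where "Du x = (\<Sum>j\<le>K. c j *\<^sub>R G j x)" for x
      have wg: "has_weak_gradient u Du \<Omega>"
        unfolding u_def[abs_def] Du_def[abs_def] by (intro has_weak_gradient_sum has_weak_gradient_cmult \<Omega> TG(1)) auto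
      have restr: "v \<in> borel_measurable ?M" if "v \<in> borel_measurable borel" for v :: "real^'n \<Rightarrow> real"
        using that by (intro measurable_restrict_space1 measurable_completion) simp
      have um: "u \<in> borel_measurable ?M"
        by (rule restr) (unfold u_def[abs_def], use TG(2) in measurable)
      have Dum: "(\<lambda>x. norm (Du x)) \<in> borel_measurable ?M"
        by (rule restr) (unfold Du_def[abs_def], use TG(3) in measurable)
      have eum: "(\<lambda>x. ennreal (u x)) \<in> borel_measurable ?M" using um by measurable
      have u0: "0 \<le> u x" for x unfolding u_def by (intro sum_nonneg mult_nonneg_nonneg c0 TG(4))
      have Dw: "ennreal (norm (Du x)) \<le> ennreal (\<kappa> / R) * w x" for x
      proof (cases "x \<in> (\<Union>j. A j)")
        case True
        then obtain i where i: "x \<in> A i" by auto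
        have iff: "x \<in> A j \<longleftrightarrow> j = i" for j using i A_disj by (auto simp: disjoint_family_on_def)
        have "norm (Du x) \<le> (\<Sum>j\<le>K. c j * norm (G j x))"
          unfolding Du_def by (rule order_trans[OF norm_sum]) (use c0 in \<open>auto intro!: sum_mono\<close>)
        also have "\<dots> \<le> (\<Sum>j\<le>K. if j = i then \<kappa> / R * b j else 0)"
        proof (rule sum_mono)
          fix j
          show "c j * norm (G j x) \<le> (if j = i then \<kappa> / R * b j else 0)"
          proof (cases "j = i")
            case True
            have "c j * norm (G j x) \<le> c j * (\<kappa> / r j)"
              using TG(8)[of j x] c0[of j] True i by (intro mult_left_mono) auto
            then show ?thesis using cb(2)[of j] True by simp
          next
            case False
            then have "norm (G j x) \<le> 0" using TG(8)[of j x] iff[of j] by simp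
            then show ?thesis using False by simp
          qed
        qed
        also have "\<dots> \<le> \<kappa> / R * b i" using \<kappa>0 R b0[of i] by simp
        finally have "ennreal (norm (Du x)) \<le> ennreal (\<kappa> / R * b i)" by (rule ennreal_leI)
        also have "\<dots> = ennreal (\<kappa> / R) * w x"
          unfolding w_def suminf_indicator_disjoint[OF A_disj i] using \<kappa>0 R b0 by (intro ennreal_mult) auto
        finally show ?thesis .
      next
        case False
        then have "norm (G j x) \<le> 0" for j using TG(8)[of j x] by simp
        then have "Du x = 0" by (simp add: Du_def)
        then show ?thesis by simp
      qed
      have DX: "\<rho>X (\<lambda>x. ennreal (norm (Du x))) \<le> ennreal (\<kappa> / R) * \<rho>Xh k"
      proof -
        have "\<rho>X (\<lambda>x. ennreal (norm (Du x))) \<le> \<rho>X (\<lambda>x. ennreal (\<kappa> / R) * w x)"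
          using wm Dum Dw by (intro bfn_mono[OF bX]) auto
        also have "\<dots> = ennreal (\<kappa> / R) * \<rho>X w" using \<kappa>0 R by (intro bfn_cmult[OF bX wm]) auto
        also have "\<dots> \<le> ennreal (\<kappa> / R) * \<rho>Xh k" by (intro mult_left_mono wX) auto
        finally show ?thesis .
      qed
      have ubd: "u x \<le> (\<Sum>j\<le>K. c j)" for x
        unfolding u_def using c0 TG(5) by (intro sum_mono) (simp add: mult_left_le)
      have W: "(u, Du) \<in> sobolev_W1 \<Omega> \<rho>X"
      proof -
        have "fnorm \<rho>X u \<le> \<rho>X (\<lambda>x. ennreal (\<Sum>j\<le>K. c j) * 1)"
          unfolding fnorm_def using um u0 ubd by (intro bfn_mono[OF bX]) (auto intro!: ennreal_leI)
        also have "\<dots> = ennreal (\<Sum>j\<le>K. c j) * \<rho>X (\<lambda>x. 1)" by (intro bfn_cmult[OF bX] sum_nonneg c0) simp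
        also have "\<dots> < \<infinity>" using bfn_one_finite[OF bX finM] by (simp add: ennreal_mult_less_top)
        finally have "fnorm \<rho>X u < \<infinity>" .
        moreover have "fnorm \<rho>X (\<lambda>x. norm (Du x)) < \<infinity>"
        proof -
          have "ennreal (\<kappa> / R) * \<rho>Xh k < \<infinity>" using True by (simp add: ennreal_mult_less_top)
          with DX show ?thesis unfolding fnorm_def by (simp add: le_less_trans)
        qed
        ultimately show ?thesis using um Dum wg by (auto simp: sobolev_W1_def fspace_def)
      qed
      \<comment> \<open>Controls the mean of u: the ball of radius \<open>r j\<close> has measure at
        most 2^-j, and c j 2^-j \<le> b j 2^-j = 2 I j.\<close>
      have intu: "(\<integral>\<^sup>+x. ennreal (u x) \<partial>?M) \<le> 2 * (\<integral>\<^sup>+s. k s \<partial>I01)"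
      proof -
        have "(\<integral>\<^sup>+x. ennreal (u x) \<partial>?M) \<le> (\<integral>\<^sup>+x. (\<Sum>j\<le>K. ennreal (c j) * indicator (ball x0 (r j)) x) \<partial>?M)"
        proof (intro nn_integral_mono)
          fix x
          have "ennreal (u x) = (\<Sum>j\<le>K. ennreal (c j * T j x))"
            unfolding u_def using c0 TG(4) by (intro sum_ennreal[symmetric]) auto
          also have "\<dots> \<le> (\<Sum>j\<le>K. ennreal (c j) * indicator (ball x0 (r j)) x)"
          proof (rule sum_mono)
            fix j
            show "ennreal (c j * T j x) \<le> ennreal (c j) * indicator (ball x0 (r j)) x"
            proof (cases "x \<in> ball x0 (r j)")
              case True
              then show ?thesis using c0[of j] TG(5)[of j x] by (simp add: ennreal_leI mult_left_le)
            qed (simp add: TG(7))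
          qed
          finally show "ennreal (u x) \<le> (\<Sum>j\<le>K. ennreal (c j) * indicator (ball x0 (r j)) x)" .
        qed
        also have "\<dots> = (\<Sum>j\<le>K. ennreal (c j) * emeasure ?M (ball x0 (r j)))"
          using ballM by (subst nn_integral_sum) (auto simp: nn_integral_cmult_indicator)
        also have "\<dots> \<le> (\<Sum>j\<le>K. 2 * ennreal (I j))"
        proof (rule sum_mono)
          fix j
          have "c j * (\<beta> * (1/2)^j) \<le> b j * (1 * (1/2)^j)"
            using cb(1) c0 b0 \<beta>0 \<beta>1 by (intro mult_mono) auto
          also have "\<dots> = 2 * I j" by (simp add: b_def power_divide)
          finally have "ennreal (c j * (\<beta> * (1/2)^j)) \<le> ennreal (2 * I j)" by (rule ennreal_leI)
          moreover have "ennreal (c j * (\<beta> * (1/2)^j)) = ennreal (c j) * emeasure ?M (ball x0 (r j))"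
            unfolding emeasure_eq_measure vol_M using c0[of j] \<beta>0 by (intro ennreal_mult) auto
          moreover have "ennreal (2 * I j) = 2 * ennreal (I j)" using I0[of j] by (subst ennreal_mult) auto
          ultimately show "ennreal (c j) * emeasure ?M (ball x0 (r j)) \<le> 2 * ennreal (I j)" by simp
        qed
        also have "\<dots> = 2 * (\<integral>\<^sup>+s. (\<Sum>j\<le>K. k s * indicator (dyadic_cell j) s) \<partial>I01)"
          unfolding I_eq by (subst nn_integral_sum) (auto simp: sum_distrib_left)
        also have "\<dots> \<le> 2 * (\<integral>\<^sup>+s. k s \<partial>I01)"
        proof (intro mult_left_mono nn_integral_mono)
          fix s assume "s \<in> space I01"
          then have "0 < s" "s < 1" by auto
          then obtain i where i: "s \<in> dyadic_cell i" by (rule dyadic_cell_cover)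
          have eq: "s \<in> dyadic_cell j \<longleftrightarrow> j = i" for j
            using i dyadic_cell_disjoint by (auto simp: disjoint_family_on_def)
          have "(\<Sum>j\<le>K. k s * indicator (dyadic_cell j) s) = (\<Sum>j\<le>K. if j = i then k s else 0)"
            by (intro sum.cong) (auto simp: indicator_def eq)
          then show "(\<Sum>j\<le>K. k s * indicator (dyadic_cell j) s) \<le> k s" by simp
        qed simp
        finally show ?thesis .
      qed
      have "ennreal \<bar>mean \<Omega> u\<bar> \<le> 2 * (\<integral>\<^sup>+s. k s \<partial>I01)"
      proof -
        have "2 * (\<integral>\<^sup>+s. k s \<partial>I01) < \<infinity>" using intk by (simp add: ennreal_mult_less_top)
        with intu have "(\<integral>\<^sup>+x. ennreal (u x) \<partial>?M) < \<infinity>" by (rule le_less_trans)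
        then have "integrable ?M u" using um u0 by (intro integrableI_bounded) auto
        then have "(\<integral>\<^sup>+x. ennreal (u x) \<partial>?M) = ennreal (LINT x|?M. u x)" using u0 by (intro nn_integral_eq_integral) auto
        moreover have "measure lebesgue \<Omega> = 1" using \<Omega>(2) by (simp add: measure_def)
        moreover have "0 \<le> (LINT x|?M. u x)" using u0 by (intro integral_nonneg_AE) auto
        ultimately show ?thesis using intu by (simp add: mean_def)
      qed
      also have "\<dots> \<le> 2 * (ennreal c1 * \<rho>Xh k)" by (intro mult_left_mono k1) simp
      finally have mean_le: "ennreal \<bar>mean \<Omega> u\<bar> \<le> ennreal (2 * c1) * \<rho>Xh k"
        using c1(1) by (simp add: ennreal_mult mult.assoc)
      have mm: "(\<lambda>x. ennreal \<bar>u x - mean \<Omega> u\<bar>) \<in> borel_measurable ?M" using um by measurable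
      have "\<rho>Y (\<lambda>x. ennreal (u x)) \<le> \<rho>Y (\<lambda>x. ennreal \<bar>u x - mean \<Omega> u\<bar> + ennreal \<bar>mean \<Omega> u\<bar> * 1)"
      proof (rule bfn_mono[OF bY _ eum])
        show "(\<lambda>x. ennreal \<bar>u x - mean \<Omega> u\<bar> + ennreal \<bar>mean \<Omega> u\<bar> * 1) \<in> borel_measurable ?M" using mm by measurable
        show "AE x in ?M. ennreal (u x) \<le> ennreal \<bar>u x - mean \<Omega> u\<bar> + ennreal \<bar>mean \<Omega> u\<bar> * 1"
          by (intro AE_I2) (simp add: ennreal_plus[symmetric] ennreal_leI del: ennreal_plus)
      qed
      also have "\<dots> \<le> \<rho>Y (\<lambda>x. ennreal \<bar>u x - mean \<Omega> u\<bar>) + \<rho>Y (\<lambda>x. ennreal \<bar>mean \<Omega> u\<bar> * 1)"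
        by (rule bfn_add[OF bY mm]) simp
      also have "\<rho>Y (\<lambda>x. ennreal \<bar>mean \<Omega> u\<bar> * 1) = ennreal \<bar>mean \<Omega> u\<bar> * ennreal cY"
        using bfn_cmult[OF bY, of "\<lambda>x. 1" "\<bar>mean \<Omega> u\<bar>"] cY(1) by simp
      also have "\<rho>Y (\<lambda>x. ennreal \<bar>u x - mean \<Omega> u\<bar>) + ennreal \<bar>mean \<Omega> u\<bar> * ennreal cY \<le>
          ennreal C * (ennreal (\<kappa> / R) * \<rho>Xh k) + (ennreal (2 * c1) * \<rho>Xh k) * ennreal cY"
      proof (intro add_mono mult_right_mono mean_le)
        have "\<rho>Y (\<lambda>x. ennreal \<bar>u x - mean \<Omega> u\<bar>) \<le> ennreal C * \<rho>X (\<lambda>x. ennreal (norm (Du x)))"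
          using C(2)[OF W] by (simp add: fnorm_def)
        also have "\<dots> \<le> ennreal C * (ennreal (\<kappa> / R) * \<rho>Xh k)" by (intro mult_left_mono DX) simp
        finally show "\<rho>Y (\<lambda>x. ennreal \<bar>u x - mean \<Omega> u\<bar>) \<le> ennreal C * (ennreal (\<kappa> / R) * \<rho>Xh k)" .
      qed simp
      also have "\<dots> = (ennreal C * ennreal (\<kappa> / R) + ennreal (2 * c1) * ennreal cY) * \<rho>Xh k"
        by (simp only: distrib_right mult.assoc mult.commute[of "ennreal cY"] mult.left_commute[of "ennreal cY"])
      also have "ennreal C * ennreal (\<kappa> / R) + ennreal (2 * c1) * ennreal cY = ennreal (C * (\<kappa> / R) + 2 * c1 * cY)"
        using C(1) \<kappa>0 R c1(1) cY(2) by (simp add: ennreal_mult[symmetric] ennreal_plus[symmetric] del: ennreal_plus)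
      finally have uY: "\<rho>Y (\<lambda>x. ennreal (u x)) \<le> ennreal (C * (\<kappa> / R) + 2 * c1 * cY) * \<rho>Xh k" .
      \<comment> \<open>On \<open>A (Suc m)\<close> the cutoffs with index at most m equal 1, so u
        is at least \<open>D K m\<close> there. This annulus has measure \<beta> 2^-(m+2), which is
        \<beta>/2 times the length of cell m; hence the factor.\<close>
      define g where "g x = ennreal (2 / \<beta>) * ennreal (u x)" for x
      have gm: "g \<in> borel_measurable ?M" unfolding g_def[abs_def] using eum by measurable
      have gAE: "AE x in ?M. g x < \<infinity>" by (simp add: g_def ennreal_mult_less_top)
      have "\<rho>Yh (F K) = \<rho>Yh (rearr I01 (F K))" by (rule ri_rearr[OF riY Fm FAE, symmetric])
      also have "\<dots> \<le> \<rho>Yh (rearr ?M g)"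
        unfolding F_def[abs_def]
      proof (rule averaging_bound[OF riY gm p1 gAE p01, where E = "\<lambda>m. A (Suc m)" and m = "\<lambda>j. (1/2)^(Suc j)"])
        show "disjoint_family (\<lambda>m. A (Suc m))" using A_disj by (auto simp: disjoint_family_on_def)
        show "emeasure ?M (A (Suc j)) \<le> ennreal ((1/2)^(Suc j))" for j
        proof -
          have "\<beta> * (1/2)^(Suc (Suc j)) \<le> 1 * (1/2)^(Suc j)"
            using \<beta>0 \<beta>1 by (intro mult_mono power_decreasing) auto
          then show ?thesis unfolding A_meas by (intro ennreal_leI) simp
        qed
        show "emeasure I01 (dyadic_cell j) \<le> ennreal ((1/2)^(Suc j))" for j by (simp only: emeasure_dyadic_cell order_refl)
        show "ennreal (D K m) * ennreal ((1/2)^(Suc m)) \<le> (\<integral>\<^sup>+x. g x * indicator (A (Suc m)) x \<partial>?M)" for m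
        proof -
          have "ennreal (D K m) * ennreal ((1/2)^(Suc m)) = ennreal (2 / \<beta> * D K m) * emeasure ?M (A (Suc m))"
            unfolding A_meas using \<beta>0 D0[of K m] by (simp add: ennreal_mult[symmetric] field_simps)
          also have "\<dots> = (\<integral>\<^sup>+x. ennreal (2 / \<beta> * D K m) * indicator (A (Suc m)) x \<partial>?M)"
            using AM by (simp add: nn_integral_cmult_indicator)
          also have "\<dots> \<le> (\<integral>\<^sup>+x. g x * indicator (A (Suc m)) x \<partial>?M)"
          proof (intro nn_integral_mono)
            fix x
            show "ennreal (2 / \<beta> * D K m) * indicator (A (Suc m)) x \<le> g x * indicator (A (Suc m)) x"
            proof (cases "x \<in> A (Suc m)")
              case True
              have "D K m = (\<Sum>j\<le>min m K. c j * T j x)"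
                unfolding D_def
              proof (intro sum.cong refl)
                fix j assume "j \<in> {..min m K}"
                then have "r (Suc m) \<le> r (Suc j)" by (intro r_mono) auto
                then have "x \<in> ball x0 (r (Suc j))" using True by (auto simp: A_def)
                then show "c j = c j * T j x" by (simp add: TG(6))
              qed
              also have "\<dots> \<le> u x"
                unfolding u_def using c0 TG(4) by (intro sum_mono2) auto
              finally have "2 / \<beta> * D K m \<le> 2 / \<beta> * u x" using \<beta>0 by (intro mult_left_mono) auto
              then have "ennreal (2 / \<beta> * D K m) \<le> g x"
                unfolding g_def using \<beta>0 u0[of x] by (simp add: ennreal_mult[symmetric] ennreal_leI)
              then show ?thesis using True by simp
            qed simp
          qed
          finally show ?thesis .
        qed
      qed (use AM dyadic_cell_disjoint in auto)
      also have "\<dots> = \<rho>Y g" by (rule repY[OF gm, symmetric])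
      also have "\<dots> = ennreal (2 / \<beta>) * \<rho>Y (\<lambda>x. ennreal (u x))"
        unfolding g_def[abs_def] using \<beta>0 by (intro bfn_cmult[OF bY eum]) auto
      also have "\<dots> \<le> ennreal (2 / \<beta>) * (ennreal (C * (\<kappa> / R) + 2 * c1 * cY) * \<rho>Xh k)"
        by (intro mult_left_mono uY) simp
      also have "\<dots> = ennreal ?C * \<rho>Xh k"
      proof -
        have "0 \<le> C * (\<kappa> / R) + 2 * c1 * cY" using C(1) \<kappa>0 R c1(1) cY(2) by simp
        then have "ennreal ?C = ennreal (2 / \<beta>) * ennreal (C * (\<kappa> / R) + 2 * c1 * cY)"
          using \<beta>0 by (intro ennreal_mult) auto
        then show ?thesis by (simp add: mult.assoc)
      qed
      finally show ?thesis .
    qed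
    \<comment> \<open>The monotone limit axiom of the norm removes the cut-off K, with a bound
      uniform in K. For t in cell m the index K = m already dominates Q k at t.\<close>
    define Fs where "Fs t = (SUP K. F K t)" for t
    have Fsm: "Fs \<in> borel_measurable I01" unfolding Fs_def[abs_def] using Fm by measurable
    have "\<rho>Yh (hardy \<alpha> k) \<le> \<rho>Yh Fs"
    proof (rule bfn_mono[OF bYh Fsm hardy_measurable[OF k]])
      show "AE t in I01. hardy \<alpha> k t \<le> Fs t"
      proof (rule AE_I01_I)
        fix t :: real assume "0 < t" "t < 1"
        then obtain m where m: "t \<in> dyadic_cell m" by (rule dyadic_cell_cover)
        have "hardy \<alpha> k t \<le> (\<Sum>j\<le>m. ennreal (((1/2)^(Suc j)) powr (\<alpha> - 1)) * (\<integral>\<^sup>+s. k s * indicator (dyadic_cell j) s \<partial>I01))"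
          by (rule hardy_upper_bound[OF \<alpha>01(2) m k])
        also have "\<dots> = (\<Sum>j\<le>m. ennreal (c j))"
          unfolding I_eq[symmetric] c_def using I0 by (simp add: ennreal_mult del: power_Suc)
        also have "\<dots> = F m t" unfolding F_eq[OF m] D_def using c0 by (simp add: sum_ennreal)
        also have "\<dots> \<le> Fs t" unfolding Fs_def by (rule SUP_upper) simp
        finally show "hardy \<alpha> k t \<le> Fs t" .
      qed
    qed
    also have "\<rho>Yh Fs = (SUP K. \<rho>Yh (F K))"
    proof (rule bfn_SUP[OF bYh Fsm Fm])
      have "incseq (\<lambda>K. F K t)" for t
        unfolding F_def incseq_def
      proof (intro allI impI suminf_le mult_right_mono ennreal_leI)
        fix K L :: nat and m assume "K \<le> L"
        then show "D K m \<le> D L m" unfolding D_def using c0 by (intro sum_mono2) auto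
      qed auto
      then show "AE t in I01. incseq (\<lambda>K. F K t) \<and> Fs t = (SUP K. F K t)" by (simp add: Fs_def)
    qed
    also have "\<dots> \<le> ennreal ?C * \<rho>Xh k" by (intro SUP_least FK)
    finally show ?thesis .
  qed
  moreover have "0 < ?C" using \<beta>0 C(1) \<kappa>0 R c1(1) cY(2) by (intro mult_pos_pos add_pos_nonneg) auto
  ultimately show ?thesis unfolding hardy_bounded_def by blast
qed

section \<open>The equivalence of the three statements\<close>

theorem theorem2:
  fixes \<Omega> :: "(real^'n) set"
    and \<rho>X \<rho>Y :: "(real^'n) fun_norm"
    and \<rho>Xh \<rho>Yh :: "real fun_norm"
    and n :: real
  assumes n_def: "n = real CARD('n)"
    and n_ge_2: "CARD('n) \<ge> 2"
    and domain: "open \<Omega>" "connected \<Omega>"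
    and measure_1: "emeasure lebesgue \<Omega> = 1"
    and X: "ri_norm (lebesgue_on \<Omega>) \<rho>X"
    and Y: "ri_norm (lebesgue_on \<Omega>) \<rho>Y"
    and Xh: "represents (lebesgue_on \<Omega>) \<rho>Xh \<rho>X"
    and Yh: "represents (lebesgue_on \<Omega>) \<rho>Yh \<rho>Y"
    and poincare: "sobolev_poincare \<Omega>"
  shows "let
      i = (\<exists>C::real. C > 0 \<and> (\<forall>f \<in> fspace I01 (L1_norm I01).
            fnorm \<rho>Yh f \<le> ennreal C *
              (\<rho>Xh (\<lambda>s. ennreal (s powr (- 1 / n)) *
                 (max_rearr I01 (\<lambda>x. ennreal \<bar>f x\<bar>) s - rearr I01 (\<lambda>x. ennreal \<bar>f x\<bar>) s))
               + fnorm (L1_norm I01) f)));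
      ii = (\<exists>C::real. C > 0 \<and> (\<forall>f \<in> fspace I01 \<rho>Xh. (\<forall>s \<in> {0<..<1}. 0 \<le> f s) \<longrightarrow>
            \<rho>Yh (\<lambda>t. \<integral>\<^sup>+ s \<in> {t<..<1}. ennreal (s powr (1 / n) * f s / s) \<partial>lebesgue)
              \<le> ennreal C * fnorm \<rho>Xh f));
      iii = (\<exists>C::real. C > 0 \<and> (\<forall>(f, Df) \<in> sobolev_W1 \<Omega> \<rho>X.
            fnorm \<rho>Y (\<lambda>x. f x - mean \<Omega> f) \<le> ennreal C * fnorm \<rho>X (\<lambda>x. norm (Df x))))
    in (i \<longleftrightarrow> ii) \<and> (ii \<longleftrightarrow> iii)"
proof -
  let ?\<alpha> = "1 / n"
  have \<alpha>: "?\<alpha> = 1 / real CARD('n)" "0 < ?\<alpha>" "?\<alpha> \<le> 1" "- 1 / n = - ?\<alpha>"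
    using n_ge_2 by (auto simp: n_def)
  have riX: "ri_norm I01 \<rho>Xh" and riY: "ri_norm I01 \<rho>Yh" using Xh Yh by (auto simp: represents_def)
  have "oscillation_bounded ?\<alpha> \<rho>Xh \<rho>Yh \<longleftrightarrow> hardy_bounded ?\<alpha> \<rho>Xh \<rho>Yh"
    using hardy_bounded_imp_oscillation_bounded[OF riX riY]
      oscillation_bounded_imp_hardy_bounded[OF riX riY \<alpha>(2,3)] by blast
  moreover have "hardy_bounded ?\<alpha> \<rho>Xh \<rho>Yh \<longleftrightarrow> sobolev_bounded \<Omega> \<rho>X \<rho>Y"
    using hardy_bounded_imp_sobolev_bounded[OF n_ge_2 \<alpha>(1) domain(1) measure_1 poincare X Xh Yh]
      sobolev_bounded_imp_hardy_bounded[OF \<alpha>(1) domain(1) measure_1 X Y Xh Yh] by blast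
  ultimately show ?thesis
    unfolding Let_def \<alpha>(4) hardy_bounded_iff[OF riX riY, symmetric]
      oscillation_bounded_def[symmetric] sobolev_bounded_def[symmetric] by blast
qed

end
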